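(* Let $T$ be an $\omega$-Calderón--Zygmund operator on $\mathbb{R}^N$ whose modulus of continuity $\omega$ satisfies the Dini condition. Let $V,W$ be $d\times d$ matrix weights on $\mathbb{R}^N$ which satisfy the joint $\mathbf A_2$ condition $[V,W]_{\mathbf A_2}<\infty$ and which both satisfy the scalar $A_\infty$ condition, i.e. $[V]_{A_\infty}^{\mathrm{sc}}<\infty$ and $[W]_{A_\infty}^{\mathrm{sc}}<\infty$. Then $$\| M_W^{1/2}\, T\, M_V^{1/2}\|_{L^2\to L^2}^2\le C\,[V]_{A_\infty}^{\mathrm{sc}}\,[W]_{A_\infty}^{\mathrm{sc}}\,[V,W]_{\mathbf A_2},$$ where the constant $C=C(T,N,d)$ depends only on $T$, $N$ and $d$ (not on $V,W$).
   Context: $\mathbb F=\mathbb R$ or $\mathbb C$. A ($d\times d$) matrix weight on $\mathbb{R}^N$ is a locally integrable function on $\mathbb{R}^N$ with values in the positive semidefinite $d\times d$ matrices. $\langle f\rangle_Q=|Q|^{-1}\int_Q f\,dx$ denotes the average over a cube $Q$ (entrywise for matrices), and $|\cdot|$ of a matrix denotes its operator norm. Joint (two-weight) matrix $\mathbf A_2$ condition: $[V,W]_{\mathbf A_2}=[W,V]_{\mathbf A_2}:=\sup_Q \bigl|\langle W\rangle_Q^{1/2}\langle V\rangle_Q^{1/2}\bigr|^2<\infty$, supremum over all cubes $Q\subset\mathbb R^N$. For a cube $Q$ let $\mathcal D(Q)$ be the collection of its dyadic subcubes (including $Q$), and let $M_Q f(x)=\sup\{|\langle f\rangle_R|: R\in\mathcal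 D(Q),\ x\in R\}$ for $x\in Q$, $M_Qf(x)=0$ for $x\notin Q$. For a scalar weight $w$, $[w]_{A_\infty}$ is the best constant $C$ in the inequality $\langle M_Q w\rangle_Q\le C\langle w\rangle_Q$ for all cubes $Q\subset\mathbb R^N$. For a matrix weight $W$, $[W]_{A_\infty}^{\mathrm{sc}}:=\sup_{e\in\mathbb F^d}[w_e]_{A_\infty}$, where $w_e(x)=(W(x)e,e)$. A modulus of continuity is an increasing subadditive function $\omega$ on $[0,\infty)$ with $\omega(0)=0$; it satisfies the Dini condition if $\int_0^1\omega(x)\frac{dx}{x}<\infty$. An operator $T$ bounded in the scalar $L^2(\mathbb R^N)$ is an $\omega$-Calderón--Zygmund operator if $Tf(x)=\int_{\mathbb R^N}K(x,y)f(y)\,dy$ for all $f\in L^2$ and $x\notin\operatorname{supp} f$, where the kernel satisfies $|K(x,y)|\le C|x-y|^{-N}$ and $|K(x,y)-K(x',y)|+|K(y,x)-K(y,x')|\le \omega\bigl(\tfrac{|x-x'|}{|x-y|}\bigr)|x-y|^{-N}$ whenever $2|x-x'|\le |x-y|$. On vector-valued functions $T$ acts componentwise, i.e. as $T\otimes \mathbf I_d$. $M_W^{1/2}$ denotes multiplication by $W^{1/2}$, so $M_W^{1/2}TM_V^{1/2}f=W^{1/2}T(V^{1/2}f)$, and the norm is the operator norm on the unweighted space $L^2(\mathbb R^N;\mathbb F^d)$ (the operator being defined initially on bounded compactly supported $f$, for which $V^{1/2}f\in L^2$). *)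

theory Defs
  imports "HOL-Analysis.Analysis"
begin

text \<open>
  The scalar field is a type \<open>'k\<close> of sort \<open>{real_normed_field, euclidean_space}\<close>.  By Frobenius'
  theorem the types of this sort are, up to isometric isomorphism, exactly \<^typ>\<open>real\<close> and
  \<^typ>\<open>complex\<close> (the norm is multiplicative, hence it is the usual absolute value, and the real
  inner product is determined by it through polarization; over \<^typ>\<open>complex\<close> it is
  \<open>inner a b = Re (a * cnj b)\<close>).

  Throughout, elements of $L^2$ are represented by Lebesgue measurable functions; identities between
  them are required almost everywhere only.
\<close>


subsection \<open>Matrices\<close>

text \<open>
  \<^const>\<open>inner\<close> on \<open>'k ^ 'd\<close> is the real part of the Hermitian product.  Since \<open>A\<close> is linear over
  \<open>'k\<close>, being self-adjoint for the real part is the same as being Hermitian, and then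
  \<open>inner (A *v x) x\<close> is the full value of the quadratic form; see \<open>psd_complex_iff\<close> and
  \<open>psd_complex_form\<close> below.
\<close>

definition psd :: "'k::{real_normed_field,euclidean_space} ^ 'd ^ 'd \<Rightarrow> bool" where
  "psd A \<longleftrightarrow> (\<forall>x y. inner (A *v x) y = inner x (A *v y)) \<and> (\<forall>x. 0 \<le> inner (A *v x) x)"

definition msqrt ::
  "'k::{real_normed_field,euclidean_space} ^ 'd ^ 'd \<Rightarrow> 'k ^ 'd ^ 'd" where
  "msqrt A = (THE B. psd B \<and> B ** B = A)"

definition mnorm :: "'k::{real_normed_field,euclidean_space} ^ 'd ^ 'd \<Rightarrow> real" where
  "mnorm A = onorm (\<lambda>x. A *v x)"

lemma inner_complex_vec:
  fixes x y :: "complex ^ 'd"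
  shows "inner x y = Re (\<Sum>i\<in>UNIV. x $ i * cnj (y $ i))"
  by (simp add: inner_vec_def inner_complex_def)

lemma hermitian_complex_form:
  fixes A :: "complex ^ 'd ^ 'd"
  assumes "\<forall>i j. A $ i $ j = cnj (A $ j $ i)"
  shows "(\<Sum>i\<in>UNIV. (A *v x) $ i * cnj (y $ i)) = (\<Sum>i\<in>UNIV. x $ i * cnj ((A *v y) $ i))"
proof -
  have "(\<Sum>i\<in>UNIV. (A *v x) $ i * cnj (y $ i))
      = (\<Sum>i\<in>UNIV. \<Sum>j\<in>UNIV. A $ i $ j * x $ j * cnj (y $ i))"
    by (simp add: matrix_vector_mult_def sum_distrib_right)
  also have "\<dots> = (\<Sum>j\<in>UNIV. \<Sum>i\<in>UNIV. A $ i $ j * x $ j * cnj (y $ i))"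
    by (rule sum.swap)
  also have "\<dots> = (\<Sum>j\<in>UNIV. \<Sum>i\<in>UNIV. x $ j * (cnj (A $ j $ i) * cnj (y $ i)))"
    using assms by (intro sum.cong refl) (metis mult.assoc mult.commute)
  also have "\<dots> = (\<Sum>i\<in>UNIV. x $ i * cnj ((A *v y) $ i))"
    by (simp add: matrix_vector_mult_def sum_distrib_left)
  finally show ?thesis .
qed

lemma selfadjoint_complex_iff:
  fixes A :: "complex ^ 'd ^ 'd"
  shows "(\<forall>x y. inner (A *v x) y = inner x (A *v y)) \<longleftrightarrow> (\<forall>i j. A $ i $ j = cnj (A $ j $ i))"
proof
  assume sa: "\<forall>x y. inner (A *v x) y = inner x (A *v y)"
  have col: "(A *v axis j c) $ i = A $ i $ j * c" for i j c
    by (simp add: matrix_vector_mult_def axis_def if_distrib cong: if_cong)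
  have *: "inner (A $ i $ j * c) e = inner c (A $ j $ i * e)" for i j c e
    using sa[rule_format, of "axis j c" "axis i e"]
    by (simp add: inner_axis inner_axis' col)
  show "\<forall>i j. A $ i $ j = cnj (A $ j $ i)"
  proof (intro allI complex_eqI)
    fix i j
    show "Re (A $ i $ j) = Re (cnj (A $ j $ i))"
      using *[of i j 1 1] by (simp add: inner_complex_def)
    show "Im (A $ i $ j) = Im (cnj (A $ j $ i))"
      using *[of i j 1 \<i>] by (simp add: inner_complex_def)
  qed
next
  assume "\<forall>i j. A $ i $ j = cnj (A $ j $ i)"
  from hermitian_complex_form[OF this]
  show "\<forall>x y. inner (A *v x) y = inner x (A *v y)"
    by (simp only: inner_complex_vec simp_thms)
qed

lemma psd_complex_iff:
  fixes A :: "complex ^ 'd ^ 'd"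
  shows "psd A \<longleftrightarrow> (\<forall>i j. A $ i $ j = cnj (A $ j $ i)) \<and>
    (\<forall>x. 0 \<le> Re (\<Sum>i\<in>UNIV. (A *v x) $ i * cnj (x $ i)))"
  unfolding psd_def selfadjoint_complex_iff by (simp only: inner_complex_vec)

lemma psd_complex_form:
  fixes A :: "complex ^ 'd ^ 'd"
  assumes "psd A"
  shows "complex_of_real (inner (A *v x) x) = (\<Sum>i\<in>UNIV. (A *v x) $ i * cnj (x $ i))"
proof -
  let ?s = "\<Sum>i\<in>UNIV. (A *v x) $ i * cnj (x $ i)"
  have "?s = (\<Sum>i\<in>UNIV. x $ i * cnj ((A *v x) $ i))"
    using assms unfolding psd_complex_iff by (intro hermitian_complex_form) (rule conjunct1)
  also have "\<dots> = cnj ?s"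
    by (simp only: cnj_sum complex_cnj_mult complex_cnj_cnj mult.commute)
  finally have "cnj ?s = ?s"
    by (rule sym)
  then have "Im ?s = 0"
    using Reals_cnj_iff[of ?s] complex_is_Real_iff[of ?s] by blast
  then show ?thesis
    unfolding inner_complex_vec by (intro complex_eqI) (simp_all only: Re_complex_of_real Im_complex_of_real)
qed


subsection \<open>Cubes, averages and weights\<close>

text \<open>
  Cubes have sides parallel to the axes and are taken half-open, so that the dyadic subcubes of
  each generation partition \<open>Q\<close>; no average depends on the boundary.
\<close>

definition cube :: "real ^ 'n \<Rightarrow> real \<Rightarrow> (real ^ 'n) set" where
  "cube a l = {x. \<forall>i. a $ i \<le> x $ i \<and> x $ i < a $ i + l}"

definition cubes :: "(real ^ 'n) set set" where
  "cubes = {cube a l | a l. 0 < l}"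

definition dyadic_subcubes :: "(real ^ 'n) set \<Rightarrow> (real ^ 'n) set set" where
  "dyadic_subcubes Q =
    {cube (\<chi> i. a $ i + l * real (m i) / 2 ^ k) (l / 2 ^ k) | a l k m.
       0 < l \<and> Q = cube a l \<and> (\<forall>i. m i < (2 ^ k :: nat))}"

text \<open>For a matrix-valued \<open>f\<close> the Bochner integral is the entrywise one.\<close>

definition average ::
  "(real ^ 'n) set \<Rightarrow> (real ^ 'n \<Rightarrow> 'b::{banach,second_countable_topology}) \<Rightarrow> 'b" where
  "average Q f = (1 / measure lebesgue Q) *\<^sub>R set_lebesgue_integral lebesgue Q f"

definition locally_integrable ::
  "(real ^ 'n \<Rightarrow> 'b::{banach,second_countable_topology}) \<Rightarrow> bool" where
  "locally_integrable f \<longleftrightarrow> (\<forall>S. compact S \<longrightarrow> set_integrable lebesgue S f)"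

definition matrix_weight ::
  "(real ^ 'n \<Rightarrow> 'k::{real_normed_field,euclidean_space} ^ 'd ^ 'd) \<Rightarrow> bool" where
  "matrix_weight W \<longleftrightarrow> locally_integrable W \<and> (\<forall>x. psd (W x))"

definition joint_A2 ::
  "(real ^ 'n \<Rightarrow> 'k::{real_normed_field,euclidean_space} ^ 'd ^ 'd) \<Rightarrow>
   (real ^ 'n \<Rightarrow> 'k ^ 'd ^ 'd) \<Rightarrow> ennreal" where
  "joint_A2 V W =
    (SUP Q\<in>cubes. ennreal ((mnorm (msqrt (average Q W) ** msqrt (average Q V)))\<^sup>2))"

text \<open>Extended-valued, since the supremum may be infinite.\<close>

definition dyadic_maximal ::
  "(real ^ 'n) set \<Rightarrow> (real ^ 'n \<Rightarrow> real) \<Rightarrow> real ^ 'n \<Rightarrow> ennreal" where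
  "dyadic_maximal Q f x =
    (if x \<in> Q then SUP R\<in>{R \<in> dyadic_subcubes Q. x \<in> R}. ennreal \<bar>average R f\<bar> else 0)"

definition A_infinity :: "(real ^ 'n \<Rightarrow> real) \<Rightarrow> ennreal" where
  "A_infinity w = Inf {C :: ennreal. \<forall>Q\<in>cubes.
     (\<integral>\<^sup>+x\<in>Q. dyadic_maximal Q w x \<partial>lebesgue) / emeasure lebesgue Q \<le> C * ennreal (average Q w)}"

definition A_infinity_sc ::
  "(real ^ 'n \<Rightarrow> 'k::{real_normed_field,euclidean_space} ^ 'd ^ 'd) \<Rightarrow> ennreal" where
  "A_infinity_sc W = (SUP e. A_infinity (\<lambda>x. inner (W x *v e) e))"


subsection \<open>Calderon--Zygmund operators\<close>

definition L2norm :: "(real ^ 'n \<Rightarrow> 'b::euclidean_space) \<Rightarrow> ennreal" where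
  "L2norm f = (let I = (\<integral>\<^sup>+x. ennreal ((norm (f x))\<^sup>2) \<partial>lebesgue)
    in if I = \<infinity> then \<infinity> else ennreal (sqrt (enn2real I)))"

definition L2 :: "(real ^ 'n \<Rightarrow> 'b::euclidean_space) set" where
  "L2 = {f \<in> borel_measurable lebesgue. L2norm f < \<infinity>}"

definition fsupp :: "(real ^ 'n \<Rightarrow> 'b::euclidean_space) \<Rightarrow> (real ^ 'n) set" where
  "fsupp f = closure {x. f x \<noteq> 0}"

text \<open>
  Linearity and boundedness together force \<open>T\<close> to respect almost everywhere equality, so \<open>T\<close>
  induces a bounded linear operator on the space of equivalence classes.
\<close>

definition L2_bounded_operator ::
  "((real ^ 'n \<Rightarrow> 'k::{real_normed_field,euclidean_space}) \<Rightarrow> real ^ 'n \<Rightarrow> 'k) \<Rightarrow> bool" where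
  "L2_bounded_operator T \<longleftrightarrow>
    (\<forall>f\<in>L2. T f \<in> L2) \<and>
    (\<forall>f\<in>L2. \<forall>g\<in>L2. \<forall>a b.
      AE x in lebesgue. T (\<lambda>y. a * f y + b * g y) x = a * T f x + b * T g x) \<and>
    (\<exists>B::real. \<forall>f\<in>L2. L2norm (T f) \<le> ennreal B * L2norm f)"

definition modulus_of_continuity :: "(real \<Rightarrow> real) \<Rightarrow> bool" where
  "modulus_of_continuity \<omega> \<longleftrightarrow>
    mono_on {0..} \<omega> \<and> (\<forall>s\<ge>0. \<forall>t\<ge>0. \<omega> (s + t) \<le> \<omega> s + \<omega> t) \<and> \<omega> 0 = 0"

definition dini :: "(real \<Rightarrow> real) \<Rightarrow> bool" where
  "dini \<omega> \<longleftrightarrow> (\<integral>\<^sup>+t\<in>{0<..1}. ennreal (\<omega> t / t) \<partial>lebesgue) < \<infinity>"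

definition CZ_kernel ::
  "(real \<Rightarrow> real) \<Rightarrow> (real ^ 'n \<Rightarrow> real ^ 'n \<Rightarrow> 'k::{real_normed_field,euclidean_space}) \<Rightarrow> bool"
  where
  "CZ_kernel \<omega> K \<longleftrightarrow>
    (\<exists>C. \<forall>x y. x \<noteq> y \<longrightarrow> norm (K x y) \<le> C / norm (x - y) ^ CARD('n)) \<and>
    (\<forall>x x' y. x \<noteq> y \<and> 2 * norm (x - x') \<le> norm (x - y) \<longrightarrow>
      norm (K x y - K x' y) + norm (K y x - K y x')
        \<le> \<omega> (norm (x - x') / norm (x - y)) / norm (x - y) ^ CARD('n))"

definition CZ_operator ::
  "(real \<Rightarrow> real) \<Rightarrow>
   ((real ^ 'n \<Rightarrow> 'k::{real_normed_field,euclidean_space}) \<Rightarrow> real ^ 'n \<Rightarrow> 'k) \<Rightarrow> bool" where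
  "CZ_operator \<omega> T \<longleftrightarrow> L2_bounded_operator T \<and>
    (\<exists>K. CZ_kernel \<omega> K \<and>
      (\<forall>f\<in>L2. AE x in lebesgue. x \<notin> fsupp f \<longrightarrow> T f x = (LINT y|lebesgue. K x y * f y)))"

definition componentwise ::
  "((real ^ 'n \<Rightarrow> 'k) \<Rightarrow> real ^ 'n \<Rightarrow> 'k) \<Rightarrow>
   (real ^ 'n \<Rightarrow> 'k::{real_normed_field,euclidean_space} ^ 'd) \<Rightarrow> real ^ 'n \<Rightarrow> 'k ^ 'd" where
  "componentwise T f = (\<lambda>x. \<chi> i. T (\<lambda>y. f y $ i) x)"

definition mult_sqrt ::
  "(real ^ 'n \<Rightarrow> 'k::{real_normed_field,euclidean_space} ^ 'd ^ 'd) \<Rightarrow>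
   (real ^ 'n \<Rightarrow> 'k ^ 'd) \<Rightarrow> real ^ 'n \<Rightarrow> 'k ^ 'd" where
  "mult_sqrt W f = (\<lambda>x. msqrt (W x) *v f x)"

text \<open>
  The norm on $L^2$ of an operator given on the dense subspace of bounded functions with compact
  support; it is infinite if the operator has no bounded extension.
\<close>

definition L2_operator_norm ::
  "((real ^ 'n \<Rightarrow> 'b::euclidean_space) \<Rightarrow> real ^ 'n \<Rightarrow> 'b) \<Rightarrow> ennreal" where
  "L2_operator_norm S =
    (SUP f\<in>{f \<in> borel_measurable lebesgue. bounded (range f) \<and> compact (fsupp f) \<and> L2norm f \<le> 1}.
       L2norm (S f))"

end

theory Submission
  imports Defs
begin

text \<open>
  By duality it suffices to bound $\int |\langle T F, G\rangle|$ for $F = V^{1/2} f$ and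
  $G = W^{1/2} g$ with bounded \<open>f\<close>, \<open>g\<close> that vanish off one large cube.  Write
  $K^2 = [V,W]_{\mathbf A_2}$ and $M_p f = (M |f|^p)^{1/p}$ for the Hardy--Littlewood maximal
  function \<open>M\<close>.  The bound is
  \[ \int |\langle T F, G\rangle| \le C K \int M_p f \, M_q g \]
  with exponents \<open>p, q < 2\<close> such that $2 - p$ is comparable to $1/[V]_{A_\infty}$ and $2 - q$ to
  $1/[W]_{A_\infty}$.  The norm of $M_p$ on $L^2$ is at most a constant times $(2-p)^{-1/2}$
  (\<open>hl_max_strong_type\<close>), so Cauchy--Schwarz gives exactly one factor
  $([V]_{A_\infty} [W]_{A_\infty})^{1/2}$, and squaring gives the theorem.

  \<^bold>\<open>One cube.\<close>  Fix a cube \<open>Q\<close> with concentric dilate \<open>Q*\<close>.  The positive matrices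
  $\langle V\rangle_{Q*}$ and $\langle W\rangle_{Q*}$ have orthonormal eigenbases, and the matrix
  problem decouples into finitely many scalar ones when \<open>F\<close> is expanded in the first basis and \<open>G\<close>
  in the second.  Let \<open>b\<close> be an eigenvector of $\langle V\rangle_{Q*}$ with eigenvalue
  $\lambda$.  Then $|\langle F, b\rangle| \le |f| (Vb,b)^{1/2}$.  The scalar weight $(Vb,b)$ has
  average $\lambda$ over \<open>Q*\<close> and $A_\infty$ constant at most $[V]_{A_\infty}$, so the sharp reverse
  Holder inequality (\<open>reverse_Holder\<close>) and Holder's inequality bound the average of
  $|\langle F, b\rangle|$ by $2 \lambda^{1/2} \langle |f|^p\rangle_{Q*}^{1/p}$
  (\<open>coefficient_average\<close>).  The same holds for \<open>G\<close> and an eigenvector \<open>u\<close> of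
  $\langle W\rangle_{Q*}$ with eigenvalue $\mu$.  The joint $\mathbf A_2$ condition enters through
  \[ (\lambda\mu)^{1/2} |\langle b, u\rangle| = |\langle \langle W\rangle^{1/2}\langle V\rangle^{1/2} b, u\rangle| \le K , \]
  so the products of the two averages with $|\langle b, u\rangle|$ are at most
  $4 K \langle |f|^p\rangle_{Q*}^{1/p} \langle |g|^q\rangle_{Q*}^{1/q}$, which is at most a constant times
  \<open>K\<close> times the infimum of $M_p f \, M_q g$ over \<open>Q\<close> (\<open>matrix_A2_local_bases\<close>).

  \<^bold>\<open>From one cube to its stopping cubes.\<close>  For a scalar function \<open>h\<close> with average \<open>a\<close> of $|h|$ over
  \<open>Q*\<close>, the weak type (1,1) estimates for \<open>T\<close> and \<open>M\<close> show that $T(1_{Q*} h)$ and $M(1_{Q*} h)$ are at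
  most $C a$ off a small part of \<open>Q\<close>.  Stopping cubes \<open>R\<close> that cover this part have total measure at
  most $|Q|/2$, and each contains many good points; comparison with a good point by the
  smoothness of the kernel shows that $T(1_{Q*} h) - T(1_{R*} h)$ is at most $C a$ on all of \<open>R\<close>
  (\<open>local_domination\<close>).  This is done for all coordinates of \<open>F\<close> simultaneously.  Hence, up to an
  error of integral at most $C K |Q| \inf_Q M_p f \, M_q g$, the form on \<open>Q\<close> is bounded by the sum of
  the forms on the stopping cubes.  Since at least half of \<open>Q\<close> lies off the stopping cubes, this
  error is at most $2 C K$ times the integral of $M_p f \, M_q g$ over that half, and in an iteration
  these halves are disjoint (\<open>form_bound_off_small_set\<close>).  After \<open>n\<close> generations the set not yet
  accounted for has measure at most $2^{-n} |Q|$, and it disappears in the limit (\<open>form_bound\<close>).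
\<close>


section \<open>Eigenbases and square roots of positive semidefinite matrices\<close>

lemma real_quadratic_nonneg_linear_coeff:
  fixes b c :: real
  assumes "\<And>t. 0 \<le> 2 * t * b + t\<^sup>2 * c"
  shows "b = 0"
proof (rule ccontr)
  assume b: "b \<noteq> 0"
  define s where "s = 1 / (\<bar>c\<bar> + 1)"
  have s: "s > 0" "s * \<bar>c\<bar> < 1" unfolding s_def by (auto simp: field_simps)
  have "s * c < 2" using s by (smt (verit) mult_left_mono abs_ge_self)
  then have "0 < s * b\<^sup>2 * (2 - s * c)" using s b by simp
  moreover have "0 \<le> 2 * (- s * b) * b + (- s * b)\<^sup>2 * c" by (rule assms)
  ultimately show False by (simp add: power2_eq_square algebra_simps)
qed

text \<open>
  The quadratic form attains its maximum on the unit sphere of the invariant subspace, and the first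
  variation at a maximiser vanishes; this is the eigenvalue equation.
\<close>

lemma selfadjoint_eigenvector_in_subspace:
  fixes A :: "'a::euclidean_space \<Rightarrow> 'a"
  assumes lin: "linear A" and sa: "\<And>x y. inner (A x) y = inner x (A y)"
    and S: "subspace S" "S \<noteq> {0}" and inv: "\<And>x. x \<in> S \<Longrightarrow> A x \<in> S"
  obtains v m where "v \<in> S" "norm v = 1" "A v = m *\<^sub>R v"
proof -
  interpret A: linear A by (rule lin)
  let ?K = "S \<inter> sphere 0 1"
  have K: "compact ?K" using S(1) by (simp add: closed_subspace closed_Int_compact)
  obtain z where z: "z \<in> S" "z \<noteq> 0" using S subspace_0 by blast
  have "inverse (norm z) *\<^sub>R z \<in> ?K" using z S by (simp add: subspace_scale)
  then have ne: "?K \<noteq> {}" by blast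
  have cont: "continuous_on ?K (\<lambda>x. inner (A x) x)"
    using lin by (intro continuous_intros linear_continuous_on) (simp add: linear_conv_bounded_linear)
  obtain v where v: "v \<in> ?K" and vmax: "\<And>y. y \<in> ?K \<Longrightarrow> inner (A y) y \<le> inner (A v) v"
    using continuous_attains_sup[OF K ne cont] by blast
  have vS: "v \<in> S" and nv: "norm v = 1" using v by auto
  define m where "m = inner (A v) v"
  have le: "inner (A y) y \<le> m * (norm y)\<^sup>2" if "y \<in> S" for y
  proof (cases "y = 0")
    case True then show ?thesis by (simp add: A.zero)
  next
    case False
    have "inverse (norm y) *\<^sub>R y \<in> ?K" using False that S by (simp add: subspace_scale)
    from vmax[OF this] have "inverse (norm y) * (inverse (norm y) * inner (A y) y) \<le> m"
      by (simp add: A.scaleR m_def)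
    then show ?thesis using False by (simp add: field_simps power2_eq_square)
  qed
  have "m * inner v w - inner (A v) w = 0" if w: "w \<in> S" for w
  proof (rule real_quadratic_nonneg_linear_coeff[where c = "m * (norm w)\<^sup>2 - inner (A w) w"])
    fix t :: real
    have "v + t *\<^sub>R w \<in> S" using vS w S(1) by (simp add: subspace_add subspace_scale)
    from le[OF this]
    have "inner (A v + t *\<^sub>R A w) (v + t *\<^sub>R w) \<le> m * inner (v + t *\<^sub>R w) (v + t *\<^sub>R w)"
      by (simp add: A.add A.scaleR power2_norm_eq_inner)
    moreover have "inner (A w) v = inner (A v) w" by (metis sa inner_commute)
    moreover have "inner v v = 1" using nv by (simp add: norm_eq_1)
    ultimately show "0 \<le> 2 * t * (m * inner v w - inner (A v) w) + t\<^sup>2 * (m * (norm w)\<^sup>2 - inner (A w) w)"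
      unfolding power2_norm_eq_inner
      by (simp add: m_def[symmetric] inner_add_left inner_add_right
          inner_commute[of w v] power2_eq_square algebra_simps)
  qed
  note * = this
  have "m *\<^sub>R v - A v \<in> S" using vS inv S(1) by (simp add: subspace_diff subspace_scale)
  from *[OF this] have "inner (m *\<^sub>R v - A v) (m *\<^sub>R v - A v) = 0"
    by (simp add: inner_diff_left)
  then have "A v = m *\<^sub>R v" by simp
  with vS nv that show ?thesis by blast
qed

text \<open>
  The space is regarded as a real one throughout: an eigenbasis of a matrix acting on \<open>complex
  ^ 'd\<close> has twice as many elements as there are coordinates. The spectral theorem is then
  needed only over the reals, for both scalar fields at once.
\<close>

definition eigenbasis :: "('a::euclidean_space \<Rightarrow> 'a) \<Rightarrow> 'a set \<Rightarrow> ('a \<Rightarrow> real) \<Rightarrow> bool" where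
  "eigenbasis A B l \<longleftrightarrow> finite B \<and> card B = DIM('a) \<and> pairwise orthogonal B \<and>
     (\<forall>b\<in>B. norm b = 1) \<and> span B = UNIV \<and> (\<forall>b\<in>B. A b = l b *\<^sub>R b)"

text \<open>
  A largest orthonormal system of eigenvectors spans, since otherwise the orthogonal complement,
  which is again invariant, contains one more eigenvector.
\<close>

theorem selfadjoint_eigenbasis:
  fixes A :: "'a::euclidean_space \<Rightarrow> 'a"
  assumes lin: "linear A" and sa: "\<And>x y. inner (A x) y = inner x (A y)"
  obtains B l where "eigenbasis A B l"
proof -
  interpret A: linear A by (rule lin)
  define P where "P B \<longleftrightarrow> pairwise orthogonal B \<and> (\<forall>b\<in>B. norm b = 1 \<and> (\<exists>m. A b = m *\<^sub>R b))"
    for B :: "'a set"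
  have indep: "independent B" if "P B" for B
    using that pairwise_orthogonal_independent unfolding P_def by force
  then have bd: "finite B \<and> card B \<le> DIM('a)" if "P B" for B
    using that independent_bound by blast
  have "\<exists>B. P B \<and> (\<forall>B'. P B' \<longrightarrow> card B' \<le> card B)"
    by (rule ex_has_greatest_nat[where b = "Suc DIM('a)" and k = "{}"])
      (use bd in \<open>auto simp: P_def less_Suc_eq_le\<close>)
  then obtain B where B: "P B" and mx: "\<And>B'. P B' \<Longrightarrow> card B' \<le> card B" by blast
  have fin: "finite B" using bd B by blast
  have "span B = UNIV"
  proof (rule ccontr)
    assume "span B \<noteq> UNIV"
    then have "dim B < DIM('a)"
      by (metis dim_eq_full dim_subset_UNIV le_neq_implies_less)
    then obtain x where x: "x \<noteq> 0" "\<And>y. y \<in> span B \<Longrightarrow> orthogonal x y"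
      using orthogonal_to_subspace_exists by blast
    define S where "S = {x. \<forall>b\<in>B. inner x b = 0}"
    have "subspace S" unfolding S_def subspace_def by (auto simp: inner_add_left)
    moreover have "x \<in> S" using x(2) by (auto simp: S_def orthogonal_def span_base)
    then have "S \<noteq> {0}" using x by blast
    moreover have "A y \<in> S" if "y \<in> S" for y
    proof -
      have "inner (A y) b = 0" if b: "b \<in> B" for b
      proof -
        obtain m where "A b = m *\<^sub>R b" using B b unfolding P_def by blast
        then show ?thesis using \<open>y \<in> S\<close> b by (simp add: sa S_def)
      qed
      then show ?thesis by (simp add: S_def)
    qed
    ultimately obtain v m where v: "v \<in> S" "norm v = 1" "A v = m *\<^sub>R v"
      using selfadjoint_eigenvector_in_subspace[OF lin sa] by metis
    have "v \<notin> B" using v by (auto simp: S_def)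
    moreover have "P (insert v B)"
      using B v unfolding P_def by (auto simp: pairwise_insert S_def orthogonal_def inner_commute)
    from mx[OF this] have "card (insert v B) \<le> card B" .
    ultimately show False using fin by simp
  qed
  moreover have "card B = DIM('a)"
    using indep[OF B] \<open>span B = UNIV\<close> by (metis dim_UNIV dim_eq_card_independent dim_span)
  moreover obtain l where "\<forall>b\<in>B. A b = l b *\<^sub>R b"
    using B unfolding P_def by metis
  ultimately have "eigenbasis A B l" using B fin by (auto simp: eigenbasis_def P_def)
  then show ?thesis by (rule that)
qed

lemma eigenbasis_expand:
  assumes "eigenbasis A B l"
  shows "(\<Sum>b\<in>B. inner x b *\<^sub>R b) = x"
  using assms by (intro orthonormal_basis_expand) (auto simp: eigenbasis_def)

lemma eigenbasis_norm:
  assumes "eigenbasis A B l"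
  shows "(norm x)\<^sup>2 = (\<Sum>b\<in>B. (inner x b)\<^sup>2)"
proof -
  have "inner x x = inner x (\<Sum>b\<in>B. inner x b *\<^sub>R b)" by (simp only: eigenbasis_expand[OF assms])
  then show ?thesis unfolding power2_norm_eq_inner by (simp add: inner_sum_right power2_eq_square)
qed

lemma eigenbasis_apply:
  assumes "eigenbasis A B l" "linear A"
  shows "A x = (\<Sum>b\<in>B. (l b * inner x b) *\<^sub>R b)"
proof -
  have "A x = A (\<Sum>b\<in>B. inner x b *\<^sub>R b)" by (simp only: eigenbasis_expand[OF assms(1)])
  also have "\<dots> = (\<Sum>b\<in>B. inner x b *\<^sub>R A b)"
    using assms(2) by (simp add: linear_sum linear_cmul o_def)
  also have "\<dots> = (\<Sum>b\<in>B. (l b * inner x b) *\<^sub>R b)"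
    using assms(1) by (intro sum.cong) (auto simp: eigenbasis_def)
  finally show ?thesis .
qed

lemma eigenbasis_inner:
  assumes "eigenbasis A B l" "b \<in> B" "c \<in> B"
  shows "inner b c = (if b = c then 1 else 0)"
  using assms by (auto simp: eigenbasis_def pairwise_def orthogonal_def norm_eq_1)

definition psd_op :: "('a::euclidean_space \<Rightarrow> 'a) \<Rightarrow> bool" where
  "psd_op A \<longleftrightarrow> linear A \<and> (\<forall>x y. inner (A x) y = inner x (A y)) \<and> (\<forall>x. 0 \<le> inner (A x) x)"

text \<open>
  The case \<open>e = 0\<close> is the uniqueness of positive square roots; the general case is
  their continuity, from which the square root of a measurable weight is measurable. At a unit
  eigenvector \<open>b\<close> of \<open>R1 - R2\<close> with eigenvalue \<open>l\<close> the number
  $\langle (R_1^2 - R_2^2) b, b\rangle$ equals $l \langle (R_1 + R_2) b, b\rangle$, and the second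
  factor is at least $|l|$.
\<close>

lemma psd_op_sqrt_close:
  assumes R1: "psd_op R1" and R2: "psd_op R2"
    and close: "\<And>x. norm (R1 (R1 x) - R2 (R2 x)) \<le> e * norm x"
  shows "(norm (R1 x - R2 x))\<^sup>2 \<le> e * (norm x)\<^sup>2"
proof -
  define D where "D x = R1 x - R2 x" for x
  have linD: "linear D" unfolding D_def using R1 R2 by (auto simp: psd_op_def intro: linear_compose_sub)
  have saD: "inner (D x) y = inner x (D y)" for x y
    using R1 R2 by (simp add: psd_op_def D_def inner_diff_left inner_diff_right)
  obtain B l where B: "eigenbasis D B l" using selfadjoint_eigenbasis[OF linD saD] by blast
  have l: "(l b)\<^sup>2 \<le> e" if b: "b \<in> B" for b
  proof -
    have nb: "norm b = 1" and Db: "D b = l b *\<^sub>R b" using B b by (auto simp: eigenbasis_def)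
    have bb: "inner b b = 1" using nb by (simp add: norm_eq_1)
    define s where "s = inner (R1 b) b + inner (R2 b) b"
    have p: "0 \<le> inner (R1 b) b" "0 \<le> inner (R2 b) b" using R1 R2 by (auto simp: psd_op_def)
    have "l b = inner (D b) b" using Db bb by simp
    then have "l b = inner (R1 b) b - inner (R2 b) b" by (simp add: D_def inner_diff_left)
    then have ls: "\<bar>l b\<bar> \<le> s" using p by (simp add: s_def)
    have "inner (R1 (R1 b) - R2 (R2 b)) b = inner (R1 b) (R1 b) - inner (R2 b) (R2 b)"
      using R1 R2 by (simp add: psd_op_def inner_diff_left)
    also have "\<dots> = inner (D b) (R1 b + R2 b)"
      by (simp add: D_def inner_diff_left inner_add_right inner_commute[of "R2 b" "R1 b"])
    also have "\<dots> = l b * s" by (simp add: Db s_def inner_add_right inner_commute distrib_left)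
    finally have "\<bar>l b * s\<bar> \<le> norm (R1 (R1 b) - R2 (R2 b)) * norm b"
      by (metis Cauchy_Schwarz_ineq2)
    also have "\<dots> \<le> e" using close[of b] nb by simp
    finally have "\<bar>l b\<bar> * s \<le> e" using p by (simp add: abs_mult s_def)
    moreover have "\<bar>l b\<bar> * \<bar>l b\<bar> \<le> \<bar>l b\<bar> * s" by (rule mult_left_mono[OF ls abs_ge_zero])
    ultimately show ?thesis by (simp add: power2_eq_square abs_mult_self_eq)
  qed
  have Dx: "inner (D x) b = l b * inner x b" if "b \<in> B" for b
    using that B by (simp add: saD eigenbasis_def)
  have "(norm (D x))\<^sup>2 = (\<Sum>b\<in>B. (l b)\<^sup>2 * (inner x b)\<^sup>2)"
    unfolding eigenbasis_norm[OF B] by (intro sum.cong) (auto simp: Dx power_mult_distrib)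
  also have "\<dots> \<le> (\<Sum>b\<in>B. e * (inner x b)\<^sup>2)"
    by (intro sum_mono mult_right_mono l) auto
  also have "\<dots> = e * (norm x)\<^sup>2" by (simp add: eigenbasis_norm[OF B] sum_distrib_left)
  finally show ?thesis by (simp add: D_def)
qed

lemma psd_op_sqrt_unique:
  assumes "psd_op R1" "psd_op R2" "\<And>x. R1 (R1 x) = R2 (R2 x)"
  shows "R1 = R2"
proof
  fix x show "R1 x = R2 x" using psd_op_sqrt_close[OF assms(1,2), of 0 x] assms(3) by simp
qed

lemma psd_op_sqrt_exists:
  fixes A :: "'a::euclidean_space \<Rightarrow> 'a"
  assumes A: "psd_op A"
  obtains R where "psd_op R" "\<And>x. R (R x) = A x"
proof -
  have lin: "linear A" using A by (simp add: psd_op_def)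
  obtain B l where B: "eigenbasis A B l"
    using selfadjoint_eigenbasis[of A] A unfolding psd_op_def by blast
  have fB: "finite B" using B by (simp add: eigenbasis_def)
  have l0: "0 \<le> l b" if "b \<in> B" for b
  proof -
    have "0 \<le> inner (A b) b" using A unfolding psd_op_def by blast
    then show ?thesis using that B by (auto simp: eigenbasis_def norm_eq_1)
  qed
  define R where "R x = (\<Sum>b\<in>B. (sqrt (l b) * inner x b) *\<^sub>R b)" for x
  have Rb: "inner (R x) b = sqrt (l b) * inner x b" if b: "b \<in> B" for x b
  proof -
    have "inner (R x) b = (\<Sum>c\<in>B. (sqrt (l c) * inner x c) * (if c = b then 1 else 0))"
      unfolding R_def inner_sum_left
      by (intro sum.cong) (auto simp: eigenbasis_inner[OF B _ b])
    also have "\<dots> = sqrt (l b) * inner x b" using b fB by (simp add: if_distrib cong: if_cong)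
    finally show ?thesis .
  qed
  have "psd_op R" unfolding psd_op_def
  proof (intro conjI allI)
    show "linear R" unfolding R_def
      by (intro linearI) (simp_all add: inner_add_left algebra_simps sum.distrib scaleR_sum_right)
    show "inner (R x) y = inner x (R y)" for x y
      by (simp add: R_def inner_sum_left inner_sum_right inner_commute[of _ y] mult_ac)
    show "0 \<le> inner (R x) x" for x
      unfolding R_def inner_sum_left
      by (intro sum_nonneg) (simp add: l0 inner_commute[of _ x] mult.assoc)
  qed
  moreover have "R (R x) = A x" for x
  proof -
    have "R (R x) = (\<Sum>b\<in>B. (sqrt (l b) * (sqrt (l b) * inner x b)) *\<^sub>R b)"
      unfolding R_def[of "R x"] by (intro sum.cong) (auto simp: Rb)
    also have "\<dots> = (\<Sum>b\<in>B. (l b * inner x b) *\<^sub>R b)"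
      by (intro sum.cong) (auto simp: l0 mult.assoc[symmetric])
    finally show ?thesis by (simp add: eigenbasis_apply[OF B lin])
  qed
  ultimately show ?thesis by (rule that)
qed

lemma norm_vector_scalar_mult:
  fixes x :: "'k::{real_normed_field,euclidean_space} ^ 'd"
  shows "norm (c *s x) = norm c * norm x"
  by (simp add: norm_vec_def L2_set_def vector_scalar_mult_def norm_mult power_mult_distrib
      sum_distrib_left[symmetric] real_sqrt_mult)

lemma linear_vector_scalar_mult:
  "linear (\<lambda>x :: 'k::{real_normed_field,euclidean_space} ^ 'd. c *s x)"
  by (intro linearI) (simp_all add: vec_eq_iff algebra_simps)

lemma inner_unit_scalar_mult:
  fixes x y :: "'k::{real_normed_field,euclidean_space} ^ 'd"
  assumes "norm c = 1"
  shows "inner (c *s x) (c *s y) = inner x y"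
proof -
  have "norm (c *s x + c *s y) = norm (x + y)"
    using assms norm_vector_scalar_mult[of c "x + y"] by (simp add: vector_add_ldistrib)
  then have "inner (c *s x + c *s y) (c *s x + c *s y) = inner (x + y) (x + y)"
    by (simp add: norm_eq)
  moreover have "inner (c *s z) (c *s z) = inner z z" for z :: "'k ^ 'd"
    using assms norm_vector_scalar_mult[of c z] by (simp add: norm_eq)
  ultimately show ?thesis by (simp add: inner_add_left inner_add_right inner_commute)
qed

lemma matrix_vector_scalar_mult_commute:
  fixes A :: "'k::field ^ 'd ^ 'm"
  shows "A *v (c *s x) = c *s (A *v x)"
  by (simp add: matrix_vector_mult_def vec_eq_iff sum_distrib_left mult_ac)

lemma psd_imp_psd_op: "psd A \<Longrightarrow> psd_op (\<lambda>x. A *v x)"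
  unfolding psd_def psd_op_def using matrix_vector_mul_linear by blast

lemma scaleR_as_vector_scalar_mult:
  fixes x :: "'k::{real_normed_field,euclidean_space} ^ 'd"
  shows "r *\<^sub>R x = of_real r *s x"
  unfolding vec_eq_iff vector_scaleR_component vector_smult_component
  unfolding scaleR_conv_of_real by simp

lemma matrix_of_commuting_op:
  fixes R :: "'k::{real_normed_field,euclidean_space} ^ 'd \<Rightarrow> 'k ^ 'd"
  assumes lin: "linear R" and comm: "\<And>c x. norm c = 1 \<Longrightarrow> R (c *s x) = c *s R x"
  obtains M where "R = (\<lambda>x. M *v x)"
proof -
  have comm': "R (c *s x) = c *s R x" for c x
  proof (cases "c = 0")
    case True then show ?thesis using linear_0[OF lin] by simp
  next
    case False
    define u where "u = c / of_real (norm c)"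
    have u: "norm u = 1" using False by (simp add: u_def norm_divide)
    have cu: "c = of_real (norm c) * u" using False by (simp add: u_def)
    have "R (c *s x) = R (norm c *\<^sub>R (u *s x))"
      unfolding scaleR_as_vector_scalar_mult by (subst cu) (simp add: vector_smult_assoc)
    also have "\<dots> = norm c *\<^sub>R (u *s R x)" by (simp add: linear_cmul[OF lin] comm[OF u])
    also have "\<dots> = (of_real (norm c) * u) *s R x"
      unfolding scaleR_as_vector_scalar_mult by (simp add: vector_smult_assoc)
    also have "\<dots> = c *s R x" by (simp only: cu[symmetric])
    finally show ?thesis .
  qed
  define M where "M = (\<chi> i j. R (axis j 1) $ i)"
  have "R x = M *v x" for x
  proof -
    have "x = (\<Sum>j\<in>UNIV. x $ j *s axis j 1)" by (simp add: basis_expansion)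
    then have "R x = R (\<Sum>j\<in>UNIV. x $ j *s axis j 1)" by simp
    also have "\<dots> = (\<Sum>j\<in>UNIV. x $ j *s R (axis j 1))"
      by (simp add: linear_sum[OF lin] comm')
    also have "\<dots> = M *v x"
      by (simp add: vec_eq_iff matrix_vector_mult_def M_def mult.commute)
    finally show ?thesis .
  qed
  then show ?thesis using that by blast
qed

text \<open>
  The root found over the reals is linear over the scalar field: conjugation by a unimodular scalar
  turns it into another positive root of the same matrix, hence into itself.
\<close>

lemma msqrt_ex1:
  fixes A :: "'k::{real_normed_field,euclidean_space} ^ 'd ^ 'd"
  assumes A: "psd A"
  shows "\<exists>!B. psd B \<and> B ** B = A"
proof -
  obtain R where R: "psd_op R" and RR: "\<And>x. R (R x) = A *v x"
    using psd_op_sqrt_exists[OF psd_imp_psd_op[OF A]] by blast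
  have linR: "linear R" using R by (simp add: psd_op_def)
  have "R (c *s x) = c *s R x" if c: "norm c = 1" for c x
  proof -
    have c0: "c \<noteq> 0" using c by auto
    have ci: "norm (inverse c) = 1" using c by (simp add: norm_inverse)
    define R' where "R' y = inverse c *s R (c *s y)" for y
    have adj: "inner (inverse c *s y) z = inner y (c *s z)" for y z :: "'k ^ 'd"
      using inner_unit_scalar_mult[OF c, of "inverse c *s y" z] c0 by (simp add: vector_smult_assoc)
    have adj': "inner (c *s y) z = inner y (inverse c *s z)" for y z :: "'k ^ 'd"
      using adj[of z y] by (simp add: inner_commute)
    have "psd_op R'" unfolding psd_op_def
    proof (intro conjI allI)
      have "linear ((\<lambda>x. inverse c *s x) \<circ> (R \<circ> (\<lambda>x. c *s x)))"
        by (intro linear_compose linR linear_vector_scalar_mult)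
      then show "linear R'" by (simp add: R'_def[abs_def] o_def)
      show "inner (R' y) z = inner y (R' z)" for y z
        using R by (simp add: R'_def adj adj'[symmetric] psd_op_def)
      show "0 \<le> inner (R' y) y" for y
      proof -
        have "0 \<le> inner (R (c *s y)) (c *s y)" using R unfolding psd_op_def by blast
        then show ?thesis by (simp add: R'_def adj)
      qed
    qed
    moreover have "R' (R' y) = R (R y)" for y
      using c0 by (simp add: R'_def vector_smult_assoc RR matrix_vector_scalar_mult_commute)
    ultimately have "R' = R" using R psd_op_sqrt_unique by blast
    then have "R x = inverse c *s R (c *s x)" by (simp add: R'_def fun_eq_iff)
    then show ?thesis using c0 by (simp add: vector_smult_assoc)
  qed
  then obtain M where M: "R = (\<lambda>x. M *v x)"
    using matrix_of_commuting_op[OF linR] by blast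
  have "psd M" using R unfolding M psd_def psd_op_def by blast
  moreover have "M ** M = A"
  proof -
    have "(M ** M) *v x = A *v x" for x using RR[of x] by (simp add: M matrix_vector_mul_assoc)
    then show ?thesis by (simp add: matrix_eq)
  qed
  moreover have "B = M" if B: "psd B" "B ** B = A" for B
  proof -
    have "(\<lambda>x. B *v x) = (\<lambda>x. M *v x)"
      using psd_op_sqrt_unique[OF psd_imp_psd_op[OF B(1)] psd_imp_psd_op[OF \<open>psd M\<close>]]
      by (simp add: matrix_vector_mul_assoc B(2) \<open>M ** M = A\<close>)
    then show ?thesis by (simp add: matrix_eq fun_eq_iff)
  qed
  ultimately show ?thesis by blast
qed

lemma
  assumes "psd A"
  shows psd_msqrt: "psd (msqrt A)" and msqrt_mult_self: "msqrt A ** msqrt A = A"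
  using theI'[OF msqrt_ex1[OF assms]] by (auto simp: msqrt_def)

lemma norm_msqrt_mult:
  assumes "psd A"
  shows "(norm (msqrt A *v x))\<^sup>2 = inner (A *v x) x"
proof -
  have "inner (msqrt A *v x) (msqrt A *v x) = inner (msqrt A *v (msqrt A *v x)) x"
    using psd_msqrt[OF assms] by (simp add: psd_def)
  then show ?thesis
    by (simp add: power2_norm_eq_inner matrix_vector_mul_assoc msqrt_mult_self[OF assms])
qed

text \<open>
  The vector $w = A^{1/2} b - l^{1/2} b$ satisfies $A^{1/2} w = - l^{1/2} w$, which positivity
  allows only if it is zero or \<open>l = 0\<close>.
\<close>

lemma msqrt_eigenvector:
  assumes A: "psd A" and b: "A *v b = l *\<^sub>R b" and l: "0 \<le> l"
  shows "msqrt A *v b = sqrt l *\<^sub>R b"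
proof -
  define R where "R = msqrt A"
  have R: "psd R" unfolding R_def by (rule psd_msqrt[OF A])
  define w where "w = R *v b - sqrt l *\<^sub>R b"
  have RR: "R *v (R *v b) = l *\<^sub>R b" by (simp add: R_def matrix_vector_mul_assoc msqrt_mult_self[OF A] b)
  have "R *v w = - sqrt l *\<^sub>R w"
    using l by (simp add: w_def matrix_vector_mult_diff_distrib RR
        linear_cmul[OF matrix_vector_mul_linear] scaleR_diff_right)
  moreover have "0 \<le> inner (R *v w) w" using R unfolding psd_def by blast
  ultimately have "sqrt l * inner w w \<le> 0" by simp
  then consider "l = 0" | "w = 0" using l
    by (smt (verit) inner_gt_zero_iff mult_pos_pos real_sqrt_gt_zero)
  then show ?thesis
  proof cases
    case 1
    have "(norm (R *v b))\<^sup>2 = 0" using norm_msqrt_mult[OF A, of b] b 1 by (simp add: R_def)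
    then show ?thesis using 1 by (simp add: R_def)
  qed (simp add: w_def R_def)
qed

lemma bounded_bilinear_matrix_vector:
  "bounded_bilinear (\<lambda>(A :: 'k::{real_normed_field,euclidean_space} ^ 'd ^ 'd) x. A *v x)"
  unfolding bilinear_conv_bounded_bilinear[symmetric] bilinear_def
  by (auto intro!: linearI simp: matrix_vector_mult_def vec_eq_iff algebra_simps sum.distrib scaleR_sum_right)

lemma continuous_on_msqrt:
  "continuous_on {A :: 'k::{real_normed_field,euclidean_space} ^ 'd ^ 'd. psd A} msqrt"
proof -
  obtain c where c: "0 < c" "\<And>(A :: 'k ^ 'd ^ 'd) x. norm (A *v x) \<le> norm A * norm x * c"
    using bounded_bilinear.pos_bounded[OF bounded_bilinear_matrix_vector] by blast
  have est: "(norm (msqrt A *v x - msqrt B *v x))\<^sup>2 \<le> (norm (A - B) * c) * (norm x)\<^sup>2"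
    if "psd A" "psd B" for A B :: "'k ^ 'd ^ 'd" and x
  proof (rule psd_op_sqrt_close)
    show "psd_op ((*v) (msqrt A))" "psd_op ((*v) (msqrt B))"
      using that by (auto intro!: psd_imp_psd_op psd_msqrt)
    show "norm (msqrt A *v (msqrt A *v x) - msqrt B *v (msqrt B *v x)) \<le> norm (A - B) * c * norm x" for x
      using c(2)[of "A - B" x] that
      by (simp add: matrix_vector_mul_assoc msqrt_mult_self matrix_vector_mult_diff_rdistrib mult_ac)
  qed
  have vec: "continuous_on {A. psd A} (\<lambda>A. msqrt A *v x)" for x :: "'k ^ 'd"
    unfolding continuous_on_def
  proof (intro ballI)
    fix B :: "'k ^ 'd ^ 'd" assume B: "B \<in> {A. psd A}"
    let ?F = "at B within {A. psd A}"
    have "((\<lambda>A. sqrt ((norm (A - B) * c) * (norm x)\<^sup>2)) \<longlongrightarrow> sqrt ((norm (B - B) * c) * (norm x)\<^sup>2)) ?F"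
      by (intro tendsto_intros)
    then have lim: "((\<lambda>A. sqrt ((norm (A - B) * c) * (norm x)\<^sup>2)) \<longlongrightarrow> 0) ?F" by simp
    have ev: "\<forall>\<^sub>F A in ?F. dist (msqrt A *v x) (msqrt B *v x) \<le> sqrt ((norm (A - B) * c) * (norm x)\<^sup>2)"
      unfolding eventually_at_topological
      by (rule exI[of _ UNIV]) (use B in \<open>auto simp: dist_norm intro!: real_le_rsqrt est\<close>)
    show "((\<lambda>A. msqrt A *v x) \<longlongrightarrow> msqrt B *v x) ?F"
      by (rule metric_tendsto_imp_tendsto[OF lim])
        (use ev in \<open>auto elim!: eventually_mono simp: dist_real_def abs_of_nonneg c(1) less_imp_le\<close>)
  qed
  have eq: "msqrt A = (\<chi> i j. (msqrt A *v axis j 1) $ i)" for A :: "'k ^ 'd ^ 'd"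
    by (simp add: vec_eq_iff matrix_vector_mult_def axis_def if_distrib cong: if_cong)
  have "continuous_on {A :: 'k ^ 'd ^ 'd. psd A} (\<lambda>A. \<chi> i j. (msqrt A *v axis j 1) $ i)"
    by (intro continuous_on_vec_lambda continuous_on_component vec)
  then show ?thesis using eq by (metis (mono_tags, lifting) continuous_on_cong)
qed

lemma borel_measurable_msqrt:
  fixes V :: "'a \<Rightarrow> 'k::{real_normed_field,euclidean_space} ^ 'd ^ 'd"
  assumes V: "V \<in> borel_measurable M" "\<And>x. psd (V x)"
  shows "(\<lambda>x. msqrt (V x)) \<in> borel_measurable M"
proof -
  have "msqrt \<in> borel_measurable (restrict_space borel {A :: 'k ^ 'd ^ 'd. psd A})"
    by (rule borel_measurable_continuous_on_restrict[OF continuous_on_msqrt])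
  moreover have "V \<in> measurable M (restrict_space borel {A. psd A})"
    using V by (intro measurable_restrict_space2) auto
  ultimately show ?thesis by (rule measurable_compose[rotated])
qed

lemma borel_measurable_matrix_vector:
  fixes V :: "'a \<Rightarrow> 'k::{real_normed_field,euclidean_space} ^ 'd ^ 'd"
  assumes "V \<in> borel_measurable M" "f \<in> borel_measurable M"
  shows "(\<lambda>x. V x *v f x) \<in> borel_measurable M"
proof (rule borel_measurable_continuous_Pair[OF assms])
  show "continuous_on UNIV (\<lambda>p :: ('k ^ 'd ^ 'd) \<times> ('k ^ 'd). fst p *v snd p)"
    by (intro bounded_bilinear.continuous_on[OF bounded_bilinear_matrix_vector] continuous_intros)
qed

lemma psd_eigenbasis:
  fixes A :: "'k::{real_normed_field,euclidean_space} ^ 'd ^ 'd"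
  assumes A: "psd A"
  obtains B l where "eigenbasis (\<lambda>x. A *v x) B l" "\<And>b. 0 \<le> l b"
    "\<And>b. b \<in> B \<Longrightarrow> l b = inner (A *v b) b"
    "\<And>b. b \<in> B \<Longrightarrow> msqrt A *v b = sqrt (l b) *\<^sub>R b"
proof -
  obtain B l where B: "eigenbasis (\<lambda>x. A *v x) B l"
    using selfadjoint_eigenbasis[of "\<lambda>x. A *v x"] A psd_imp_psd_op[OF A] unfolding psd_op_def by blast
  define l' where "l' b = inner (A *v b) b" for b
  have "l b = l' b" if "b \<in> B" for b
    using that B by (simp add: eigenbasis_def l'_def norm_eq_1)
  then have B': "eigenbasis (\<lambda>x. A *v x) B l'" using B by (simp add: eigenbasis_def)
  moreover have l'0: "0 \<le> l' b" for b using A unfolding psd_def l'_def by blast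
  moreover have "msqrt A *v b = sqrt (l' b) *\<^sub>R b" if "b \<in> B" for b
    using that B' A l'0 by (intro msqrt_eigenvector) (auto simp: eigenbasis_def)
  ultimately show ?thesis using that l'_def by blast
qed

text \<open>
  This is where the joint $\mathbf A_2$ condition acts on coordinates. The scalar \<open>t\<close>
  stands for a value of the operator applied to the \<open>b\<close>-coordinate; it need not be
  real, although the coordinate is.
\<close>

lemma eigenvector_pairing_le:
  fixes V W :: "'k::{real_normed_field,euclidean_space} ^ 'd ^ 'd"
  assumes W: "psd W"
    and b: "msqrt V *v b = s *\<^sub>R b" "norm b = 1" and u: "msqrt W *v u = r *\<^sub>R u" "norm u = 1"
  shows "\<bar>s * r * inner (t *s b) u\<bar> \<le> norm t * mnorm (msqrt W ** msqrt V)"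
proof -
  have "s * r * inner (t *s b) u = inner (s *\<^sub>R (t *s b)) (r *\<^sub>R u)" by simp
  also have "s *\<^sub>R (t *s b) = msqrt V *v (t *s b)"
    by (simp add: matrix_vector_scalar_mult_commute b scaleR_as_vector_scalar_mult vector_smult_assoc mult.commute)
  also have "inner (msqrt V *v (t *s b)) (r *\<^sub>R u) = inner (msqrt W *v (msqrt V *v (t *s b))) u"
    using psd_msqrt[OF W] by (simp add: psd_def u(1)[symmetric])
  also have "\<dots> = inner ((msqrt W ** msqrt V) *v (t *s b)) u" by (simp add: matrix_vector_mul_assoc)
  finally have "\<bar>s * r * inner (t *s b) u\<bar> \<le> norm ((msqrt W ** msqrt V) *v (t *s b)) * norm u"
    by (metis Cauchy_Schwarz_ineq2)
  also have "\<dots> \<le> mnorm (msqrt W ** msqrt V) * norm (t *s b) * norm u"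
    unfolding mnorm_def by (intro mult_right_mono onorm matrix_vector_mul_bounded_linear) auto
  finally show ?thesis by (simp add: u b norm_vector_scalar_mult mult.commute)
qed


section \<open>The layer cake formula and the Hardy--Littlewood maximal function\<close>

lemma sigma_finite_lebesgue: "sigma_finite_measure (lebesgue :: 'a::euclidean_space measure)"
proof -
  obtain A :: "'a set set" where A: "countable A" "A \<subseteq> sets lborel" "\<Union>A = space lborel"
      "\<forall>a\<in>A. emeasure lborel a \<noteq> \<infinity>"
    using lborel.sigma_finite_countable by blast
  show ?thesis
    by (unfold_locales, rule exI[of _ A]) (use A in auto)
qed

lemma set_nn_integral_UN_disjoint:
  fixes h :: "'a \<Rightarrow> ennreal"
  assumes "countable I" "disjoint_family_on X I" "\<And>i. i \<in> I \<Longrightarrow> X i \<in> sets M"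
    and h: "h \<in> borel_measurable M"
  shows "(\<integral>\<^sup>+x\<in>(\<Union>i\<in>I. X i). h x \<partial>M) = (\<integral>\<^sup>+i. (\<integral>\<^sup>+x\<in>X i. h x \<partial>M) \<partial>count_space I)"
proof -
  have "(\<integral>\<^sup>+x\<in>(\<Union>i\<in>I. X i). h x \<partial>M) = emeasure (density M h) (\<Union>i\<in>I. X i)"
    using assms by (intro emeasure_density[symmetric] sets.countable_UN') auto
  also have "\<dots> = (\<integral>\<^sup>+i. emeasure (density M h) (X i) \<partial>count_space I)"
    using assms by (intro emeasure_UN_countable) auto
  also have "\<dots> = (\<integral>\<^sup>+i. (\<integral>\<^sup>+x\<in>X i. h x \<partial>M) \<partial>count_space I)"
    using assms by (intro nn_integral_cong emeasure_density) auto
  finally show ?thesis .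
qed

lemma emeasure_UN_le_count_space:
  assumes "countable I" "\<And>i. i \<in> I \<Longrightarrow> X i \<in> sets M"
  shows "emeasure M (\<Union>i\<in>I. X i) \<le> (\<integral>\<^sup>+i. emeasure M (X i) \<partial>count_space I)"
proof -
  have "emeasure M (\<Union>i\<in>I. X i) = (\<integral>\<^sup>+x. indicator (\<Union>i\<in>I. X i) x \<partial>M)"
    using assms by (intro nn_integral_indicator[symmetric] sets.countable_UN') auto
  also have "\<dots> \<le> (\<integral>\<^sup>+x. (\<integral>\<^sup>+i. indicator (X i) x \<partial>count_space I) \<partial>M)"
  proof (rule nn_integral_mono)
    fix x assume "x \<in> space M"
    show "indicator (\<Union>i\<in>I. X i) x \<le> (\<integral>\<^sup>+i. indicator (X i) x \<partial>count_space I)"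
    proof (cases "x \<in> (\<Union>i\<in>I. X i)")
      case True
      then obtain i where i: "i \<in> I" "x \<in> X i" by blast
      have "(1::ennreal) = (\<integral>\<^sup>+j. indicator {i} j \<partial>count_space I)"
        using i by (simp add: nn_integral_indicator)
      also have "\<dots> \<le> (\<integral>\<^sup>+i. indicator (X i) x \<partial>count_space I)"
        using i by (intro nn_integral_mono) (auto simp: indicator_def)
      finally show ?thesis using True by simp
    qed simp
  qed
  also have "\<dots> = (\<integral>\<^sup>+i. (\<integral>\<^sup>+x. indicator (X i) x \<partial>M) \<partial>count_space I)"
    using assms by (intro nn_integral_count_space_nn_integral) auto
  also have "\<dots> = (\<integral>\<^sup>+i. emeasure M (X i) \<partial>count_space I)"
    using assms by (intro nn_integral_cong nn_integral_indicator) auto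
  finally show ?thesis .
qed

lemma powr_eq_nn_integral:
  fixes u s :: real
  assumes "0 \<le> u" "0 < s"
  shows "ennreal (u powr s) = (\<integral>\<^sup>+t\<in>{0<..<u}. ennreal (s * t powr (s - 1)) \<partial>lborel)"
proof -
  have "((\<lambda>t. t powr (s - 1)) has_integral (u powr (s - 1 + 1) / (s - 1 + 1))) {0..u}"
    using assms by (intro has_integral_powr_from_0) auto
  then have "((\<lambda>t. s * t powr (s - 1)) has_integral (s * (u powr (s - 1 + 1) / (s - 1 + 1)))) {0..u}"
    by (rule has_integral_mult_right)
  then have "((\<lambda>t. s * t powr (s - 1)) has_integral (u powr s)) {0..u}"
    using assms by simp
  then have "(\<integral>\<^sup>+t\<in>{0..u}. ennreal (s * t powr (s - 1)) \<partial>lborel) = ennreal (u powr s)"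
    using assms by (intro nn_integral_has_integral_lebesgue') auto
  moreover have "(\<integral>\<^sup>+t\<in>{0..u}. ennreal (s * t powr (s - 1)) \<partial>lborel)
      = (\<integral>\<^sup>+t\<in>{0<..<u}. ennreal (s * t powr (s - 1)) \<partial>lborel)"
  proof (rule nn_integral_cong_AE)
    have "AE t in lborel. t \<noteq> 0" "AE t in lborel. t \<noteq> u" by (rule AE_lborel_singleton)+
    then show "AE t in lborel. ennreal (s * t powr (s - 1)) * indicator {0..u} t
        = ennreal (s * t powr (s - 1)) * indicator {0<..<u} t"
      by eventually_elim (auto simp: indicator_def)
  qed
  ultimately show ?thesis by simp
qed

lemma layer_cake:
  fixes u :: "'a \<Rightarrow> real" and g :: "'a \<Rightarrow> ennreal"
  assumes M: "sigma_finite_measure M"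
    and [measurable]: "u \<in> borel_measurable M" "g \<in> borel_measurable M"
    and u: "\<And>x. 0 \<le> u x" and s: "0 < s"
  shows "(\<integral>\<^sup>+x. g x * ennreal (u x powr s) \<partial>M)
    = (\<integral>\<^sup>+t\<in>{0<..}. ennreal (s * t powr (s - 1)) * (\<integral>\<^sup>+x. g x * indicator {x. t < u x} x \<partial>M) \<partial>lborel)"
proof -
  interpret M: sigma_finite_measure M by (rule M)
  interpret P: pair_sigma_finite "lborel :: real measure" M ..
  let ?f = "\<lambda>t x. ennreal (s * t powr (s - 1)) * indicator {0<..} t * (g x * indicator {p. fst p < u (snd p)} (t, x))"
  have [measurable]: "case_prod ?f \<in> borel_measurable (lborel \<Otimes>\<^sub>M M)"
    by measurable
  have "(\<integral>\<^sup>+x. g x * ennreal (u x powr s) \<partial>M) = (\<integral>\<^sup>+x. (\<integral>\<^sup>+t. ?f t x \<partial>lborel) \<partial>M)"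
  proof (rule nn_integral_cong)
    fix x assume "x \<in> space M"
    have "g x * ennreal (u x powr s) = (\<integral>\<^sup>+t. g x * (ennreal (s * t powr (s - 1)) * indicator {0<..<u x} t) \<partial>lborel)"
      unfolding powr_eq_nn_integral[OF u s] by (rule nn_integral_cmult[symmetric]) measurable
    also have "\<dots> = (\<integral>\<^sup>+t. ?f t x \<partial>lborel)"
      by (intro nn_integral_cong) (auto simp: indicator_def mult_ac)
    finally show "g x * ennreal (u x powr s) = (\<integral>\<^sup>+t. ?f t x \<partial>lborel)" .
  qed
  also have "\<dots> = (\<integral>\<^sup>+t. (\<integral>\<^sup>+x. ?f t x \<partial>M) \<partial>lborel)"
    by (rule P.Fubini') measurable
  also have "\<dots> = (\<integral>\<^sup>+t\<in>{0<..}. ennreal (s * t powr (s - 1)) * (\<integral>\<^sup>+x. g x * indicator {x. t < u x} x \<partial>M) \<partial>lborel)"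
  proof (rule nn_integral_cong)
    fix t :: real
    have "(\<integral>\<^sup>+x. ?f t x \<partial>M) = (\<integral>\<^sup>+x. (ennreal (s * t powr (s - 1)) * indicator {0<..} t) * (g x * indicator {x. t < u x} x) \<partial>M)"
      by (intro nn_integral_cong) (auto simp: indicator_def)
    also have "\<dots> = (ennreal (s * t powr (s - 1)) * indicator {0<..} t) * (\<integral>\<^sup>+x. (g x * indicator {x. t < u x} x) \<partial>M)"
      by (rule nn_integral_cmult) measurable
    finally show "(\<integral>\<^sup>+x. ?f t x \<partial>M) = ennreal (s * t powr (s - 1)) * (\<integral>\<^sup>+x. g x * indicator {x. t < u x} x \<partial>M) * indicator {0<..} t"
      by (simp add: mult_ac)
  qed
  finally show ?thesis .
qed

text \<open>
  Centred balls are normalised by the power of the radius instead of their volume, which keeps the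
  constants in the comparison with cubes free of the volume of the unit ball.
\<close>

definition hl_max :: "(real ^ 'n \<Rightarrow> ennreal) \<Rightarrow> real ^ 'n \<Rightarrow> ennreal" where
  "hl_max h x = (SUP r\<in>{0<..}. ennreal (1 / r ^ CARD('n)) * (\<integral>\<^sup>+y\<in>ball x r. h y \<partial>lebesgue))"

lemma hl_max_mono:
  assumes "\<And>x. h x \<le> k x"
  shows "hl_max h (x :: real ^ 'n) \<le> hl_max k x"
  unfolding hl_max_def
proof (rule SUP_mono, rule bexI)
  fix r :: real assume "r \<in> {0<..}"
  show "ennreal (1 / r ^ CARD('n)) * (\<integral>\<^sup>+y\<in>ball x r. h y \<partial>lebesgue)
      \<le> ennreal (1 / r ^ CARD('n)) * (\<integral>\<^sup>+y\<in>ball x r. k y \<partial>lebesgue)"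
    by (intro mult_left_mono nn_integral_mono mult_right_mono assms zero_le)
qed

lemma set_integral_le_hl_max:
  fixes h :: "real ^ 'n \<Rightarrow> ennreal"
  assumes r: "0 < r" and S: "S \<subseteq> ball x r"
  shows "(\<integral>\<^sup>+y\<in>S. h y \<partial>lebesgue) \<le> ennreal (r ^ CARD('n)) * hl_max h x"
proof -
  let ?I = "\<integral>\<^sup>+y\<in>ball x r. h y \<partial>lebesgue"
  have "(\<integral>\<^sup>+y\<in>S. h y \<partial>lebesgue) \<le> ?I"
    using S by (intro nn_integral_mono) (auto simp: indicator_def)
  also have "?I = ennreal (r ^ CARD('n)) * (ennreal (1 / r ^ CARD('n)) * ?I)"
    using r by (simp add: mult.assoc[symmetric] ennreal_mult[symmetric])
  also have "\<dots> \<le> ennreal (r ^ CARD('n)) * hl_max h x"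
    unfolding hl_max_def using r by (intro mult_left_mono SUP_upper) auto
  finally show ?thesis .
qed

lemma hl_max_leI:
  assumes "\<And>r. 0 < r \<Longrightarrow> ennreal (1 / r ^ CARD('n)) * (\<integral>\<^sup>+y\<in>ball x r. h y \<partial>lebesgue) \<le> c"
  shows "hl_max h (x :: real ^ 'n) \<le> c"
  unfolding hl_max_def using assms by (intro SUP_least) auto

lemma emeasure_lebesgue_ball:
  assumes "0 \<le> r"
  shows "emeasure lebesgue (ball (x :: real ^ 'n) r) = ennreal (unit_ball_vol (CARD('n)) * r ^ CARD('n))"
  using emeasure_ball[OF assms, of x] by simp

lemma hl_max_const_le: "hl_max (\<lambda>_. c) (x :: real ^ 'n) \<le> ennreal (unit_ball_vol (CARD('n))) * c"
proof (rule hl_max_leI)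
  fix r :: real assume r: "0 < r"
  have "ennreal (1 / r ^ CARD('n)) * (\<integral>\<^sup>+y\<in>ball x r. c \<partial>lebesgue)
      = (ennreal (1 / r ^ CARD('n)) * ennreal (unit_ball_vol (CARD('n)) * r ^ CARD('n))) * c"
    using r by (simp add: nn_integral_cmult_indicator emeasure_ball mult_ac)
  also have "\<dots> = ennreal (unit_ball_vol (CARD('n))) * c"
    using r by (simp add: ennreal_mult[symmetric])
  finally show "ennreal (1 / r ^ CARD('n)) * (\<integral>\<^sup>+y\<in>ball x r. c \<partial>lebesgue) \<le> ennreal (unit_ball_vol (CARD('n))) * c"
    by simp
qed

lemma hl_max_add_le:
  fixes h k :: "real ^ 'n \<Rightarrow> ennreal"
  assumes "h \<in> borel_measurable lebesgue" "k \<in> borel_measurable lebesgue"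
  shows "hl_max (\<lambda>x. h x + k x) x \<le> hl_max h x + hl_max k x"
proof (rule hl_max_leI)
  fix r :: real assume r: "0 < r"
  have "(\<integral>\<^sup>+y\<in>ball x r. (h y + k y) \<partial>lebesgue)
      = (\<integral>\<^sup>+y\<in>ball x r. h y \<partial>lebesgue) + (\<integral>\<^sup>+y\<in>ball x r. k y \<partial>lebesgue)"
    using assms by (subst nn_integral_add[symmetric]) (auto simp: distrib_right
        intro!: borel_measurable_times_ennreal borel_measurable_indicator)
  then show "ennreal (1 / r ^ CARD('n)) * (\<integral>\<^sup>+y\<in>ball x r. (h y + k y) \<partial>lebesgue) \<le> hl_max h x + hl_max k x"
    unfolding hl_max_def using r by (auto simp: distrib_left intro!: add_mono SUP_upper)
qed

lemma open_hl_max_greater: "open {x :: real ^ 'n. l < hl_max h x}"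
proof (subst open_contains_ball, intro ballI)
  fix x :: "real ^ 'n" assume "x \<in> {x. l < hl_max h x}"
  then obtain r where r: "0 < r"
    and l: "l < ennreal (1 / r ^ CARD('n)) * (\<integral>\<^sup>+y\<in>ball x r. h y \<partial>lebesgue)"
    unfolding hl_max_def by (auto simp: less_SUP_iff)
  let ?I = "\<integral>\<^sup>+y\<in>ball x r. h y \<partial>lebesgue"
  have "\<exists>r'>r. l < ennreal (1 / r' ^ CARD('n)) * ?I"
  proof (cases ?I)
    case (real i)
    have "((\<lambda>r'. ennreal (1 / r' ^ CARD('n) * i)) \<longlongrightarrow> ennreal (1 / r ^ CARD('n) * i)) (at_right r)"
      using r by (intro tendsto_ennrealI tendsto_intros) auto
    moreover have "l < ennreal (1 / r ^ CARD('n) * i)"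
      using l unfolding real by (subst (asm) ennreal_mult[symmetric]) (use real r in auto)
    ultimately have "\<forall>\<^sub>F r' in at_right r. l < ennreal (1 / r' ^ CARD('n) * i)"
      by (rule order_tendstoD)
    moreover have "\<forall>\<^sub>F r' in at_right r. r < r'" by (simp add: eventually_at_right_less)
    ultimately have "\<forall>\<^sub>F r' in at_right r. r < r' \<and> l < ennreal (1 / r' ^ CARD('n) * i)"
      by eventually_elim simp
    then obtain r' where "r < r'" "l < ennreal (1 / r' ^ CARD('n) * i)"
      using eventually_happens trivial_limit_at_right_real by blast
    then have "r' > r \<and> l < ennreal (1 / r' ^ CARD('n)) * ?I"
      unfolding real by (subst ennreal_mult[symmetric]) (use real r in auto)
    then show ?thesis by blast
  next
    case top
    have "l < \<infinity>" using l by (metis infinity_ennreal_def less_top_ennreal order_less_le_trans top_greatest not_less_iff_gr_or_eq)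
    then show ?thesis using top r by (intro exI[of _ "2 * r"]) (auto simp: ennreal_mult_top)
  qed
  then obtain r' where r': "r < r'" "l < ennreal (1 / r' ^ CARD('n)) * ?I" by blast
  have "ball x (r' - r) \<subseteq> {x. l < hl_max h x}"
  proof
    fix y assume y: "y \<in> ball x (r' - r)"
    have sub: "ball x r \<subseteq> ball y r'"
    proof
      fix z assume "z \<in> ball x r"
      then show "z \<in> ball y r'" using y dist_triangle[of y z x] by (simp add: dist_commute)
    qed
    note r'(2)
    also have "ennreal (1 / r' ^ CARD('n)) * ?I \<le> ennreal (1 / r' ^ CARD('n)) * (\<integral>\<^sup>+z\<in>ball y r'. h z \<partial>lebesgue)"
      using sub by (intro mult_left_mono nn_integral_mono) (auto simp: indicator_def)
    also have "\<dots> \<le> hl_max h y" unfolding hl_max_def using r' r by (intro SUP_upper) auto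
    finally show "y \<in> {x. l < hl_max h x}" by simp
  qed
  then show "\<exists>e>0. ball x e \<subseteq> {x. l < hl_max h x}" using r' by (intro exI[of _ "r' - r"]) auto
qed

lemma sets_hl_max_greater: "{x. l < hl_max h x} \<in> sets lebesgue"
  by (simp add: sets_completionI_sets borel_open open_hl_max_greater)

lemma hl_max_measurable [measurable]: "hl_max h \<in> borel_measurable lebesgue"
  by (rule borel_measurableI_greater) (simp add: sets_completionI_sets borel_open open_hl_max_greater)

text \<open>
  By the Vitali covering lemma, disjoint balls on which the average of \<open>h\<close> is large can
  be chosen such that their fivefold dilates cover the level set.
\<close>

lemma hl_max_weak_type:
  fixes h :: "real ^ 'n \<Rightarrow> ennreal"
  assumes h: "h \<in> borel_measurable lebesgue" and l: "0 < l"
  shows "ennreal l * emeasure lebesgue {x. ennreal l < hl_max h x}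
    \<le> ennreal (5 ^ CARD('n) * unit_ball_vol (CARD('n))) * (\<integral>\<^sup>+x. h x \<partial>lebesgue)"
proof (cases "\<integral>\<^sup>+x. h x \<partial>lebesgue")
  case top
  have "0 < ennreal (5 ^ CARD('n) * unit_ball_vol (CARD('n)))" by simp
  then show ?thesis unfolding top by (simp only: ennreal_mult_top less_imp_neq[THEN not_sym]) simp
next
  case (real t)
  define v where "v = unit_ball_vol (CARD('n))"
  have v: "0 < v" by (simp add: v_def)
  let ?I = "\<lambda>x r. \<integral>\<^sup>+y\<in>ball x r. h y \<partial>lebesgue"
  define S where "S = {x. ennreal l < hl_max h x}"
  have "\<exists>r>0. ennreal l < ennreal (1 / r ^ CARD('n)) * ?I x r" if "x \<in> S" for x
    using that unfolding S_def hl_max_def by (auto simp: less_SUP_iff)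
  then obtain r where r: "\<And>x. x \<in> S \<Longrightarrow> 0 < r x"
      and lr: "\<And>x. x \<in> S \<Longrightarrow> ennreal l < ennreal (1 / r x ^ CARD('n)) * ?I x (r x)" by metis
  have lI: "ennreal (l * r x ^ CARD('n)) \<le> ?I x (r x)" if x: "x \<in> S" for x
  proof -
    have "ennreal (r x ^ CARD('n)) * ennreal l \<le> ennreal (r x ^ CARD('n)) * (ennreal (1 / r x ^ CARD('n)) * ?I x (r x))"
      using lr[OF x] by (intro mult_left_mono) auto
    also have "\<dots> = ?I x (r x)"
      using r[OF x] by (simp add: mult.assoc[symmetric] ennreal_mult[symmetric])
    finally show ?thesis using r[OF x] l by (simp add: ennreal_mult[symmetric] mult.commute)
  qed
  have rB: "r x \<le> max 1 (t / l)" if x: "x \<in> S" for x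
  proof (cases "r x \<le> 1")
    case False
    have "?I x (r x) \<le> (\<integral>\<^sup>+x. h x \<partial>lebesgue)" by (intro nn_integral_mono) (auto simp: indicator_def)
    then have "ennreal (l * r x ^ CARD('n)) \<le> ennreal t"
      unfolding real(2) by (rule order_trans[OF lI[OF x]])
    then have "l * r x ^ CARD('n) \<le> t" using real by simp
    moreover have "r x \<le> r x ^ CARD('n)" using False by (intro self_le_power) auto
    ultimately have "l * r x \<le> t" using l by (smt (verit) mult_left_mono)
    then have "r x \<le> t / l" using l by (simp add: field_simps)
    then show ?thesis by simp
  qed (auto)
  have rr: "0 < r x \<and> r x \<le> max 1 (t / l)" if "x \<in> S" for x
    using r rB that by blast
  obtain C where C: "countable C" "C \<subseteq> S"
    "pairwise (\<lambda>i j. disjnt (cball i (r i)) (cball j (r j))) C"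
    and cov: "\<And>i. i \<in> S \<Longrightarrow> \<exists>j. j \<in> C \<and> \<not> disjnt (cball i (r i)) (cball j (r j)) \<and> cball i (r i) \<subseteq> ball j (5 * r j)"
    using Vitali_covering_lemma_cballs_balls[of S r "max 1 (t / l)" "\<lambda>x. x", OF rr] by blast
  have "S \<subseteq> (\<Union>j\<in>C. ball j (5 * r j))"
  proof
    fix x assume x: "x \<in> S"
    then show "x \<in> (\<Union>j\<in>C. ball j (5 * r j))"
      using cov[OF x] r[OF x] by (meson UN_iff centre_in_cball less_imp_le subsetD)
  qed
  then have "emeasure lebesgue S \<le> emeasure lebesgue (\<Union>j\<in>C. ball j (5 * r j))"
    using C by (intro emeasure_mono sets.countable_UN') auto
  also have "\<dots> \<le> (\<integral>\<^sup>+j. emeasure lebesgue (ball j (5 * r j)) \<partial>count_space C)"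
    using C by (intro emeasure_UN_le_count_space) auto
  finally have "ennreal l * emeasure lebesgue S \<le> ennreal l * (\<integral>\<^sup>+j. emeasure lebesgue (ball j (5 * r j)) \<partial>count_space C)"
    by (rule mult_left_mono) auto
  also have "\<dots> = (\<integral>\<^sup>+j. ennreal l * emeasure lebesgue (ball j (5 * r j)) \<partial>count_space C)"
    by (rule nn_integral_cmult[symmetric]) auto
  also have "\<dots> \<le> (\<integral>\<^sup>+j. ennreal (5 ^ CARD('n) * v) * ?I j (r j) \<partial>count_space C)"
  proof (rule nn_integral_mono)
    fix j assume "j \<in> space (count_space C)"
    then have j: "j \<in> S" using C by auto
    have em: "emeasure lebesgue (ball j (5 * r j)) = ennreal (v * (5 * r j) ^ CARD('n))"
      unfolding v_def using r[OF j] by (intro emeasure_lebesgue_ball) simp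
    have "ennreal l * emeasure lebesgue (ball j (5 * r j)) = ennreal (5 ^ CARD('n) * v) * ennreal (l * r j ^ CARD('n))"
      unfolding em using r[OF j] l v by (simp add: ennreal_mult[symmetric] power_mult_distrib mult_ac)
    also have "\<dots> \<le> ennreal (5 ^ CARD('n) * v) * ?I j (r j)" by (intro mult_left_mono lI j) auto
    finally show "ennreal l * emeasure lebesgue (ball j (5 * r j)) \<le> ennreal (5 ^ CARD('n) * v) * ?I j (r j)" .
  qed
  also have "\<dots> = ennreal (5 ^ CARD('n) * v) * (\<integral>\<^sup>+j. ?I j (r j) \<partial>count_space C)"
    by (rule nn_integral_cmult) auto
  also have "(\<integral>\<^sup>+j. ?I j (r j) \<partial>count_space C) = (\<integral>\<^sup>+y\<in>(\<Union>j\<in>C. ball j (r j)). h y \<partial>lebesgue)"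
  proof (rule set_nn_integral_UN_disjoint[symmetric, OF C(1) _ _ h])
    have "disjnt (ball i (r i)) (ball j (r j))" if "i \<in> C" "j \<in> C" "i \<noteq> j" for i j
      using C(3) that unfolding pairwise_def
      by (meson ball_subset_cball disjnt_subset1 disjnt_subset2)
    then show "disjoint_family_on (\<lambda>j. ball j (r j)) C"
      by (auto simp: disjoint_family_on_def disjnt_def)
  qed auto
  also have "\<dots> \<le> (\<integral>\<^sup>+x. h x \<partial>lebesgue)" by (intro nn_integral_mono) (auto simp: indicator_def)
  finally show ?thesis by (simp add: S_def v_def mult_left_mono)
qed

text \<open>
  Interpolation between the weak type (1,1) estimate and the bound on $L^\infty$. The factor
  $1/(s-1)$ is what produces the first power of each $A_\infty$ constant in the end. Boundedness of
  \<open>h\<close> makes the maximal function finite everywhere, so that it has real powers.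
\<close>

lemma hl_max_strong_type:
  fixes h :: "real ^ 'n \<Rightarrow> real"
  assumes h[measurable]: "h \<in> borel_measurable lebesgue" and h0: "\<And>x. 0 \<le> h x" and hb: "\<And>x. h x \<le> b"
    and s: "1 < s" "s \<le> 2"
  defines "v \<equiv> unit_ball_vol (CARD('n))"
  defines "C \<equiv> 4 * 5 ^ CARD('n) * v * (1 + 2 * v)"
  shows "(\<integral>\<^sup>+x. ennreal (enn2real (hl_max (\<lambda>y. ennreal (h y)) x) powr s) \<partial>lebesgue)
    \<le> ennreal (C / (s - 1)) * (\<integral>\<^sup>+x. ennreal (h x powr s) \<partial>lebesgue)"
    and "hl_max (\<lambda>y. ennreal (h y)) x < \<infinity>"
proof -
  have v: "0 < v" by (simp add: v_def)
  have "hl_max (\<lambda>y. ennreal (h y)) x \<le> ennreal v * ennreal b" for x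
    unfolding v_def by (rule order_trans[OF hl_max_mono hl_max_const_le]) (use hb in \<open>auto intro!: ennreal_leI\<close>)
  then show fin: "hl_max (\<lambda>y. ennreal (h y)) x < \<infinity>" for x
    by (metis ennreal_less_top ennreal_mult_less_top infinity_ennreal_def order_le_less_trans)
  define u where "u x = enn2real (hl_max (\<lambda>y. ennreal (h y)) x)" for x
  have [measurable]: "u \<in> borel_measurable lebesgue" unfolding u_def[abs_def] by measurable
  have u: "ennreal (u x) = hl_max (\<lambda>y. ennreal (h y)) x" for x
    using fin[of x] by (simp add: u_def)
  have u0: "0 \<le> u x" for x by (simp add: u_def)
  let ?I = "\<lambda>t. \<integral>\<^sup>+x. ennreal (h x) * indicator {x. t < 2 * v * h x} x \<partial>lebesgue"
  have key: "ennreal (s * t powr (s - 1)) * emeasure lebesgue {x. t < u x}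
      \<le> ennreal (s / (s - 1) * (2 * 5 ^ CARD('n) * v)) * (ennreal ((s - 1) * t powr (s - 1 - 1)) * ?I t)"
    if t: "0 < t" for t
  proof -
    \<comment> \<open>The part of \<open>h\<close> below $t/(2v)$ has maximal function at most $t/2$, so
      only \<open>?h1\<close> can push it above \<open>t\<close>.\<close>
    let ?h1 = "\<lambda>x. ennreal (h x) * indicator {x. t < 2 * v * h x} x"
    have [measurable]: "?h1 \<in> borel_measurable lebesgue" by measurable
    have "ennreal (h x) \<le> ?h1 x + ennreal (t / (2 * v))" for x
      using v h0[of x] by (auto simp: indicator_def field_simps intro!: ennreal_leI)
    then have le: "hl_max (\<lambda>y. ennreal (h y)) x \<le> hl_max ?h1 x + ennreal (t / 2)" for x
    proof -
      have "hl_max (\<lambda>y. ennreal (h y)) x \<le> hl_max (\<lambda>y. ?h1 y + ennreal (t / (2 * v))) x"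
        by (rule hl_max_mono) fact
      also have "\<dots> \<le> hl_max ?h1 x + hl_max (\<lambda>_. ennreal (t / (2 * v))) x"
        by (rule hl_max_add_le) measurable
      also have "hl_max (\<lambda>_. ennreal (t / (2 * v))) x \<le> ennreal v * ennreal (t / (2 * v))"
        unfolding v_def by (rule hl_max_const_le)
      also have "\<dots> = ennreal (t / 2)" using v t by (simp add: ennreal_mult[symmetric])
      finally show ?thesis by (simp add: add_left_mono)
    qed
    have "{x. t < u x} \<subseteq> {x. ennreal (t / 2) < hl_max ?h1 x}"
    proof
      fix x assume "x \<in> {x. t < u x}"
      then have "ennreal t < ennreal (u x)" using t by (simp add: ennreal_less_iff)
      also have "\<dots> \<le> hl_max ?h1 x + ennreal (t / 2)" using le[of x] by (simp add: u)
      finally have *: "ennreal (t / 2) + ennreal (t / 2) < hl_max ?h1 x + ennreal (t / 2)"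
        using t by (simp add: ennreal_plus[symmetric])
      have "ennreal (t / 2) < hl_max ?h1 x"
      proof (rule ccontr)
        assume "\<not> ?thesis"
        then have "hl_max ?h1 x + ennreal (t / 2) \<le> ennreal (t / 2) + ennreal (t / 2)"
          by (intro add_right_mono) simp
        then show False using * by (simp add: not_less[symmetric])
      qed
      then show "x \<in> {x. ennreal (t / 2) < hl_max ?h1 x}" by simp
    qed
    then have "emeasure lebesgue {x. t < u x} \<le> emeasure lebesgue {x. ennreal (t / 2) < hl_max ?h1 x}"
      by (intro emeasure_mono sets_hl_max_greater)
    then have "ennreal (t / 2) * emeasure lebesgue {x. t < u x}
        \<le> ennreal (t / 2) * emeasure lebesgue {x. ennreal (t / 2) < hl_max ?h1 x}"
      by (rule mult_left_mono) simp
    also have "\<dots> \<le> ennreal (5 ^ CARD('n) * v) * ?I t"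
      unfolding v_def by (rule hl_max_weak_type) (use t in \<open>auto simp: v_def[symmetric]\<close>)
    finally have "ennreal (t / 2) * emeasure lebesgue {x. t < u x} \<le> ennreal (5 ^ CARD('n) * v) * ?I t" .
    then have "ennreal (s * t powr (s - 1) * (2 / t)) * (ennreal (t / 2) * emeasure lebesgue {x. t < u x})
        \<le> ennreal (s * t powr (s - 1) * (2 / t)) * (ennreal (5 ^ CARD('n) * v) * ?I t)"
      by (rule mult_left_mono) simp
    moreover have "ennreal (s * t powr (s - 1) * (2 / t)) * ennreal (t / 2) = ennreal (s * t powr (s - 1))"
      using t s by (simp add: ennreal_mult[symmetric])
    moreover have "ennreal (s * t powr (s - 1) * (2 / t)) * ennreal (5 ^ CARD('n) * v)
      = ennreal (s / (s - 1) * (2 * 5 ^ CARD('n) * v)) * ennreal ((s - 1) * t powr (s - 1 - 1))"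
      using t s v by (simp add: ennreal_mult[symmetric] powr_diff power2_eq_square mult_ac)
    ultimately show ?thesis by (simp add: mult.assoc[symmetric])
  qed
  have "(\<integral>\<^sup>+x. ennreal (u x powr s) \<partial>lebesgue) = (\<integral>\<^sup>+x. 1 * ennreal (u x powr s) \<partial>lebesgue)" by simp
  also have "\<dots> = (\<integral>\<^sup>+t\<in>{0<..}. ennreal (s * t powr (s - 1)) * (\<integral>\<^sup>+x. 1 * indicator {x. t < u x} x \<partial>lebesgue) \<partial>lborel)"
    using s u0 by (intro layer_cake sigma_finite_lebesgue) auto
  also have "\<dots> \<le> (\<integral>\<^sup>+t. ennreal (s / (s - 1) * (2 * 5 ^ CARD('n) * v)) *
      (ennreal ((s - 1) * t powr (s - 1 - 1)) * ?I t * indicator {0<..} t) \<partial>lborel)"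
  proof (rule nn_integral_mono)
    fix t :: real
    have "{x \<in> space lebesgue. t < u x} \<in> sets lebesgue" by measurable
    then have "(\<integral>\<^sup>+x. 1 * indicator {x. t < u x} x \<partial>lebesgue) = emeasure lebesgue {x. t < u x}"
      by simp
    then show "ennreal (s * t powr (s - 1)) * (\<integral>\<^sup>+x. 1 * indicator {x. t < u x} x \<partial>lebesgue) * indicator {0<..} t
      \<le> ennreal (s / (s - 1) * (2 * 5 ^ CARD('n) * v)) * (ennreal ((s - 1) * t powr (s - 1 - 1)) * ?I t * indicator {0<..} t)"
      using key[of t] by (auto simp: indicator_def)
  qed
  also have "\<dots> = ennreal (s / (s - 1) * (2 * 5 ^ CARD('n) * v)) *
      (\<integral>\<^sup>+t\<in>{0<..}. ennreal ((s - 1) * t powr (s - 1 - 1)) * ?I t \<partial>lborel)"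
  proof (rule nn_integral_cmult)
    interpret sigma_finite_measure "lebesgue :: (real ^ 'n) measure" by (rule sigma_finite_lebesgue)
    show "(\<lambda>t. ennreal ((s - 1) * t powr (s - 1 - 1)) * ?I t * indicator {0<..} t) \<in> borel_measurable lborel"
      by measurable
  qed
  also have "(\<integral>\<^sup>+t\<in>{0<..}. ennreal ((s - 1) * t powr (s - 1 - 1)) * ?I t \<partial>lborel)
      = (\<integral>\<^sup>+x. ennreal (h x) * ennreal ((2 * v * h x) powr (s - 1)) \<partial>lebesgue)"
    using s v h0 by (intro layer_cake[symmetric] sigma_finite_lebesgue) auto
  also have "\<dots> \<le> (\<integral>\<^sup>+x. ennreal (1 + 2 * v) * ennreal (h x powr s) \<partial>lebesgue)"
  proof (rule nn_integral_mono)
    fix x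
    have "(2 * v) powr (s - 1) \<le> 1 + 2 * v"
    proof (cases "2 * v \<le> 1")
      case True
      then have "(2 * v) powr (s - 1) \<le> 1" using v s by (intro powr_le1) auto
      then show ?thesis using v by linarith
    next
      case False
      then have "(2 * v) powr (s - 1) \<le> (2 * v) powr 1" using s by (intro powr_mono) auto
      then show ?thesis using v by simp
    qed
    then have "(2 * v) powr (s - 1) * h x powr s \<le> (1 + 2 * v) * h x powr s"
      by (rule mult_right_mono) simp
    moreover have "h x * (2 * v * h x) powr (s - 1) = (2 * v) powr (s - 1) * (h x * h x powr (s - 1))"
      using h0[of x] v by (subst powr_mult) auto
    moreover have "h x * h x powr (s - 1) = h x powr s"
      using h0[of x] powr_mult_base[of "h x" "s - 1"] by simp
    ultimately have "h x * (2 * v * h x) powr (s - 1) \<le> (1 + 2 * v) * h x powr s"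
      by simp
    then show "ennreal (h x) * ennreal ((2 * v * h x) powr (s - 1)) \<le> ennreal (1 + 2 * v) * ennreal (h x powr s)"
      using h0[of x] v by (simp add: ennreal_mult[symmetric] ennreal_leI del: ennreal_plus)
  qed
  also have "\<dots> = ennreal (1 + 2 * v) * (\<integral>\<^sup>+x. ennreal (h x powr s) \<partial>lebesgue)"
    by (rule nn_integral_cmult) measurable
  finally have "(\<integral>\<^sup>+x. ennreal (u x powr s) \<partial>lebesgue) \<le>
      ennreal (s / (s - 1) * (2 * 5 ^ CARD('n) * v)) * (ennreal (1 + 2 * v) * (\<integral>\<^sup>+x. ennreal (h x powr s) \<partial>lebesgue))"
    by (simp add: mult_left_mono)
  also have "\<dots> = ennreal (s / (s - 1) * (2 * 5 ^ CARD('n) * v) * (1 + 2 * v)) * (\<integral>\<^sup>+x. ennreal (h x powr s) \<partial>lebesgue)"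
    using s v by (simp add: mult.assoc[symmetric] ennreal_mult[symmetric] del: ennreal_plus)
  also have "\<dots> \<le> ennreal (C / (s - 1)) * (\<integral>\<^sup>+x. ennreal (h x powr s) \<partial>lebesgue)"
  proof (intro mult_right_mono ennreal_leI)
    have "s * (2 * 5 ^ CARD('n) * v * (1 + 2 * v)) \<le> 2 * (2 * 5 ^ CARD('n) * v * (1 + 2 * v))"
      using s v by (intro mult_right_mono) auto
    then show "s / (s - 1) * (2 * 5 ^ CARD('n) * v) * (1 + 2 * v) \<le> C / (s - 1)"
      using s by (simp add: C_def divide_right_mono mult_ac)
  qed auto
  finally show "(\<integral>\<^sup>+x. ennreal (enn2real (hl_max (\<lambda>y. ennreal (h y)) x) powr s) \<partial>lebesgue)
    \<le> ennreal (C / (s - 1)) * (\<integral>\<^sup>+x. ennreal (h x powr s) \<partial>lebesgue)"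
    by (simp add: u_def)
qed


section \<open>Dyadic cubes and stopping cubes\<close>

lemma mem_cube: "x \<in> cube a l \<longleftrightarrow> (\<forall>i. a $ i \<le> x $ i \<and> x $ i < a $ i + l)"
  by (simp add: cube_def)

lemma corner_in_cube: "0 < l \<Longrightarrow> a \<in> cube a l"
  by (simp add: mem_cube)

lemma cube_eq_iff:
  assumes "0 < l" "0 < l'"
  shows "cube a l = cube a' l' \<longleftrightarrow> a = a' \<and> l = l'"
proof
  assume eq: "cube a l = cube a' l'"
  have "a \<in> cube a' l'" "a' \<in> cube a l" using eq corner_in_cube assms by blast+
  then have a: "a = a'" by (auto simp: mem_cube vec_eq_iff intro: antisym)
  have sub: "s \<le> t" if "cube a s = cube a t" "0 < s" "0 < t" for s t
  proof (rule ccontr)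
    assume "\<not> s \<le> t"
    then have "(\<chi> i. a $ i + t) \<in> cube a s" using that(3) by (simp add: mem_cube)
    then have "(\<chi> i. a $ i + t) \<in> cube a t" unfolding that(1) .
    then show False by (simp add: mem_cube)
  qed
  show "a = a' \<and> l = l'" using a eq sub[of l l'] sub[of l' l] assms by auto
qed auto

lemma cube_borel [measurable]: "cube a l \<in> sets borel"
proof -
  have "cube a l = (\<Inter>i\<in>UNIV. {x. a $ i \<le> x $ i} \<inter> {x. x $ i < a $ i + l})"
    by (auto simp: cube_def)
  also have "\<dots> \<in> sets borel"
    by (intro sets.countable_INT'' sets.Int borel_closed borel_open closed_Collect_le open_Collect_less
        continuous_intros) auto
  finally show ?thesis .
qed

lemma cube_lebesgue [measurable]: "cube a l \<in> sets lebesgue"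
  by (simp add: sets_completionI_sets)

lemma emeasure_cube:
  assumes l: "0 < l"
  shows "emeasure lebesgue (cube (a :: real ^ 'n) l) = ennreal (l ^ CARD('n))"
proof -
  define b where "b = (\<chi> i. a $ i + l)"
  have ab: "\<forall>c\<in>Basis. a \<bullet> c \<le> b \<bullet> c" using l by (auto simp: b_def Basis_vec_def inner_axis)
  have "box a b \<subseteq> cube a l" "cube a l \<subseteq> cbox a b"
    by (auto simp: cube_def b_def mem_box_cart less_imp_le)
  then have "emeasure lborel (box a b) \<le> emeasure lborel (cube a l)"
      "emeasure lborel (cube a l) \<le> emeasure lborel (cbox a b)"
    by (auto intro!: emeasure_mono)
  moreover have "emeasure lborel (box a b) = emeasure lborel (cbox a b)"
    using ab by (simp add: emeasure_lborel_box_eq emeasure_lborel_cbox_eq)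
  ultimately have "emeasure lborel (cube a l) = emeasure lborel (cbox a b)" by (metis antisym)
  also have "\<dots> = ennreal (measure lborel (cbox a b))"
    by (rule emeasure_eq_ennreal_measure) (simp add: emeasure_lborel_cbox_eq)
  also have "measure lborel (cbox a b) = l ^ CARD('n)"
    using l by (subst content_cbox_cart) (auto simp: b_def interval_ne_empty_cart)
  finally show ?thesis by simp
qed

lemma measure_cube: "0 < l \<Longrightarrow> measure lebesgue (cube (a :: real ^ 'n) l) = l ^ CARD('n)"
  unfolding measure_def emeasure_cube by simp

lemma cubesE:
  assumes "Q \<in> cubes" obtains a l where "0 < l" "Q = cube a l"
  using assms by (auto simp: cubes_def)

lemma cubes_facts:
  assumes "Q \<in> cubes"
  shows cubes_sets: "Q \<in> sets lebesgue" and emeasure_cubes: "emeasure lebesgue Q = ennreal (measure lebesgue Q)"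
    and measure_cubes_pos: "0 < measure lebesgue Q"
proof -
  obtain a l where l: "0 < l" "Q = cube a l" using assms by (rule cubesE)
  show "Q \<in> sets lebesgue" unfolding l by (rule cube_lebesgue)
  show "emeasure lebesgue Q = ennreal (measure lebesgue Q)"
    unfolding l measure_cube[OF l(1)] by (rule emeasure_cube[OF l(1)])
  show "0 < measure lebesgue Q" unfolding l measure_cube[OF l(1)] using l by simp
qed

text \<open>
  The factor \<open>CARD('n)\<close> instead of its square root comes from the comparison of the
  Euclidean norm with the sum of the coordinates.
\<close>

lemma cube_subset_ball:
  fixes x :: "real ^ 'n"
  assumes "x \<in> cube a l"
  shows "cube a l \<subseteq> ball x (real CARD('n) * l)"
proof
  fix y assume y: "y \<in> cube a l"
  have *: "\<bar>(x - y) $ i\<bar> < l" for i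
  proof -
    have "a $ i \<le> x $ i \<and> x $ i < a $ i + l" "a $ i \<le> y $ i \<and> y $ i < a $ i + l"
      using assms y by (auto simp: mem_cube)
    then show ?thesis by (simp add: abs_less_iff)
  qed
  have "norm (x - y) \<le> (\<Sum>i\<in>UNIV. \<bar>(x - y) $ i\<bar>)" by (rule norm_le_l1_cart)
  also have "\<dots> < (\<Sum>i\<in>(UNIV :: 'n set). l)" using * by (intro sum_strict_mono) auto
  finally show "y \<in> ball x (real CARD('n) * l)" by (simp add: dist_norm)
qed

text \<open>
  The half-open dyadic cube of generation \<open>k\<close> around \<open>x\<close> in the grid of
  \<open>cube a l\<close>. Describing it by equality of integer parts makes nestedness a statement
  about integer division.
\<close>

definition cell :: "real ^ 'n \<Rightarrow> real \<Rightarrow> nat \<Rightarrow> real ^ 'n \<Rightarrow> (real ^ 'n) set" where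
  "cell a l k x = {y. \<forall>i. \<lfloor>2 ^ k * ((y $ i - a $ i) / l)\<rfloor> = \<lfloor>2 ^ k * ((x $ i - a $ i) / l)\<rfloor>}"

lemma mem_cell_self: "x \<in> cell a l k x"
  by (simp add: cell_def)

lemma cell_eq: "y \<in> cell a l k x \<Longrightarrow> cell a l k y = cell a l k x"
  by (auto simp: cell_def)

lemma floor_dyadic_coarser:
  fixes s t :: real
  assumes "\<lfloor>2 ^ k' * s\<rfloor> = \<lfloor>2 ^ k' * t\<rfloor>" "k \<le> k'"
  shows "\<lfloor>2 ^ k * s\<rfloor> = \<lfloor>2 ^ k * t\<rfloor>"
proof -
  have "\<lfloor>2 ^ k * u\<rfloor> = \<lfloor>2 ^ k' * u\<rfloor> div 2 ^ (k' - k)" for u :: real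
  proof -
    have "(2::real) ^ k' = 2 ^ k * 2 ^ (k' - k)" using assms(2) by (simp add: power_add[symmetric])
    then have "2 ^ k * u = 2 ^ k' * u / real_of_int (2 ^ (k' - k))" by simp
    then show ?thesis by (simp only: floor_divide_real_eq_div[OF zero_le_power] zero_le_numeral)
  qed
  then show ?thesis using assms by simp
qed

lemma cell_mono: "k \<le> k' \<Longrightarrow> cell a l k' x \<subseteq> cell a l k x"
  unfolding cell_def using floor_dyadic_coarser by blast

lemma cell_nested:
  assumes "k \<le> k'" "cell a l k x \<inter> cell a l k' y \<noteq> {}"
  shows "cell a l k' y \<subseteq> cell a l k x"
  using assms cell_mono cell_eq by blast

lemma cell_eq_cube:
  assumes l: "0 < l"
  shows "cell a l k x = cube (\<chi> i. a $ i + l * of_int \<lfloor>2 ^ k * ((x $ i - a $ i) / l)\<rfloor> / 2 ^ k) (l / 2 ^ k)"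
proof -
  have "\<lfloor>2 ^ k * (t / l)\<rfloor> = m \<longleftrightarrow> l * of_int m / 2 ^ k \<le> t \<and> t < l * of_int m / 2 ^ k + l / 2 ^ k"
    for t m
    using l by (auto simp: floor_eq_iff field_simps)
  then have "\<lfloor>2 ^ k * ((y $ i - a $ i) / l)\<rfloor> = m
      \<longleftrightarrow> a $ i + l * of_int m / 2 ^ k \<le> y $ i \<and> y $ i < a $ i + l * of_int m / 2 ^ k + l / 2 ^ k" for y i m
    by (simp add: diff_less_eq le_diff_eq add_ac)
  then show ?thesis by (simp add: cell_def cube_def)
qed

lemma cell_0: "0 < l \<Longrightarrow> x \<in> cube a l \<Longrightarrow> cell a l 0 x = cube a l"
proof -
  assume l: "0 < l" and x: "x \<in> cube a l"
  have "\<lfloor>2 ^ 0 * ((x $ i - a $ i) / l)\<rfloor> = 0" for i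
  proof -
    have "a $ i \<le> x $ i \<and> x $ i < a $ i + l" using x by (simp add: mem_cube)
    then show ?thesis using l by (simp add: floor_eq_iff field_simps)
  qed
  then show ?thesis unfolding cell_eq_cube[OF l] by simp
qed

lemma dyadic_subcubes_eq:
  assumes l: "0 < l"
  shows "dyadic_subcubes (cube a l) = {cell a l k x | k x. x \<in> cube a l}" (is "?L = ?R")
proof
  show "?L \<subseteq> ?R"
  proof
    fix R assume "R \<in> ?L"
    then obtain k m where m: "\<forall>i. m i < (2 ^ k :: nat)"
      and R: "R = cube (\<chi> i. a $ i + l * real (m i) / 2 ^ k) (l / 2 ^ k)"
      using l by (auto simp: dyadic_subcubes_def cube_eq_iff)
    define x where "x = (\<chi> i. a $ i + l * real (m i) / 2 ^ k)"
    have "real (m i) < 2 ^ k" for i using m by (metis of_nat_less_iff of_nat_numeral of_nat_power)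
    then have "x \<in> cube a l" using l by (auto simp: x_def mem_cube field_simps)
    moreover have "R = cell a l k x"
      unfolding cell_eq_cube[OF l] R x_def using l by simp
    ultimately show "R \<in> ?R" by blast
  qed
  show "?R \<subseteq> ?L"
  proof
    fix R assume "R \<in> ?R"
    then obtain k x where x: "x \<in> cube a l" and R: "R = cell a l k x" by blast
    define m where "m i = nat \<lfloor>2 ^ k * ((x $ i - a $ i) / l)\<rfloor>" for i
    have b: "0 \<le> (x $ i - a $ i) / l" "(x $ i - a $ i) / l < 1" for i
    proof -
      have "a $ i \<le> x $ i \<and> x $ i < a $ i + l" using x by (simp add: mem_cube)
      then show "0 \<le> (x $ i - a $ i) / l" "(x $ i - a $ i) / l < 1" using l by (auto simp: field_simps)
    qed
    have nn: "0 \<le> 2 ^ k * ((x $ i - a $ i) / l)" for i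
      by (intro mult_nonneg_nonneg b) simp
    have "\<lfloor>2 ^ k * ((x $ i - a $ i) / l)\<rfloor> < 2 ^ k" for i
    proof -
      have "2 ^ k * ((x $ i - a $ i) / l) < 2 ^ k * 1" by (intro mult_strict_left_mono b) simp
      then show ?thesis by (simp add: floor_less_iff)
    qed
    then have "\<forall>i. m i < 2 ^ k" by (simp add: m_def nat_less_iff nn)
    moreover have "R = cube (\<chi> i. a $ i + l * real (m i) / 2 ^ k) (l / 2 ^ k)"
      unfolding R cell_eq_cube[OF l] using nn by (simp add: m_def)
    ultimately show "R \<in> ?L" unfolding dyadic_subcubes_def using l by blast
  qed
qed

lemma emeasure_cell:
  assumes "0 < l"
  shows "emeasure lebesgue (cell (a :: real ^ 'n) l k x) = ennreal ((l / 2 ^ k) ^ CARD('n))"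
  unfolding cell_eq_cube[OF assms] using assms by (intro emeasure_cube) simp

lemma dyadic_cases:
  assumes "Q \<in> cubes"
  obtains a l where "0 < l" "Q = cube a l" "dyadic_subcubes Q = {cell a l k x | k x. x \<in> Q}"
proof -
  obtain a l where l: "0 < l" "Q = cube a l" using assms by (rule cubesE)
  show ?thesis by (rule that[OF l]) (simp only: l dyadic_subcubes_eq)
qed

lemma dyadicE:
  assumes "Q \<in> cubes" "R \<in> dyadic_subcubes Q"
  obtains a l k x where "0 < l" "Q = cube a l" "x \<in> Q" "R = cell a l k x"
proof -
  obtain a l where l: "0 < l" "Q = cube a l" and D: "dyadic_subcubes Q = {cell a l k x | k x. x \<in> Q}"
    using assms(1) by (rule dyadic_cases)
  from assms(2) obtain k x where "R = cell a l k x" "x \<in> Q" unfolding D by blast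
  then show ?thesis by (intro that[OF l])
qed

lemma dyadic_in_cubes:
  assumes "Q \<in> cubes" "R \<in> dyadic_subcubes Q"
  shows "R \<in> cubes"
proof -
  obtain a l k x where l: "0 < l" and R: "R = cell a l k x" using assms by (rule dyadicE)
  have "0 < l / 2 ^ k" using l by simp
  then show ?thesis unfolding cubes_def R cell_eq_cube[OF l] by blast
qed

lemma dyadic_subset:
  assumes "Q \<in> cubes" "R \<in> dyadic_subcubes Q"
  shows "R \<subseteq> Q"
proof -
  obtain a l k x where "0 < l" "R = cell a l k x" "x \<in> Q" "Q = cube a l"
    using assms by (rule dyadicE) blast
  then show ?thesis using cell_mono[of 0 k a l x] cell_0[of l x a] by simp
qed

lemma self_in_dyadic:
  assumes "Q \<in> cubes"
  shows "Q \<in> dyadic_subcubes Q"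
proof -
  obtain a l where l: "0 < l" "Q = cube a l" using assms by (rule cubesE)
  have "cell a l 0 a \<in> dyadic_subcubes (cube a l)"
    unfolding dyadic_subcubes_eq[OF l(1)] using corner_in_cube[OF l(1), of a] by blast
  then show ?thesis unfolding cell_0[OF l(1) corner_in_cube[OF l(1)]] l .
qed

lemma dyadic_nested:
  assumes "Q \<in> cubes" "R \<in> dyadic_subcubes Q" "S \<in> dyadic_subcubes Q" "R \<inter> S \<noteq> {}"
  shows "R \<subseteq> S \<or> S \<subseteq> R"
proof -
  obtain a l where D: "dyadic_subcubes Q = {cell a l k x | k x. x \<in> Q}" using assms(1) by (rule dyadic_cases) blast
  obtain k x where R: "R = cell a l k x" using assms(2) unfolding D by blast
  obtain k' x' where S: "S = cell a l k' x'" using assms(3) unfolding D by blast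
  show ?thesis
  proof (cases "k \<le> k'")
    case True
    then have "S \<subseteq> R" using assms(4) unfolding R S by (rule cell_nested)
    then show ?thesis ..
  next
    case False
    then have "k' \<le> k" by simp
    moreover have "S \<inter> R \<noteq> {}" using assms(4) by blast
    ultimately have "R \<subseteq> S" unfolding R S by (rule cell_nested)
    then show ?thesis ..
  qed
qed

lemma countable_dyadic:
  fixes Q :: "(real ^ 'n) set"
  assumes Q: "Q \<in> cubes"
  shows "countable (dyadic_subcubes Q)"
proof -
  obtain a l where l: "0 < l" "Q = cube a l" using Q by (rule cubesE)
  let ?c = "\<lambda>(k, m :: 'n \<Rightarrow> nat). cube (\<chi> i. a $ i + l * real (m i) / 2 ^ k) (l / 2 ^ k)"
  have "dyadic_subcubes Q \<subseteq> range ?c"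
  proof
    fix R assume "R \<in> dyadic_subcubes Q"
    then obtain k m where "R = cube (\<chi> i. a $ i + l * real (m i) / 2 ^ k) (l / 2 ^ k)"
      using l by (auto simp: dyadic_subcubes_def cube_eq_iff)
    then show "R \<in> range ?c" by (intro image_eqI[of _ _ "(k, m)"]) auto
  qed
  then show ?thesis by (rule countable_subset) (intro countable_image countableI_type)
qed

lemma dyadic_parent:
  fixes Q :: "(real ^ 'n) set"
  assumes "Q \<in> cubes" "R \<in> dyadic_subcubes Q" "R \<noteq> Q"
  obtains S where "S \<in> dyadic_subcubes Q" "R \<subset> S" "measure lebesgue S = 2 ^ CARD('n) * measure lebesgue R"
proof -
  obtain a l where l: "0 < l" "Q = cube a l" and D: "dyadic_subcubes Q = {cell a l k x | k x. x \<in> Q}"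
    using assms(1) by (rule dyadic_cases) blast
  obtain k x where R: "R = cell a l k x" and x: "x \<in> Q" using assms(2) unfolding D by blast
  have "k \<noteq> 0"
  proof
    assume "k = 0"
    then have "R = Q" using x unfolding R l by (simp only: cell_0[OF l(1)])
    then show False using assms(3) by simp
  qed
  then obtain j where k: "k = Suc j" using not0_implies_Suc by blast
  let ?S = "cell a l j x"
  have m: "measure lebesgue ?S = 2 ^ CARD('n) * measure lebesgue R"
    using l by (simp add: measure_def emeasure_cell R k power_divide power_mult_distrib)
  have "0 < measure lebesgue R" using assms dyadic_in_cubes measure_cubes_pos by blast
  moreover have "(1 :: real) < 2 ^ CARD('n)" by (simp add: one_less_power)
  ultimately have "measure lebesgue R * 1 < measure lebesgue R * 2 ^ CARD('n)"
    by (intro mult_strict_left_mono)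
  then have "R \<noteq> ?S" using m by (auto simp: mult.commute)
  moreover have "R \<subseteq> ?S" unfolding R k by (rule cell_mono) simp
  ultimately have "R \<subset> ?S" by blast
  moreover have "?S \<in> dyadic_subcubes Q" unfolding D using x by blast
  ultimately show ?thesis using m by (intro that)
qed

lemma dyadic_small:
  assumes "Q \<in> cubes" "x \<in> Q" "open U" "x \<in> U"
  obtains R where "R \<in> dyadic_subcubes Q" "x \<in> R" "R \<subseteq> U"
proof -
  obtain a l where l: "0 < l" "Q = cube a l" and D: "dyadic_subcubes Q = {cell a l k x | k x. x \<in> Q}"
    using assms(1) by (rule dyadic_cases) blast
  obtain e where e: "0 < e" "ball x e \<subseteq> U" using assms open_contains_ball by blast
  let ?N = "real CARD('a)"
  obtain k where "?N * l / e < 2 ^ k" using real_arch_pow[of 2] by auto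
  then have k: "?N * (l / 2 ^ k) < e" using e by (simp add: field_simps)
  have "cell a l k x \<subseteq> ball x (?N * (l / 2 ^ k))"
    using mem_cell_self[of x a l k] unfolding cell_eq_cube[OF l(1)] by (rule cube_subset_ball)
  also have "\<dots> \<subseteq> U" using k e by (meson ball_subset_ball_iff less_imp_le order_trans subset_ball)
  finally have "cell a l k x \<subseteq> U" .
  moreover have "cell a l k x \<in> dyadic_subcubes Q" unfolding D using assms(2) by blast
  ultimately show ?thesis using mem_cell_self[of x a l k] by (intro that)
qed

lemma cell_in_cell:
  fixes a z :: "real ^ 'n" and l :: real and k :: nat
  assumes l: "0 < l"
  defines "a' \<equiv> \<chi> i. a $ i + l * of_int \<lfloor>2 ^ k * ((z $ i - a $ i) / l)\<rfloor> / 2 ^ k"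
  shows "cell a' (l / 2 ^ k) j x = cell a l (k + j) x"
proof -
  have "\<lfloor>2 ^ j * ((y $ i - a' $ i) / (l / 2 ^ k))\<rfloor>
      = \<lfloor>2 ^ (k + j) * ((y $ i - a $ i) / l)\<rfloor> - 2 ^ j * \<lfloor>2 ^ k * ((z $ i - a $ i) / l)\<rfloor>" for y i
  proof -
    have "2 ^ j * ((y $ i - a' $ i) / (l / 2 ^ k))
      = 2 ^ (k + j) * ((y $ i - a $ i) / l) - of_int (2 ^ j * \<lfloor>2 ^ k * ((z $ i - a $ i) / l)\<rfloor>)"
      using l by (simp add: a'_def field_simps power_add)
    then show ?thesis by (simp only: floor_diff_of_int)
  qed
  then show ?thesis by (simp add: cell_def)
qed

lemma dyadic_of_dyadic:
  assumes Q: "Q \<in> cubes" and R: "R \<in> dyadic_subcubes Q"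
  shows "dyadic_subcubes R = {S \<in> dyadic_subcubes Q. S \<subseteq> R}"
proof -
  obtain a l where l: "0 < l" "Q = cube a l" and D: "dyadic_subcubes Q = {cell a l k x | k x. x \<in> Q}"
    using Q by (rule dyadic_cases) blast
  obtain k z where Rk: "R = cell a l k z" and z: "z \<in> Q" using R unfolding D by blast
  define a' where "a' = (\<chi> i. a $ i + l * of_int \<lfloor>2 ^ k * ((z $ i - a $ i) / l)\<rfloor> / 2 ^ k)"
  have R': "R = cube a' (l / 2 ^ k)" unfolding Rk cell_eq_cube[OF l(1)] a'_def ..
  have "dyadic_subcubes R = {cell a' (l / 2 ^ k) j x | j x. x \<in> R}"
    unfolding R' by (rule dyadic_subcubes_eq) (use l in simp)
  then have DR: "dyadic_subcubes R = {cell a l (k + j) x | j x. x \<in> R}"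
    unfolding a'_def cell_in_cell[OF l(1)] .
  have RQ: "R \<subseteq> Q" using dyadic_subset Q R .
  show ?thesis
  proof (intro equalityI subsetI)
    fix S assume "S \<in> dyadic_subcubes R"
    then obtain j x where S: "S = cell a l (k + j) x" and x: "x \<in> R" using DR by blast
    have "S \<subseteq> cell a l k x" unfolding S by (rule cell_mono) simp
    also have "\<dots> = R" using x cell_eq unfolding Rk by blast
    finally have "S \<subseteq> R" .
    moreover have "S \<in> dyadic_subcubes Q" unfolding D S using x RQ by blast
    ultimately show "S \<in> {S \<in> dyadic_subcubes Q. S \<subseteq> R}" by simp
  next
    fix S assume S: "S \<in> {S \<in> dyadic_subcubes Q. S \<subseteq> R}"
    then have SR: "S \<subseteq> R" and "S \<in> dyadic_subcubes Q" by auto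
    then obtain k' x where Sk: "S = cell a l k' x" and x: "x \<in> Q" unfolding D by blast
    have xR: "x \<in> R" using SR mem_cell_self[of x a l k'] unfolding Sk by (rule subsetD)
    have "k \<le> k'"
    proof (rule ccontr)
      assume "\<not> k \<le> k'"
      then have lt: "l / 2 ^ k < l / 2 ^ k'" using l by (intro divide_strict_left_mono) auto
      then have "(l / 2 ^ k) ^ CARD('a) < (l / 2 ^ k') ^ CARD('a)" using l by (intro power_strict_mono) auto
      moreover have "emeasure lebesgue S \<le> emeasure lebesgue R"
        by (rule emeasure_mono[OF SR cubes_sets[OF dyadic_in_cubes[OF Q R]]])
      then have "ennreal ((l / 2 ^ k') ^ CARD('a)) \<le> ennreal ((l / 2 ^ k) ^ CARD('a))"
        unfolding Sk Rk emeasure_cell[OF l(1)] .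
      then have "(l / 2 ^ k') ^ CARD('a) \<le> (l / 2 ^ k) ^ CARD('a)" using l by simp
      ultimately show False by linarith
    qed
    then have "S = cell a l (k + (k' - k)) x" using Sk by simp
    then show "S \<in> dyadic_subcubes R" unfolding DR using xR by blast
  qed
qed

definition maximal_sets :: "'a set set \<Rightarrow> 'a set set" where
  "maximal_sets B = {R \<in> B. \<forall>S\<in>B. R \<subseteq> S \<longrightarrow> S = R}"

lemma maximal_dyadic_above:
  fixes Q :: "(real ^ 'n) set"
  assumes Q: "Q \<in> cubes" and B: "B \<subseteq> dyadic_subcubes Q" and R: "R \<in> B"
  shows "\<exists>S\<in>maximal_sets B. R \<subseteq> S"
proof -
  obtain a l where l: "0 < l" "Q = cube a l" and D: "dyadic_subcubes Q = {cell a l k x | k x. x \<in> Q}"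
    using Q by (rule dyadic_cases) blast
  define P where "P k \<longleftrightarrow> (\<exists>x. cell a l k x \<in> B \<and> R \<subseteq> cell a l k x)" for k
  obtain j y where "R = cell a l j y" using subsetD[OF B R] unfolding D by blast
  then have "P j" using R unfolding P_def by blast
  then have "\<exists>k. P k" ..
  then have L: "P (LEAST k. P k)" by (rule LeastI_ex)
  define k where "k = (LEAST k. P k)"
  obtain x where x: "cell a l k x \<in> B" "R \<subseteq> cell a l k x" using L unfolding P_def k_def by blast
  have "S = cell a l k x" if S: "S \<in> B" "cell a l k x \<subseteq> S" for S
  proof -
    obtain k' x' where S': "S = cell a l k' x'" using subsetD[OF B S(1)] unfolding D by blast
    have "P k'" unfolding P_def using S S' x by blast
    then have "k \<le> k'" unfolding k_def by (rule Least_le)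
    moreover have "cell a l k x \<inter> cell a l k' x' \<noteq> {}"
      using S(2) mem_cell_self[of x a l k] unfolding S' by auto
    ultimately have "S \<subseteq> cell a l k x" unfolding S' by (rule cell_nested)
    then show ?thesis using S by blast
  qed
  then have "cell a l k x \<in> maximal_sets B" using x(1) unfolding maximal_sets_def by auto
  then show ?thesis using x(2) by auto
qed

lemma maximal_dyadic:
  fixes Q :: "(real ^ 'n) set"
  assumes Q: "Q \<in> cubes" and B: "B \<subseteq> dyadic_subcubes Q"
  shows "maximal_sets B \<subseteq> B" "countable (maximal_sets B)"
    "disjoint_family_on (\<lambda>R. R) (maximal_sets B)" "\<Union>(maximal_sets B) = \<Union>B"
proof -
  show sub: "maximal_sets B \<subseteq> B" by (auto simp: maximal_sets_def)
  then show "countable (maximal_sets B)" using B countable_dyadic[OF Q] by (meson countable_subset)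
  show "disjoint_family_on (\<lambda>R. R) (maximal_sets B)"
    unfolding disjoint_family_on_def
  proof (intro ballI impI)
    fix R S assume RS: "R \<in> maximal_sets B" "S \<in> maximal_sets B" "R \<noteq> S"
    then have RB: "R \<in> B" "S \<in> B" using sub by auto
    show "R \<inter> S = {}"
    proof (rule ccontr)
      assume "R \<inter> S \<noteq> {}"
      then have "R \<subseteq> S \<or> S \<subseteq> R"
        by (rule dyadic_nested[OF Q subsetD[OF B RB(1)] subsetD[OF B RB(2)]])
      then show False using RS RB unfolding maximal_sets_def by auto
    qed
  qed
  have "x \<in> \<Union>(maximal_sets B)" if "x \<in> R" "R \<in> B" for x R
    using maximal_dyadic_above[OF Q B that(2)] that(1) by auto
  then show "\<Union>(maximal_sets B) = \<Union>B" using sub by auto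
qed

text \<open>
  The one-sided Lebesgue differentiation that stopping arguments need, without a differentiation
  theorem: if the set $A$ where \<open>h\<close> exceeds $c' > c$ had positive measure, cover it by
  maximal dyadic cubes inside an open set that is only slightly larger; integrating \<open>h\<close>
  over them gives $c' |A| \le c (|A| + e)$ for every $e > 0$.
\<close>

lemma density_bound_AE:
  fixes h :: "real ^ 'n \<Rightarrow> ennreal"
  assumes Q: "Q \<in> cubes" and F: "F \<in> sets lebesgue" "F \<subseteq> Q" and h: "h \<in> borel_measurable lebesgue"
    and c: "0 \<le> c"
    and avg: "\<And>R. R \<in> dyadic_subcubes Q \<Longrightarrow> R \<inter> F \<noteq> {} \<Longrightarrow> (\<integral>\<^sup>+x\<in>R. h x \<partial>lebesgue) \<le> ennreal c * emeasure lebesgue R"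
  shows "AE x in lebesgue. x \<in> F \<longrightarrow> h x \<le> ennreal c"
proof -
  have null: "emeasure lebesgue {x\<in>F. ennreal c' < h x} = 0" if c': "c < c'" for c'
  proof -
    define A where "A = {x\<in>F. ennreal c' < h x}"
    have A: "A \<in> sets lebesgue"
    proof -
      have "A = F \<inter> {x \<in> space lebesgue. ennreal c' < h x}" by (auto simp: A_def)
      moreover have "{x \<in> space lebesgue. ennreal c' < h x} \<in> sets lebesgue" using h by measurable
      ultimately show ?thesis using F by simp
    qed
    have "emeasure lebesgue A \<le> emeasure lebesgue Q"
      using F Q by (intro emeasure_mono cubes_sets) (auto simp: A_def)
    then have fin: "emeasure lebesgue A < \<infinity>" using emeasure_cubes[OF Q] by (simp add: le_less_trans)
    define m where "m = measure lebesgue A"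
    have m: "emeasure lebesgue A = ennreal m" "0 \<le> m" using fin by (simp_all add: m_def emeasure_eq_ennreal_measure)
    have "c' * m \<le> c * m + c * e" if e: "0 < e" for e
    proof -
      obtain U where U: "open U" "A \<subseteq> U" "emeasure lebesgue (U - A) < ennreal e"
        using sets_lebesgue_outer_open[OF A e] by metis
      define B where "B = {R \<in> dyadic_subcubes Q. R \<subseteq> U \<and> R \<inter> F \<noteq> {}}"
      have BD: "B \<subseteq> dyadic_subcubes Q" by (auto simp: B_def)
      note mx = maximal_dyadic[OF Q BD]
      have ms: "R \<in> sets lebesgue" if "R \<in> maximal_sets B" for R
        using that mx(1) BD dyadic_in_cubes[OF Q] cubes_sets by blast
      have AB: "A \<subseteq> \<Union>(maximal_sets B)"
      proof
        fix x assume x: "x \<in> A"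
        have xQ: "x \<in> Q" and xU: "x \<in> U" using x U(2) F(2) by (auto simp: A_def)
        obtain R where "R \<in> dyadic_subcubes Q" "x \<in> R" "R \<subseteq> U"
          by (rule dyadic_small[OF Q xQ U(1) xU])
        then show "x \<in> \<Union>(maximal_sets B)" using x mx(4) by (auto simp: B_def A_def)
      qed
      have BU: "\<Union>(maximal_sets B) \<subseteq> U" using mx(4) by (auto simp: B_def)
      have "ennreal c' * emeasure lebesgue A = (\<integral>\<^sup>+x\<in>A. ennreal c' \<partial>lebesgue)"
        using A by (simp add: nn_integral_cmult_indicator)
      also have "\<dots> \<le> (\<integral>\<^sup>+x\<in>(\<Union>R\<in>maximal_sets B. R). h x \<partial>lebesgue)"
        using AB by (intro nn_integral_mono) (auto simp: indicator_def A_def)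
      also have "\<dots> = (\<integral>\<^sup>+R. (\<integral>\<^sup>+x\<in>R. h x \<partial>lebesgue) \<partial>count_space (maximal_sets B))"
        using mx ms h by (intro set_nn_integral_UN_disjoint) auto
      also have "\<dots> \<le> (\<integral>\<^sup>+R. ennreal c * emeasure lebesgue R \<partial>count_space (maximal_sets B))"
        using mx(1) by (intro nn_integral_mono avg) (auto simp: B_def)
      also have "\<dots> = ennreal c * (\<integral>\<^sup>+R. emeasure lebesgue R \<partial>count_space (maximal_sets B))"
        by (rule nn_integral_cmult) auto
      also have "(\<integral>\<^sup>+R. emeasure lebesgue R \<partial>count_space (maximal_sets B)) = emeasure lebesgue (\<Union>R\<in>maximal_sets B. R)"
        using mx ms by (intro emeasure_UN_countable[symmetric]) auto
      also have "\<dots> \<le> emeasure lebesgue (A \<union> (U - A))"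
        using BU A U(1) by (intro emeasure_mono sets.Un sets.Diff) (auto simp: sets_completionI_sets)
      also have "\<dots> \<le> emeasure lebesgue A + emeasure lebesgue (U - A)"
        using A U(1) by (intro emeasure_subadditive sets.Diff) (auto simp: sets_completionI_sets)
      also have "\<dots> \<le> ennreal m + ennreal e" using U m by (intro add_mono) auto
      finally have "ennreal c' * ennreal m \<le> ennreal c * (ennreal m + ennreal e)"
        unfolding m by (simp add: mult_left_mono)
      then have "ennreal (c' * m) \<le> ennreal (c * (m + e))"
        using m e c c' by (simp add: ennreal_mult[symmetric] ennreal_plus[symmetric] del: ennreal_plus)
      moreover have "0 \<le> c * (m + e)" using m e c by simp
      ultimately have "c' * m \<le> c * (m + e)" by (simp only: ennreal_le_iff)
      then show ?thesis by (simp add: distrib_left)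
    qed
    then have "c' * m \<le> c * m"
    proof (cases "c = 0")
      case False
      show ?thesis
      proof (rule field_le_epsilon)
        fix e :: real assume "0 < e"
        then have "c' * m \<le> c * m + c * (e / c)" using False c by (intro \<open>\<And>e. 0 < e \<Longrightarrow> c' * m \<le> c * m + c * e\<close>) simp
        then show "c' * m \<le> c * m + e" using False by simp
      qed
    qed (use \<open>\<And>e. 0 < e \<Longrightarrow> c' * m \<le> c * m + c * e\<close>[of 1] in simp)
    then have "m = 0" using c' m(2) by (metis mult_right_le_imp_le not_less order_le_less)
    then show ?thesis using m by (simp add: A_def)
  qed
  have "AE x in lebesgue. x \<in> F \<longrightarrow> h x \<le> ennreal (c + 1 / real (Suc n))" for n
  proof (rule AE_I)
    show "emeasure lebesgue {x\<in>F. ennreal (c + 1 / real (Suc n)) < h x} = 0"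
      by (rule null) simp
    have "{x \<in> space lebesgue. ennreal (c + 1 / real (Suc n)) < h x} \<in> sets lebesgue" using h by measurable
    then have "F \<inter> {x \<in> space lebesgue. ennreal (c + 1 / real (Suc n)) < h x} \<in> sets lebesgue" using F by simp
    then show "{x\<in>F. ennreal (c + 1 / real (Suc n)) < h x} \<in> sets lebesgue" by (simp add: Int_def)
  qed auto
  then have "AE x in lebesgue. \<forall>n. x \<in> F \<longrightarrow> h x \<le> ennreal (c + 1 / real (Suc n))"
    unfolding AE_all_countable by (rule allI)
  then show ?thesis
  proof eventually_elim
    fix x assume *: "\<forall>n. x \<in> F \<longrightarrow> h x \<le> ennreal (c + 1 / real (Suc n))"
    have lim: "(\<lambda>n. ennreal (c + 1 / real (Suc n))) \<longlonglongrightarrow> ennreal (c + 0)"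
      by (intro tendsto_ennrealI tendsto_add tendsto_const LIMSEQ_Suc[OF lim_1_over_n])
    show "x \<in> F \<longrightarrow> h x \<le> ennreal c"
      using LIMSEQ_le_const[OF lim] * by auto
  qed
qed

text \<open>
  The Calderon--Zygmund decomposition: maximal dyadic subcubes on which the average exceeds
  \<open>c\<close>. The upper bound holds because the parent of a stopping cube is not one.
\<close>

lemma stopping_cubes:
  fixes h :: "real ^ 'n \<Rightarrow> ennreal"
  assumes Q: "Q \<in> cubes" and h: "h \<in> borel_measurable lebesgue" and c: "0 \<le> c"
    and avg: "(\<integral>\<^sup>+x\<in>Q. h x \<partial>lebesgue) \<le> ennreal c * emeasure lebesgue Q"
  obtains P where "P \<subseteq> dyadic_subcubes Q" "countable P" "disjoint_family_on (\<lambda>R. R) P"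
    "\<forall>R\<in>P. ennreal c * emeasure lebesgue R \<le> (\<integral>\<^sup>+x\<in>R. h x \<partial>lebesgue)"
    "\<forall>R\<in>P. (\<integral>\<^sup>+x\<in>R. h x \<partial>lebesgue) \<le> ennreal (2 ^ CARD('n) * c) * emeasure lebesgue R"
    "AE x in lebesgue. x \<in> Q - \<Union>P \<longrightarrow> h x \<le> ennreal c"
proof -
  define B where "B = {R \<in> dyadic_subcubes Q. ennreal c * emeasure lebesgue R < (\<integral>\<^sup>+x\<in>R. h x \<partial>lebesgue)}"
  have BD: "B \<subseteq> dyadic_subcubes Q" by (auto simp: B_def)
  note mx = maximal_dyadic[OF Q BD]
  have QB: "Q \<notin> B" using avg by (auto simp: B_def)
  have ab: "(\<integral>\<^sup>+x\<in>S. h x \<partial>lebesgue) \<le> ennreal c * emeasure lebesgue S"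
    if "R \<in> maximal_sets B" "S \<in> dyadic_subcubes Q" "R \<subset> S" for R S
  proof -
    have "S \<notin> B" using that unfolding maximal_sets_def by blast
    then show ?thesis using that by (simp add: B_def not_less)
  qed
  show ?thesis
  proof (intro that[of "maximal_sets B"] ballI)
    show "maximal_sets B \<subseteq> dyadic_subcubes Q" using mx(1) BD by blast
    show "countable (maximal_sets B)" "disjoint_family_on (\<lambda>R. R) (maximal_sets B)" by fact+
    show "ennreal c * emeasure lebesgue R \<le> (\<integral>\<^sup>+x\<in>R. h x \<partial>lebesgue)" if "R \<in> maximal_sets B" for R
      using that mx(1) by (auto simp: B_def)
    show "(\<integral>\<^sup>+x\<in>R. h x \<partial>lebesgue) \<le> ennreal (2 ^ CARD('n) * c) * emeasure lebesgue R"
      if R: "R \<in> maximal_sets B" for R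
    proof -
      have RD: "R \<in> dyadic_subcubes Q" "R \<noteq> Q" using R mx(1) BD QB by auto
      obtain S where S: "S \<in> dyadic_subcubes Q" "R \<subset> S" "measure lebesgue S = 2 ^ CARD('n) * measure lebesgue R"
        using dyadic_parent[OF Q RD] by blast
      have "(\<integral>\<^sup>+x\<in>R. h x \<partial>lebesgue) \<le> (\<integral>\<^sup>+x\<in>S. h x \<partial>lebesgue)"
        using S by (intro nn_integral_mono) (auto simp: indicator_def)
      also have "\<dots> \<le> ennreal c * emeasure lebesgue S" using ab R S by blast
      also have "\<dots> = ennreal (2 ^ CARD('n) * c) * emeasure lebesgue R"
        using S(3) emeasure_cubes[OF dyadic_in_cubes[OF Q S(1)]] emeasure_cubes[OF dyadic_in_cubes[OF Q RD(1)]] c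
        by (simp add: ennreal_mult[symmetric] mult_ac)
      finally show ?thesis .
    qed
    show "AE x in lebesgue. x \<in> Q - \<Union>(maximal_sets B) \<longrightarrow> h x \<le> ennreal c"
    proof (rule density_bound_AE[OF Q _ _ h c])
      have "R \<in> sets lebesgue" if "R \<in> maximal_sets B" for R
        using that mx(1) BD dyadic_in_cubes[OF Q] cubes_sets by blast
      then show "Q - \<Union>(maximal_sets B) \<in> sets lebesgue"
        using mx(2) cubes_sets[OF Q] by (intro sets.Diff sets.countable_Union) auto
      show "(\<integral>\<^sup>+x\<in>R. h x \<partial>lebesgue) \<le> ennreal c * emeasure lebesgue R"
        if "R \<in> dyadic_subcubes Q" "R \<inter> (Q - \<Union>(maximal_sets B)) \<noteq> {}" for R
        using that mx(4) by (auto simp: B_def not_less[symmetric])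
    qed auto
  qed
qed


section \<open>The sharp reverse Holder inequality\<close>

text \<open>
  The form in which local integrability of a scalar weight is used: averages, which are Bochner
  integrals, agree with the corresponding integrals of nonnegative functions.
\<close>

definition averaged_weight :: "(real ^ 'n \<Rightarrow> real) \<Rightarrow> bool" where
  "averaged_weight w \<longleftrightarrow> w \<in> borel_measurable lebesgue \<and> (\<forall>x. 0 \<le> w x) \<and>
     (\<forall>R\<in>cubes. 0 \<le> average R w \<and>
        (\<integral>\<^sup>+x\<in>R. ennreal (w x) \<partial>lebesgue) = ennreal (average R w) * emeasure lebesgue R)"

text \<open>
  The dyadic maximal function of \<open>w\<close> along the cubes of \<open>G\<close> only. Families
  with cubes of bounded generation give bounded functions, which a self-improving estimate needs.
\<close>

definition dyadic_sup :: "(real ^ 'n) set set \<Rightarrow> (real ^ 'n \<Rightarrow> real) \<Rightarrow> real ^ 'n \<Rightarrow> ennreal" where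
  "dyadic_sup G w x = (SUP R\<in>G. ennreal (average R w) * indicator R x)"

lemma dyadic_sup_upper:
  "R \<in> G \<Longrightarrow> x \<in> R \<Longrightarrow> ennreal (average R w) \<le> dyadic_sup G w x"
  unfolding dyadic_sup_def by (rule SUP_upper2[of R]) auto

lemma dyadic_sup_leI:
  assumes "\<And>R. R \<in> G \<Longrightarrow> x \<in> R \<Longrightarrow> ennreal (average R w) \<le> c"
  shows "dyadic_sup G w x \<le> c"
  unfolding dyadic_sup_def using assms by (intro SUP_least) (auto simp: indicator_def)

lemma dyadic_sup_less:
  "c < dyadic_sup G w x \<longleftrightarrow> (\<exists>R\<in>G. x \<in> R \<and> c < ennreal (average R w))"
  unfolding dyadic_sup_def less_SUP_iff by (auto simp: indicator_def split: if_splits)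

lemma dyadic_sup_measurable:
  assumes "Q \<in> cubes" "G \<subseteq> dyadic_subcubes Q"
  shows "dyadic_sup G w \<in> borel_measurable lebesgue"
proof -
  have "countable G" using assms countable_dyadic countable_subset by blast
  moreover have "R \<in> sets lebesgue" if "R \<in> G" for R
    using that assms dyadic_in_cubes cubes_sets by blast
  ultimately show ?thesis unfolding dyadic_sup_def[abs_def]
    by (intro borel_measurable_SUP borel_measurable_times_ennreal borel_measurable_indicator) auto
qed

lemma dyadic_maximal_eq:
  assumes Q: "Q \<in> cubes" and w: "averaged_weight w"
  shows "dyadic_maximal Q w x = dyadic_sup (dyadic_subcubes Q) w x"
proof -
  have ab: "\<bar>average R w\<bar> = average R w" if "R \<in> dyadic_subcubes Q" for R
    using w dyadic_in_cubes[OF Q that] by (auto simp: averaged_weight_def)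
  show ?thesis
  proof (cases "x \<in> Q")
    case True
    have "dyadic_maximal Q w x = (SUP R\<in>{R \<in> dyadic_subcubes Q. x \<in> R}. ennreal (average R w))"
      unfolding dyadic_maximal_def using True ab by (auto intro!: SUP_cong)
    also have "\<dots> = dyadic_sup (dyadic_subcubes Q) w x"
      by (intro antisym SUP_least dyadic_sup_leI) (auto intro: dyadic_sup_upper SUP_upper2)
    finally show ?thesis .
  next
    case False
    then have "dyadic_sup (dyadic_subcubes Q) w x \<le> 0"
      using dyadic_subset[OF Q] by (intro dyadic_sup_leI) blast
    then show ?thesis using False by (simp add: dyadic_maximal_def)
  qed
qed

text \<open>
  On a maximal cube \<open>R\<close> with average above \<open>l\<close> the maximal function
  localises: a larger cube has average at most \<open>l\<close>, so only the subcubes of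
  \<open>R\<close> matter. The family \<open>G\<close> contains with a cube all larger ones, hence
  the parent of \<open>R\<close>, which gives the upper bound for the average over \<open>R\<close>.
\<close>

lemma truncated_stopping_cubes:
  fixes w :: "real ^ 'n \<Rightarrow> real"
  assumes Q: "Q \<in> cubes" and w: "averaged_weight w"
    and G: "G \<subseteq> dyadic_subcubes Q" and up: "\<And>R S. R \<in> G \<Longrightarrow> S \<in> dyadic_subcubes Q \<Longrightarrow> R \<subseteq> S \<Longrightarrow> S \<in> G"
    and l: "average Q w \<le> l"
  obtains P where "P \<subseteq> G" "countable P" "disjoint_family_on (\<lambda>R. R) P"
    "{x. ennreal l < dyadic_sup G w x} = \<Union>P"
    "\<forall>R\<in>P. (\<integral>\<^sup>+x\<in>R. ennreal (w x) \<partial>lebesgue) \<le> ennreal (2 ^ CARD('n) * l) * emeasure lebesgue R"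
    "\<forall>R\<in>P. \<forall>x\<in>R. dyadic_sup G w x \<le> dyadic_sup (dyadic_subcubes R) w x"
proof -
  define B where "B = {R \<in> G. l < average R w}"
  have BD: "B \<subseteq> dyadic_subcubes Q" using G by (auto simp: B_def)
  note mx = maximal_dyadic[OF Q BD]
  have l0: "0 \<le> l" using w Q l unfolding averaged_weight_def by force
  show ?thesis
  proof (intro that[of "maximal_sets B"] ballI)
    show "maximal_sets B \<subseteq> G" using mx(1) by (auto simp: B_def)
    show "countable (maximal_sets B)" "disjoint_family_on (\<lambda>R. R) (maximal_sets B)" by fact+
    show "{x. ennreal l < dyadic_sup G w x} = \<Union>(maximal_sets B)"
      unfolding mx(4) dyadic_sup_less using l0 by (auto simp: B_def ennreal_less_iff)
    show "(\<integral>\<^sup>+x\<in>R. ennreal (w x) \<partial>lebesgue) \<le> ennreal (2 ^ CARD('n) * l) * emeasure lebesgue R"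
      if R: "R \<in> maximal_sets B" for R
    proof -
      have RB: "R \<in> B" using R mx(1) by blast
      have RD: "R \<in> dyadic_subcubes Q" "R \<noteq> Q" using RB BD l by (auto simp: B_def)
      obtain S where S: "S \<in> dyadic_subcubes Q" "R \<subset> S" "measure lebesgue S = 2 ^ CARD('n) * measure lebesgue R"
        using dyadic_parent[OF Q RD] by blast
      have SG: "S \<in> G" using up[OF _ S(1)] RB S(2) by (auto simp: B_def)
      have "S \<notin> B" using R S(2) unfolding maximal_sets_def by auto
      then have Sl: "average S w \<le> l" using SG by (simp add: B_def)
      have Sc: "S \<in> cubes" using dyadic_in_cubes[OF Q S(1)] .
      have "(\<integral>\<^sup>+x\<in>R. ennreal (w x) \<partial>lebesgue) \<le> (\<integral>\<^sup>+x\<in>S. ennreal (w x) \<partial>lebesgue)"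
        using S by (intro nn_integral_mono) (auto simp: indicator_def)
      also have "\<dots> = ennreal (average S w) * emeasure lebesgue S" using w Sc by (simp add: averaged_weight_def)
      also have "\<dots> \<le> ennreal l * emeasure lebesgue S" using Sl by (intro mult_right_mono ennreal_leI) auto
      also have "\<dots> = ennreal (2 ^ CARD('n) * l) * emeasure lebesgue R"
        using S(3) emeasure_cubes[OF Sc] emeasure_cubes[OF dyadic_in_cubes[OF Q RD(1)]] l0
        by (simp add: ennreal_mult[symmetric] mult_ac)
      finally show ?thesis .
    qed
    show "dyadic_sup G w x \<le> dyadic_sup (dyadic_subcubes R) w x" if R: "R \<in> maximal_sets B" and x: "x \<in> R" for R x
    proof (rule dyadic_sup_leI)
      fix S assume S: "S \<in> G" "x \<in> S"
      have RB: "R \<in> B" using R mx(1) by blast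
      have RD: "R \<in> dyadic_subcubes Q" using RB BD by blast
      show "ennreal (average S w) \<le> dyadic_sup (dyadic_subcubes R) w x"
      proof (cases "S \<in> B")
        case True
        obtain T where T: "T \<in> maximal_sets B" "S \<subseteq> T" using maximal_dyadic_above[OF Q BD True] by blast
        have "T = R"
        proof (rule ccontr)
          assume "T \<noteq> R"
          then have "T \<inter> R = {}" using mx(3) T(1) R unfolding disjoint_family_on_def by blast
          then show False using T S x by blast
        qed
        then have "S \<in> dyadic_subcubes R"
          unfolding dyadic_of_dyadic[OF Q RD] using S T G by auto
        then show ?thesis by (rule dyadic_sup_upper) (rule S)
      next
        case False
        then have "average S w \<le> average R w" using S RB by (simp add: B_def)
        then have "ennreal (average S w) \<le> ennreal (average R w)" by (rule ennreal_leI)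
        also have "\<dots> \<le> dyadic_sup (dyadic_subcubes R) w x"
          by (rule dyadic_sup_upper[OF self_in_dyadic[OF dyadic_in_cubes[OF Q RD]] x])
        finally show ?thesis .
      qed
    qed
  qed
qed

text \<open>
  Levels below \<open>A\<close> contribute at most the first term, and above \<open>A\<close> the
  hypothesis turns the integral of \<open>g\<close> over a level set into the measure of that set,
  which is the layer cake formula of a power with exponent one larger.
\<close>

lemma layer_cake_good_levels:
  fixes u :: "real ^ 'n \<Rightarrow> real" and g :: "real ^ 'n \<Rightarrow> ennreal"
  assumes [measurable]: "u \<in> borel_measurable lebesgue" "g \<in> borel_measurable lebesgue"
    and u: "\<And>x. 0 \<le> u x" and e: "0 < e" and A: "0 \<le> A" and B: "0 \<le> B"
    and lev: "\<And>l. A \<le> l \<Longrightarrow> 0 < l \<Longrightarrow>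
      (\<integral>\<^sup>+x. g x * indicator {x. l < u x} x \<partial>lebesgue) \<le> ennreal (B * l) * emeasure lebesgue {x. l < u x}"
  shows "(\<integral>\<^sup>+x. g x * ennreal (u x powr e) \<partial>lebesgue)
    \<le> ennreal (A powr e) * (\<integral>\<^sup>+x. g x \<partial>lebesgue)
      + ennreal (e * B / (1 + e)) * (\<integral>\<^sup>+x. ennreal (u x powr (1 + e)) \<partial>lebesgue)"
proof -
  interpret sigma_finite_measure "lebesgue :: (real ^ 'n) measure" by (rule sigma_finite_lebesgue)
  let ?J = "\<lambda>l. \<integral>\<^sup>+x. g x * indicator {x. l < u x} x \<partial>lebesgue"
  let ?E = "\<lambda>l. \<integral>\<^sup>+x. 1 * indicator {x. l < u x} x \<partial>lebesgue"
  have E: "?E l = emeasure lebesgue {x. l < u x}" for l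
  proof -
    have "{x \<in> space lebesgue. l < u x} \<in> sets lebesgue" by measurable
    then show ?thesis by simp
  qed
  have "(\<integral>\<^sup>+x. g x * ennreal (u x powr e) \<partial>lebesgue)
    = (\<integral>\<^sup>+l\<in>{0<..}. ennreal (e * l powr (e - 1)) * ?J l \<partial>lborel)"
    using u e by (intro layer_cake sigma_finite_lebesgue) auto
  also have "\<dots> \<le> (\<integral>\<^sup>+l. (\<integral>\<^sup>+x. g x \<partial>lebesgue) * (ennreal (e * l powr (e - 1)) * indicator {0<..<A} l)
      + ennreal (e * B / (1 + e)) * (ennreal ((1 + e) * l powr (1 + e - 1)) * ?E l * indicator {0<..} l) \<partial>lborel)"
  proof (rule nn_integral_mono)
    fix l :: real
    have "ennreal (e * l powr (e - 1)) * ?J l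
        \<le> ennreal (e * B / (1 + e)) * (ennreal ((1 + e) * l powr (1 + e - 1)) * ?E l)"
      if "A \<le> l" "0 < l"
    proof -
      have "ennreal (e * l powr (e - 1)) * ?J l \<le> ennreal (e * l powr (e - 1)) * (ennreal (B * l) * ?E l)"
        unfolding E by (rule mult_left_mono[OF lev[OF that]]) simp
      also have "ennreal (e * l powr (e - 1)) * (ennreal (B * l) * ?E l) = ennreal (e * l powr (e - 1) * (B * l)) * ?E l"
        using e B that by (simp add: ennreal_mult mult.assoc)
      also have "e * l powr (e - 1) * (B * l) = e * B / (1 + e) * ((1 + e) * l powr (1 + e - 1))"
        using e that by (simp add: powr_diff field_simps)
      also have "ennreal (e * B / (1 + e) * ((1 + e) * l powr (1 + e - 1))) * ?E l
        = ennreal (e * B / (1 + e)) * (ennreal ((1 + e) * l powr (1 + e - 1)) * ?E l)"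
        using e B by (subst ennreal_mult) (auto simp: mult.assoc)
      finally show ?thesis .
    qed
    moreover have "?J l \<le> (\<integral>\<^sup>+x. g x \<partial>lebesgue)"
      by (intro nn_integral_mono) (auto simp: indicator_def)
    then have "ennreal (e * l powr (e - 1)) * ?J l \<le> (\<integral>\<^sup>+x. g x \<partial>lebesgue) * ennreal (e * l powr (e - 1))"
      by (subst mult.commute) (rule mult_right_mono, auto)
    ultimately show "ennreal (e * l powr (e - 1)) * ?J l * indicator {0<..} l
      \<le> (\<integral>\<^sup>+x. g x \<partial>lebesgue) * (ennreal (e * l powr (e - 1)) * indicator {0<..<A} l)
      + ennreal (e * B / (1 + e)) * (ennreal ((1 + e) * l powr (1 + e - 1)) * ?E l * indicator {0<..} l)"
      by (cases "l \<le> 0"; cases "l < A") (auto intro: add_increasing2 order_trans)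
  qed
  also have "\<dots> = (\<integral>\<^sup>+x. g x \<partial>lebesgue) * (\<integral>\<^sup>+l\<in>{0<..<A}. ennreal (e * l powr (e - 1)) \<partial>lborel)
      + ennreal (e * B / (1 + e)) * (\<integral>\<^sup>+l\<in>{0<..}. ennreal ((1 + e) * l powr (1 + e - 1)) * ?E l \<partial>lborel)"
    by (subst nn_integral_add, measurable, subst nn_integral_cmult, measurable, subst nn_integral_cmult, measurable)
  also have "(\<integral>\<^sup>+l\<in>{0<..<A}. ennreal (e * l powr (e - 1)) \<partial>lborel) = ennreal (A powr e)"
    using A e by (rule powr_eq_nn_integral[symmetric])
  also have "(\<integral>\<^sup>+l\<in>{0<..}. ennreal ((1 + e) * l powr (1 + e - 1)) * ?E l \<partial>lborel)
      = (\<integral>\<^sup>+x. 1 * ennreal (u x powr (1 + e)) \<partial>lebesgue)"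
    using u e by (intro layer_cake[symmetric] sigma_finite_lebesgue) auto
  finally show ?thesis by (simp add: mult.commute)
qed

lemma ennreal_absorb_half:
  fixes X a :: ennreal
  assumes "X \<le> a + ennreal c * X" "X < \<infinity>" "0 \<le> c" "c \<le> 1 / 2"
  shows "X \<le> 2 * a"
proof (cases a)
  case (real r)
  obtain x where x: "X = ennreal x" "0 \<le> x" using assms(2) by (cases X) auto
  have "ennreal x \<le> ennreal (r + c * x)"
    using assms(1) real x assms(3) by (simp add: ennreal_mult ennreal_plus)
  moreover have "0 \<le> r + c * x" using real x assms(3) by simp
  ultimately have "x \<le> r + c * x" by (simp only: ennreal_le_iff)
  moreover have "c * x \<le> 1 / 2 * x" using assms x by (intro mult_right_mono) auto
  ultimately have "x \<le> 2 * r" by simp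
  then show ?thesis using real x by (simp add: ennreal_leI ennreal_mult[symmetric] flip: ennreal_numeral)
qed (simp add: ennreal_mult_top)

text \<open>
  The gain \<open>e\<close> in the exponent is inversely proportional to \<open>C\<close>, which is
  optimal up to a dimensional constant. Let \<open>M\<close> be the dyadic maximal function of
  \<open>w\<close> on \<open>Q\<close>. On its level set at \<open>l\<close>, a union of stopping
  cubes, the integral of \<open>M\<close> is at most \<open>C\<close> times that of \<open>w\<close>
  by the $A_\infty$ condition on each stopping cube, and the integral of \<open>w\<close> is at most
  $2^N l$ times the measure. The layer cake formula with density \<open>M\<close> bounds $\int
  M^{1+e}$ by a good term plus $e C 2^N \int M^{1+e}$, and the choice of \<open>e\<close> makes the
  last factor 1/2; with density \<open>w\<close> it bounds $\int w M^e$ by $\int M^{1+e}$ and a good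
  term. Finally $w \le M$ almost everywhere.
\<close>

theorem reverse_Holder:
  fixes w :: "real ^ 'n \<Rightarrow> real"
  assumes w: "averaged_weight w" and C: "1 \<le> C"
    and Ainf: "\<And>Q. Q \<in> cubes \<Longrightarrow>
      (\<integral>\<^sup>+x. dyadic_sup (dyadic_subcubes Q) w x * indicator Q x \<partial>lebesgue) \<le> ennreal C * (\<integral>\<^sup>+x\<in>Q. ennreal (w x) \<partial>lebesgue)"
    and Q: "Q \<in> cubes"
  defines "e \<equiv> 1 / (2 * 2 ^ CARD('n) * C)"
  shows "(\<integral>\<^sup>+x\<in>Q. ennreal (w x powr (1 + e)) \<partial>lebesgue) \<le> ennreal (4 * average Q w powr (1 + e)) * emeasure lebesgue Q"
proof -
  have "(1 :: real) \<le> 2 ^ CARD('n)" by (rule one_le_power) simp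
  then have "(1 :: real) * 1 \<le> (2 * 2 ^ CARD('n)) * C"
    using C by (intro mult_mono) linarith+
  then have e: "0 < e" "e \<le> 1" using C by (auto simp: e_def divide_le_eq_1)
  have eC: "e * (C * 2 ^ CARD('n)) = 1 / 2" using C by (simp add: e_def)
  have wm[measurable]: "w \<in> borel_measurable lebesgue" and w0: "\<And>x. 0 \<le> w x" using w by (auto simp: averaged_weight_def)
  have Qs[measurable]: "Q \<in> sets lebesgue" using Q cubes_sets by blast
  define A where "A = average Q w"
  have A: "0 \<le> A" and wQ: "(\<integral>\<^sup>+x\<in>Q. ennreal (w x) \<partial>lebesgue) = ennreal A * emeasure lebesgue Q"
    using w Q by (auto simp: averaged_weight_def A_def)
  \<comment> \<open>The absorption of $\int M^{1+e}$ requires that it is finite, hence the truncation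
    to cubes whose measure is at least $2^{-k}$ times that of \<open>Q\<close>, for which
    \<open>M\<close> is at most $2^k$ times the average.\<close>
  define G where "G k = {R \<in> dyadic_subcubes Q. measure lebesgue Q \<le> 2 ^ k * measure lebesgue R}" for k :: nat
  have GD: "G k \<subseteq> dyadic_subcubes Q" for k by (auto simp: G_def)
  have up: "S \<in> G k" if "R \<in> G k" "S \<in> dyadic_subcubes Q" "R \<subseteq> S" for R S k
  proof -
    have "emeasure lebesgue R \<le> emeasure lebesgue S"
      using that Q by (intro emeasure_mono cubes_sets) (auto intro: dyadic_in_cubes)
    moreover have "R \<in> cubes" "S \<in> cubes" using that GD dyadic_in_cubes[OF Q] by blast+
    ultimately have "measure lebesgue R \<le> measure lebesgue S" by (simp add: emeasure_cubes)
    then have "2 ^ k * measure lebesgue R \<le> 2 ^ k * measure lebesgue S" by simp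
    moreover have "measure lebesgue Q \<le> 2 ^ k * measure lebesgue R" using that(1) by (simp add: G_def)
    ultimately have "measure lebesgue Q \<le> 2 ^ k * measure lebesgue S" by linarith
    then show ?thesis using that(2) by (simp add: G_def)
  qed
  define M where "M k = dyadic_sup (G k) w" for k
  have Mm[measurable]: "M k \<in> borel_measurable lebesgue" for k
    unfolding M_def by (rule dyadic_sup_measurable[OF Q GD])
  have Mbound: "M k x \<le> ennreal (2 ^ k * A)" for k x
    unfolding M_def
  proof (rule dyadic_sup_leI)
    fix R assume R: "R \<in> G k" "x \<in> R"
    have Rc: "R \<in> cubes" and RQ: "R \<subseteq> Q" using R GD dyadic_in_cubes[OF Q] dyadic_subset[OF Q] by blast+
    have "ennreal (average R w) * emeasure lebesgue R \<le> ennreal A * emeasure lebesgue Q"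
    proof -
      have "ennreal (average R w) * emeasure lebesgue R = (\<integral>\<^sup>+x\<in>R. ennreal (w x) \<partial>lebesgue)"
        using w Rc by (simp add: averaged_weight_def)
      also have "\<dots> \<le> (\<integral>\<^sup>+x\<in>Q. ennreal (w x) \<partial>lebesgue)"
        using RQ by (intro nn_integral_mono) (auto simp: indicator_def)
      finally show ?thesis unfolding wQ .
    qed
    then have "ennreal (average R w * measure lebesgue R) \<le> ennreal (A * measure lebesgue Q)"
      using A w Rc by (simp add: emeasure_cubes[OF Rc] emeasure_cubes[OF Q] ennreal_mult averaged_weight_def)
    then have "average R w * measure lebesgue R \<le> A * measure lebesgue Q"
      using A by (simp add: mult_nonneg_nonneg)
    also have "\<dots> \<le> A * (2 ^ k * measure lebesgue R)"
      using R A by (intro mult_left_mono) (auto simp: G_def)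
    finally have "average R w * measure lebesgue R \<le> (2 ^ k * A) * measure lebesgue R" by (simp add: mult_ac)
    then have "average R w \<le> 2 ^ k * A" using measure_cubes_pos[OF Rc] by simp
    then show "ennreal (average R w) \<le> ennreal (2 ^ k * A)" by (rule ennreal_leI)
  qed
  define u where "u k x = enn2real (M k x)" for k x
  have um[measurable]: "u k \<in> borel_measurable lebesgue" for k unfolding u_def[abs_def] by measurable
  have u: "ennreal (u k x) = M k x" for k x
    unfolding u_def using Mbound[of k x] by (intro ennreal_enn2real) (auto simp: le_less_trans)
  have u0: "0 \<le> u k x" for k x by (simp add: u_def)
  have uQ: "u k x = 0" if "x \<notin> Q" for k x
  proof -
    have "M k x \<le> 0" unfolding M_def using that GD dyadic_subset[OF Q] by (intro dyadic_sup_leI) blast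
    then show ?thesis by (simp add: u_def)
  qed
  have MD: "M k x \<le> dyadic_sup (dyadic_subcubes Q) w x" for k x
    unfolding M_def by (intro dyadic_sup_leI dyadic_sup_upper) (use GD in auto)
  \<comment> \<open>the two level set estimates, with densities \<open>M\<close> and
    \<open>w\<close>\<close>
  have levels: "(\<integral>\<^sup>+x. M k x * indicator {x. l < u k x} x \<partial>lebesgue)
        \<le> ennreal (C * 2 ^ CARD('n) * l) * emeasure lebesgue {x. l < u k x} \<and>
      (\<integral>\<^sup>+x. ennreal (w x) * indicator Q x * indicator {x. l < u k x} x \<partial>lebesgue)
        \<le> ennreal (2 ^ CARD('n) * l) * emeasure lebesgue {x. l < u k x}"
    if l: "A \<le> l" "0 < l" for k l
  proof -
    obtain P where P: "P \<subseteq> G k" "countable P" "disjoint_family_on (\<lambda>R. R) P"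
        and lev: "{x. ennreal l < dyadic_sup (G k) w x} = \<Union>P"
        and wR: "\<forall>R\<in>P. (\<integral>\<^sup>+x\<in>R. ennreal (w x) \<partial>lebesgue) \<le> ennreal (2 ^ CARD('n) * l) * emeasure lebesgue R"
        and loc: "\<forall>R\<in>P. \<forall>x\<in>R. dyadic_sup (G k) w x \<le> dyadic_sup (dyadic_subcubes R) w x"
      by (rule truncated_stopping_cubes[where G = "G k", OF Q w GD up l(1)[unfolded A_def]])
    have Rc: "R \<in> cubes" if "R \<in> P" for R using that P(1) GD dyadic_in_cubes[OF Q] by blast
    have Rs: "R \<in> sets lebesgue" if "R \<in> P" for R using Rc[OF that] cubes_sets by blast
    have set: "{x. l < u k x} = (\<Union>R\<in>P. R)"
    proof -
      have "{x. l < u k x} = {x. ennreal l < dyadic_sup (G k) w x}"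
        using l u[of k] unfolding M_def[symmetric] by (auto simp: ennreal_less_iff simp flip: u)
      then show ?thesis using lev by simp
    qed
    have sumP: "ennreal B * (\<integral>\<^sup>+R. emeasure lebesgue R \<partial>count_space P) = ennreal B * emeasure lebesgue {x. l < u k x}" for B
      unfolding set using P Rs by (subst emeasure_UN_countable) auto
    have wle: "(\<integral>\<^sup>+R. (\<integral>\<^sup>+x\<in>R. ennreal (w x) \<partial>lebesgue) \<partial>count_space P) \<le> ennreal (2 ^ CARD('n) * l) * emeasure lebesgue {x. l < u k x}"
    proof -
      have "(\<integral>\<^sup>+R. (\<integral>\<^sup>+x\<in>R. ennreal (w x) \<partial>lebesgue) \<partial>count_space P)
          \<le> (\<integral>\<^sup>+R. ennreal (2 ^ CARD('n) * l) * emeasure lebesgue R \<partial>count_space P)"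
        by (intro nn_integral_mono wR[rule_format]) simp
      also have "\<dots> = ennreal (2 ^ CARD('n) * l) * (\<integral>\<^sup>+R. emeasure lebesgue R \<partial>count_space P)"
        by (rule nn_integral_cmult) simp
      finally show ?thesis unfolding sumP .
    qed
    have "(\<integral>\<^sup>+x. M k x * indicator {x. l < u k x} x \<partial>lebesgue) = (\<integral>\<^sup>+R. (\<integral>\<^sup>+x\<in>R. M k x \<partial>lebesgue) \<partial>count_space P)"
      unfolding set using P Rs by (intro set_nn_integral_UN_disjoint) auto
    also have "\<dots> \<le> (\<integral>\<^sup>+R. ennreal C * (\<integral>\<^sup>+x\<in>R. ennreal (w x) \<partial>lebesgue) \<partial>count_space P)"
    proof (rule nn_integral_mono)
      fix R assume "R \<in> space (count_space P)"
      then have R: "R \<in> P" by simp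
      have "(\<integral>\<^sup>+x\<in>R. M k x \<partial>lebesgue) \<le> (\<integral>\<^sup>+x\<in>R. dyadic_sup (dyadic_subcubes R) w x \<partial>lebesgue)"
        unfolding M_def by (intro nn_integral_mono) (use bspec[OF loc R] in \<open>auto simp: indicator_def\<close>)
      also have "\<dots> \<le> ennreal C * (\<integral>\<^sup>+x\<in>R. ennreal (w x) \<partial>lebesgue)" by (rule Ainf[OF Rc[OF R]])
      finally show "(\<integral>\<^sup>+x\<in>R. M k x \<partial>lebesgue) \<le> ennreal C * (\<integral>\<^sup>+x\<in>R. ennreal (w x) \<partial>lebesgue)" .
    qed
    also have "\<dots> = ennreal C * (\<integral>\<^sup>+R. (\<integral>\<^sup>+x\<in>R. ennreal (w x) \<partial>lebesgue) \<partial>count_space P)"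
      by (rule nn_integral_cmult) simp
    also have "\<dots> \<le> ennreal C * (ennreal (2 ^ CARD('n) * l) * emeasure lebesgue {x. l < u k x})"
      by (rule mult_left_mono[OF wle]) simp
    also have "\<dots> = ennreal (C * 2 ^ CARD('n) * l) * emeasure lebesgue {x. l < u k x}"
      using C l by (simp add: ennreal_mult mult.assoc)
    finally have 1: "(\<integral>\<^sup>+x. M k x * indicator {x. l < u k x} x \<partial>lebesgue)
        \<le> ennreal (C * 2 ^ CARD('n) * l) * emeasure lebesgue {x. l < u k x}" .
    have "(\<integral>\<^sup>+x. ennreal (w x) * indicator Q x * indicator {x. l < u k x} x \<partial>lebesgue)
        \<le> (\<integral>\<^sup>+x\<in>{x. l < u k x}. ennreal (w x) \<partial>lebesgue)"
      by (intro nn_integral_mono) (auto simp: indicator_def)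
    also have "\<dots> = (\<integral>\<^sup>+R. (\<integral>\<^sup>+x\<in>R. ennreal (w x) \<partial>lebesgue) \<partial>count_space P)"
      unfolding set using P Rs by (intro set_nn_integral_UN_disjoint) auto
    finally show ?thesis using 1 wle by (auto intro: order_trans)
  qed
  let ?X = "\<lambda>k. \<integral>\<^sup>+x. ennreal (u k x powr (1 + e)) \<partial>lebesgue"
  have X: "?X k \<le> ennreal (2 * C * A powr (1 + e)) * emeasure lebesgue Q" for k
  proof -
    have "?X k = (\<integral>\<^sup>+x. M k x * ennreal (u k x powr e) \<partial>lebesgue)"
      using u0 powr_mult_base[OF u0] by (intro nn_integral_cong) (simp add: ennreal_mult[symmetric] flip: u)
    also have "\<dots> \<le> ennreal (A powr e) * (\<integral>\<^sup>+x. M k x \<partial>lebesgue) + ennreal (e * (C * 2 ^ CARD('n)) / (1 + e)) * ?X k"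
      using C A e u0 levels by (intro layer_cake_good_levels) auto
    finally have "?X k \<le> 2 * (ennreal (A powr e) * (\<integral>\<^sup>+x. M k x \<partial>lebesgue))"
    proof (rule ennreal_absorb_half)
      have "?X k \<le> (\<integral>\<^sup>+x. ennreal ((2 ^ k * A) powr (1 + e)) * indicator Q x \<partial>lebesgue)"
      proof (rule nn_integral_mono)
        fix x
        have "u k x \<le> 2 ^ k * A" using Mbound[of k x] A by (simp flip: u)
        then show "ennreal (u k x powr (1 + e)) \<le> ennreal ((2 ^ k * A) powr (1 + e)) * indicator Q x"
          using u0 e uQ[of x k] by (auto simp: indicator_def intro!: ennreal_leI powr_mono2)
      qed
      also have "\<dots> = ennreal ((2 ^ k * A) powr (1 + e)) * ennreal (measure lebesgue Q)"
        using Qs by (simp add: nn_integral_cmult_indicator emeasure_cubes[OF Q])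
      also have "\<dots> < \<infinity>" by (simp add: ennreal_mult_less_top)
      finally show "?X k < \<infinity>" .
      show "0 \<le> e * (C * 2 ^ CARD('n)) / (1 + e)" "e * (C * 2 ^ CARD('n)) / (1 + e) \<le> 1 / 2"
        unfolding eC using e by (auto simp: field_simps)
    qed
    also have "(\<integral>\<^sup>+x. M k x \<partial>lebesgue) \<le> (\<integral>\<^sup>+x. dyadic_sup (dyadic_subcubes Q) w x * indicator Q x \<partial>lebesgue)"
    proof (rule nn_integral_mono)
      fix x show "M k x \<le> dyadic_sup (dyadic_subcubes Q) w x * indicator Q x"
        using MD[of k x] uQ[of x k] u[of k x] by (cases "x \<in> Q") auto
    qed
    also have "\<dots> \<le> ennreal C * (ennreal A * emeasure lebesgue Q)" using Ainf[OF Q] wQ by simp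
    finally have "?X k \<le> 2 * (ennreal (A powr e) * (ennreal C * (ennreal A * emeasure lebesgue Q)))"
      by (simp add: mult_left_mono)
    also have "\<dots> = ennreal (2 * C * A powr (1 + e)) * emeasure lebesgue Q"
    proof -
      have "2 * (ennreal (A powr e) * (ennreal C * (ennreal A * emeasure lebesgue Q)))
          = ennreal (2 * (A powr e * (C * A))) * emeasure lebesgue Q"
        using A C by (simp add: ennreal_mult mult.assoc)
      also have "2 * (A powr e * (C * A)) = 2 * C * A powr (1 + e)"
        using powr_mult_base[OF A, of e] by (simp add: mult_ac)
      finally show ?thesis .
    qed
    finally show ?thesis .
  qed
  have Y: "(\<integral>\<^sup>+x. ennreal (w x) * indicator Q x * ennreal (u k x powr e) \<partial>lebesgue) \<le> ennreal (2 * A powr (1 + e)) * emeasure lebesgue Q" for k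
  proof -
    have "(\<integral>\<^sup>+x. ennreal (w x) * indicator Q x * ennreal (u k x powr e) \<partial>lebesgue)
      \<le> ennreal (A powr e) * (\<integral>\<^sup>+x\<in>Q. ennreal (w x) \<partial>lebesgue) + ennreal (e * 2 ^ CARD('n) / (1 + e)) * ?X k"
      using A e u0 levels by (intro layer_cake_good_levels) auto
    also have "\<dots> \<le> ennreal (A powr e) * (ennreal A * emeasure lebesgue Q)
        + ennreal (e * 2 ^ CARD('n)) * (ennreal (2 * C * A powr (1 + e)) * emeasure lebesgue Q)"
      unfolding wQ using e by (intro add_left_mono mult_mono X ennreal_leI) (auto simp: field_simps)
    also have "\<dots> = ennreal (A powr e * A) * emeasure lebesgue Q + ennreal (e * 2 ^ CARD('n) * (2 * C * A powr (1 + e))) * emeasure lebesgue Q"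
      using A C e by (simp add: ennreal_mult mult.assoc)
    also have "\<dots> = ennreal (A powr e * A + e * 2 ^ CARD('n) * (2 * C * A powr (1 + e))) * emeasure lebesgue Q"
      using A C e by (simp add: ennreal_plus distrib_right)
    also have "A powr e * A + e * 2 ^ CARD('n) * (2 * C * A powr (1 + e)) = 2 * A powr (1 + e)"
    proof -
      have "e * 2 ^ CARD('n) * (2 * C * A powr (1 + e)) = 2 * (e * (C * 2 ^ CARD('n))) * A powr (1 + e)" by simp
      then show ?thesis unfolding eC using powr_mult_base[OF A, of e] by (simp add: mult_ac)
    qed
    finally show ?thesis .
  qed
  have inc: "incseq (\<lambda>k x. ennreal (w x) * indicator Q x * ennreal (u k x powr e))"
  proof (rule incseq_SucI, rule le_funI)
    fix k x
    have "G k \<subseteq> G (Suc k)"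
    proof
      fix R assume R: "R \<in> G k"
      have "2 ^ k * measure lebesgue R \<le> 2 ^ Suc k * measure lebesgue R" by (intro mult_right_mono) auto
      moreover have "measure lebesgue Q \<le> 2 ^ k * measure lebesgue R" using R by (simp add: G_def)
      ultimately have "measure lebesgue Q \<le> 2 ^ Suc k * measure lebesgue R" by linarith
      then show "R \<in> G (Suc k)" using R by (simp add: G_def)
    qed
    then have "M k x \<le> M (Suc k) x" unfolding M_def by (intro dyadic_sup_leI dyadic_sup_upper) auto
    then have "u k x \<le> u (Suc k) x" using u0 by (simp flip: u)
    then show "ennreal (w x) * indicator Q x * ennreal (u k x powr e) \<le> ennreal (w x) * indicator Q x * ennreal (u (Suc k) x powr e)"
      using u0 e by (intro mult_left_mono ennreal_leI powr_mono2) auto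
  qed
  \<comment> \<open>$w \le M$ almost everywhere, stated for rational levels to leave one exceptional
    null set\<close>
  have "AE x in lebesgue. \<forall>q\<in>{q \<in> \<rat>. 0 \<le> q}. x \<in> {x \<in> Q. dyadic_sup (dyadic_subcubes Q) w x \<le> ennreal q} \<longrightarrow> ennreal (w x) \<le> ennreal q"
  proof (rule AE_ball_countable'[rotated])
    show "countable {q \<in> \<rat>. 0 \<le> (q::real)}" by (rule countable_subset[OF _ countable_rat]) auto
    fix q :: real assume q: "q \<in> {q \<in> \<rat>. 0 \<le> q}"
    let ?F = "{x \<in> Q. dyadic_sup (dyadic_subcubes Q) w x \<le> ennreal q}"
    show "AE x in lebesgue. x \<in> ?F \<longrightarrow> ennreal (w x) \<le> ennreal q"
    proof (rule density_bound_AE[OF Q])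
      have [measurable]: "dyadic_sup (dyadic_subcubes Q) w \<in> borel_measurable lebesgue"
        by (rule dyadic_sup_measurable[OF Q]) simp
      have "Q \<inter> {x \<in> space lebesgue. dyadic_sup (dyadic_subcubes Q) w x \<le> ennreal q} \<in> sets lebesgue"
        by measurable
      then show "?F \<in> sets lebesgue" by (simp add: Int_def)
      fix R assume R: "R \<in> dyadic_subcubes Q" "R \<inter> ?F \<noteq> {}"
      then obtain x where x: "x \<in> R" "dyadic_sup (dyadic_subcubes Q) w x \<le> ennreal q" by blast
      have "(\<integral>\<^sup>+x\<in>R. ennreal (w x) \<partial>lebesgue) = ennreal (average R w) * emeasure lebesgue R"
        using w dyadic_in_cubes[OF Q R(1)] by (auto simp: averaged_weight_def)
      also have "\<dots> \<le> ennreal q * emeasure lebesgue R"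
        using dyadic_sup_upper[OF R(1) x(1), of w] x(2) by (intro mult_right_mono) auto
      finally show "(\<integral>\<^sup>+x\<in>R. ennreal (w x) \<partial>lebesgue) \<le> ennreal q * emeasure lebesgue R" .
    qed (use q in auto)
  qed
  \<comment> \<open>Where \<open>w x\<close> is positive, half of it is strictly below the full dyadic
    maximal function, so some truncation exceeds it.\<close>
  then have AEw: "AE x in lebesgue. ennreal ((1 / 2) * w x powr (1 + e)) * indicator Q x
      \<le> (SUP k. ennreal (w x) * indicator Q x * ennreal (u k x powr e))"
  proof eventually_elim
    fix x assume q: "\<forall>q\<in>{q \<in> \<rat>. 0 \<le> q}. x \<in> {x \<in> Q. dyadic_sup (dyadic_subcubes Q) w x \<le> ennreal q} \<longrightarrow> ennreal (w x) \<le> ennreal q"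
    show "ennreal ((1 / 2) * w x powr (1 + e)) * indicator Q x
      \<le> (SUP k. ennreal (w x) * indicator Q x * ennreal (u k x powr e))"
    proof (cases "x \<in> Q \<and> 0 < w x")
      case False
      then have "x \<notin> Q \<or> w x = 0" using w0[of x] by (auto simp: order_le_less)
      then show ?thesis by auto
    next
      case True
      then have xQ: "x \<in> Q" and wx: "0 < w x" by auto
      have "ennreal (w x / 2) < dyadic_sup (dyadic_subcubes Q) w x"
      proof (rule ccontr)
        assume "\<not> ?thesis"
        then have le: "dyadic_sup (dyadic_subcubes Q) w x \<le> ennreal (w x / 2)" by simp
        obtain q where qq: "q \<in> \<rat>" "w x / 2 < q" "q < w x" using Rats_dense_in_real[of "w x / 2" "w x"] wx by auto
        have "ennreal (w x / 2) \<le> ennreal q" using qq by (intro ennreal_leI) simp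
        with le have "dyadic_sup (dyadic_subcubes Q) w x \<le> ennreal q" by (rule order_trans)
        then have "ennreal (w x) \<le> ennreal q" using q qq xQ wx by auto
        then show False using qq wx by simp
      qed
      then obtain R where R: "R \<in> dyadic_subcubes Q" "x \<in> R" and a: "ennreal (w x / 2) < ennreal (average R w)"
        unfolding dyadic_sup_less by blast
      have Rp: "0 < measure lebesgue R" using measure_cubes_pos dyadic_in_cubes[OF Q R(1)] by blast
      obtain k where "measure lebesgue Q / measure lebesgue R < 2 ^ k" using real_arch_pow[of 2] by auto
      then have "R \<in> G k" using R Rp by (auto simp: G_def field_simps)
      then have "ennreal (average R w) \<le> M k x" unfolding M_def using R by (intro dyadic_sup_upper)
      with less_imp_le[OF a] have "ennreal (w x / 2) \<le> M k x" by (rule order_trans)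
      then have "ennreal (w x / 2) \<le> ennreal (u k x)" unfolding u .
      then have "w x / 2 \<le> u k x" using u0 by simp
      then have "(w x / 2) powr e \<le> u k x powr e" using wx e by (intro powr_mono2) auto
      moreover have "(1 / 2) * w x powr e \<le> (w x / 2) powr e"
      proof -
        have "(1 / 2 :: real) powr 1 \<le> (1 / 2) powr e" using e by (intro powr_mono') auto
        then have "(1 / 2) * w x powr e \<le> (1 / 2) powr e * w x powr e" by (intro mult_right_mono) auto
        then show ?thesis using wx by (simp add: powr_divide)
      qed
      ultimately have "(1 / 2) * w x powr e \<le> u k x powr e" by linarith
      then have "w x * ((1 / 2) * w x powr e) \<le> w x * u k x powr e" using wx by (intro mult_left_mono) auto
      then have "(1 / 2) * w x powr (1 + e) \<le> w x * u k x powr e"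
        using powr_mult_base[of "w x" e] wx by (simp add: mult_ac)
      then have "ennreal ((1 / 2) * w x powr (1 + e)) * indicator Q x \<le> ennreal (w x) * indicator Q x * ennreal (u k x powr e)"
        using xQ wx by (simp add: ennreal_mult[symmetric] ennreal_leI)
      also have "\<dots> \<le> (SUP k. ennreal (w x) * indicator Q x * ennreal (u k x powr e))" by (rule SUP_upper) simp
      finally show ?thesis .
    qed
  qed
  have "ennreal (1 / 2) * (\<integral>\<^sup>+x\<in>Q. ennreal (w x powr (1 + e)) \<partial>lebesgue)
      = (\<integral>\<^sup>+x. ennreal ((1 / 2) * w x powr (1 + e)) * indicator Q x \<partial>lebesgue)"
  proof -
    have "ennreal (1 / 2) * (\<integral>\<^sup>+x\<in>Q. ennreal (w x powr (1 + e)) \<partial>lebesgue)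
      = (\<integral>\<^sup>+x. ennreal (1 / 2) * (ennreal (w x powr (1 + e)) * indicator Q x) \<partial>lebesgue)"
      by (rule nn_integral_cmult[symmetric]) measurable
    also have "\<dots> = (\<integral>\<^sup>+x. ennreal ((1 / 2) * w x powr (1 + e)) * indicator Q x \<partial>lebesgue)"
      by (intro nn_integral_cong) (subst ennreal_mult, auto simp: mult.assoc)
    finally show ?thesis .
  qed
  also have "\<dots> \<le> (\<integral>\<^sup>+x. (SUP k. ennreal (w x) * indicator Q x * ennreal (u k x powr e)) \<partial>lebesgue)"
    by (rule nn_integral_mono_AE[OF AEw])
  also have "\<dots> = (SUP k. \<integral>\<^sup>+x. ennreal (w x) * indicator Q x * ennreal (u k x powr e) \<partial>lebesgue)"
    by (rule nn_integral_monotone_convergence_SUP[OF inc]) measurable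
  also have "\<dots> \<le> ennreal (2 * A powr (1 + e)) * emeasure lebesgue Q"
    by (rule SUP_least) (rule Y)
  finally have "2 * (ennreal (1 / 2) * (\<integral>\<^sup>+x\<in>Q. ennreal (w x powr (1 + e)) \<partial>lebesgue)) \<le> 2 * (ennreal (2 * A powr (1 + e)) * emeasure lebesgue Q)"
    by (rule mult_left_mono) simp
  moreover have "2 * (ennreal (1 / 2) * Z) = Z" for Z
  proof -
    have "2 * (ennreal (1 / 2) * Z) = (ennreal 2 * ennreal (1 / 2)) * Z" by (simp add: mult.assoc)
    also have "ennreal 2 * ennreal (1 / 2) = 1" by (subst ennreal_mult[symmetric]) auto
    finally show ?thesis by simp
  qed
  moreover have "2 * (ennreal (2 * A powr (1 + e)) * Z) = ennreal (4 * A powr (1 + e)) * Z" for Z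
  proof -
    have "2 * (ennreal (2 * A powr (1 + e)) * Z) = (ennreal 2 * ennreal (2 * A powr (1 + e))) * Z" by (simp add: mult.assoc)
    also have "ennreal 2 * ennreal (2 * A powr (1 + e)) = ennreal (4 * A powr (1 + e))" by (subst ennreal_mult[symmetric]) auto
    finally show ?thesis .
  qed
  ultimately show ?thesis by (simp add: A_def)
qed


section \<open>Calderon--Zygmund operators with Dini-continuous kernels\<close>

lemma L2_iff: "f \<in> L2 \<longleftrightarrow> f \<in> borel_measurable lebesgue \<and> (\<integral>\<^sup>+x. ennreal ((norm (f x))\<^sup>2) \<partial>lebesgue) < \<infinity>"
  by (auto simp: L2_def L2norm_def Let_def less_top[symmetric])

lemma L2norm_square: "(L2norm f)\<^sup>2 = (\<integral>\<^sup>+x. ennreal ((norm (f x))\<^sup>2) \<partial>lebesgue)"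
proof (cases "\<integral>\<^sup>+x. ennreal ((norm (f x))\<^sup>2) \<partial>lebesgue")
  case (real r)
  then show ?thesis by (simp add: L2norm_def power2_eq_square ennreal_mult[symmetric])
qed (simp add: L2norm_def power2_eq_square ennreal_top_mult)

lemma L2_measurable: "f \<in> L2 \<Longrightarrow> f \<in> borel_measurable lebesgue"
  by (simp add: L2_iff)

lemma L2_bound:
  assumes "f \<in> borel_measurable lebesgue" "g \<in> L2" "h \<in> L2"
    and "\<And>x. norm (f x) \<le> norm (g x) + norm (h x)"
  shows "f \<in> L2"
proof -
  have [measurable]: "g \<in> borel_measurable lebesgue" "h \<in> borel_measurable lebesgue"
    using assms L2_measurable by auto
  have "(norm (f x))\<^sup>2 \<le> 2 * (norm (g x))\<^sup>2 + 2 * (norm (h x))\<^sup>2" for x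
  proof -
    have "(norm (f x))\<^sup>2 \<le> (norm (g x) + norm (h x))\<^sup>2" by (intro power_mono assms) auto
    also have "\<dots> \<le> 2 * (norm (g x))\<^sup>2 + 2 * (norm (h x))\<^sup>2"
      using zero_le_power2[of "norm (g x) - norm (h x)"] by (simp add: power2_eq_square algebra_simps)
    finally show ?thesis .
  qed
  then have "(\<integral>\<^sup>+x. ennreal ((norm (f x))\<^sup>2) \<partial>lebesgue) \<le> (\<integral>\<^sup>+x. ennreal (2 * (norm (g x))\<^sup>2 + 2 * (norm (h x))\<^sup>2) \<partial>lebesgue)"
    by (intro nn_integral_mono ennreal_leI)
  also have "\<dots> = (\<integral>\<^sup>+x. 2 * ennreal ((norm (g x))\<^sup>2) + 2 * ennreal ((norm (h x))\<^sup>2) \<partial>lebesgue)"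
    by (intro nn_integral_cong) (simp add: ennreal_plus ennreal_mult)
  also have "\<dots> = 2 * (\<integral>\<^sup>+x. ennreal ((norm (g x))\<^sup>2) \<partial>lebesgue) + 2 * (\<integral>\<^sup>+x. ennreal ((norm (h x))\<^sup>2) \<partial>lebesgue)"
    by (subst nn_integral_add, measurable, subst nn_integral_cmult, measurable, subst nn_integral_cmult, measurable)
  also have "\<dots> < \<infinity>" using assms(2,3) by (auto simp: L2_iff ennreal_mult_less_top)
  finally show ?thesis using assms(1) by (simp add: L2_iff)
qed

lemma L2_zero: "(\<lambda>x. 0) \<in> L2"
  by (simp add: L2_iff)

lemma L2_add: "f \<in> L2 \<Longrightarrow> g \<in> L2 \<Longrightarrow> (\<lambda>x. f x + g x) \<in> L2"
  by (rule L2_bound[of _ f g]) (auto intro: L2_measurable norm_triangle_ineq borel_measurable_add)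

lemma L2_diff: "f \<in> L2 \<Longrightarrow> g \<in> L2 \<Longrightarrow> (\<lambda>x. f x - g x) \<in> L2"
  by (rule L2_bound[of _ f g]) (auto intro: L2_measurable norm_triangle_ineq4 borel_measurable_diff)

definition restrict_to :: "'a set \<Rightarrow> ('a \<Rightarrow> 'b::real_vector) \<Rightarrow> 'a \<Rightarrow> 'b" where
  "restrict_to S f x = indicator S x *\<^sub>R f x"

lemma restrict_to_simps [simp]:
  "x \<in> S \<Longrightarrow> restrict_to S f x = f x" "x \<notin> S \<Longrightarrow> restrict_to S f x = 0"
  by (auto simp: restrict_to_def)

lemma restrict_to_measurable:
  fixes f :: "'a::euclidean_space \<Rightarrow> 'b::euclidean_space"
  shows "S \<in> sets lebesgue \<Longrightarrow> f \<in> borel_measurable lebesgue \<Longrightarrow> restrict_to S f \<in> borel_measurable lebesgue"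
  unfolding restrict_to_def[abs_def] by (intro borel_measurable_scaleR borel_measurable_indicator)

lemma norm_restrict_to_le: "norm (restrict_to S f x) \<le> norm (f x)"
  by (cases "x \<in> S") auto

lemma L2_restrict_to: "S \<in> sets lebesgue \<Longrightarrow> f \<in> L2 \<Longrightarrow> restrict_to S f \<in> L2"
  by (rule L2_bound[of _ f f])
    (auto intro: L2_measurable restrict_to_measurable order_trans[OF norm_restrict_to_le])

lemma nn_integral_restrict_to:
  fixes f :: "'a::euclidean_space \<Rightarrow> 'b::real_normed_vector"
  shows "(\<integral>\<^sup>+x. ennreal (norm (restrict_to S f x)) \<partial>lebesgue) = (\<integral>\<^sup>+x\<in>S. ennreal (norm (f x)) \<partial>lebesgue)"
  by (intro nn_integral_cong) (auto simp: restrict_to_def indicator_def)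

lemma L2_imp_L1_on_finite:
  assumes f: "f \<in> L2" and S: "S \<in> sets lebesgue" "emeasure lebesgue S < \<infinity>" and z: "\<And>x. x \<notin> S \<Longrightarrow> f x = 0"
  shows "(\<integral>\<^sup>+x. ennreal (norm (f x)) \<partial>lebesgue) < \<infinity>"
proof -
  have [measurable]: "f \<in> borel_measurable lebesgue" "S \<in> sets lebesgue" using f S L2_measurable by auto
  have "ennreal (norm (f x)) \<le> indicator S x + ennreal ((norm (f x))\<^sup>2)" for x
  proof -
    have "norm (f x) \<le> 1 + (norm (f x))\<^sup>2"
    proof -
      have "2 * norm (f x) \<le> 1 + (norm (f x))\<^sup>2"
        using zero_le_power2[of "norm (f x) - 1"] by (simp add: power2_eq_square algebra_simps)
      then show ?thesis using norm_ge_zero[of "f x"] by linarith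
    qed
    then have "ennreal (norm (f x)) \<le> ennreal (1 + (norm (f x))\<^sup>2)" by (rule ennreal_leI)
    then show ?thesis using z[of x] by (cases "x \<in> S") auto
  qed
  then have "(\<integral>\<^sup>+x. ennreal (norm (f x)) \<partial>lebesgue) \<le> (\<integral>\<^sup>+x. indicator S x + ennreal ((norm (f x))\<^sup>2) \<partial>lebesgue)"
    by (rule nn_integral_mono)
  also have "\<dots> = emeasure lebesgue S + (\<integral>\<^sup>+x. ennreal ((norm (f x))\<^sup>2) \<partial>lebesgue)"
    by (subst nn_integral_add) auto
  also have "\<dots> < \<infinity>" using S f by (auto simp: L2_iff)
  finally show ?thesis .
qed

lemma Markov_inequality:
  fixes u :: "'a \<Rightarrow> ennreal"
  assumes [measurable]: "u \<in> borel_measurable M"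
  shows "t * emeasure M {x \<in> space M. t < u x} \<le> (\<integral>\<^sup>+x. u x \<partial>M)"
proof -
  have "t * emeasure M {x \<in> space M. t < u x} = (\<integral>\<^sup>+x. t * indicator {x \<in> space M. t < u x} x \<partial>M)"
    by (rule nn_integral_cmult_indicator[symmetric]) measurable
  also have "\<dots> \<le> (\<integral>\<^sup>+x. u x \<partial>M)" by (intro nn_integral_mono) (auto simp: indicator_def)
  finally show ?thesis .
qed

lemma AE_exists_in_positive_measure:
  assumes "AE x in M. P x" "S \<in> sets M" "emeasure M S > 0"
  obtains x where "x \<in> S" "P x"
proof -
  obtain N where N: "{x \<in> space M. \<not> P x} \<subseteq> N" "N \<in> null_sets M" using assms(1) by (auto elim!: AE_E3)
  have "\<not> S \<subseteq> N"
  proof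
    assume "S \<subseteq> N"
    then have "emeasure M S \<le> emeasure M N" using N by (intro emeasure_mono) auto
    then show False using N assms(3) by auto
  qed
  then show ?thesis using that N sets.sets_into_space[OF assms(2)] by blast
qed

lemma not_in_fsuppI:
  assumes "0 < r" "\<And>y. y \<in> ball x r \<Longrightarrow> f y = 0"
  shows "x \<notin> fsupp f"
proof
  assume "x \<in> fsupp f"
  then obtain y where "f y \<noteq> 0" "dist y x < r" using assms(1) by (auto simp: fsupp_def closure_approachable)
  then show False using assms(2)[of y] by (simp add: dist_commute)
qed

text \<open>
  The Dini condition is used only as the summability of \<open>\<omega>\<close> along the negative
  powers of two, and \<open>B\<close> is the square of the norm of \<open>T\<close> on $L^2$.
\<close>

locale dini_cz =
  fixes T :: "(real ^ 'n \<Rightarrow> 'k::{real_normed_field,euclidean_space}) \<Rightarrow> real ^ 'n \<Rightarrow> 'k"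
    and K :: "real ^ 'n \<Rightarrow> real ^ 'n \<Rightarrow> 'k" and \<omega> :: "real \<Rightarrow> real" and B CK :: real
  assumes T_L2: "f \<in> L2 \<Longrightarrow> T f \<in> L2"
    and T_linear: "f \<in> L2 \<Longrightarrow> g \<in> L2 \<Longrightarrow> AE x in lebesgue. T (\<lambda>y. a * f y + b * g y) x = a * T f x + b * T g x"
    and T_bounded: "f \<in> L2 \<Longrightarrow> (\<integral>\<^sup>+x. ennreal ((norm (T f x))\<^sup>2) \<partial>lebesgue) \<le> ennreal B * (\<integral>\<^sup>+x. ennreal ((norm (f x))\<^sup>2) \<partial>lebesgue)"
    and B: "0 \<le> B" and CK: "0 \<le> CK"
    and size: "x \<noteq> y \<Longrightarrow> norm (K x y) \<le> CK / norm (x - y) ^ CARD('n)"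
    and smooth1: "x \<noteq> y \<Longrightarrow> 2 * norm (x - x') \<le> norm (x - y) \<Longrightarrow>
       norm (K x y - K x' y) \<le> \<omega> (norm (x - x') / norm (x - y)) / norm (x - y) ^ CARD('n)"
    and smooth2: "x \<noteq> y \<Longrightarrow> 2 * norm (x - x') \<le> norm (x - y) \<Longrightarrow>
       norm (K y x - K y x') \<le> \<omega> (norm (x - x') / norm (x - y)) / norm (x - y) ^ CARD('n)"
    and \<omega>_mono: "0 \<le> s \<Longrightarrow> s \<le> t \<Longrightarrow> \<omega> s \<le> \<omega> t" and \<omega>_nonneg: "0 \<le> t \<Longrightarrow> 0 \<le> \<omega> t"
    and \<omega>_summable: "summable (\<lambda>k. \<omega> (1 / 2 ^ Suc k))"
    and T_kernel: "f \<in> L2 \<Longrightarrow> AE x in lebesgue. x \<notin> fsupp f \<longrightarrow> T f x = (LINT y|lebesgue. K x y * f y)"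
begin

definition dini_sum :: real where "dini_sum = (\<Sum>k. \<omega> (1 / 2 ^ Suc k))"

definition ball_vol :: real where "ball_vol = unit_ball_vol (CARD('n))"

lemma dini_sum_nonneg: "0 \<le> dini_sum"
  unfolding dini_sum_def by (intro suminf_nonneg \<omega>_summable \<omega>_nonneg) simp

lemma ball_vol_pos: "0 < ball_vol" by (simp add: ball_vol_def)

lemma \<omega>_small:
  assumes "0 < \<epsilon>"
  obtains d where "0 < d" "\<And>t. 0 \<le> t \<Longrightarrow> t \<le> d \<Longrightarrow> \<omega> t < \<epsilon>"
proof -
  have "(\<lambda>k. \<omega> (1 / 2 ^ Suc k)) \<longlonglongrightarrow> 0" by (rule summable_LIMSEQ_zero[OF \<omega>_summable])
  then obtain k where "\<omega> (1 / 2 ^ Suc k) < \<epsilon>"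
    using order_tendstoD(2)[of "\<lambda>k. \<omega> (1 / 2 ^ Suc k)" 0 sequentially \<epsilon>] assms
    by (auto simp: eventually_sequentially)
  then show ?thesis by (intro that[of "1 / 2 ^ Suc k"]) (auto intro: le_less_trans[OF \<omega>_mono])
qed

lemma K_continuous: "continuous_on (- {x}) (K x)"
  unfolding continuous_on_iff
proof (intro ballI allI impI)
  fix y and e :: real assume y: "y \<in> - {x}" and e: "0 < e"
  let ?n = "norm (y - x)"
  have n: "0 < ?n" using y by simp
  obtain d where d: "0 < d" "\<And>t. 0 \<le> t \<Longrightarrow> t \<le> d \<Longrightarrow> \<omega> t < e * ?n ^ CARD('n)"
    using \<omega>_small[of "e * ?n ^ CARD('n)"] e n by auto
  show "\<exists>d>0. \<forall>y'\<in>- {x}. dist y' y < d \<longrightarrow> dist (K x y') (K x y) < e"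
  proof (intro exI[of _ "min (?n / 2) (d * ?n)"] conjI ballI impI)
    show "0 < min (?n / 2) (d * ?n)" using n d by simp
    fix y' assume "dist y' y < min (?n / 2) (d * ?n)"
    then have c: "norm (y - y') < ?n / 2" "norm (y - y') < d * ?n" by (auto simp: dist_norm norm_minus_commute)
    have "norm (K x y - K x y') \<le> \<omega> (norm (y - y') / ?n) / ?n ^ CARD('n)"
      using y c by (intro smooth2) auto
    also have "\<dots> < e * ?n ^ CARD('n) / ?n ^ CARD('n)"
      using n c by (intro divide_strict_right_mono d) (auto simp: field_simps)
    finally show "dist (K x y') (K x y) < e" using n by (simp add: dist_norm norm_minus_commute)
  qed
qed

lemma integrable_kernel:
  assumes f: "f \<in> borel_measurable lebesgue" "(\<integral>\<^sup>+y. ennreal (norm (f y)) \<partial>lebesgue) < \<infinity>"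
    and r: "0 < r" and z: "\<And>y. norm (x - y) < r \<Longrightarrow> f y = 0"
  shows "integrable lebesgue (\<lambda>y. K x y * f y)"
proof -
  have "(\<lambda>y. indicator (- {x}) y *\<^sub>R K x y) \<in> borel_measurable borel"
    by (rule borel_measurable_continuous_on_indicator[OF _ K_continuous]) auto
  then have K0: "(\<lambda>y. indicator (- {x}) y *\<^sub>R K x y) \<in> borel_measurable lebesgue"
    by (simp add: measurable_completion)
  have "K x y * f y = (indicator (- {x}) y *\<^sub>R K x y) * f y" for y
    using z[of y] r by (cases "y = x") auto
  then have m: "(\<lambda>y. K x y * f y) \<in> borel_measurable lebesgue"
    using borel_measurable_times[OF K0 f(1)] by simp
  show ?thesis unfolding integrable_iff_bounded
  proof
    show "(\<lambda>y. K x y * f y) \<in> borel_measurable lebesgue" by (rule m)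
    have "norm (K x y * f y) \<le> CK / r ^ CARD('n) * norm (f y)" for y
    proof (cases "norm (x - y) < r")
      case False
      then have "x \<noteq> y" "r \<le> norm (x - y)" using r by auto
      then have "norm (K x y) \<le> CK / norm (x - y) ^ CARD('n)" by (intro size)
      also have "\<dots> \<le> CK / r ^ CARD('n)"
        using r CK \<open>r \<le> norm (x - y)\<close> by (intro divide_left_mono power_mono mult_pos_pos zero_less_power) auto
      finally show ?thesis unfolding norm_mult by (rule mult_right_mono) simp
    qed (simp add: z)
    then have "(\<integral>\<^sup>+y. ennreal (norm (K x y * f y)) \<partial>lebesgue) \<le> (\<integral>\<^sup>+y. ennreal (CK / r ^ CARD('n)) * ennreal (norm (f y)) \<partial>lebesgue)"
      using CK r by (intro nn_integral_mono) (simp add: ennreal_mult[symmetric] ennreal_leI)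
    also have "\<dots> = ennreal (CK / r ^ CARD('n)) * (\<integral>\<^sup>+y. ennreal (norm (f y)) \<partial>lebesgue)"
      using f by (intro nn_integral_cmult) auto
    also have "\<dots> < \<infinity>" using f by (simp add: ennreal_mult_less_top)
    finally show "(\<integral>\<^sup>+y. ennreal (norm (K x y * f y)) \<partial>lebesgue) < \<infinity>" .
  qed
qed

text \<open>
  A radially decreasing step function that dominates the oscillation of the kernel at distances at
  least \<open>2 * \<delta>\<close> when one variable moves by at most \<open>\<delta>\<close>; the
  \<open>k\<close>-th term handles the distances between $2^{k+1}\delta$ and $2^{k+2}\delta$.
\<close>

definition maj :: "real \<Rightarrow> real ^ 'n \<Rightarrow> real ^ 'n \<Rightarrow> ennreal" where
  "maj \<delta> x y = (\<Sum>k. ennreal (\<omega> (1 / 2 ^ Suc k) / (2 ^ Suc k * \<delta>) ^ CARD('n)) * indicator (ball x (2 ^ Suc (Suc k) * \<delta>)) y)"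

lemma maj_measurable [measurable]: "maj \<delta> x \<in> borel_measurable lebesgue"
  unfolding maj_def[abs_def]
  by (intro borel_measurable_suminf_order borel_measurable_times_ennreal borel_measurable_indicator) auto

lemma kernel_difference_le_maj:
  assumes d: "0 < \<delta>" "2 * \<delta> \<le> norm (x - y)" and t: "0 \<le> t" "t \<le> \<delta>"
  shows "ennreal (\<omega> (t / norm (x - y)) / norm (x - y) ^ CARD('n)) \<le> maj \<delta> x y"
proof -
  let ?n = "norm (x - y)"
  have n: "0 < ?n" using d by linarith
  obtain j where j0: "?n / \<delta> < 2 ^ j" using real_arch_pow[of 2] by auto
  \<comment> \<open>the dyadic annulus around \<open>x\<close> that contains \<open>y\<close>\<close>
  define j' where "j' = (LEAST j. ?n / \<delta> < 2 ^ j)"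
  have j': "?n / \<delta> < 2 ^ j'" unfolding j'_def by (rule LeastI) (rule j0)
  have "\<not> j' \<le> 1"
  proof
    assume "j' \<le> 1"
    then have "(2::real) ^ j' \<le> 2 ^ 1" by (intro power_increasing) auto
    then have "?n / \<delta> < 2" using order_less_le_trans[OF j'] by simp
    then show False using d by (simp add: field_simps)
  qed
  then obtain k where k: "j' = Suc (Suc k)" by (metis One_nat_def Suc_le_mono le_add1 not_less_eq_eq old.nat.exhaust plus_1_eq_Suc)
  have "\<not> ?n / \<delta> < 2 ^ Suc k" using not_less_Least[of "Suc k" "\<lambda>j. ?n / \<delta> < 2 ^ j"] k unfolding j'_def by simp
  then have low: "2 ^ Suc k * \<delta> \<le> ?n" using d by (simp add: field_simps)
  have hi: "?n < 2 ^ Suc (Suc k) * \<delta>" using j' d unfolding k by (simp add: field_simps)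
  have "t / ?n \<le> \<delta> / (2 ^ Suc k * \<delta>)" using t d low by (intro frac_le) auto
  then have "t / ?n \<le> 1 / 2 ^ Suc k" using d by simp
  then have "\<omega> (t / ?n) \<le> \<omega> (1 / 2 ^ Suc k)" using t n by (intro \<omega>_mono) auto
  moreover have "0 \<le> \<omega> (1 / 2 ^ Suc k)" by (rule \<omega>_nonneg) simp
  ultimately have "\<omega> (t / ?n) / ?n ^ CARD('n) \<le> \<omega> (1 / 2 ^ Suc k) / (2 ^ Suc k * \<delta>) ^ CARD('n)"
    using low d by (intro frac_le power_mono) auto
  then have "ennreal (\<omega> (t / ?n) / ?n ^ CARD('n))
      \<le> ennreal (\<omega> (1 / 2 ^ Suc k) / (2 ^ Suc k * \<delta>) ^ CARD('n)) * indicator (ball x (2 ^ Suc (Suc k) * \<delta>)) y"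
    using hi by (simp add: dist_norm ennreal_leI)
  also have "\<dots> \<le> maj \<delta> x y"
  proof -
    let ?F = "\<lambda>k. ennreal (\<omega> (1 / 2 ^ Suc k) / (2 ^ Suc k * \<delta>) ^ CARD('n)) * indicator (ball x (2 ^ Suc (Suc k) * \<delta>)) y"
    have "sum ?F {k} \<le> suminf ?F" by (rule sum_le_suminf) auto
    moreover have "sum ?F {k} = ?F k" by (simp only: sum.insert finite.emptyI empty_iff simp_thms sum.empty add_0_right)
    ultimately show ?thesis unfolding maj_def by metis
  qed
  finally show ?thesis .
qed

lemma maj_integral_le:
  fixes h :: "real ^ 'n \<Rightarrow> ennreal"
  assumes h[measurable]: "h \<in> borel_measurable lebesgue" and d: "0 < \<delta>" and z: "norm (x - z) \<le> \<delta>"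
  shows "(\<integral>\<^sup>+y. maj \<delta> x y * h y \<partial>lebesgue) \<le> ennreal (4 ^ CARD('n) * dini_sum) * hl_max h z"
proof -
  let ?c = "\<lambda>k. \<omega> (1 / 2 ^ Suc k) / (2 ^ Suc k * \<delta>) ^ CARD('n)"
  have w0: "0 \<le> \<omega> (1 / 2 ^ Suc k)" for k by (rule \<omega>_nonneg) simp
  have "(\<integral>\<^sup>+y. maj \<delta> x y * h y \<partial>lebesgue)
      = (\<integral>\<^sup>+y. (\<Sum>k. ennreal (?c k) * (h y * indicator (ball x (2 ^ Suc (Suc k) * \<delta>)) y)) \<partial>lebesgue)"
    unfolding maj_def by (intro nn_integral_cong) (simp add: ennreal_suminf_multc[symmetric] mult_ac)
  also have "\<dots> = (\<Sum>k. \<integral>\<^sup>+y. ennreal (?c k) * (h y * indicator (ball x (2 ^ Suc (Suc k) * \<delta>)) y) \<partial>lebesgue)"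
    by (rule nn_integral_suminf) (auto intro!: borel_measurable_times_ennreal borel_measurable_indicator)
  also have "\<dots> \<le> (\<Sum>k. ennreal (4 ^ CARD('n) * \<omega> (1 / 2 ^ Suc k)) * hl_max h z)"
  proof (rule suminf_le)
    fix k
    have "(\<integral>\<^sup>+y. ennreal (?c k) * (h y * indicator (ball x (2 ^ Suc (Suc k) * \<delta>)) y) \<partial>lebesgue)
       = ennreal (?c k) * (\<integral>\<^sup>+y\<in>ball x (2 ^ Suc (Suc k) * \<delta>). h y \<partial>lebesgue)"
      by (rule nn_integral_cmult) (auto intro!: borel_measurable_times_ennreal borel_measurable_indicator)
    also have "\<dots> \<le> ennreal (?c k) * (ennreal ((2 ^ Suc (Suc (Suc k)) * \<delta>) ^ CARD('n)) * hl_max h z)"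
    proof (intro mult_left_mono set_integral_le_hl_max)
      show "ball x (2 ^ Suc (Suc k) * \<delta>) \<subseteq> ball z (2 ^ Suc (Suc (Suc k)) * \<delta>)"
      proof
        fix y assume "y \<in> ball x (2 ^ Suc (Suc k) * \<delta>)"
        then have "dist z y < \<delta> + 2 ^ Suc (Suc k) * \<delta>"
          using dist_triangle[of z y x] z by (simp add: dist_norm norm_minus_commute)
        moreover have "1 * \<delta> \<le> 2 ^ Suc (Suc k) * \<delta>"
          by (rule mult_right_mono[OF one_le_power]) (use d in auto)
        ultimately show "y \<in> ball z (2 ^ Suc (Suc (Suc k)) * \<delta>)" by simp
      qed
    qed (use d in auto)
    also have "\<dots> = ennreal (?c k * (2 ^ Suc (Suc (Suc k)) * \<delta>) ^ CARD('n)) * hl_max h z"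
      using w0[of k] d by (subst ennreal_mult) (auto simp: mult.assoc)
    also have "?c k * (2 ^ Suc (Suc (Suc k)) * \<delta>) ^ CARD('n) = 4 ^ CARD('n) * \<omega> (1 / 2 ^ Suc k)"
    proof -
      have "2 ^ Suc (Suc (Suc k)) * \<delta> = 4 * (2 ^ Suc k * \<delta>)" by simp
      then have "(2 ^ Suc (Suc (Suc k)) * \<delta>) ^ CARD('n) = 4 ^ CARD('n) * (2 ^ Suc k * \<delta>) ^ CARD('n)"
        by (simp only: power_mult_distrib)
      moreover have "(2 ^ Suc k * \<delta>) ^ CARD('n) \<noteq> 0" using d by simp
      ultimately show ?thesis by simp
    qed
    finally show "(\<integral>\<^sup>+y. ennreal (?c k) * (h y * indicator (ball x (2 ^ Suc (Suc k) * \<delta>)) y) \<partial>lebesgue)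
        \<le> ennreal (4 ^ CARD('n) * \<omega> (1 / 2 ^ Suc k)) * hl_max h z" .
  qed auto
  also have "\<dots> = (\<Sum>k. ennreal (4 ^ CARD('n) * \<omega> (1 / 2 ^ Suc k))) * hl_max h z"
    by (rule ennreal_suminf_multc)
  also have "(\<Sum>k. ennreal (4 ^ CARD('n) * \<omega> (1 / 2 ^ Suc k))) = ennreal (\<Sum>k. 4 ^ CARD('n) * \<omega> (1 / 2 ^ Suc k))"
    using w0 by (intro suminf_ennreal2 summable_mult \<omega>_summable) auto
  also have "(\<Sum>k. 4 ^ CARD('n) * \<omega> (1 / 2 ^ Suc k)) = 4 ^ CARD('n) * dini_sum"
    unfolding dini_sum_def by (rule suminf_mult[OF \<omega>_summable])
  finally show ?thesis .
qed

text \<open>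
  For \<open>f\<close> supported away from \<open>x\<close>, moving the point by
  \<open>\<delta>\<close> changes \<open>T f\<close> by at most a constant times the maximal
  function. The balls of the majorant are centred at \<open>x\<close>, and each lies in the ball of
  twice its radius around \<open>x'\<close>.
\<close>

lemma kernel_oscillation:
  assumes f: "f \<in> borel_measurable lebesgue" "(\<integral>\<^sup>+y. ennreal (norm (f y)) \<partial>lebesgue) < \<infinity>"
    and d: "0 < \<delta>" and xx: "norm (x - x') \<le> \<delta>" and z: "\<And>y. norm (x - y) < 2 * \<delta> \<Longrightarrow> f y = 0"
  shows "ennreal (norm ((LINT y|lebesgue. K x y * f y) - (LINT y|lebesgue. K x' y * f y)))
    \<le> ennreal (4 ^ CARD('n) * dini_sum) * hl_max (\<lambda>y. ennreal (norm (f y))) x'"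
proof -
  have z': "f y = 0" if "norm (x' - y) < \<delta>" for y
  proof (rule z)
    have "norm (x - y) \<le> norm (x - x') + norm (x' - y)" using norm_triangle_ineq[of "x - x'" "x' - y"] by simp
    then show "norm (x - y) < 2 * \<delta>" using xx that by simp
  qed
  have i: "integrable lebesgue (\<lambda>y. K x y * f y)" by (rule integrable_kernel[OF f, of "2 * \<delta>"]) (use d z in auto)
  have i': "integrable lebesgue (\<lambda>y. K x' y * f y)" by (rule integrable_kernel[OF f d z'])
  have "(LINT y|lebesgue. K x y * f y) - (LINT y|lebesgue. K x' y * f y) = (LINT y|lebesgue. K x y * f y - K x' y * f y)"
    using i i' by simp
  also have "ennreal (norm \<dots>) \<le> (\<integral>\<^sup>+y. ennreal (norm (K x y * f y - K x' y * f y)) \<partial>lebesgue)"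
    by (rule integral_norm_bound_ennreal) (use i i' in simp)
  also have "\<dots> \<le> (\<integral>\<^sup>+y. maj \<delta> x y * ennreal (norm (f y)) \<partial>lebesgue)"
  proof (rule nn_integral_mono)
    fix y
    show "ennreal (norm (K x y * f y - K x' y * f y)) \<le> maj \<delta> x y * ennreal (norm (f y))"
    proof (cases "norm (x - y) < 2 * \<delta>")
      case False
      then have n: "2 * \<delta> \<le> norm (x - y)" by simp
      have "norm (K x y - K x' y) \<le> \<omega> (norm (x - x') / norm (x - y)) / norm (x - y) ^ CARD('n)"
        using n xx d by (intro smooth1) auto
      then have "ennreal (norm (K x y - K x' y)) \<le> maj \<delta> x y"
        using kernel_difference_le_maj[OF d n _ xx] by (auto intro: order_trans ennreal_leI)
      then have "ennreal (norm (K x y - K x' y)) * ennreal (norm (f y)) \<le> maj \<delta> x y * ennreal (norm (f y))"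
        by (rule mult_right_mono) simp
      then show ?thesis by (simp add: norm_mult ennreal_mult[symmetric] flip: left_diff_distrib)
    qed (simp add: z)
  qed
  also have "\<dots> \<le> ennreal (4 ^ CARD('n) * dini_sum) * hl_max (\<lambda>y. ennreal (norm (f y))) x'"
    using f by (intro maj_integral_le d xx) auto
  finally show ?thesis .
qed

text \<open>
  Because \<open>b\<close> has integral zero, the kernel may be replaced by its difference from the
  value at the centre of the support.
\<close>

lemma Hormander_bound:
  assumes b: "b \<in> L2" "(\<integral>\<^sup>+y. ennreal (norm (b y)) \<partial>lebesgue) < \<infinity>" and b0: "(LINT y|lebesgue. b y) = 0"
    and d: "0 < \<delta>" and z: "\<And>y. \<delta> < norm (c - y) \<Longrightarrow> b y = 0"
  shows "(\<integral>\<^sup>+x\<in>{x. 2 * \<delta> \<le> norm (c - x)}. ennreal (norm (T b x)) \<partial>lebesgue)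
    \<le> ennreal (4 ^ CARD('n) * dini_sum * ball_vol) * (\<integral>\<^sup>+y. ennreal (norm (b y)) \<partial>lebesgue)"
proof -
  let ?I = "\<integral>\<^sup>+y. ennreal (norm (b y)) \<partial>lebesgue"
  have bm[measurable]: "b \<in> borel_measurable lebesgue" using b L2_measurable by blast
  have bi: "integrable lebesgue b" using b by (simp add: integrable_iff_bounded)
  have "(\<integral>\<^sup>+x\<in>{x. 2 * \<delta> \<le> norm (c - x)}. ennreal (norm (T b x)) \<partial>lebesgue) \<le> (\<integral>\<^sup>+x. maj \<delta> c x * ?I \<partial>lebesgue)"
  proof (rule nn_integral_mono_AE)
    show "AE x in lebesgue. ennreal (norm (T b x)) * indicator {x. 2 * \<delta> \<le> norm (c - x)} x \<le> maj \<delta> c x * ?I"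
      using T_kernel[OF b(1)]
    proof eventually_elim
      fix x assume rep: "x \<notin> fsupp b \<longrightarrow> T b x = (LINT y|lebesgue. K x y * b y)"
      show "ennreal (norm (T b x)) * indicator {x. 2 * \<delta> \<le> norm (c - x)} x \<le> maj \<delta> c x * ?I"
      proof (cases "2 * \<delta> \<le> norm (c - x)")
        case True
        have zx: "b y = 0" if "norm (x - y) < \<delta>" for y
        proof (rule z)
          have "norm (c - x) \<le> norm (c - y) + norm (x - y)"
            using norm_triangle_ineq[of "c - y" "y - x"] by (simp add: norm_minus_commute)
          then show "\<delta> < norm (c - y)" using True that by simp
        qed
        have "x \<notin> fsupp b" by (rule not_in_fsuppI[OF d]) (simp add: zx dist_norm)
        then have "T b x = (LINT y|lebesgue. K x y * b y)" using rep by simp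
        also have "\<dots> = (LINT y|lebesgue. K x y * b y) - (LINT y|lebesgue. K x c * b y)"
          by (simp add: b0 bi)
        also have "\<dots> = (LINT y|lebesgue. K x y * b y - K x c * b y)"
          using integrable_kernel[OF bm b(2) d zx] bi by simp
        also have "ennreal (norm \<dots>) \<le> (\<integral>\<^sup>+y. ennreal (norm (K x y * b y - K x c * b y)) \<partial>lebesgue)"
          by (rule integral_norm_bound_ennreal) (use integrable_kernel[OF bm b(2) d zx] bi in simp)
        also have "\<dots> \<le> (\<integral>\<^sup>+y. maj \<delta> c x * ennreal (norm (b y)) \<partial>lebesgue)"
        proof (rule nn_integral_mono)
          fix y
          show "ennreal (norm (K x y * b y - K x c * b y)) \<le> maj \<delta> c x * ennreal (norm (b y))"
          proof (cases "\<delta> < norm (c - y)")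
            case False
            then have cy: "norm (c - y) \<le> \<delta>" by simp
            have "norm (K x c - K x y) \<le> \<omega> (norm (c - y) / norm (c - x)) / norm (c - x) ^ CARD('n)"
              using True cy d by (intro smooth2) auto
            then have "ennreal (norm (K x c - K x y)) \<le> maj \<delta> c x"
              using kernel_difference_le_maj[OF d True _ cy] by (auto intro: order_trans ennreal_leI)
            then have "ennreal (norm (K x c - K x y)) * ennreal (norm (b y)) \<le> maj \<delta> c x * ennreal (norm (b y))"
              by (rule mult_right_mono) simp
            then show ?thesis by (simp add: norm_mult norm_minus_commute[of "K x y"] ennreal_mult[symmetric] flip: left_diff_distrib)
          qed (simp add: z)
        qed
        also have "\<dots> = maj \<delta> c x * ?I" by (rule nn_integral_cmult) measurable
        finally show ?thesis using True by simp
      qed simp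
    qed
  qed
  also have "\<dots> = (\<integral>\<^sup>+x. maj \<delta> c x * 1 \<partial>lebesgue) * ?I" by (simp add: nn_integral_multc)
  also have "\<dots> \<le> (ennreal (4 ^ CARD('n) * dini_sum) * hl_max (\<lambda>_. 1) c) * ?I"
    by (intro mult_right_mono maj_integral_le d) (use d in auto)
  also have "\<dots> \<le> (ennreal (4 ^ CARD('n) * dini_sum) * (ennreal ball_vol * 1)) * ?I"
    unfolding ball_vol_def by (intro mult_right_mono mult_left_mono hl_max_const_le) auto
  also have "\<dots> = ennreal (4 ^ CARD('n) * dini_sum * ball_vol) * ?I"
    using dini_sum_nonneg ball_vol_pos by (simp add: ennreal_mult)
  finally show ?thesis .
qed

lemma T_diff:
  assumes "f \<in> L2" "g \<in> L2"
  shows "AE x in lebesgue. T (\<lambda>y. f y - g y) x = T f x - T g x"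
  using T_linear[OF assms, of 1 "-1"] by simp

lemma T_add:
  assumes "f \<in> L2" "g \<in> L2"
  shows "AE x in lebesgue. T (\<lambda>y. f y + g y) x = T f x + T g x"
  using T_linear[OF assms, of 1 1] by simp

lemma T_zero: "AE x in lebesgue. T (\<lambda>y. 0) x = 0"
  using T_linear[OF L2_zero L2_zero, of 0 0] by simp

lemma L2_scale: "f \<in> L2 \<Longrightarrow> (\<lambda>x. (c::'k) * f x) \<in> L2"
proof -
  assume f: "f \<in> L2"
  have "(\<integral>\<^sup>+x. ennreal ((norm (c * f x))\<^sup>2) \<partial>lebesgue) = ennreal ((norm c)\<^sup>2) * (\<integral>\<^sup>+x. ennreal ((norm (f x))\<^sup>2) \<partial>lebesgue)"
    using L2_measurable[OF f] by (subst nn_integral_cmult[symmetric]) (auto simp: norm_mult power_mult_distrib ennreal_mult)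
  then show ?thesis using f by (auto simp: L2_iff ennreal_mult_less_top)
qed

lemma T_sum:
  assumes "finite F" "\<And>i. i \<in> F \<Longrightarrow> f i \<in> L2"
  shows "(\<lambda>y. \<Sum>i\<in>F. c i * f i y) \<in> L2 \<and> (AE x in lebesgue. T (\<lambda>y. \<Sum>i\<in>F. c i * f i y) x = (\<Sum>i\<in>F. c i * T (f i) x))"
  using assms
proof (induction F rule: finite_induct)
  case empty then show ?case using L2_zero T_zero by simp
next
  case (insert j F)
  then have IH: "(\<lambda>y. \<Sum>i\<in>F. c i * f i y) \<in> L2" "AE x in lebesgue. T (\<lambda>y. \<Sum>i\<in>F. c i * f i y) x = (\<Sum>i\<in>F. c i * T (f i) x)"
    and fj: "f j \<in> L2" by auto
  have e: "(\<lambda>y. \<Sum>i\<in>insert j F. c i * f i y) = (\<lambda>y. c j * f j y + 1 * (\<Sum>i\<in>F. c i * f i y))"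
    using insert by (auto simp: fun_eq_iff)
  have "(\<lambda>y. c j * f j y + 1 * (\<Sum>i\<in>F. c i * f i y)) \<in> L2"
    using L2_add[OF L2_scale[OF fj] IH(1)] by simp
  moreover have "AE x in lebesgue. T (\<lambda>y. c j * f j y + 1 * (\<Sum>i\<in>F. c i * f i y)) x = (\<Sum>i\<in>insert j F. c i * T (f i) x)"
    using T_linear[OF fj IH(1), of "c j" 1] IH(2) by eventually_elim (use insert in simp)
  ultimately show ?case unfolding e by blast
qed

lemma T_null:
  assumes f: "f \<in> L2" "AE x in lebesgue. f x = 0"
  shows "AE x in lebesgue. T f x = 0"
proof -
  have [measurable]: "T f \<in> borel_measurable lebesgue" using T_L2[OF f(1)] L2_measurable by blast
  have "(\<integral>\<^sup>+x. ennreal ((norm (f x))\<^sup>2) \<partial>lebesgue) = 0"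
    using f(2) by (subst nn_integral_0_iff_AE) (use L2_measurable[OF f(1)] in auto)
  then have "(\<integral>\<^sup>+x. ennreal ((norm (T f x))\<^sup>2) \<partial>lebesgue) \<le> 0" using T_bounded[OF f(1)] by simp
  then have "AE x in lebesgue. ennreal ((norm (T f x))\<^sup>2) = 0" by (subst (asm) le_zero_eq) (simp add: nn_integral_0_iff_AE)
  then show ?thesis by eventually_elim simp
qed

lemma T_Chebyshev:
  assumes f: "f \<in> L2" and l: "0 < l"
  shows "ennreal (l\<^sup>2) * emeasure lebesgue {x. l < norm (T f x)} \<le> ennreal B * (\<integral>\<^sup>+x. ennreal ((norm (f x))\<^sup>2) \<partial>lebesgue)"
proof -
  have [measurable]: "T f \<in> borel_measurable lebesgue" using T_L2[OF f] L2_measurable by blast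
  have "{x. l < norm (T f x)} = {x \<in> space lebesgue. ennreal (l\<^sup>2) < ennreal ((norm (T f x))\<^sup>2)}"
    using l by (auto simp: ennreal_less_iff power_strict_mono dest: power2_less_imp_less)
  then have "ennreal (l\<^sup>2) * emeasure lebesgue {x. l < norm (T f x)} \<le> (\<integral>\<^sup>+x. ennreal ((norm (T f x))\<^sup>2) \<partial>lebesgue)"
    using Markov_inequality[of "\<lambda>x. ennreal ((norm (T f x))\<^sup>2)" lebesgue "ennreal (l\<^sup>2)"] by simp
  also have "\<dots> \<le> ennreal B * (\<integral>\<^sup>+x. ennreal ((norm (f x))\<^sup>2) \<partial>lebesgue)" by (rule T_bounded[OF f])
  finally show ?thesis .
qed

end

text \<open>
  Monotonicity of \<open>\<omega>\<close> bounds the integral from below by half of the sum, one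
  dyadic interval for each term.
\<close>

lemma dini_imp_summable:
  assumes mono: "\<And>s t. 0 \<le> s \<Longrightarrow> s \<le> t \<Longrightarrow> \<omega> s \<le> \<omega> t" and z: "\<And>t. 0 \<le> t \<Longrightarrow> 0 \<le> \<omega> t" and d: "dini \<omega>"
  shows "summable (\<lambda>k. \<omega> (1 / 2 ^ Suc k))"
proof -
  let ?I = "\<integral>\<^sup>+t\<in>{0<..1}. ennreal (\<omega> t / t) \<partial>lebesgue"
  obtain M where M: "?I = ennreal M" "0 \<le> M" using d unfolding dini_def by (cases ?I) auto
  let ?J = "\<lambda>k. {1 / 2 ^ Suc k<..1 / 2 ^ k :: real}"
  let ?w = "\<lambda>k. \<omega> (1 / 2 ^ Suc k)"
  have w0: "0 \<le> ?w k" for k by (rule z) simp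
  have "sum ?w {..<n} \<le> 2 * M" for n
  proof -
    have "(\<Sum>k<n. ennreal (2 ^ k * ?w k) * indicator (?J k) t) \<le> ennreal (\<omega> t / t) * indicator {0<..1} t" for t
    proof (cases "\<exists>k<n. t \<in> ?J k")
      case True
      then obtain j where j: "j < n" "t \<in> ?J j" by blast
      have uniq: "t \<notin> ?J k" if "k \<noteq> j" for k
      proof
        assume k: "t \<in> ?J k"
        have *: "False" if "a < b" "t \<in> ?J a" "t \<in> ?J b" for a b
        proof -
          have "(1::real) / 2 ^ b \<le> 1 / 2 ^ Suc a" using that by (intro divide_left_mono power_increasing) auto
          then show False using that by auto
        qed
        show False using *[of k j] *[of j k] k j \<open>k \<noteq> j\<close> by (meson linorder_neqE_nat)
      qed
      have "(\<Sum>k<n. ennreal (2 ^ k * ?w k) * indicator (?J k) t) = (\<Sum>k<n. if k = j then ennreal (2 ^ j * ?w j) else 0)"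
        using uniq j by (intro sum.cong) auto
      also have "\<dots> = ennreal (2 ^ j * ?w j)" using j by simp
      also have "\<dots> \<le> ennreal (\<omega> t / t)"
      proof (rule ennreal_leI)
        have t: "0 < t" using j by (auto intro: less_trans[rotated])
        have "2 ^ j * ?w j = ?w j / (1 / 2 ^ j)" by simp
        also have "\<dots> \<le> \<omega> t / t" using j t w0 by (intro frac_le mono) (auto simp: z)
        finally show "2 ^ j * ?w j \<le> \<omega> t / t" .
      qed
      also have "\<dots> = ennreal (\<omega> t / t) * indicator {0<..1} t"
      proof -
        have "0 < t" using j by (auto intro: less_trans[rotated])
        moreover have "t \<le> 1" using j(2) order_trans[of t "1 / 2 ^ j" 1] by (auto simp: divide_le_eq_1)
        ultimately show ?thesis by simp
      qed
      finally show ?thesis .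
    next
      case False
      then have "(\<Sum>k<n. ennreal (2 ^ k * ?w k) * indicator (?J k) t) = 0" by (intro sum.neutral) auto
      then show ?thesis by (simp only: zero_le)
    qed
    then have "(\<integral>\<^sup>+t. (\<Sum>k<n. ennreal (2 ^ k * ?w k) * indicator (?J k) t) \<partial>lebesgue) \<le> ennreal M"
      unfolding M(1)[symmetric] by (intro nn_integral_mono)
    moreover have "(\<integral>\<^sup>+t. (\<Sum>k<n. ennreal (2 ^ k * ?w k) * indicator (?J k) t) \<partial>lebesgue) = (\<Sum>k<n. ennreal (2 ^ k * ?w k) * emeasure lebesgue (?J k))"
      by (subst nn_integral_sum)
        (auto simp: nn_integral_cmult_indicator intro!: borel_measurable_times_ennreal borel_measurable_indicator)
    moreover have "ennreal (2 ^ k * ?w k) * emeasure lebesgue (?J k) = ennreal (?w k / 2)" for k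
    proof -
      have "emeasure lebesgue (?J k) = ennreal (1 / 2 ^ k - 1 / 2 ^ Suc k)" by (simp add: field_simps)
      also have "1 / 2 ^ k - 1 / 2 ^ Suc k = (1 / 2 ^ Suc k :: real)" by (simp add: field_simps)
      finally show ?thesis using w0[of k] by (simp add: ennreal_mult[symmetric])
    qed
    ultimately have "(\<Sum>k<n. ennreal (?w k / 2)) \<le> ennreal M" by simp
    then have "ennreal (\<Sum>k<n. ?w k / 2) \<le> ennreal M" using w0 by (subst (asm) sum_ennreal) auto
    then have "(\<Sum>k<n. ?w k / 2) \<le> M" using M by simp
    then show ?thesis by (simp add: sum_divide_distrib[symmetric])
  qed
  then show ?thesis by (intro summableI_nonneg_bounded w0)
qed

lemma CZ_operator_dini_cz:
  fixes T :: "(real ^ 'n \<Rightarrow> 'k::{real_normed_field,euclidean_space}) \<Rightarrow> real ^ 'n \<Rightarrow> 'k"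
  assumes m: "modulus_of_continuity \<omega>" and d: "dini \<omega>" and cz: "CZ_operator \<omega> T"
  obtains K B CK where "dini_cz T K \<omega> B CK"
proof -
  have L: "L2_bounded_operator T" using cz by (simp add: CZ_operator_def)
  obtain K where K: "CZ_kernel \<omega> K" and rep: "\<forall>f\<in>L2. AE x in lebesgue. x \<notin> fsupp f \<longrightarrow> T f x = (LINT y|lebesgue. K x y * f y)"
    using cz unfolding CZ_operator_def by blast
  obtain C where C: "\<forall>x y. x \<noteq> y \<longrightarrow> norm (K x y) \<le> C / norm (x - y) ^ CARD('n)"
    using K unfolding CZ_kernel_def by blast
  have sm: "norm (K x y - K x' y) + norm (K y x - K y x') \<le> \<omega> (norm (x - x') / norm (x - y)) / norm (x - y) ^ CARD('n)"
    if "x \<noteq> y" "2 * norm (x - x') \<le> norm (x - y)" for x x' y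
    using K that unfolding CZ_kernel_def by blast
  obtain B where B: "\<forall>f\<in>L2. L2norm (T f) \<le> ennreal B * L2norm f" using L unfolding L2_bounded_operator_def by blast
  have mono: "\<omega> s \<le> \<omega> t" if "0 \<le> s" "s \<le> t" for s t
    using m that unfolding modulus_of_continuity_def by (auto intro: mono_onD)
  have nn: "0 \<le> \<omega> t" if "0 \<le> t" for t
    using mono[of 0 t] that m by (simp add: modulus_of_continuity_def)
  have "dini_cz T K \<omega> ((max B 0)\<^sup>2) (max C 0)"
  proof
    show "T f \<in> L2" if "f \<in> L2" for f using L that by (simp add: L2_bounded_operator_def)
    show "AE x in lebesgue. T (\<lambda>y. a * f y + b * g y) x = a * T f x + b * T g x" if "f \<in> L2" "g \<in> L2" for f g a b
      using L that unfolding L2_bounded_operator_def by blast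
    show "(\<integral>\<^sup>+x. ennreal ((norm (T f x))\<^sup>2) \<partial>lebesgue) \<le> ennreal ((max B 0)\<^sup>2) * (\<integral>\<^sup>+x. ennreal ((norm (f x))\<^sup>2) \<partial>lebesgue)"
      if f: "f \<in> L2" for f
    proof -
      have "L2norm (T f) \<le> ennreal (max B 0) * L2norm f"
        using B f by (meson ennreal_leI max.cobounded1 mult_right_mono order_trans zero_le)
      then have "(L2norm (T f))\<^sup>2 \<le> (ennreal (max B 0) * L2norm f)\<^sup>2"
        unfolding power2_eq_square by (intro mult_mono) auto
      also have "\<dots> = ennreal ((max B 0)\<^sup>2) * (L2norm f)\<^sup>2"
        by (simp add: power_mult_distrib ennreal_power)
      finally show ?thesis unfolding L2norm_square .
    qed
    show "norm (K x y) \<le> max C 0 / norm (x - y) ^ CARD('n)" if "x \<noteq> y" for x y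
    proof -
      have "norm (K x y) \<le> C / norm (x - y) ^ CARD('n)" using C that by blast
      also have "\<dots> \<le> max C 0 / norm (x - y) ^ CARD('n)" by (intro divide_right_mono) auto
      finally show ?thesis .
    qed
    show "norm (K x y - K x' y) \<le> \<omega> (norm (x - x') / norm (x - y)) / norm (x - y) ^ CARD('n)"
      if "x \<noteq> y" "2 * norm (x - x') \<le> norm (x - y)" for x x' y
      using sm[OF that] norm_ge_zero[of "K y x - K y x'"] by linarith
    show "norm (K y x - K y x') \<le> \<omega> (norm (x - x') / norm (x - y)) / norm (x - y) ^ CARD('n)"
      if "x \<noteq> y" "2 * norm (x - x') \<le> norm (x - y)" for x x' y
      using sm[OF that] norm_ge_zero[of "K x y - K x' y"] by linarith
    show "summable (\<lambda>k. \<omega> (1 / 2 ^ Suc k))" by (rule dini_imp_summable[OF mono nn d])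
    show "AE x in lebesgue. x \<notin> fsupp f \<longrightarrow> T f x = (LINT y|lebesgue. K x y * f y)" if "f \<in> L2" for f
      using rep that by blast
  qed (use mono nn in auto)
  then show ?thesis by (rule that)
qed


section \<open>The weak type (1,1) estimate\<close>

context dini_cz
begin

text \<open>
  The three terms come from the bounded part of the decomposition, from the dilated stopping cubes
  and from the parts of mean zero away from their cubes.
\<close>

definition weak_const :: real where
  "weak_const = 4 * B * 2 ^ CARD('n) + ball_vol * (2 * real CARD('n)) ^ CARD('n) + 8 * (4 ^ CARD('n) * dini_sum * ball_vol)"

lemma weak_const_nonneg: "0 \<le> weak_const"
  using B dini_sum_nonneg ball_vol_pos by (simp add: weak_const_def)

text \<open>
  The Calderon--Zygmund decomposition at height \<open>l\<close> on a cube that contains the support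
  of \<open>f\<close> and on which the average of $|f|$ is at most \<open>l\<close>. The hypothesis
  on the average keeps all stopping cubes inside that cube.
\<close>

lemma weak_type_local:
  assumes R: "R \<in> cubes" and f: "f \<in> L2" and z: "\<And>x. x \<notin> R \<Longrightarrow> f x = 0" and l: "0 < l"
    and avg: "(\<integral>\<^sup>+x. ennreal (norm (f x)) \<partial>lebesgue) \<le> ennreal l * emeasure lebesgue R"
  shows "ennreal l * emeasure lebesgue {x. l < norm (T f x)} \<le> ennreal weak_const * (\<integral>\<^sup>+x. ennreal (norm (f x)) \<partial>lebesgue)"
proof -
  let ?h = "\<lambda>x. ennreal (norm (f x))"
  let ?N = "CARD('n)"
  define I where "I = (\<integral>\<^sup>+x. ?h x \<partial>lebesgue)"
  have fm[measurable]: "f \<in> borel_measurable lebesgue" using f L2_measurable by blast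
  have Rs: "R \<in> sets lebesgue" using R cubes_sets by blast
  have If: "I < \<infinity>" unfolding I_def
    by (rule L2_imp_L1_on_finite[OF f Rs _ z]) (simp add: emeasure_cubes[OF R])
  have fi: "integrable lebesgue f" using If by (simp add: integrable_iff_bounded I_def)
  have "(\<integral>\<^sup>+x\<in>R. ?h x \<partial>lebesgue) \<le> I" unfolding I_def by (intro nn_integral_mono) (auto simp: indicator_def)
  then have avgR: "(\<integral>\<^sup>+x\<in>R. ?h x \<partial>lebesgue) \<le> ennreal l * emeasure lebesgue R" using avg unfolding I_def by (rule order_trans)
  obtain P where PD: "P \<subseteq> dyadic_subcubes R" and Pc: "countable P" and Pd: "disjoint_family_on (\<lambda>S. S) P"
    and Plow: "\<forall>S\<in>P. ennreal l * emeasure lebesgue S \<le> (\<integral>\<^sup>+x\<in>S. ?h x \<partial>lebesgue)"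
    and Phigh: "\<forall>S\<in>P. (\<integral>\<^sup>+x\<in>S. ?h x \<partial>lebesgue) \<le> ennreal (2 ^ ?N * l) * emeasure lebesgue S"
    and Pout: "AE x in lebesgue. x \<in> R - \<Union>P \<longrightarrow> ?h x \<le> ennreal l"
    by (rule stopping_cubes[OF R _ less_imp_le[OF l] avgR]) measurable
  have Scube: "S \<in> cubes" if "S \<in> P" for S using that PD dyadic_in_cubes[OF R] by blast
  have Ss: "S \<in> sets lebesgue" if "S \<in> P" for S using Scube[OF that] cubes_sets by blast
  define U where "U = \<Union>P"
  have Us[measurable]: "U \<in> sets lebesgue" unfolding U_def using Pc Ss by (intro sets.countable_Union) auto
  have UR: "U \<subseteq> R" unfolding U_def using PD dyadic_subset[OF R] by blast
  have SU: "S \<subseteq> U" if "S \<in> P" for S using that by (auto simp: U_def)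
  have hsum: "(\<integral>\<^sup>+S. (\<integral>\<^sup>+x\<in>S. ?h x \<partial>lebesgue) \<partial>count_space P) = (\<integral>\<^sup>+x\<in>U. ?h x \<partial>lebesgue)"
    unfolding U_def using set_nn_integral_UN_disjoint[OF Pc Pd Ss, of ?h] by simp
  have hU: "(\<integral>\<^sup>+x\<in>U. ?h x \<partial>lebesgue) \<le> I" unfolding I_def by (intro nn_integral_mono) (auto simp: indicator_def)
  define av where "av S = average S f" for S
  have avS: "measure lebesgue S *\<^sub>R av S = (LINT x|lebesgue. indicator S x *\<^sub>R f x)" if "S \<in> P" for S
    using measure_cubes_pos[OF Scube[OF that]] by (simp add: av_def average_def set_lebesgue_integral_def)
  have av1: "ennreal (norm (av S)) * emeasure lebesgue S \<le> (\<integral>\<^sup>+x\<in>S. ?h x \<partial>lebesgue)" if S: "S \<in> P" for S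
  proof -
    have "ennreal (norm (av S)) * emeasure lebesgue S = ennreal (norm (measure lebesgue S *\<^sub>R av S))"
      by (simp add: emeasure_cubes[OF Scube[OF S]] ennreal_mult mult.commute)
    also have "\<dots> \<le> (\<integral>\<^sup>+x. ennreal (norm (indicator S x *\<^sub>R f x)) \<partial>lebesgue)"
      unfolding avS[OF S] using Ss[OF S] fi
      by (intro integral_norm_bound_ennreal) (rule integrable_mult_indicator)
    also have "\<dots> = (\<integral>\<^sup>+x\<in>S. ?h x \<partial>lebesgue)" by (intro nn_integral_cong) (auto simp: indicator_def)
    finally show ?thesis .
  qed
  have av2: "norm (av S) \<le> 2 ^ ?N * l" if S: "S \<in> P" for S
  proof -
    have "ennreal (norm (av S)) * emeasure lebesgue S \<le> ennreal (2 ^ ?N * l) * emeasure lebesgue S"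
      by (rule order_trans[OF av1[OF S] bspec[OF Phigh S]])
    then have "norm (av S) * measure lebesgue S \<le> 2 ^ ?N * l * measure lebesgue S"
      using l by (simp add: emeasure_cubes[OF Scube[OF S]] ennreal_mult[symmetric])
    then show ?thesis using measure_cubes_pos[OF Scube[OF S]] by simp
  qed
  \<comment> \<open>the good part: averages on the stopping cubes, and \<open>f\<close> elsewhere,
    where it is at most \<open>l\<close>\<close>
  define g where "g x = (if x \<in> U then av (THE S. S \<in> P \<and> x \<in> S) else f x)" for x
  have gS: "g x = av S" if "S \<in> P" "x \<in> S" for x S
  proof -
    have "(THE S. S \<in> P \<and> x \<in> S) = S"
      using that Pd by (intro the_equality) (auto simp: disjoint_family_on_def)
    then show ?thesis using that SU by (auto simp: g_def)
  qed
  have gO: "g x = f x" if "x \<notin> U" for x using that by (simp add: g_def)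
  have gm[measurable]: "g \<in> borel_measurable lebesgue"
  proof (rule measurableI)
    fix A :: "'k set" assume A: "A \<in> sets borel"
    have "g -` A \<inter> space lebesgue = ((f -` A \<inter> space lebesgue) - U) \<union> \<Union>{S \<in> P. av S \<in> A}"
      (is "?L = ?R")
    proof (rule set_eqI)
      fix x show "x \<in> ?L \<longleftrightarrow> x \<in> ?R"
      proof (cases "x \<in> U")
        case True
        then obtain S where S: "S \<in> P" "x \<in> S" by (auto simp: U_def)
        have un: "S' = S" if "S' \<in> P" "x \<in> S'" for S' using that S Pd by (auto simp: disjoint_family_on_def)
        have "x \<in> \<Union>{S \<in> P. av S \<in> A} \<longleftrightarrow> av S \<in> A"
        proof
          assume "x \<in> \<Union>{S \<in> P. av S \<in> A}"
          then obtain S' where "S' \<in> P" "av S' \<in> A" "x \<in> S'" by auto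
          then show "av S \<in> A" using un[of S'] by simp
        next
          assume "av S \<in> A"
          then show "x \<in> \<Union>{S \<in> P. av S \<in> A}" using S by (intro UnionI[of S]) simp_all
        qed
        then show ?thesis using True by (simp add: gS[OF S])
      next
        case False
        then have "x \<notin> \<Union>{S \<in> P. av S \<in> A}" unfolding U_def by simp
        then show ?thesis using False by (simp add: gO)
      qed
    qed
    also have "\<dots> \<in> sets lebesgue"
    proof (rule sets.Un)
      show "f -` A \<inter> space lebesgue - U \<in> sets lebesgue" by (rule sets.Diff[OF measurable_sets[OF fm A] Us])
      have "countable {S \<in> P. av S \<in> A}" by (rule countable_subset[OF _ Pc]) simp
      then show "\<Union>{S \<in> P. av S \<in> A} \<in> sets lebesgue"
        by (rule sets.countable_Union) (use Ss in auto)
    qed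
    finally show "g -` A \<inter> space lebesgue \<in> sets lebesgue" .
  qed simp
  have gI: "(\<integral>\<^sup>+x. ennreal (norm (g x)) \<partial>lebesgue) \<le> I"
  proof -
    have "(\<integral>\<^sup>+x. ennreal (norm (g x)) \<partial>lebesgue)
        = (\<integral>\<^sup>+x. ennreal (norm (g x)) * indicator U x + ?h x * indicator (- U) x \<partial>lebesgue)"
      by (intro nn_integral_cong) (auto simp: indicator_def gO)
    also have "\<dots> = (\<integral>\<^sup>+x\<in>U. ennreal (norm (g x)) \<partial>lebesgue) + (\<integral>\<^sup>+x\<in>- U. ?h x \<partial>lebesgue)"
      by (rule nn_integral_add) measurable
    also have "(\<integral>\<^sup>+x\<in>U. ennreal (norm (g x)) \<partial>lebesgue) = (\<integral>\<^sup>+S. (\<integral>\<^sup>+x\<in>S. ennreal (norm (g x)) \<partial>lebesgue) \<partial>count_space P)"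
      unfolding U_def using set_nn_integral_UN_disjoint[OF Pc Pd Ss, of "\<lambda>x. ennreal (norm (g x))"] by simp
    also have "\<dots> \<le> (\<integral>\<^sup>+S. (\<integral>\<^sup>+x\<in>S. ?h x \<partial>lebesgue) \<partial>count_space P)"
    proof (rule nn_integral_mono)
      fix S assume "S \<in> space (count_space P)"
      then have S: "S \<in> P" by simp
      have "(\<integral>\<^sup>+x\<in>S. ennreal (norm (g x)) \<partial>lebesgue) = (\<integral>\<^sup>+x\<in>S. ennreal (norm (av S)) \<partial>lebesgue)"
        by (intro nn_integral_cong) (auto simp: indicator_def gS[OF S])
      also have "\<dots> = ennreal (norm (av S)) * emeasure lebesgue S"
        using Ss[OF S] by (rule nn_integral_cmult_indicator)
      finally show "(\<integral>\<^sup>+x\<in>S. ennreal (norm (g x)) \<partial>lebesgue) \<le> (\<integral>\<^sup>+x\<in>S. ?h x \<partial>lebesgue)" using av1[OF S] by simp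
    qed
    also have "\<dots> = (\<integral>\<^sup>+x\<in>U. ?h x \<partial>lebesgue)" by (rule hsum)
    also have "(\<integral>\<^sup>+x\<in>U. ?h x \<partial>lebesgue) + (\<integral>\<^sup>+x\<in>- U. ?h x \<partial>lebesgue)
        = (\<integral>\<^sup>+x. ?h x * indicator U x + ?h x * indicator (- U) x \<partial>lebesgue)"
      by (rule nn_integral_add[symmetric]) measurable
    also have "\<dots> = I" unfolding I_def by (intro nn_integral_cong) (auto simp: indicator_def)
    finally show ?thesis by (simp add: add_right_mono)
  qed
  have gb: "AE x in lebesgue. norm (g x) \<le> 2 ^ ?N * l"
    using Pout
  proof eventually_elim
    fix x assume o: "x \<in> R - \<Union>P \<longrightarrow> ?h x \<le> ennreal l"
    have "(1::real) \<le> 2 ^ ?N" by (rule one_le_power) simp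
    then have ll: "1 * l \<le> 2 ^ ?N * l" using l by (intro mult_right_mono) auto
    show "norm (g x) \<le> 2 ^ ?N * l"
    proof (cases "x \<in> U")
      case True
      then obtain S where "S \<in> P" "x \<in> S" by (auto simp: U_def)
      then show ?thesis using gS av2 by auto
    next
      case False
      have "norm (f x) \<le> l" using o False l z[of x] by (cases "x \<in> R") (auto simp: U_def)
      then show ?thesis using ll gO[OF False] by simp
    qed
  qed
  have g2: "(\<integral>\<^sup>+x. ennreal ((norm (g x))\<^sup>2) \<partial>lebesgue) \<le> ennreal (2 ^ ?N * l) * I"
  proof -
    have "(\<integral>\<^sup>+x. ennreal ((norm (g x))\<^sup>2) \<partial>lebesgue) \<le> (\<integral>\<^sup>+x. ennreal (2 ^ ?N * l) * ennreal (norm (g x)) \<partial>lebesgue)"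
    proof (rule nn_integral_mono_AE)
      show "AE x in lebesgue. ennreal ((norm (g x))\<^sup>2) \<le> ennreal (2 ^ ?N * l) * ennreal (norm (g x))"
        using gb
      proof eventually_elim
        fix x assume "norm (g x) \<le> 2 ^ ?N * l"
        then have "norm (g x) * norm (g x) \<le> 2 ^ ?N * l * norm (g x)" by (rule mult_right_mono) simp
        then have "ennreal ((norm (g x))\<^sup>2) \<le> ennreal (2 ^ ?N * l * norm (g x))"
          unfolding power2_eq_square by (rule ennreal_leI)
        then show "ennreal ((norm (g x))\<^sup>2) \<le> ennreal (2 ^ ?N * l) * ennreal (norm (g x))"
          using l by (simp add: ennreal_mult)
      qed
    qed
    also have "\<dots> = ennreal (2 ^ ?N * l) * (\<integral>\<^sup>+x. ennreal (norm (g x)) \<partial>lebesgue)" by (rule nn_integral_cmult) measurable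
    also have "\<dots> \<le> ennreal (2 ^ ?N * l) * I" by (rule mult_left_mono[OF gI]) simp
    finally show ?thesis .
  qed
  have gL2: "g \<in> L2" using g2 If by (auto simp: L2_iff ennreal_mult_less_top intro: le_less_trans)
  define b where "b x = f x - g x" for x
  have bL2: "b \<in> L2" unfolding b_def[abs_def] by (rule L2_diff[OF f gL2])
  have bm[measurable]: "b \<in> borel_measurable lebesgue" using bL2 L2_measurable by blast
  have b0: "b x = 0" if "x \<notin> U" for x using that by (simp add: b_def gO)
  have bSL2: "restrict_to S b \<in> L2" if "S \<in> P" for S by (rule L2_restrict_to[OF Ss[OF that] bL2])
  have bSI: "(\<integral>\<^sup>+x. ennreal (norm (restrict_to S b x)) \<partial>lebesgue) \<le> 2 * (\<integral>\<^sup>+x\<in>S. ?h x \<partial>lebesgue)" if S: "S \<in> P" for S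
  proof -
    have Sm[measurable]: "S \<in> sets lebesgue" by (rule Ss[OF S])
    have "(\<integral>\<^sup>+x. ennreal (norm (restrict_to S b x)) \<partial>lebesgue)
        \<le> (\<integral>\<^sup>+x. ?h x * indicator S x + ennreal (norm (av S)) * indicator S x \<partial>lebesgue)"
    proof (rule nn_integral_mono)
      fix x show "ennreal (norm (restrict_to S b x)) \<le> ?h x * indicator S x + ennreal (norm (av S)) * indicator S x"
        using norm_triangle_ineq4[of "f x" "av S"] gS[OF S, of x]
        by (cases "x \<in> S") (auto simp: b_def ennreal_plus[symmetric] intro!: ennreal_leI simp del: ennreal_plus)
    qed
    also have "\<dots> = (\<integral>\<^sup>+x\<in>S. ?h x \<partial>lebesgue) + ennreal (norm (av S)) * emeasure lebesgue S"
      by (subst nn_integral_add) (auto simp: nn_integral_cmult_indicator)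
    also have "\<dots> \<le> (\<integral>\<^sup>+x\<in>S. ?h x \<partial>lebesgue) + (\<integral>\<^sup>+x\<in>S. ?h x \<partial>lebesgue)" by (intro add_left_mono av1 S)
    finally show ?thesis by (simp add: mult_2)
  qed
  have bSm: "(LINT x|lebesgue. restrict_to S b x) = 0" if S: "S \<in> P" for S
  proof -
    have "(LINT x|lebesgue. restrict_to S b x) = (LINT x|lebesgue. indicator S x *\<^sub>R f x - indicator S x *\<^sub>R av S)"
      by (intro Bochner_Integration.integral_cong) (auto simp: indicator_def restrict_to_def b_def gS[OF S])
    also have "\<dots> = (LINT x|lebesgue. indicator S x *\<^sub>R f x) - (LINT x|lebesgue. indicator S x *\<^sub>R av S)"
      using Ss[OF S] fi emeasure_cubes[OF Scube[OF S]]
      by (intro Bochner_Integration.integral_diff integrable_mult_indicator integrable_indicator integrable_scaleR_left) auto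
    also have "(LINT x|lebesgue. indicator S x *\<^sub>R av S) = measure lebesgue S *\<^sub>R av S"
      using Ss[OF S] emeasure_cubes[OF Scube[OF S]] by (subst integral_scaleR_left) auto
    finally show ?thesis using avS[OF S] by simp
  qed
  \<comment> \<open>a ball of radius \<open>d\<close> around the corner of each stopping cube contains
    it\<close>
  have "\<exists>c d. 0 < d \<and> (\<forall>y. d < norm (c - y) \<longrightarrow> y \<notin> S) \<and>
      emeasure lebesgue (ball c (2 * d)) = ennreal (ball_vol * (2 * real ?N) ^ ?N) * emeasure lebesgue S" if S: "S \<in> P" for S
  proof -
    obtain a t where t: "0 < t" "S = cube a t" using Scube[OF S] by (rule cubesE)
    have sub: "S \<subseteq> ball a (real ?N * t)" unfolding t by (rule cube_subset_ball[OF corner_in_cube[OF t(1)]])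
    have "emeasure lebesgue (ball a (2 * (real ?N * t))) = ennreal (ball_vol * (2 * (real ?N * t)) ^ ?N)"
      unfolding ball_vol_def using t by (intro emeasure_lebesgue_ball) simp
    also have "\<dots> = ennreal (ball_vol * (2 * real ?N) ^ ?N) * emeasure lebesgue S"
      unfolding t emeasure_cube[OF t(1)] using ball_vol_pos t
      by (subst ennreal_mult[symmetric]) (auto simp: power_mult_distrib mult_ac)
    finally show ?thesis using t sub
      by (intro exI[of _ a] exI[of _ "real ?N * t"]) (auto simp: dist_norm)
  qed
  then obtain c d where d: "\<And>S. S \<in> P \<Longrightarrow> 0 < d S" and cd: "\<And>S y. S \<in> P \<Longrightarrow> d S < norm (c S - y) \<Longrightarrow> y \<notin> S"
    and cball: "\<And>S. S \<in> P \<Longrightarrow> emeasure lebesgue (ball (c S) (2 * d S)) = ennreal (ball_vol * (2 * real ?N) ^ ?N) * emeasure lebesgue S"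
    by metis
  define Om where "Om = (\<Union>S\<in>P. ball (c S) (2 * d S))"
  have Oms: "Om \<in> sets lebesgue" unfolding Om_def using Pc by (intro sets.countable_UN') auto
  have Om: "ennreal l * emeasure lebesgue Om \<le> ennreal (ball_vol * (2 * real ?N) ^ ?N) * I"
  proof -
    have "ennreal l * emeasure lebesgue Om \<le> ennreal l * (\<integral>\<^sup>+S. emeasure lebesgue (ball (c S) (2 * d S)) \<partial>count_space P)"
      unfolding Om_def using Pc by (intro mult_left_mono emeasure_UN_le_count_space) auto
    also have "\<dots> = (\<integral>\<^sup>+S. ennreal l * emeasure lebesgue (ball (c S) (2 * d S)) \<partial>count_space P)"
      by (rule nn_integral_cmult[symmetric]) simp
    also have "\<dots> \<le> (\<integral>\<^sup>+S. ennreal (ball_vol * (2 * real ?N) ^ ?N) * (\<integral>\<^sup>+x\<in>S. ?h x \<partial>lebesgue) \<partial>count_space P)"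
    proof (rule nn_integral_mono)
      fix S assume "S \<in> space (count_space P)"
      then have S: "S \<in> P" by simp
      have "ennreal l * emeasure lebesgue (ball (c S) (2 * d S)) = ennreal (ball_vol * (2 * real ?N) ^ ?N) * (ennreal l * emeasure lebesgue S)"
        unfolding cball[OF S] by (simp add: mult_ac)
      also have "\<dots> \<le> ennreal (ball_vol * (2 * real ?N) ^ ?N) * (\<integral>\<^sup>+x\<in>S. ?h x \<partial>lebesgue)"
        using Plow S by (intro mult_left_mono) auto
      finally show "ennreal l * emeasure lebesgue (ball (c S) (2 * d S)) \<le> ennreal (ball_vol * (2 * real ?N) ^ ?N) * (\<integral>\<^sup>+x\<in>S. ?h x \<partial>lebesgue)" .
    qed
    also have "\<dots> = ennreal (ball_vol * (2 * real ?N) ^ ?N) * (\<integral>\<^sup>+x\<in>U. ?h x \<partial>lebesgue)"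
      unfolding hsum[symmetric] by (rule nn_integral_cmult) simp
    also have "\<dots> \<le> ennreal (ball_vol * (2 * real ?N) ^ ?N) * I" by (intro mult_left_mono hU) simp
    finally show ?thesis .
  qed
  have E1: "ennreal l * emeasure lebesgue {x. l / 2 < norm (T g x)} \<le> ennreal (4 * B * 2 ^ ?N) * I"
  proof -
    have "ennreal ((l / 2)\<^sup>2) * emeasure lebesgue {x. l / 2 < norm (T g x)} \<le> ennreal B * (ennreal (2 ^ ?N * l) * I)"
    proof (rule order_trans[OF T_Chebyshev[OF gL2]])
      show "0 < l / 2" using l by simp
      show "ennreal B * (\<integral>\<^sup>+x. ennreal ((norm (g x))\<^sup>2) \<partial>lebesgue) \<le> ennreal B * (ennreal (2 ^ ?N * l) * I)"
        by (rule mult_left_mono[OF g2]) simp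
    qed
    then have "ennreal (4 / l) * (ennreal ((l / 2)\<^sup>2) * emeasure lebesgue {x. l / 2 < norm (T g x)})
        \<le> ennreal (4 / l) * (ennreal B * (ennreal (2 ^ ?N * l) * I))" by (rule mult_left_mono) simp
    moreover have "ennreal (4 / l) * ennreal ((l / 2)\<^sup>2) = ennreal l"
      using l by (subst ennreal_mult[symmetric]) (auto simp: power2_eq_square)
    moreover have "ennreal (4 / l) * (ennreal B * ennreal (2 ^ ?N * l)) = ennreal (4 * B * 2 ^ ?N)"
      using l B by (simp add: ennreal_mult[symmetric])
    ultimately show ?thesis by (simp add: mult.assoc[symmetric])
  qed
  \<comment> \<open>Linearity splits the image of the bad part pointwise for finitely many pieces
    only; these are treated by cancellation. The others together have a small $L^2$ norm and cost
    \<open>\<eta>\<close> by Chebyshev's inequality.\<close>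
  have main: "ennreal l * emeasure lebesgue {x. l < norm (T f x)} \<le> ennreal weak_const * I + ennreal \<eta>" if \<eta>: "0 < \<eta>" for \<eta>
  proof -
    define \<eta>' where "\<eta>' = \<eta> * l / (16 * (B + 1))"
    have \<eta>': "0 < \<eta>'" using \<eta> l B by (simp add: \<eta>'_def)
    obtain F where F: "finite F" "F \<subseteq> P" "(\<integral>\<^sup>+x\<in>U - \<Union>F. ennreal ((norm (b x))\<^sup>2) \<partial>lebesgue) < ennreal \<eta>'"
    proof (cases "P = {}")
      case True
      then have "(\<integral>\<^sup>+x\<in>U - \<Union>{}. ennreal ((norm (b x))\<^sup>2) \<partial>lebesgue) < ennreal \<eta>'" using \<eta>' by (simp add: U_def)
      then show ?thesis using that[of "{}"] by simp
    next
      case False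
      define \<mu> where "\<mu> = density lebesgue (\<lambda>x. ennreal ((norm (b x))\<^sup>2))"
      define Z where "Z n = U - \<Union>(from_nat_into P ` {..<n})" for n
      have rng: "range (from_nat_into P) = P" using False Pc by (rule range_from_nat_into)
      have Fs: "from_nat_into P ` {..<n} \<subseteq> P" for n using rng by blast
      have Zs: "Z n \<in> sets lebesgue" for n unfolding Z_def using Fs Ss by (intro sets.Diff Us sets.finite_Union) blast+
      have "(\<lambda>n. emeasure \<mu> (Z n)) \<longlonglongrightarrow> emeasure \<mu> (\<Inter>n. Z n)"
      proof (rule Lim_emeasure_decseq)
        show "range Z \<subseteq> sets \<mu>" using Zs by (auto simp: \<mu>_def)
        show "decseq Z" unfolding decseq_def Z_def by (auto intro: less_le_trans)
        show "emeasure \<mu> (Z n) \<noteq> \<infinity>" for n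
        proof -
          have "emeasure \<mu> (Z n) \<le> (\<integral>\<^sup>+x. ennreal ((norm (b x))\<^sup>2) \<partial>lebesgue)"
            unfolding \<mu>_def using Zs by (subst emeasure_density) (auto intro!: nn_integral_mono simp: indicator_def)
          then show ?thesis using bL2 by (auto simp: L2_iff)
        qed
      qed
      moreover have "(\<Inter>n. Z n) = {}"
      proof (rule equals0I)
        fix x assume x: "x \<in> (\<Inter>n. Z n)"
        then have "x \<in> U" by (auto simp: Z_def)
        then obtain S where "S \<in> P" "x \<in> S" by (auto simp: U_def)
        then have "S \<in> range (from_nat_into P)" using rng by simp
        then obtain j where "S = from_nat_into P j" by (rule rangeE)
        then have "x \<notin> Z (Suc j)" using \<open>x \<in> S\<close> by (auto simp: Z_def)
        then show False using x by blast
      qed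
      ultimately have "(\<lambda>n. emeasure \<mu> (Z n)) \<longlonglongrightarrow> 0" by simp
      then have "\<forall>\<^sub>F n in sequentially. emeasure \<mu> (Z n) < ennreal \<eta>'" by (rule order_tendstoD) (use \<eta>' in simp)
      then obtain n where "emeasure \<mu> (Z n) < ennreal \<eta>'" by (auto simp: eventually_sequentially)
      then have "(\<integral>\<^sup>+x\<in>Z n. ennreal ((norm (b x))\<^sup>2) \<partial>lebesgue) < ennreal \<eta>'"
        unfolding \<mu>_def using Zs[of n] by (subst (asm) emeasure_density) auto
      then show ?thesis using that[of "from_nat_into P ` {..<n}"] Fs by (simp add: Z_def)
    qed
    have FU: "\<Union>F \<in> sets lebesgue" using F Ss by (intro sets.finite_Union) blast+
    define r where "r = restrict_to (U - \<Union>F) b"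
    have rL2: "r \<in> L2" unfolding r_def by (rule L2_restrict_to[OF sets.Diff[OF Us FU] bL2])
    have r2: "(\<integral>\<^sup>+x. ennreal ((norm (r x))\<^sup>2) \<partial>lebesgue) \<le> ennreal \<eta>'"
    proof -
      have "(\<integral>\<^sup>+x. ennreal ((norm (r x))\<^sup>2) \<partial>lebesgue) = (\<integral>\<^sup>+x\<in>U - \<Union>F. ennreal ((norm (b x))\<^sup>2) \<partial>lebesgue)"
        by (intro nn_integral_cong) (auto simp: r_def restrict_to_def indicator_def)
      then show ?thesis using F(3) by simp
    qed
    \<comment> \<open>the good part, finitely many pieces of mean zero and a remainder that is small in
      $L^2$\<close>
    have split: "f y = g y + ((\<Sum>S\<in>F. 1 * restrict_to S b y) + r y)" for y
    proof -
      have "(\<Sum>S\<in>F. 1 * restrict_to S b y) + r y = b y"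
      proof (cases "y \<in> \<Union>F")
        case True
        then obtain S where S: "S \<in> F" "y \<in> S" by blast
        have "y \<notin> S'" if "S' \<in> F" "S' \<noteq> S" for S' using that S F(2) Pd unfolding disjoint_family_on_def by blast
        then have "(\<Sum>S'\<in>F. 1 * restrict_to S' b y) = (\<Sum>S'\<in>F. if S' = S then b y else 0)"
          using S by (intro sum.cong) auto
        then show ?thesis using S F(1) True by (simp add: r_def)
      next
        case False
        then have "(\<Sum>S\<in>F. 1 * restrict_to S b y) = 0" by (intro sum.neutral) auto
        moreover have "r y = b y" using False b0[of y] by (cases "y \<in> U") (auto simp: r_def)
        ultimately show ?thesis by simp
      qed
      then show ?thesis by (simp add: b_def)
    qed
    have sL2: "(\<lambda>y. \<Sum>S\<in>F. 1 * restrict_to S b y) \<in> L2"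
      and sT: "AE x in lebesgue. T (\<lambda>y. \<Sum>S\<in>F. 1 * restrict_to S b y) x = (\<Sum>S\<in>F. 1 * T (restrict_to S b) x)"
      using T_sum[OF F(1), of "\<lambda>S. restrict_to S b" "\<lambda>_. 1"] bSL2 F(2) by auto
    \<comment> \<open>a majorant of the finite sum off the dilated cubes, each piece being cut off near
      its own cube\<close>
    define u where "u x = (\<Sum>S\<in>F. ennreal (norm (T (restrict_to S b) x)) * indicator {x. 2 * d S \<le> norm (c S - x)} x)" for x
    have far: "{x. 2 * d S \<le> norm (c S - x)} \<in> sets lebesgue" for S
      by (intro sets_completionI_sets) (simp add: borel_closed closed_Collect_le continuous_intros)
    have TSm: "T (restrict_to S b) \<in> borel_measurable lebesgue" if "S \<in> F" for S
      using that F(2) bSL2 T_L2 L2_measurable by blast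
    have um[measurable]: "u \<in> borel_measurable lebesgue" unfolding u_def[abs_def]
      using TSm far by (intro borel_measurable_sum borel_measurable_times_ennreal borel_measurable_indicator) auto
    have uI: "(\<integral>\<^sup>+x. u x \<partial>lebesgue) \<le> ennreal (2 * (4 ^ ?N * dini_sum * ball_vol)) * I"
    proof -
      have "(\<integral>\<^sup>+x. u x \<partial>lebesgue) = (\<Sum>S\<in>F. \<integral>\<^sup>+x. ennreal (norm (T (restrict_to S b) x)) * indicator {x. 2 * d S \<le> norm (c S - x)} x \<partial>lebesgue)"
        unfolding u_def using TSm far by (intro nn_integral_sum borel_measurable_times_ennreal borel_measurable_indicator) auto
      also have "\<dots> \<le> (\<Sum>S\<in>F. ennreal (4 ^ ?N * dini_sum * ball_vol) * (2 * (\<integral>\<^sup>+x\<in>S. ?h x \<partial>lebesgue)))"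
      proof (rule sum_mono)
        fix S assume "S \<in> F"
        then have S: "S \<in> P" using F by blast
        have fin: "(\<integral>\<^sup>+x. ennreal (norm (restrict_to S b x)) \<partial>lebesgue) < \<infinity>"
        proof (rule le_less_trans[OF bSI[OF S]])
          have "(\<integral>\<^sup>+x\<in>S. ?h x \<partial>lebesgue) \<le> I" unfolding I_def by (intro nn_integral_mono) (auto simp: indicator_def)
          then show "2 * (\<integral>\<^sup>+x\<in>S. ?h x \<partial>lebesgue) < \<infinity>" using If by (auto simp: ennreal_mult_less_top)
        qed
        have "(\<integral>\<^sup>+x. ennreal (norm (T (restrict_to S b) x)) * indicator {x. 2 * d S \<le> norm (c S - x)} x \<partial>lebesgue)
          \<le> ennreal (4 ^ ?N * dini_sum * ball_vol) * (\<integral>\<^sup>+x. ennreal (norm (restrict_to S b x)) \<partial>lebesgue)"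
          by (rule Hormander_bound[OF bSL2[OF S] fin bSm[OF S] d[OF S]]) (use cd[OF S] in auto)
        also have "\<dots> \<le> ennreal (4 ^ ?N * dini_sum * ball_vol) * (2 * (\<integral>\<^sup>+x\<in>S. ?h x \<partial>lebesgue))"
          by (intro mult_left_mono bSI S) simp
        finally show "(\<integral>\<^sup>+x. ennreal (norm (T (restrict_to S b) x)) * indicator {x. 2 * d S \<le> norm (c S - x)} x \<partial>lebesgue)
          \<le> ennreal (4 ^ ?N * dini_sum * ball_vol) * (2 * (\<integral>\<^sup>+x\<in>S. ?h x \<partial>lebesgue))" .
      qed
      also have "\<dots> = ennreal (4 ^ ?N * dini_sum * ball_vol) * (2 * (\<Sum>S\<in>F. \<integral>\<^sup>+x\<in>S. ?h x \<partial>lebesgue))"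
        by (simp add: sum_distrib_left)
      also have "(\<Sum>S\<in>F. \<integral>\<^sup>+x\<in>S. ?h x \<partial>lebesgue) = (\<integral>\<^sup>+x. (\<Sum>S\<in>F. ?h x * indicator S x) \<partial>lebesgue)"
        using F(2) Ss by (intro nn_integral_sum[symmetric] borel_measurable_times_ennreal borel_measurable_indicator) auto
      also have "\<dots> \<le> I" unfolding I_def
      proof (rule nn_integral_mono)
        fix x
        show "(\<Sum>S\<in>F. ?h x * indicator S x) \<le> ?h x"
        proof (cases "x \<in> \<Union>F")
          case True
          then obtain S where S: "S \<in> F" "x \<in> S" by blast
          have "x \<notin> S'" if "S' \<in> F" "S' \<noteq> S" for S' using that S F(2) Pd unfolding disjoint_family_on_def by blast
          then have "(\<Sum>S'\<in>F. ?h x * indicator S' x) = (\<Sum>S'\<in>F. if S' = S then ?h x else 0)"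
            using S by (intro sum.cong) auto
          then show ?thesis using S F(1) by simp
        next
          case False
          then have "(\<Sum>S\<in>F. ?h x * indicator S x) = 0" by (intro sum.neutral) auto
          then show ?thesis by simp
        qed
      qed
      finally have "(\<integral>\<^sup>+x. u x \<partial>lebesgue) \<le> ennreal (4 ^ ?N * dini_sum * ball_vol) * (2 * I)" by (simp add: mult_left_mono)
      also have "\<dots> = ennreal (2 * (4 ^ ?N * dini_sum * ball_vol)) * I"
        using dini_sum_nonneg ball_vol_pos by (simp add: ennreal_mult mult_ac)
      finally show ?thesis .
    qed
    \<comment> \<open>the height is shared out as \<open>l / 2 + l / 4 + l / 4\<close>\<close>
    let ?E1 = "{x. l / 2 < norm (T g x)}" and ?E2 = "{x. l / 4 < norm (T r x)}" and ?E3 = "{x. ennreal (l / 4) < u x}"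
    have E1s: "?E1 \<in> sets lebesgue"
    proof -
      have [measurable]: "T g \<in> borel_measurable lebesgue" using T_L2[OF gL2] L2_measurable by blast
      have "{x \<in> space lebesgue. l / 2 < norm (T g x)} \<in> sets lebesgue" by measurable
      then show ?thesis by simp
    qed
    have E2s: "?E2 \<in> sets lebesgue"
    proof -
      have [measurable]: "T r \<in> borel_measurable lebesgue" using T_L2[OF rL2] L2_measurable by blast
      have "{x \<in> space lebesgue. l / 4 < norm (T r x)} \<in> sets lebesgue" by measurable
      then show ?thesis by simp
    qed
    have E3s: "?E3 \<in> sets lebesgue"
    proof -
      have "{x \<in> space lebesgue. ennreal (l / 4) < u x} \<in> sets lebesgue" by measurable
      then show ?thesis by simp
    qed
    have E2: "ennreal l * emeasure lebesgue ?E2 \<le> ennreal \<eta>"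
    proof -
      have "ennreal ((l / 4)\<^sup>2) * emeasure lebesgue ?E2 \<le> ennreal B * ennreal \<eta>'"
      proof (rule order_trans[OF T_Chebyshev[OF rL2]])
        show "0 < l / 4" using l by simp
        show "ennreal B * (\<integral>\<^sup>+x. ennreal ((norm (r x))\<^sup>2) \<partial>lebesgue) \<le> ennreal B * ennreal \<eta>'"
          by (rule mult_left_mono[OF r2]) simp
      qed
      then have "ennreal (16 / l) * (ennreal ((l / 4)\<^sup>2) * emeasure lebesgue ?E2) \<le> ennreal (16 / l) * (ennreal B * ennreal \<eta>')"
        by (rule mult_left_mono) simp
      moreover have "ennreal (16 / l) * ennreal ((l / 4)\<^sup>2) = ennreal l"
        using l by (subst ennreal_mult[symmetric]) (auto simp: power2_eq_square)
      moreover have "ennreal (16 / l) * (ennreal B * ennreal \<eta>') = ennreal (16 / l * (B * \<eta>'))"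
        using l B \<eta>' by (simp add: ennreal_mult[symmetric])
      moreover have "16 / l * (B * \<eta>') \<le> \<eta>"
      proof -
        have "16 / l * (B * \<eta>') = \<eta> * (B / (B + 1))" using l B by (simp add: \<eta>'_def field_simps)
        also have "\<dots> \<le> \<eta> * 1" using \<eta> B by (intro mult_left_mono) auto
        finally show ?thesis by simp
      qed
      then have "ennreal (16 / l * (B * \<eta>')) \<le> ennreal \<eta>" by (rule ennreal_leI)
      ultimately show ?thesis by (simp only: mult.assoc[symmetric])
    qed
    have E3: "ennreal l * emeasure lebesgue ?E3 \<le> ennreal (8 * (4 ^ ?N * dini_sum * ball_vol)) * I"
    proof -
      have "ennreal (l / 4) * emeasure lebesgue ?E3 \<le> ennreal (2 * (4 ^ ?N * dini_sum * ball_vol)) * I"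
        using Markov_inequality[OF um, of "ennreal (l / 4)"] uI by (auto intro: order_trans)
      then have "ennreal 4 * (ennreal (l / 4) * emeasure lebesgue ?E3) \<le> ennreal 4 * (ennreal (2 * (4 ^ ?N * dini_sum * ball_vol)) * I)"
        by (rule mult_left_mono) simp
      moreover have "ennreal 4 * ennreal (l / 4) = ennreal l"
        using l by (subst ennreal_mult[symmetric]) auto
      moreover have "ennreal 4 * ennreal (2 * (4 ^ ?N * dini_sum * ball_vol)) = ennreal (8 * (4 ^ ?N * dini_sum * ball_vol))"
        using dini_sum_nonneg ball_vol_pos by (subst ennreal_mult[symmetric]) auto
      ultimately show ?thesis by (simp only: mult.assoc[symmetric])
    qed
    have "AE x in lebesgue. T f x = T g x + (T (\<lambda>y. \<Sum>S\<in>F. 1 * restrict_to S b y) x + T r x)"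
    proof -
      have fe: "f = (\<lambda>y. g y + ((\<Sum>S\<in>F. 1 * restrict_to S b y) + r y))" using split by (intro ext)
      have "AE x in lebesgue. T (\<lambda>y. g y + ((\<Sum>S\<in>F. 1 * restrict_to S b y) + r y)) x = T g x + T (\<lambda>y. (\<Sum>S\<in>F. 1 * restrict_to S b y) + r y) x"
        by (rule T_add[OF gL2 L2_add[OF sL2 rL2]])
      moreover have "AE x in lebesgue. T (\<lambda>y. (\<Sum>S\<in>F. 1 * restrict_to S b y) + r y) x = T (\<lambda>y. \<Sum>S\<in>F. 1 * restrict_to S b y) x + T r x"
        by (rule T_add[OF sL2 rL2])
      ultimately have "AE x in lebesgue. T (\<lambda>y. g y + ((\<Sum>S\<in>F. 1 * restrict_to S b y) + r y)) x = T g x + (T (\<lambda>y. \<Sum>S\<in>F. 1 * restrict_to S b y) x + T r x)"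
        by eventually_elim simp
      then show ?thesis unfolding fe[symmetric] .
    qed
    then have "AE x in lebesgue. x \<in> {x. l < norm (T f x)} \<longrightarrow> x \<in> ?E1 \<union> (?E2 \<union> (Om \<union> ?E3))"
      using sT
    proof eventually_elim
      fix x assume Tx: "T f x = T g x + (T (\<lambda>y. \<Sum>S\<in>F. 1 * restrict_to S b y) x + T r x)"
        and Sx: "T (\<lambda>y. \<Sum>S\<in>F. 1 * restrict_to S b y) x = (\<Sum>S\<in>F. 1 * T (restrict_to S b) x)"
      show "x \<in> {x. l < norm (T f x)} \<longrightarrow> x \<in> ?E1 \<union> (?E2 \<union> (Om \<union> ?E3))"
      proof (rule impI, rule ccontr)
        assume lx: "x \<in> {x. l < norm (T f x)}" and nx: "x \<notin> ?E1 \<union> (?E2 \<union> (Om \<union> ?E3))"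
        have fx: "2 * d S \<le> norm (c S - x)" if "S \<in> F" for S
          using nx that F(2) by (auto simp: Om_def dist_norm not_less)
        have "u x = (\<Sum>S\<in>F. ennreal (norm (T (restrict_to S b) x)))"
          unfolding u_def using fx by (intro sum.cong) auto
        also have "\<dots> = ennreal (\<Sum>S\<in>F. norm (T (restrict_to S b) x))" by (simp add: sum_ennreal)
        finally have "(\<Sum>S\<in>F. norm (T (restrict_to S b) x)) \<le> l / 4" using nx l by (simp add: not_less)
        moreover have "norm (\<Sum>S\<in>F. 1 * T (restrict_to S b) x) \<le> (\<Sum>S\<in>F. norm (T (restrict_to S b) x))"
          using norm_sum[of "\<lambda>S. T (restrict_to S b) x" F] by simp
        moreover have "norm (T f x) \<le> norm (T g x) + (norm (\<Sum>S\<in>F. 1 * T (restrict_to S b) x) + norm (T r x))"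
          unfolding Tx Sx by (rule order_trans[OF norm_triangle_ineq add_left_mono[OF norm_triangle_ineq]])
        moreover have "norm (T g x) \<le> l / 2" "norm (T r x) \<le> l / 4" using nx by auto
        ultimately show False using lx by simp
      qed
    qed
    then have "emeasure lebesgue {x. l < norm (T f x)} \<le> emeasure lebesgue (?E1 \<union> (?E2 \<union> (Om \<union> ?E3)))"
      using E1s E2s E3s Oms by (intro emeasure_mono_AE) auto
    also have "\<dots> \<le> emeasure lebesgue ?E1 + (emeasure lebesgue ?E2 + (emeasure lebesgue Om + emeasure lebesgue ?E3))"
      by (intro order_trans[OF emeasure_subadditive] add_left_mono order_refl sets.Un E1s E2s E3s Oms)
    finally have "ennreal l * emeasure lebesgue {x. l < norm (T f x)}
      \<le> ennreal l * (emeasure lebesgue ?E1 + (emeasure lebesgue ?E2 + (emeasure lebesgue Om + emeasure lebesgue ?E3)))"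
      by (rule mult_left_mono) simp
    also have "\<dots> \<le> ennreal (4 * B * 2 ^ ?N) * I + (ennreal \<eta> + (ennreal (ball_vol * (2 * real ?N) ^ ?N) * I + ennreal (8 * (4 ^ ?N * dini_sum * ball_vol)) * I))"
      unfolding distrib_left by (intro add_mono E1 E2 Om E3)
    also have "\<dots> = ennreal weak_const * I + ennreal \<eta>"
    proof -
      have "ennreal weak_const = ennreal (4 * B * 2 ^ ?N) + ennreal (ball_vol * (2 * real ?N) ^ ?N) + ennreal (8 * (4 ^ ?N * dini_sum * ball_vol))"
        unfolding weak_const_def using B dini_sum_nonneg ball_vol_pos by (subst ennreal_plus[symmetric], simp, simp)+ simp
      then show ?thesis by (simp add: distrib_right add_ac)
    qed
    finally show ?thesis .
  qed
  show ?thesis unfolding I_def[symmetric]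
    by (rule ennreal_le_epsilon) (use main in blast)
qed

end


section \<open>Local domination off stopping cubes\<close>

text \<open>
  The concentric cube with a margin of \<open>2 * N * l\<close> on every side, where
  \<open>l\<close> is the side length and \<open>N\<close> the dimension. The diameter of the cube
  is less than \<open>N * l\<close>; points off the dilate are therefore at least twice as far from
  any point of the cube as two points of the cube are from each other, as the smoothness of the
  kernel requires.
\<close>

definition dilate :: "(real ^ 'n) set \<Rightarrow> (real ^ 'n) set" where
  "dilate Q = (THE S. \<exists>a l. 0 < l \<and> Q = cube a l \<and>
     S = cube (\<chi> i. a $ i - 2 * real CARD('n) * l) ((4 * real CARD('n) + 1) * l))"

lemma dilate_cube:
  assumes l: "0 < l"
  shows "dilate (cube (a :: real ^ 'n) l) = cube (\<chi> i. a $ i - 2 * real CARD('n) * l) ((4 * real CARD('n) + 1) * l)"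
  unfolding dilate_def
proof (rule the_equality)
  show "\<exists>b t. 0 < t \<and> cube a l = cube b t \<and>
    cube (\<chi> i. a $ i - 2 * real CARD('n) * l) ((4 * real CARD('n) + 1) * l) =
    cube (\<chi> i. b $ i - 2 * real CARD('n) * t) ((4 * real CARD('n) + 1) * t)"
    using l by blast
  fix S assume "\<exists>b t. 0 < t \<and> cube a l = cube b t \<and> S = cube (\<chi> i. b $ i - 2 * real CARD('n) * t) ((4 * real CARD('n) + 1) * t)"
  then obtain b t where "0 < t" "cube a l = cube b t" "S = cube (\<chi> i. b $ i - 2 * real CARD('n) * t) ((4 * real CARD('n) + 1) * t)"
    by blast
  moreover from this(1,2) have "a = b \<and> l = t" using cube_eq_iff[OF l, of t a b] by simp
  ultimately show "S = cube (\<chi> i. a $ i - 2 * real CARD('n) * l) ((4 * real CARD('n) + 1) * l)" by simp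
qed

lemma dilate_in_cubes:
  assumes "Q \<in> cubes" shows "dilate Q \<in> cubes"
proof -
  obtain a l where l: "0 < l" "Q = cube a l" using assms by (rule cubesE)
  have "0 < (4 * real CARD('a) + 1) * l" using l by (intro mult_pos_pos) auto
  then show ?thesis unfolding l dilate_cube[OF l(1)] cubes_def by blast
qed

lemma emeasure_dilate:
  fixes Q :: "(real ^ 'n) set"
  assumes "Q \<in> cubes"
  shows "emeasure lebesgue (dilate Q) = ennreal ((4 * real CARD('n) + 1) ^ CARD('n)) * emeasure lebesgue Q"
proof -
  obtain a l where l: "0 < l" "Q = cube a l" using assms by (rule cubesE)
  have p: "0 < (4 * real CARD('n) + 1) * l" using l by (intro mult_pos_pos) auto
  show ?thesis unfolding l dilate_cube[OF l(1)] emeasure_cube[OF p] emeasure_cube[OF l(1)]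
    using l by (subst ennreal_mult[symmetric]) (auto simp: power_mult_distrib)
qed

lemma cube_subset_cubeD:
  assumes l: "0 < l'" and sub: "cube a' l' \<subseteq> cube a l"
  shows "a $ i \<le> a' $ i" "a' $ i + l' \<le> a $ i + l"
proof -
  have "a' \<in> cube a l" using corner_in_cube[OF l] sub by blast
  then have b: "a $ i \<le> a' $ i" "a' $ i < a $ i + l" for i by (auto simp: mem_cube)
  then show "a $ i \<le> a' $ i" by blast
  show "a' $ i + l' \<le> a $ i + l"
  proof (rule ccontr)
    assume n: "\<not> ?thesis"
    let ?y = "\<chi> j. if j = i then a $ i + l else a' $ j"
    have "?y \<in> cube a' l'" using n b[of i] l by (auto simp: mem_cube)
    then have "?y \<in> cube a l" using sub by blast
    then have "?y $ i < a $ i + l" unfolding mem_cube by blast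
    then show False by simp
  qed
qed

lemma dilate_mono:
  fixes Q R :: "(real ^ 'n) set"
  assumes "Q \<in> cubes" "R \<in> cubes" "R \<subseteq> Q"
  shows "dilate R \<subseteq> dilate Q"
proof -
  obtain a l where l: "0 < l" "Q = cube a l" using assms(1) by (rule cubesE)
  obtain a' l' where l': "0 < l'" "R = cube a' l'" using assms(2) by (rule cubesE)
  have sub: "cube a' l' \<subseteq> cube a l" using assms(3) unfolding l l' .
  note c = cube_subset_cubeD[OF l'(1) sub]
  have ll: "l' \<le> l" using c(1)[of undefined] c(2)[of undefined] by linarith
  then have N: "real CARD('n) * l' \<le> real CARD('n) * l" by (intro mult_left_mono) auto
  show ?thesis unfolding l l' dilate_cube[OF l(1)] dilate_cube[OF l'(1)]
  proof
    fix x assume x: "x \<in> cube (\<chi> i. a' $ i - 2 * real CARD('n) * l') ((4 * real CARD('n) + 1) * l')"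
    show "x \<in> cube (\<chi> i. a $ i - 2 * real CARD('n) * l) ((4 * real CARD('n) + 1) * l)"
      unfolding mem_cube
    proof
      fix i
      have "a' $ i - 2 * real CARD('n) * l' \<le> x $ i \<and> x $ i < a' $ i - 2 * real CARD('n) * l' + (4 * real CARD('n) + 1) * l'"
        using x unfolding mem_cube by simp
      moreover have "2 * real CARD('n) * l' = 2 * (real CARD('n) * l')" "2 * real CARD('n) * l = 2 * (real CARD('n) * l)"
        "(4 * real CARD('n) + 1) * l' = 4 * (real CARD('n) * l') + l'" "(4 * real CARD('n) + 1) * l = 4 * (real CARD('n) * l) + l"
        by (simp_all add: distrib_right)
      ultimately have "a $ i - 2 * real CARD('n) * l \<le> x $ i" "x $ i < a $ i - 2 * real CARD('n) * l + (4 * real CARD('n) + 1) * l"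
        using c(1)[of i] c(2)[of i] N by linarith+
      then show "(\<chi> i. a $ i - 2 * real CARD('n) * l) $ i \<le> x $ i \<and>
          x $ i < (\<chi> i. a $ i - 2 * real CARD('n) * l) $ i + (4 * real CARD('n) + 1) * l"
        by simp
    qed
  qed
qed

lemma ball_subset_dilate:
  fixes x :: "real ^ 'n"
  assumes l: "0 < l" and x: "x \<in> cube a l"
  shows "ball x (2 * (real CARD('n) * l)) \<subseteq> dilate (cube a l)"
proof
  fix y assume "y \<in> ball x (2 * (real CARD('n) * l))"
  then have "norm (x - y) < 2 * (real CARD('n) * l)" by (simp add: dist_norm)
  then have "\<bar>(x - y) $ i\<bar> < 2 * (real CARD('n) * l)" for i
    using component_le_norm_cart[of "x - y" i] by linarith
  then have "\<bar>x $ i - y $ i\<bar> < 2 * (real CARD('n) * l)" for i by simp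
  moreover have "a $ i \<le> x $ i \<and> x $ i < a $ i + l" for i using x by (simp add: mem_cube)
  ultimately show "y \<in> dilate (cube a l)"
    unfolding dilate_cube[OF l] mem_cube by (auto simp: abs_less_iff algebra_simps) (smt (verit))+
qed

lemma subset_dilate:
  assumes "Q \<in> cubes" shows "Q \<subseteq> dilate Q"
proof -
  obtain a l where l: "0 < l" "Q = cube a l" using assms by (rule cubesE)
  have "x \<in> dilate (cube a l)" if "x \<in> cube a l" for x
    using ball_subset_dilate[OF l(1) that] l by (intro subsetD[OF ball_subset_dilate[OF l(1) that]]) simp
  then show ?thesis unfolding l by blast
qed

text \<open>
  The weak type estimate divided by the average \<open>a\<close>, in a form that remains true when
  \<open>a\<close> is zero.
\<close>

lemma hl_max_weak_average:
  fixes h :: "real ^ 'n \<Rightarrow> ennreal"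
  assumes h: "h \<in> borel_measurable lebesgue" and a: "0 \<le> a" and A: "1 \<le> A"
    and avg: "(\<integral>\<^sup>+x. h x \<partial>lebesgue) \<le> ennreal a * c"
  shows "ennreal A * emeasure lebesgue {x. ennreal (A * a) < hl_max h x} \<le> ennreal (5 ^ CARD('n) * unit_ball_vol (CARD('n))) * c"
proof (cases "a = 0")
  case True
  then have z: "(\<integral>\<^sup>+x. h x \<partial>lebesgue) = 0" using avg by simp
  have "hl_max h x \<le> 0" for x
  proof (rule hl_max_leI)
    fix r :: real
    have "(\<integral>\<^sup>+y\<in>ball x r. h y \<partial>lebesgue) \<le> (\<integral>\<^sup>+x. h x \<partial>lebesgue)"
      by (intro nn_integral_mono) (auto simp: indicator_def)
    then show "ennreal (1 / r ^ CARD('n)) * (\<integral>\<^sup>+y\<in>ball x r. h y \<partial>lebesgue) \<le> 0" using z by simp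
  qed
  then have "{x. ennreal (A * a) < hl_max h x} = {}" using True by (auto simp: not_less)
  then show ?thesis by (simp only: emeasure_empty mult_zero_right zero_le)
next
  case False
  let ?C = "ennreal (5 ^ CARD('n) * unit_ball_vol (CARD('n)))"
  have "ennreal (A * a) * emeasure lebesgue {x. ennreal (A * a) < hl_max h x} \<le> ?C * (\<integral>\<^sup>+x. h x \<partial>lebesgue)"
    using False a A by (intro hl_max_weak_type h) simp
  also have "\<dots> \<le> ?C * (ennreal a * c)" by (rule mult_left_mono[OF avg]) simp
  finally have "ennreal (1 / a) * (ennreal (A * a) * emeasure lebesgue {x. ennreal (A * a) < hl_max h x}) \<le> ennreal (1 / a) * (?C * (ennreal a * c))"
    by (rule mult_left_mono) simp
  moreover have "ennreal (1 / a) * ennreal (A * a) = ennreal A" using False a A by (subst ennreal_mult[symmetric]) auto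
  moreover have "ennreal (1 / a) * (?C * (ennreal a * c)) = ?C * c"
  proof -
    have "ennreal (1 / a) * ennreal a = 1" using False a by (subst ennreal_mult[symmetric]) auto
    moreover have "ennreal (1 / a) * (?C * (ennreal a * c)) = (ennreal (1 / a) * ennreal a) * (?C * c)"
      by (simp only: mult_ac)
    ultimately show ?thesis by simp
  qed
  ultimately show ?thesis by (simp only: mult.assoc[symmetric])
qed

context dini_cz
begin

text \<open>
  If the average is zero, then \<open>f\<close> and \<open>T f\<close> vanish almost everywhere and
  the estimate remains true.
\<close>

lemma weak_type_average:
  assumes R: "R \<in> cubes" and f: "f \<in> L2" and z: "\<And>x. x \<notin> R \<Longrightarrow> f x = 0" and a: "0 \<le> a" and A: "1 \<le> A"
    and avg: "(\<integral>\<^sup>+x. ennreal (norm (f x)) \<partial>lebesgue) \<le> ennreal a * emeasure lebesgue R"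
  shows "ennreal A * emeasure lebesgue {x. A * a < norm (T f x)} \<le> ennreal weak_const * emeasure lebesgue R"
proof (cases "a = 0")
  case True
  have [measurable]: "f \<in> borel_measurable lebesgue" "T f \<in> borel_measurable lebesgue"
    using f T_L2 L2_measurable by blast+
  have "(\<integral>\<^sup>+x. ennreal (norm (f x)) \<partial>lebesgue) = 0" using avg True by simp
  then have "AE x in lebesgue. ennreal (norm (f x)) = 0" by (simp add: nn_integral_0_iff_AE)
  then have "AE x in lebesgue. f x = 0" by eventually_elim simp
  then have "AE x in lebesgue. T f x = 0" by (rule T_null[OF f])
  then have "AE x in lebesgue. x \<in> {x. A * a < norm (T f x)} \<longrightarrow> x \<in> {}" by eventually_elim (simp add: True)
  then have "emeasure lebesgue {x. A * a < norm (T f x)} \<le> emeasure lebesgue ({} :: (real ^ 'n) set)"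
    by (rule emeasure_mono_AE) simp
  then have "emeasure lebesgue {x. A * a < norm (T f x)} = 0" by simp
  then show ?thesis by (simp only: mult_zero_right zero_le)
next
  case False
  have "a \<le> A * a" using A a by (simp add: mult_le_cancel_right1)
  then have "ennreal a * emeasure lebesgue R \<le> ennreal (A * a) * emeasure lebesgue R"
    by (intro mult_right_mono ennreal_leI) auto
  with avg have "(\<integral>\<^sup>+x. ennreal (norm (f x)) \<partial>lebesgue) \<le> ennreal (A * a) * emeasure lebesgue R" by (rule order_trans)
  then have "ennreal (A * a) * emeasure lebesgue {x. A * a < norm (T f x)} \<le> ennreal weak_const * (\<integral>\<^sup>+x. ennreal (norm (f x)) \<partial>lebesgue)"
    using False a A by (intro weak_type_local[OF R f z]) auto
  also have "\<dots> \<le> ennreal weak_const * (ennreal a * emeasure lebesgue R)" by (rule mult_left_mono[OF avg]) simp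
  finally have "ennreal (1 / a) * (ennreal (A * a) * emeasure lebesgue {x. A * a < norm (T f x)}) \<le> ennreal (1 / a) * (ennreal weak_const * (ennreal a * emeasure lebesgue R))"
    by (rule mult_left_mono) simp
  moreover have "ennreal (1 / a) * ennreal (A * a) = ennreal A" using False a A by (subst ennreal_mult[symmetric]) auto
  moreover have "ennreal (1 / a) * (ennreal weak_const * (ennreal a * emeasure lebesgue R)) = ennreal weak_const * emeasure lebesgue R"
  proof -
    have "ennreal (1 / a) * ennreal a = 1" using False a by (subst ennreal_mult[symmetric]) auto
    moreover have "ennreal (1 / a) * (ennreal weak_const * (ennreal a * emeasure lebesgue R))
        = (ennreal (1 / a) * ennreal a) * (ennreal weak_const * emeasure lebesgue R)"
      by (simp only: mult_ac)
    ultimately show ?thesis by simp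
  qed
  ultimately show ?thesis by (simp only: mult.assoc[symmetric])
qed

text \<open>
  With \<open>m\<close> functions, the set where one of the operators or maximal functions exceeds
  \<open>A\<close> times its average has measure at most this constant times that of the cube,
  divided by \<open>A\<close>.
\<close>

definition exceptional_const :: "nat \<Rightarrow> real" where
  "exceptional_const m = real m * ((weak_const + 5 ^ CARD('n) * ball_vol) * (4 * real CARD('n) + 1) ^ CARD('n))"

text \<open>This makes the exceptional set at most the part $2^{-N-2}$ of the cube.\<close>

definition level_const :: "nat \<Rightarrow> real" where "level_const m = 1 + 2 ^ (CARD('n) + 2) * exceptional_const m"

text \<open>
  This makes the operator restarted on a stopping cube exceptional on at most a quarter of it.
\<close>

definition restart_const :: real where "restart_const = 1 + 4 * (weak_const * (4 * real CARD('n) + 1) ^ CARD('n))"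

text \<open>
  The three terms bound the operator and the restarted operator at a good point, and the oscillation
  of the difference over the stopping cube.
\<close>

definition local_const :: "nat \<Rightarrow> real" where
  "local_const m = level_const m + restart_const * (real CARD('n) ^ CARD('n) * level_const m) + 4 ^ CARD('n) * dini_sum * level_const m"

lemma loc_consts: "0 \<le> exceptional_const m" "1 \<le> level_const m" "1 \<le> restart_const" "level_const m \<le> local_const m" "0 \<le> local_const m"
proof -
  show e: "0 \<le> exceptional_const m" using weak_const_nonneg ball_vol_pos by (simp add: exceptional_const_def)
  show a: "1 \<le> level_const m" using e by (simp add: level_const_def)
  show t: "1 \<le> restart_const" using weak_const_nonneg by (simp add: restart_const_def)
  have "0 \<le> restart_const * (real CARD('n) ^ CARD('n) * level_const m)" "0 \<le> 4 ^ CARD('n) * dini_sum * level_const m"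
    using a t dini_sum_nonneg by auto
  then show "level_const m \<le> local_const m" by (simp add: local_const_def)
  then show "0 \<le> local_const m" using a by simp
qed

text \<open>
  Let \<open>E\<close> be the subset of \<open>Q\<close> where some $T F_i$ or some maximal function
  of $F_i$ is large. The stopping cubes are taken for the indicator of \<open>E\<close> at density
  $2^{-N-1}$; as \<open>E\<close> is small, they fill at most half of \<open>Q\<close>, and
  \<open>E\<close> fills at most half of each of them. On a stopping cube \<open>R\<close> the
  difference is the operator applied to the part \<open>H\<close> of the function off the dilate of
  \<open>R\<close>, which has oscillation at most a constant times the maximal function at any point
  of \<open>R\<close>. Hence it is enough to bound the difference at one point off \<open>E\<close>.
  There the first summand is controlled by the choice of \<open>E\<close>, and the second, the
  operator restarted on \<open>R\<close>, by the weak type estimate on at least three quarters of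
  \<open>R\<close>.
\<close>

theorem local_domination:
  fixes f :: "'i \<Rightarrow> real ^ 'n \<Rightarrow> 'k"
  assumes Q: "Q \<in> cubes" and J: "finite J" "card J \<le> m"
    and f: "\<And>i. i \<in> J \<Longrightarrow> f i \<in> L2" and a: "\<And>i. i \<in> J \<Longrightarrow> 0 \<le> a i"
    and avg: "\<And>i. i \<in> J \<Longrightarrow> (\<integral>\<^sup>+x\<in>dilate Q. ennreal (norm (f i x)) \<partial>lebesgue) \<le> ennreal (a i) * emeasure lebesgue (dilate Q)"
  obtains P where "P \<subseteq> dyadic_subcubes Q" "countable P" "disjoint_family_on (\<lambda>R. R) P"
    "emeasure lebesgue (\<Union>P) \<le> ennreal (1 / 2) * emeasure lebesgue Q"
    "\<forall>i\<in>J. AE x in lebesgue. x \<in> Q - \<Union>P \<longrightarrow> norm (T (restrict_to (dilate Q) (f i)) x) \<le> local_const m * a i"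
    "\<forall>R\<in>P. \<forall>i\<in>J. AE x in lebesgue. x \<in> R \<longrightarrow>
       norm (T (restrict_to (dilate Q) (f i)) x - T (restrict_to (dilate R) (f i)) x) \<le> local_const m * a i"
proof -
  let ?N = "CARD('n)"
  let ?k = "(4 * real ?N + 1) ^ ?N"
  let ?CM = "5 ^ ?N * ball_vol"
  define F where "F i = restrict_to (dilate Q) (f i)" for i
  have dQ: "dilate Q \<in> cubes" by (rule dilate_in_cubes[OF Q])
  have dQs: "dilate Q \<in> sets lebesgue" by (rule cubes_sets[OF dQ])
  have Qs: "Q \<in> sets lebesgue" by (rule cubes_sets[OF Q])
  have FL2: "F i \<in> L2" if "i \<in> J" for i unfolding F_def by (rule L2_restrict_to[OF dQs f[OF that]])
  have F0: "F i x = 0" if "x \<notin> dilate Q" for i x using that by (simp add: F_def)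
  have FI: "(\<integral>\<^sup>+x. ennreal (norm (F i x)) \<partial>lebesgue) \<le> ennreal (a i) * emeasure lebesgue (dilate Q)" if "i \<in> J" for i
    unfolding F_def nn_integral_restrict_to by (rule avg[OF that])
  have Ffin: "(\<integral>\<^sup>+x. ennreal (norm (F i x)) \<partial>lebesgue) < \<infinity>" if "i \<in> J" for i
    by (rule le_less_trans[OF FI[OF that]]) (simp add: emeasure_cubes[OF dQ] ennreal_mult_less_top)
  define q where "q = measure lebesgue Q"
  have q: "0 < q" "emeasure lebesgue Q = ennreal q" unfolding q_def using measure_cubes_pos[OF Q] emeasure_cubes[OF Q] by auto
  let ?E1 = "\<lambda>i. {x. level_const m * a i < norm (T (F i) x)}"
  let ?E2 = "\<lambda>i. {x. ennreal (level_const m * a i) < hl_max (\<lambda>x. ennreal (norm (F i x))) x}"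
  have Tm: "T (F i) \<in> borel_measurable lebesgue" if "i \<in> J" for i using T_L2[OF FL2[OF that]] L2_measurable by blast
  have E1s: "?E1 i \<in> sets lebesgue" if "i \<in> J" for i
  proof -
    have [measurable]: "T (F i) \<in> borel_measurable lebesgue" by (rule Tm[OF that])
    have "{x \<in> space lebesgue. level_const m * a i < norm (T (F i) x)} \<in> sets lebesgue" by measurable
    then show ?thesis by simp
  qed
  have E2s: "?E2 i \<in> sets lebesgue" for i by (rule sets_hl_max_greater)
  define E where "E = Q \<inter> (\<Union>i\<in>J. ?E1 i \<union> ?E2 i)"
  have Us: "(\<Union>i\<in>J. ?E1 i \<union> ?E2 i) \<in> sets lebesgue" using J E1s E2s by (intro sets.finite_UN sets.Un)
  have Es: "E \<in> sets lebesgue" unfolding E_def by (rule sets.Int[OF Qs Us])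
  have Efin: "emeasure lebesgue E \<le> ennreal q" unfolding q(2)[symmetric] by (rule emeasure_mono[OF _ Qs]) (auto simp: E_def)
  have E_small: "emeasure lebesgue E \<le> ennreal (1 / 2 ^ (?N + 2)) * ennreal q"
  proof -
    have "ennreal (level_const m) * emeasure lebesgue E \<le> ennreal (level_const m) * emeasure lebesgue (\<Union>i\<in>J. ?E1 i \<union> ?E2 i)"
      by (intro mult_left_mono emeasure_mono Us) (auto simp: E_def)
    also have "\<dots> \<le> ennreal (level_const m) * (\<Sum>i\<in>J. emeasure lebesgue (?E1 i \<union> ?E2 i))"
      using J E1s E2s by (intro mult_left_mono emeasure_subadditive_finite) auto
    also have "\<dots> = (\<Sum>i\<in>J. ennreal (level_const m) * emeasure lebesgue (?E1 i \<union> ?E2 i))" by (rule sum_distrib_left)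
    also have "\<dots> \<le> (\<Sum>i\<in>J. ennreal ((weak_const + ?CM) * ?k) * ennreal q)"
    proof (rule sum_mono)
      fix i assume i: "i \<in> J"
      have "ennreal (level_const m) * emeasure lebesgue (?E1 i \<union> ?E2 i) \<le> ennreal (level_const m) * (emeasure lebesgue (?E1 i) + emeasure lebesgue (?E2 i))"
        using E1s[OF i] E2s by (intro mult_left_mono emeasure_subadditive) auto
      also have "\<dots> = ennreal (level_const m) * emeasure lebesgue (?E1 i) + ennreal (level_const m) * emeasure lebesgue (?E2 i)"
        by (rule distrib_left)
      also have "\<dots> \<le> ennreal weak_const * emeasure lebesgue (dilate Q) + ennreal ?CM * emeasure lebesgue (dilate Q)"
      proof (rule add_mono)
        show "ennreal (level_const m) * emeasure lebesgue (?E1 i) \<le> ennreal weak_const * emeasure lebesgue (dilate Q)"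
          by (rule weak_type_average[OF dQ FL2[OF i] F0 a[OF i] loc_consts(2) FI[OF i]])
        show "ennreal (level_const m) * emeasure lebesgue (?E2 i) \<le> ennreal ?CM * emeasure lebesgue (dilate Q)"
          unfolding ball_vol_def using L2_measurable[OF FL2[OF i]]
          by (intro hl_max_weak_average[OF _ a[OF i] loc_consts(2) FI[OF i]]) auto
      qed
      also have "\<dots> = ennreal ((weak_const + ?CM) * ?k) * ennreal q"
        unfolding emeasure_dilate[OF Q] q(2) using weak_const_nonneg ball_vol_pos q(1)
        by (simp add: ennreal_mult[symmetric] ennreal_plus[symmetric] distrib_right mult.assoc del: ennreal_plus)
      finally show "ennreal (level_const m) * emeasure lebesgue (?E1 i \<union> ?E2 i) \<le> ennreal ((weak_const + ?CM) * ?k) * ennreal q" .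
    qed
    also have "\<dots> = ennreal (real (card J) * ((weak_const + ?CM) * ?k) * q)"
      using weak_const_nonneg ball_vol_pos q(1) by (simp add: ennreal_mult ennreal_of_nat_eq_real_of_nat mult.assoc)
    also have "\<dots> \<le> ennreal (exceptional_const m * q)"
      unfolding exceptional_const_def using J(2) weak_const_nonneg ball_vol_pos q(1) by (intro ennreal_leI mult_right_mono) auto
    finally have le: "ennreal (level_const m) * emeasure lebesgue E \<le> ennreal (exceptional_const m * q)" .
    define e where "e = measure lebesgue E"
    have e: "emeasure lebesgue E = ennreal e" "0 \<le> e"
      unfolding e_def using neq_top_trans[OF ennreal_neq_top Efin] by (auto intro: emeasure_eq_ennreal_measure)
    have "level_const m * e \<le> exceptional_const m * q"
      using le loc_consts(1,2)[of m] q e by (simp add: ennreal_mult[symmetric])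
    then have "2 ^ (?N + 2) * (level_const m * e) \<le> 2 ^ (?N + 2) * (exceptional_const m * q)" by (rule mult_left_mono) simp
    also have "\<dots> = (level_const m - 1) * q" by (simp add: level_const_def)
    also have "\<dots> \<le> level_const m * q" using q by (intro mult_right_mono) auto
    finally have "level_const m * (2 ^ (?N + 2) * e) \<le> level_const m * q" by (simp add: mult_ac)
    then have "2 ^ (?N + 2) * e \<le> q" using loc_consts(2)[of m] by simp
    then have "e \<le> 1 / 2 ^ (?N + 2) * q" by (simp add: field_simps)
    then show ?thesis unfolding e using q by (simp add: ennreal_mult[symmetric] ennreal_leI)
  qed
  let ?c = "1 / 2 ^ (?N + 1) :: real"
  have indm: "(\<lambda>x. indicator E x :: ennreal) \<in> borel_measurable lebesgue" using Es by simp
  have ind: "(\<integral>\<^sup>+x\<in>S. indicator E x \<partial>lebesgue) = emeasure lebesgue (E \<inter> S)" if "S \<in> sets lebesgue" for S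
    using Es that by (simp flip: indicator_inter_arith)
  have c0: "0 \<le> ?c" by simp
  have avgE: "(\<integral>\<^sup>+x\<in>Q. indicator E x \<partial>lebesgue) \<le> ennreal ?c * emeasure lebesgue Q"
  proof -
    have "(\<integral>\<^sup>+x\<in>Q. indicator E x \<partial>lebesgue) \<le> emeasure lebesgue E" unfolding ind[OF Qs] by (intro emeasure_mono Es) auto
    also note E_small
    also have "ennreal (1 / 2 ^ (?N + 2)) * ennreal q \<le> ennreal ?c * emeasure lebesgue Q"
      unfolding q(2) by (intro mult_right_mono ennreal_leI) (auto simp: field_simps)
    finally show ?thesis .
  qed
  obtain P where PD: "P \<subseteq> dyadic_subcubes Q" and Pc: "countable P" and Pd: "disjoint_family_on (\<lambda>S. S) P"
    and Plow: "\<forall>S\<in>P. ennreal ?c * emeasure lebesgue S \<le> (\<integral>\<^sup>+x\<in>S. indicator E x \<partial>lebesgue)"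
    and Phigh: "\<forall>S\<in>P. (\<integral>\<^sup>+x\<in>S. indicator E x \<partial>lebesgue) \<le> ennreal (2 ^ ?N * ?c) * emeasure lebesgue S"
    and Pout: "AE x in lebesgue. x \<in> Q - \<Union>P \<longrightarrow> indicator E x \<le> ennreal ?c"
    by (rule stopping_cubes[OF Q indm c0 avgE])
  have Rcube: "R \<in> cubes" if "R \<in> P" for R using that PD dyadic_in_cubes[OF Q] by blast
  have Rs: "R \<in> sets lebesgue" if "R \<in> P" for R using Rcube[OF that] cubes_sets by blast
  have RQ: "R \<subseteq> Q" if "R \<in> P" for R using that PD dyadic_subset[OF Q] by blast
  have half: "emeasure lebesgue (\<Union>P) \<le> ennreal (1 / 2) * emeasure lebesgue Q"
  proof -
    have "emeasure lebesgue (\<Union>P) = (\<integral>\<^sup>+R. emeasure lebesgue R \<partial>count_space P)"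
      using emeasure_UN_countable[of P "\<lambda>R. R" lebesgue] Pc Pd Rs by simp
    then have "ennreal ?c * emeasure lebesgue (\<Union>P) = (\<integral>\<^sup>+R. ennreal ?c * emeasure lebesgue R \<partial>count_space P)"
      by (simp add: nn_integral_cmult)
    also have "\<dots> \<le> (\<integral>\<^sup>+R. (\<integral>\<^sup>+x\<in>R. indicator E x \<partial>lebesgue) \<partial>count_space P)"
      using Plow by (intro nn_integral_mono) auto
    also have "\<dots> = (\<integral>\<^sup>+x\<in>(\<Union>R\<in>P. R). indicator E x \<partial>lebesgue)"
      by (rule set_nn_integral_UN_disjoint[symmetric, OF Pc Pd Rs indm])
    also have "\<dots> \<le> (\<integral>\<^sup>+x. indicator E x \<partial>lebesgue)" by (intro nn_integral_mono) (auto simp: indicator_def)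
    also have "\<dots> = emeasure lebesgue E" using Es by (rule nn_integral_indicator)
    finally have "ennreal ?c * emeasure lebesgue (\<Union>P) \<le> ennreal (1 / 2 ^ (?N + 2)) * ennreal q" using E_small by (rule order_trans)
    then have "ennreal (2 ^ (?N + 1)) * (ennreal ?c * emeasure lebesgue (\<Union>P)) \<le> ennreal (2 ^ (?N + 1)) * (ennreal (1 / 2 ^ (?N + 2)) * ennreal q)"
      by (rule mult_left_mono) simp
    moreover have "ennreal (2 ^ (?N + 1)) * ennreal ?c = 1" by (subst ennreal_mult[symmetric]) auto
    moreover have "ennreal (2 ^ (?N + 1)) * ennreal (1 / 2 ^ (?N + 2)) = ennreal (1 / 2)" by (subst ennreal_mult[symmetric]) auto
    ultimately show ?thesis unfolding q(2) by (simp only: mult.assoc[symmetric] mult_1)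
  qed
  have outside: "AE x in lebesgue. x \<in> Q - \<Union>P \<longrightarrow> norm (T (F i) x) \<le> local_const m * a i" if i: "i \<in> J" for i
    using Pout
  proof eventually_elim
    fix x assume o: "x \<in> Q - \<Union>P \<longrightarrow> indicator E x \<le> ennreal ?c"
    show "x \<in> Q - \<Union>P \<longrightarrow> norm (T (F i) x) \<le> local_const m * a i"
    proof
      assume x: "x \<in> Q - \<Union>P"
      have "x \<notin> E"
      proof
        assume "x \<in> E"
        then have "ennreal 1 \<le> ennreal ?c" using o x by simp
        then have "1 \<le> ?c" by (subst (asm) ennreal_le_iff) auto
        moreover have "(1::real) < 2 ^ (?N + 1)" by (rule one_less_power) auto
        ultimately show False by (simp add: field_simps)
      qed
      then have "norm (T (F i) x) \<le> level_const m * a i" using x i by (auto simp: E_def not_less)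
      also have "\<dots> \<le> local_const m * a i" by (rule mult_right_mono[OF loc_consts(4) a[OF i]])
      finally show "norm (T (F i) x) \<le> local_const m * a i" .
    qed
  qed
  have inside: "AE x in lebesgue. x \<in> R \<longrightarrow> norm (T (F i) x - T (restrict_to (dilate R) (f i)) x) \<le> local_const m * a i"
    if R: "R \<in> P" and i: "i \<in> J" for R i
  proof -
    obtain b l where l: "0 < l" "R = cube b l" using Rcube[OF R] by (rule cubesE)
    let ?\<delta> = "real ?N * l"
    have \<delta>: "0 < ?\<delta>" using l by simp
    have dR: "dilate R \<in> cubes" by (rule dilate_in_cubes[OF Rcube[OF R]])
    have dRs: "dilate R \<in> sets lebesgue" by (rule cubes_sets[OF dR])
    have dRQ: "dilate R \<subseteq> dilate Q" by (rule dilate_mono[OF Q Rcube[OF R] RQ[OF R]])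
    define G where "G = restrict_to (dilate R) (f i)"
    \<comment> \<open>the part of the function that the passage from \<open>Q\<close> to
      \<open>R\<close> removes\<close>
    define H where "H y = F i y - G y" for y
    have GL2: "G \<in> L2" unfolding G_def by (rule L2_restrict_to[OF dRs f[OF i]])
    have HL2: "H \<in> L2" unfolding H_def[abs_def] by (rule L2_diff[OF FL2[OF i] GL2])
    have H0: "H y = 0" if "y \<in> dilate R" for y using that dRQ by (auto simp: H_def G_def F_def)
    have HF: "norm (H y) \<le> norm (F i y)" for y by (cases "y \<in> dilate R") (auto simp: H_def G_def restrict_to_simps F_def dest: subsetD[OF dRQ])
    have Hm: "H \<in> borel_measurable lebesgue" using HL2 L2_measurable by blast
    have Hfin: "(\<integral>\<^sup>+x. ennreal (norm (H x)) \<partial>lebesgue) < \<infinity>"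
      by (rule le_less_trans[OF _ Ffin[OF i]]) (intro nn_integral_mono ennreal_leI HF)
    have Hball: "H y = 0" if "x \<in> R" "norm (x - y) < 2 * ?\<delta>" for x y
    proof (rule H0)
      show "y \<in> dilate R" unfolding l
        by (rule subsetD[OF ball_subset_dilate[OF l(1)]]) (use that l in \<open>auto simp: dist_norm\<close>)
    qed
    have Hsupp: "x \<notin> fsupp H" if "x \<in> R" for x
      by (rule not_in_fsuppI[of "2 * ?\<delta>"]) (use \<delta> Hball[OF that] in \<open>auto simp: dist_norm\<close>)
    have TH: "AE x in lebesgue. T H x = T (F i) x - T G x" unfolding H_def[abs_def] by (rule T_diff[OF FL2[OF i] GL2])
    have rep: "AE x in lebesgue. x \<in> R \<longrightarrow> T H x = (LINT y|lebesgue. K x y * H y)"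
      using T_kernel[OF HL2] by eventually_elim (use Hsupp in auto)
    define aR where "aR = real ?N ^ ?N * (level_const m * a i)"
    have aR: "0 \<le> aR" using a[OF i] loc_consts(2)[of m] by (simp add: aR_def)
    define p where "p = measure lebesgue R"
    have p: "0 < p" "emeasure lebesgue R = ennreal p" unfolding p_def using measure_cubes_pos[OF Rcube[OF R]] emeasure_cubes[OF Rcube[OF R]] by auto
    have RE: "emeasure lebesgue (E \<inter> R) \<le> ennreal (1 / 2 * p)"
    proof -
      have "emeasure lebesgue (E \<inter> R) \<le> ennreal (2 ^ ?N * ?c) * ennreal p" using Phigh R unfolding ind[OF Rs[OF R], symmetric] p(2)[symmetric] by blast
      also have "\<dots> = ennreal (1 / 2 * p)" using p by (subst ennreal_mult[symmetric]) auto
      finally show ?thesis .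
    qed
    have RnE: "R - E \<noteq> {}"
    proof
      assume "R - E = {}"
      then have "E \<inter> R = R" by blast
      then show False using RE p by (simp add: ennreal_leI)
    qed
    \<comment> \<open>The average over the dilate of \<open>R\<close> is controlled by the maximal
      function at a point off \<open>E\<close>.\<close>
    have Gavg: "(\<integral>\<^sup>+x. ennreal (norm (G x)) \<partial>lebesgue) \<le> ennreal aR * emeasure lebesgue (dilate R)"
    proof -
      obtain z where z: "z \<in> R" "z \<notin> E" using RnE by blast
      have zM: "hl_max (\<lambda>x. ennreal (norm (F i x))) z \<le> ennreal (level_const m * a i)"
        using z RQ[OF R] i by (auto simp: E_def not_less)
      have zd: "z \<in> dilate R" using subset_dilate[OF Rcube[OF R]] z by blast
      have kl: "0 < (4 * real ?N + 1) * l" using l by (intro mult_pos_pos) auto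
      have sub: "dilate R \<subseteq> ball z (real ?N * ((4 * real ?N + 1) * l))"
        using zd unfolding l dilate_cube[OF l(1)] by (rule cube_subset_ball)
      have "(\<integral>\<^sup>+x. ennreal (norm (G x)) \<partial>lebesgue) = (\<integral>\<^sup>+x\<in>dilate R. ennreal (norm (F i x)) \<partial>lebesgue)"
        unfolding G_def nn_integral_restrict_to using dRQ
        by (intro nn_integral_cong) (auto simp: F_def indicator_def dest: subsetD[OF dRQ])
      also have "\<dots> \<le> ennreal ((real ?N * ((4 * real ?N + 1) * l)) ^ ?N) * hl_max (\<lambda>x. ennreal (norm (F i x))) z"
        by (rule set_integral_le_hl_max[OF _ sub]) (use kl in simp)
      also have "\<dots> \<le> ennreal ((real ?N * ((4 * real ?N + 1) * l)) ^ ?N) * ennreal (level_const m * a i)"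
        by (rule mult_left_mono[OF zM]) simp
      also have "\<dots> = ennreal ((real ?N * ((4 * real ?N + 1) * l)) ^ ?N * (level_const m * a i))"
        using kl a[OF i] loc_consts(2)[of m] by (intro ennreal_mult[symmetric]) auto
      also have "(real ?N * ((4 * real ?N + 1) * l)) ^ ?N * (level_const m * a i) = aR * ((4 * real ?N + 1) * l) ^ ?N"
        unfolding power_mult_distrib[of "real ?N" "(4 * real ?N + 1) * l"] aR_def by (simp only: mult_ac)
      also have "ennreal (aR * ((4 * real ?N + 1) * l) ^ ?N) = ennreal aR * emeasure lebesgue (dilate R)"
        unfolding l dilate_cube[OF l(1)] emeasure_cube[OF kl] using kl aR by (intro ennreal_mult) auto
      finally show ?thesis .
    qed
    let ?B = "{x. restart_const * aR < norm (T G x)}"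
    have Bs: "?B \<in> sets lebesgue"
    proof -
      have [measurable]: "T G \<in> borel_measurable lebesgue" using T_L2[OF GL2] L2_measurable by blast
      have "{x \<in> space lebesgue. restart_const * aR < norm (T G x)} \<in> sets lebesgue" by measurable
      then show ?thesis by simp
    qed
    have B_small: "emeasure lebesgue (?B \<inter> R) \<le> ennreal (1 / 4 * p)"
    proof -
      have "ennreal restart_const * emeasure lebesgue (?B \<inter> R) \<le> ennreal restart_const * emeasure lebesgue ?B"
        by (intro mult_left_mono emeasure_mono Bs) auto
      also have "\<dots> \<le> ennreal weak_const * emeasure lebesgue (dilate R)"
        by (rule weak_type_average[OF dR GL2 _ aR loc_consts(3) Gavg]) (simp add: G_def)
      also have "\<dots> = ennreal (weak_const * ?k * p)"
        unfolding emeasure_dilate[OF Rcube[OF R]] p(2) using weak_const_nonneg p by (simp add: ennreal_mult mult.assoc)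
      finally have le: "ennreal restart_const * emeasure lebesgue (?B \<inter> R) \<le> ennreal (weak_const * ?k * p)" .
      define e where "e = measure lebesgue (?B \<inter> R)"
      have "emeasure lebesgue (?B \<inter> R) \<le> ennreal p" unfolding p(2)[symmetric] by (intro emeasure_mono Rs[OF R]) auto
      then have e: "emeasure lebesgue (?B \<inter> R) = ennreal e" "0 \<le> e"
        unfolding e_def using neq_top_trans[OF ennreal_neq_top] by (auto intro: emeasure_eq_ennreal_measure)
      have "restart_const * e \<le> weak_const * ?k * p" using le weak_const_nonneg p e loc_consts(3) by (simp add: ennreal_mult[symmetric])
      also have "weak_const * ?k * p \<le> 1 / 4 * (restart_const * p)"
      proof -
        have "restart_const * p = p + 4 * (weak_const * ?k * p)" by (simp add: restart_const_def distrib_right mult.assoc)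
        then show ?thesis using p by linarith
      qed
      finally have "restart_const * e \<le> restart_const * (1 / 4 * p)" by simp
      then have "e \<le> 1 / 4 * p" by (rule mult_left_le_imp_le) (use loc_consts(3) in simp)
      then show ?thesis unfolding e by (rule ennreal_leI)
    qed
    \<comment> \<open>Good points exist, since \<open>E\<close> and \<open>?B\<close> fill at most three
      quarters of \<open>R\<close>.\<close>
    let ?Z = "R - (E \<inter> R \<union> ?B \<inter> R)"
    have Zs: "?Z \<in> sets lebesgue" by (intro sets.Diff sets.Un sets.Int Rs[OF R] Es Bs)
    have Zpos: "0 < emeasure lebesgue ?Z"
    proof (rule ccontr)
      assume "\<not> ?thesis"
      then have Z0: "emeasure lebesgue ?Z = 0" by (simp add: not_less)
      have "emeasure lebesgue R \<le> emeasure lebesgue (?Z \<union> (E \<inter> R \<union> ?B \<inter> R))"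
        by (intro emeasure_mono sets.Un Zs sets.Int Rs[OF R] Es Bs) auto
      also have "\<dots> \<le> emeasure lebesgue ?Z + (emeasure lebesgue (E \<inter> R) + emeasure lebesgue (?B \<inter> R))"
        by (intro order_trans[OF emeasure_subadditive] add_left_mono order_refl sets.Un Zs sets.Int Rs[OF R] Es Bs)
      also have "\<dots> \<le> 0 + (ennreal (1 / 2 * p) + ennreal (1 / 4 * p))"
        unfolding Z0 by (intro add_mono RE B_small) simp
      also have "\<dots> = ennreal (3 / 4 * p)" using p by (simp add: ennreal_plus[symmetric] del: ennreal_plus)
      finally have "ennreal p \<le> ennreal (3 / 4 * p)" unfolding p(2) .
      then have "p \<le> 3 / 4 * p" using p by (subst (asm) ennreal_le_iff) auto
      then show False using p by simp
    qed
    have "AE x in lebesgue. T H x = T (F i) x - T G x \<and> (x \<in> R \<longrightarrow> T H x = (LINT y|lebesgue. K x y * H y))"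
      using TH rep by eventually_elim simp
    then obtain z where z: "z \<in> ?Z" and Tz: "T H z = T (F i) z - T G z \<and> (z \<in> R \<longrightarrow> T H z = (LINT y|lebesgue. K z y * H y))"
      by (rule AE_exists_in_positive_measure[OF _ Zs Zpos])
    have zR: "z \<in> R" and zE: "z \<notin> E" and zB: "norm (T G z) \<le> restart_const * aR" using z by auto
    have z1: "norm (T (F i) z) \<le> level_const m * a i" and z2: "hl_max (\<lambda>x. ennreal (norm (F i x))) z \<le> ennreal (level_const m * a i)"
      using zR zE RQ[OF R] i by (auto simp: E_def not_less)
    have THz: "norm (LINT y|lebesgue. K z y * H y) \<le> level_const m * a i + restart_const * aR"
    proof -
      have "T H z = (LINT y|lebesgue. K z y * H y)" "T H z = T (F i) z - T G z" using Tz zR by auto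
      then have "(LINT y|lebesgue. K z y * H y) = T (F i) z - T G z" by (rule subst)
      then show ?thesis using norm_triangle_ineq4[of "T (F i) z" "T G z"] z1 zB by simp
    qed
    show ?thesis
      using TH rep
    proof eventually_elim
      fix x assume Tx: "T H x = T (F i) x - T G x" and rx: "x \<in> R \<longrightarrow> T H x = (LINT y|lebesgue. K x y * H y)"
      show "x \<in> R \<longrightarrow> norm (T (F i) x - T (restrict_to (dilate R) (f i)) x) \<le> local_const m * a i"
      proof
        assume xR: "x \<in> R"
        have "z \<in> ball x ?\<delta>" using cube_subset_ball[of x b l] xR zR unfolding l by blast
        then have xz: "norm (x - z) \<le> ?\<delta>" by (simp add: dist_norm)
        have "ennreal (norm ((LINT y|lebesgue. K x y * H y) - (LINT y|lebesgue. K z y * H y)))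
            \<le> ennreal (4 ^ ?N * dini_sum) * hl_max (\<lambda>y. ennreal (norm (H y))) z"
          by (rule kernel_oscillation[OF Hm Hfin \<delta> xz]) (rule Hball[OF xR])
        also have "\<dots> \<le> ennreal (4 ^ ?N * dini_sum) * ennreal (level_const m * a i)"
          by (intro mult_left_mono order_trans[OF hl_max_mono z2] ennreal_leI HF) simp
        also have "\<dots> = ennreal (4 ^ ?N * dini_sum * (level_const m * a i))"
          using dini_sum_nonneg a[OF i] loc_consts(2)[of m] by (subst ennreal_mult) auto
        finally have "norm ((LINT y|lebesgue. K x y * H y) - (LINT y|lebesgue. K z y * H y)) \<le> 4 ^ ?N * dini_sum * (level_const m * a i)"
          using dini_sum_nonneg a[OF i] loc_consts(2)[of m] by (subst (asm) ennreal_le_iff) auto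
        moreover have "norm (LINT y|lebesgue. K x y * H y) \<le> norm (LINT y|lebesgue. K z y * H y)
            + norm ((LINT y|lebesgue. K x y * H y) - (LINT y|lebesgue. K z y * H y))"
          using norm_triangle_sub by blast
        ultimately have "norm (LINT y|lebesgue. K x y * H y) \<le> (level_const m * a i + restart_const * aR) + 4 ^ ?N * dini_sum * (level_const m * a i)"
          using THz by linarith
        also have "\<dots> = local_const m * a i" by (simp add: local_const_def aR_def algebra_simps)
        finally show "norm (T (F i) x - T (restrict_to (dilate R) (f i)) x) \<le> local_const m * a i"
          using Tx rx xR unfolding G_def[symmetric] by simp
      qed
    qed
  qed
  show ?thesis
    by (rule that[OF PD Pc Pd half]) (use outside inside in \<open>auto simp: F_def\<close>)
qed

end


section \<open>Maximal functions with an exponent\<close>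

lemma set_nn_integral_zeroD:
  fixes f :: "'a \<Rightarrow> real"
  assumes "f \<in> borel_measurable M" "Q \<in> sets M" "(\<integral>\<^sup>+x\<in>Q. ennreal (f x) \<partial>M) = 0"
  shows "AE x in M. x \<in> Q \<longrightarrow> f x \<le> 0"
proof -
  have "(\<lambda>x. ennreal (f x) * indicator Q x) \<in> borel_measurable M" using assms(1,2) by measurable
  then have "AE x in M. ennreal (f x) * indicator Q x = 0" using assms(3) by (simp add: nn_integral_0_iff_AE)
  then show ?thesis by eventually_elim (auto simp: indicator_def ennreal_eq_0_iff)
qed

text \<open>
  Holder's inequality with exponents \<open>2 * (1 + e)\<close> and \<open>2 * (1 + e) / (1 + 2 *
  e)\<close>, via Young's inequality for the normalised functions; it is stated with bounds
  \<open>\<alpha>\<close>, \<open>\<beta>\<close> for the power means because these are what a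
  reverse Holder inequality and a maximal function provide.
\<close>

lemma Holder_average:
  fixes w \<phi> :: "'a \<Rightarrow> real"
  assumes [measurable]: "w \<in> borel_measurable M" "\<phi> \<in> borel_measurable M" "Q \<in> sets M"
    and w: "\<And>x. 0 \<le> w x" and \<phi>: "\<And>x. 0 \<le> \<phi> x" and e: "0 < e" and \<alpha>: "0 \<le> \<alpha>" and \<beta>: "0 \<le> \<beta>"
    and Iw: "(\<integral>\<^sup>+x\<in>Q. ennreal (w x powr (1 + e)) \<partial>M) \<le> ennreal (\<alpha> powr (2 * (1 + e))) * c"
    and I\<phi>: "(\<integral>\<^sup>+x\<in>Q. ennreal (\<phi> x powr (2 * (1 + e) / (1 + 2 * e))) \<partial>M) \<le> ennreal (\<beta> powr (2 * (1 + e) / (1 + 2 * e))) * c"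
  shows "(\<integral>\<^sup>+x\<in>Q. ennreal (sqrt (w x) * \<phi> x) \<partial>M) \<le> ennreal (\<alpha> * \<beta>) * c"
proof -
  let ?P = "2 * (1 + e)" and ?p = "2 * (1 + e) / (1 + 2 * e)"
  have P: "1 < ?P" and p: "1 < ?p" and Pp: "1 / ?P + 1 / ?p = 1" using e by (auto simp: field_simps)
  consider "\<alpha> = 0" | "\<beta> = 0" | "0 < \<alpha>" "0 < \<beta>" using \<alpha> \<beta> by linarith
  then show ?thesis
  proof cases
    case 1
    then have "(\<integral>\<^sup>+x\<in>Q. ennreal (w x powr (1 + e)) \<partial>M) = 0" using Iw by simp
    then have "AE x in M. x \<in> Q \<longrightarrow> w x powr (1 + e) \<le> 0" by (intro set_nn_integral_zeroD) measurable
    then have "AE x in M. ennreal (sqrt (w x) * \<phi> x) * indicator Q x = 0"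
    proof eventually_elim
      fix x assume "x \<in> Q \<longrightarrow> w x powr (1 + e) \<le> 0"
      then have "x \<in> Q \<Longrightarrow> w x = 0" using w[of x] powr_gt_zero[of "w x" "1 + e"] by force
      then show "ennreal (sqrt (w x) * \<phi> x) * indicator Q x = 0" by (cases "x \<in> Q") auto
    qed
    then have "(\<integral>\<^sup>+x\<in>Q. ennreal (sqrt (w x) * \<phi> x) \<partial>M) = 0" by (simp add: nn_integral_0_iff_AE)
    then show ?thesis by simp
  next
    case 2
    then have "(\<integral>\<^sup>+x\<in>Q. ennreal (\<phi> x powr ?p) \<partial>M) = 0" using I\<phi> by simp
    then have "AE x in M. x \<in> Q \<longrightarrow> \<phi> x powr ?p \<le> 0" by (intro set_nn_integral_zeroD) measurable
    then have "AE x in M. ennreal (sqrt (w x) * \<phi> x) * indicator Q x = 0"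
    proof eventually_elim
      fix x assume "x \<in> Q \<longrightarrow> \<phi> x powr ?p \<le> 0"
      then have "x \<in> Q \<Longrightarrow> \<phi> x = 0" using \<phi>[of x] powr_gt_zero[of "\<phi> x" ?p] by force
      then show "ennreal (sqrt (w x) * \<phi> x) * indicator Q x = 0" by (cases "x \<in> Q") auto
    qed
    then have "(\<integral>\<^sup>+x\<in>Q. ennreal (sqrt (w x) * \<phi> x) \<partial>M) = 0" by (simp add: nn_integral_0_iff_AE)
    then show ?thesis by simp
  next
    case 3
    have pw: "sqrt (w x) * \<phi> x \<le> \<alpha> * \<beta> / (?P * \<alpha> powr ?P) * w x powr (1 + e) + \<alpha> * \<beta> / (?p * \<beta> powr ?p) * \<phi> x powr ?p" for x
    proof -
      have "(sqrt (w x) / \<alpha>) * (\<phi> x / \<beta>) \<le> (sqrt (w x) / \<alpha>) powr ?P / ?P + (\<phi> x / \<beta>) powr ?p / ?p"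
        using 3 w \<phi> by (intro Youngs_inequality P p Pp) auto
      also have "(sqrt (w x) / \<alpha>) powr ?P = w x powr (1 + e) / \<alpha> powr ?P"
      proof -
        have "sqrt (w x) powr ?P = w x powr (1 + e)"
          using w[of x] by (simp add: powr_half_sqrt[symmetric] powr_powr add_divide_distrib)
        then show ?thesis using w[of x] 3 by (simp add: powr_divide)
      qed
      also have "(\<phi> x / \<beta>) powr ?p = \<phi> x powr ?p / \<beta> powr ?p" using \<phi>[of x] 3 by (simp add: powr_divide)
      finally have "\<alpha> * \<beta> * ((sqrt (w x) / \<alpha>) * (\<phi> x / \<beta>)) \<le> \<alpha> * \<beta> * (w x powr (1 + e) / \<alpha> powr ?P / ?P + \<phi> x powr ?p / \<beta> powr ?p / ?p)"
        using 3 by (intro mult_left_mono) auto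
      moreover have "\<alpha> * \<beta> * ((sqrt (w x) / \<alpha>) * (\<phi> x / \<beta>)) = sqrt (w x) * \<phi> x" using 3 by simp
      moreover have "\<alpha> * \<beta> * (w x powr (1 + e) / \<alpha> powr ?P / ?P + \<phi> x powr ?p / \<beta> powr ?p / ?p)
          = \<alpha> * \<beta> / (?P * \<alpha> powr ?P) * w x powr (1 + e) + \<alpha> * \<beta> / (?p * \<beta> powr ?p) * \<phi> x powr ?p"
      proof -
        have r: "c * (y / z / k + y' / z' / k') = c / (k * z) * y + c / (k' * z') * y'" for c y z k y' z' k' :: real
          by (simp add: distrib_left mult_ac)
        show ?thesis by (rule r)
      qed
      ultimately show ?thesis by simp
    qed
    let ?a = "\<alpha> * \<beta> / (?P * \<alpha> powr ?P)" and ?b = "\<alpha> * \<beta> / (?p * \<beta> powr ?p)"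
    have ab: "0 \<le> ?a" "0 \<le> ?b" using 3 e by auto
    have "(\<integral>\<^sup>+x\<in>Q. ennreal (sqrt (w x) * \<phi> x) \<partial>M)
        \<le> (\<integral>\<^sup>+x. ennreal ?a * (ennreal (w x powr (1 + e)) * indicator Q x) + ennreal ?b * (ennreal (\<phi> x powr ?p) * indicator Q x) \<partial>M)"
    proof (rule nn_integral_mono)
      fix x
      have "ennreal (sqrt (w x) * \<phi> x) \<le> ennreal ?a * ennreal (w x powr (1 + e)) + ennreal ?b * ennreal (\<phi> x powr ?p)"
        using ennreal_leI[OF pw[of x]] ab by (simp only: ennreal_mult ennreal_plus mult_nonneg_nonneg powr_ge_zero)
      then show "ennreal (sqrt (w x) * \<phi> x) * indicator Q x
        \<le> ennreal ?a * (ennreal (w x powr (1 + e)) * indicator Q x) + ennreal ?b * (ennreal (\<phi> x powr ?p) * indicator Q x)"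
        by (cases "x \<in> Q") auto
    qed
    also have "\<dots> = ennreal ?a * (\<integral>\<^sup>+x\<in>Q. ennreal (w x powr (1 + e)) \<partial>M) + ennreal ?b * (\<integral>\<^sup>+x\<in>Q. ennreal (\<phi> x powr ?p) \<partial>M)"
      by (subst nn_integral_add, measurable, subst nn_integral_cmult, measurable, subst nn_integral_cmult, measurable)
    also have "\<dots> \<le> ennreal ?a * (ennreal (\<alpha> powr ?P) * c) + ennreal ?b * (ennreal (\<beta> powr ?p) * c)"
      by (intro add_mono mult_left_mono Iw I\<phi>) auto
    also have "\<dots> = (ennreal (?a * \<alpha> powr ?P) + ennreal (?b * \<beta> powr ?p)) * c"
      using ab by (simp only: ennreal_mult powr_ge_zero distrib_right mult.assoc)
    also have "ennreal (?a * \<alpha> powr ?P) + ennreal (?b * \<beta> powr ?p) = ennreal (\<alpha> * \<beta>)"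
    proof -
      have "?a * \<alpha> powr ?P = \<alpha> * \<beta> * (1 / ?P)" "?b * \<beta> powr ?p = \<alpha> * \<beta> * (1 / ?p)" using 3 by simp_all
      moreover have "\<alpha> * \<beta> * (1 / ?P) + \<alpha> * \<beta> * (1 / ?p) = \<alpha> * \<beta>" by (simp only: distrib_left[symmetric] Pp mult_1_right)
      moreover have "0 \<le> \<alpha> * \<beta> * (1 / ?P)" "0 \<le> \<alpha> * \<beta> * (1 / ?p)" using 3 e by auto
      ultimately show ?thesis by (simp only: ennreal_plus[symmetric])
    qed
    finally show ?thesis .
  qed
qed

definition hl_p :: "real \<Rightarrow> (real ^ 'n \<Rightarrow> real) \<Rightarrow> real ^ 'n \<Rightarrow> real" where
  "hl_p p \<phi> x = (enn2real (hl_max (\<lambda>y. ennreal (\<phi> y powr p)) x)) powr (1 / p)"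

text \<open>the constant of \<open>hl_max_strong_type\<close> as a function of the dimension\<close>

definition hl_const :: "nat \<Rightarrow> real" where
  "hl_const n = 4 * 5 ^ n * unit_ball_vol (real n) * (1 + 2 * unit_ball_vol (real n))"

lemma hl_p_nonneg: "0 \<le> hl_p p \<phi> x"
  by (simp add: hl_p_def)

lemma hl_p_measurable [measurable]: "hl_p p \<phi> \<in> borel_measurable lebesgue"
  unfolding hl_p_def[abs_def] by measurable

text \<open>
  The strong type estimate is applied to $\phi^p$ with the exponent \<open>2 / p\<close>, which
  exceeds 1 by \<open>e / (1 + e)\<close>.
\<close>

lemma hl_p_bounds:
  fixes \<phi> :: "real ^ 'n \<Rightarrow> real"
  assumes [measurable]: "\<phi> \<in> borel_measurable lebesgue" and \<phi>: "\<And>x. 0 \<le> \<phi> x" "\<And>x. \<phi> x \<le> b" and e: "0 < e" "e \<le> 1"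
  defines "p \<equiv> 2 * (1 + e) / (1 + 2 * e)"
  shows hl_p_L2: "(\<integral>\<^sup>+x. ennreal ((hl_p p \<phi> x)\<^sup>2) \<partial>lebesgue) \<le> ennreal (hl_const CARD('n) * (2 / e)) * (\<integral>\<^sup>+x. ennreal ((\<phi> x)\<^sup>2) \<partial>lebesgue)"
    and hl_p_average: "Q \<in> cubes \<Longrightarrow> x \<in> Q \<Longrightarrow>
      (\<integral>\<^sup>+y\<in>dilate Q. ennreal (\<phi> y powr p) \<partial>lebesgue) \<le> ennreal ((real CARD('n) ^ CARD('n) * hl_p p \<phi> x) powr p) * emeasure lebesgue (dilate Q)"
proof -
  have p: "1 < p" "p < 2" using e by (auto simp: p_def field_simps)
  define s where "s = 2 / p"
  have s_eq: "s = (1 + 2 * e) / (1 + e)" using e by (simp add: s_def p_def divide_simps) (simp add: algebra_simps)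
  have s1: "s - 1 = e / (1 + e)" using e by (simp add: s_eq field_simps)
  have s: "1 < s" "s \<le> 2" using e unfolding s_eq by (auto simp: field_simps)
  let ?h = "\<lambda>y. \<phi> y powr p"
  have hb: "?h x \<le> b powr p" for x using \<phi> p by (intro powr_mono2) auto
  have hm: "?h \<in> borel_measurable lebesgue" by measurable
  note st = hl_max_strong_type[OF hm _ hb s]
  have fin: "hl_max (\<lambda>y. ennreal (?h y)) x < \<infinity>" for x by (rule st(2)) simp
  let ?m = "\<lambda>x. enn2real (hl_max (\<lambda>y. ennreal (?h y)) x)"
  have K0: "0 \<le> hl_const CARD('n)" by (simp add: hl_const_def)
  have "(hl_p p \<phi> x)\<^sup>2 = ?m x powr s" for x
  proof -
    have "(hl_p p \<phi> x)\<^sup>2 = (?m x powr (1 / p)) powr 2" by (simp add: hl_p_def flip: powr_numeral)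
    then show ?thesis by (simp add: powr_powr s_def)
  qed
  then have "(\<integral>\<^sup>+x. ennreal ((hl_p p \<phi> x)\<^sup>2) \<partial>lebesgue) = (\<integral>\<^sup>+x. ennreal (?m x powr s) \<partial>lebesgue)" by simp
  also have "\<dots> \<le> ennreal (hl_const CARD('n) / (s - 1)) * (\<integral>\<^sup>+x. ennreal (?h x powr s) \<partial>lebesgue)"
    unfolding hl_const_def by (rule st(1)) simp
  also have "(\<integral>\<^sup>+x. ennreal (?h x powr s) \<partial>lebesgue) = (\<integral>\<^sup>+x. ennreal ((\<phi> x)\<^sup>2) \<partial>lebesgue)"
  proof (rule nn_integral_cong)
    fix x
    have "?h x powr s = \<phi> x powr 2" using p by (simp add: powr_powr s_def)
    also have "\<dots> = (\<phi> x)\<^sup>2" using \<phi>(1)[of x] by simp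
    finally show "ennreal (?h x powr s) = ennreal ((\<phi> x)\<^sup>2)" by simp
  qed
  also have "ennreal (hl_const CARD('n) / (s - 1)) * (\<integral>\<^sup>+x. ennreal ((\<phi> x)\<^sup>2) \<partial>lebesgue)
      \<le> ennreal (hl_const CARD('n) * (2 / e)) * (\<integral>\<^sup>+x. ennreal ((\<phi> x)\<^sup>2) \<partial>lebesgue)"
  proof (intro mult_right_mono ennreal_leI)
    have "hl_const CARD('n) / (s - 1) = hl_const CARD('n) * ((1 + e) / e)" unfolding s1 by simp
    also have "\<dots> \<le> hl_const CARD('n) * (2 / e)" using K0 e by (intro mult_left_mono divide_right_mono) auto
    finally show "hl_const CARD('n) / (s - 1) \<le> hl_const CARD('n) * (2 / e)" .
  qed simp
  finally show "(\<integral>\<^sup>+x. ennreal ((hl_p p \<phi> x)\<^sup>2) \<partial>lebesgue) \<le> ennreal (hl_const CARD('n) * (2 / e)) * (\<integral>\<^sup>+x. ennreal ((\<phi> x)\<^sup>2) \<partial>lebesgue)" .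
  show "(\<integral>\<^sup>+y\<in>dilate Q. ennreal (?h y) \<partial>lebesgue) \<le> ennreal ((real CARD('n) ^ CARD('n) * hl_p p \<phi> x) powr p) * emeasure lebesgue (dilate Q)"
    if Q: "Q \<in> cubes" and x: "x \<in> Q"
  proof -
    obtain a l where l: "0 < l" "dilate Q = cube a l" using dilate_in_cubes[OF Q] by (rule cubesE)
    have "x \<in> cube a l" using subset_dilate[OF Q] x l by blast
    then have sub: "cube a l \<subseteq> ball x (real CARD('n) * l)" by (rule cube_subset_ball)
    have "(\<integral>\<^sup>+y\<in>dilate Q. ennreal (?h y) \<partial>lebesgue) \<le> ennreal ((real CARD('n) * l) ^ CARD('n)) * hl_max (\<lambda>y. ennreal (?h y)) x"
      unfolding l by (rule set_integral_le_hl_max[OF _ sub]) (use l in simp)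
    also have "hl_max (\<lambda>y. ennreal (?h y)) x = ennreal (?m x)" using fin[of x] by simp
    also have "ennreal ((real CARD('n) * l) ^ CARD('n)) * ennreal (?m x) = ennreal (real CARD('n) ^ CARD('n) * ?m x) * emeasure lebesgue (dilate Q)"
      unfolding l emeasure_cube[OF l(1)] using l by (simp add: ennreal_mult[symmetric] power_mult_distrib mult_ac)
    also have "\<dots> \<le> ennreal ((real CARD('n) ^ CARD('n) * hl_p p \<phi> x) powr p) * emeasure lebesgue (dilate Q)"
    proof (intro mult_right_mono ennreal_leI)
      have N1: "(1::real) \<le> real CARD('n) ^ CARD('n)" by (intro one_le_power) simp
      then have "(real CARD('n) ^ CARD('n)) powr 1 \<le> (real CARD('n) ^ CARD('n)) powr p" using p by (intro powr_mono) auto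
      then have "real CARD('n) ^ CARD('n) \<le> (real CARD('n) ^ CARD('n)) powr p" using N1 by simp
      moreover have "(hl_p p \<phi> x) powr p = ?m x" using p by (simp add: hl_p_def powr_powr)
      ultimately show "real CARD('n) ^ CARD('n) * ?m x \<le> (real CARD('n) ^ CARD('n) * hl_p p \<phi> x) powr p"
        using N1 by (subst powr_mult) (auto simp: hl_p_nonneg intro!: mult_right_mono)
    qed simp
    finally show ?thesis .
  qed
qed

lemma Cauchy_Schwarz_real_nn:
  fixes u w :: "'a \<Rightarrow> real"
  assumes [measurable]: "u \<in> borel_measurable M" "w \<in> borel_measurable M"
    and U: "(\<integral>\<^sup>+x. ennreal ((u x)\<^sup>2) \<partial>M) \<le> ennreal a" and W: "(\<integral>\<^sup>+x. ennreal ((w x)\<^sup>2) \<partial>M) \<le> ennreal b"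
    and ab: "0 \<le> a" "0 \<le> b"
  shows "(\<integral>\<^sup>+x. ennreal (u x * w x) \<partial>M) \<le> ennreal (sqrt a * sqrt b)"
proof -
  let ?I = "\<integral>\<^sup>+x. ennreal \<bar>u x\<bar> * ennreal \<bar>w x\<bar> \<partial>M"
  have sq: "(ennreal \<bar>t\<bar>)\<^sup>2 = ennreal (t\<^sup>2)" for t :: real by (simp add: ennreal_power)
  have "?I\<^sup>2 \<le> (\<integral>\<^sup>+x. (ennreal \<bar>u x\<bar>)\<^sup>2 \<partial>M) * (\<integral>\<^sup>+x. (ennreal \<bar>w x\<bar>)\<^sup>2 \<partial>M)"
    by (rule Cauchy_Schwarz_nn_integral) measurable
  also have "\<dots> \<le> ennreal a * ennreal b" unfolding sq by (intro mult_mono U W) auto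
  also have "\<dots> = ennreal (a * b)" using ab by (intro ennreal_mult[symmetric])
  finally have le: "?I\<^sup>2 \<le> ennreal (a * b)" .
  have "?I \<le> ennreal (sqrt a * sqrt b)"
  proof (cases ?I)
    case (real r)
    then have "r\<^sup>2 \<le> a * b" using le ab by (simp add: ennreal_power)
    then have "r \<le> sqrt (a * b)" by (rule real_le_rsqrt)
    then show ?thesis unfolding real by (simp add: real_sqrt_mult ennreal_leI)
  next
    case top
    then show ?thesis using le by (simp add: top_unique power2_eq_square ennreal_top_mult)
  qed
  moreover have "(\<integral>\<^sup>+x. ennreal (u x * w x) \<partial>M) \<le> ?I"
    by (intro nn_integral_mono) (simp add: ennreal_mult[symmetric] ennreal_leI abs_mult[symmetric])
  ultimately show ?thesis by (rule order_trans[rotated])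
qed


section \<open>Bilinear forms of vector-valued functions\<close>

text \<open>
  The coordinates in a real basis are real; they are embedded into the scalar field because the
  operator acts on functions with values there.
\<close>

definition coordinate :: "(real ^ 'n \<Rightarrow> 'b::euclidean_space) \<Rightarrow> 'b \<Rightarrow> real ^ 'n \<Rightarrow> 'k::{real_normed_field,euclidean_space}" where
  "coordinate F b x = of_real (inner (F x) b)"

lemma coordinate_L2:
  assumes "F \<in> L2"
  shows "(coordinate F b :: real ^ 'n \<Rightarrow> 'k::{real_normed_field,euclidean_space}) \<in> L2"
proof -
  have Fm[measurable]: "F \<in> borel_measurable lebesgue" using assms L2_measurable by blast
  have "continuous_on UNIV (\<lambda>y. of_real (inner y b) :: 'k)" by (intro continuous_intros)
  then have "(\<lambda>y. of_real (inner y b) :: 'k) \<in> borel_measurable borel" by (rule borel_measurable_continuous_onI)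
  then have m: "(coordinate F b :: real ^ 'n \<Rightarrow> 'k) \<in> borel_measurable lebesgue"
    unfolding coordinate_def[abs_def] by (rule measurable_compose[OF Fm])
  have "(\<integral>\<^sup>+x. ennreal ((norm (coordinate F b x :: 'k))\<^sup>2) \<partial>lebesgue) \<le> (\<integral>\<^sup>+x. ennreal ((norm b)\<^sup>2) * ennreal ((norm (F x))\<^sup>2) \<partial>lebesgue)"
  proof (rule nn_integral_mono)
    fix x
    have "norm (coordinate F b x :: 'k) \<le> norm b * norm (F x)"
      using Cauchy_Schwarz_ineq2[of "F x" b] by (simp add: coordinate_def mult.commute)
    then have "(norm (coordinate F b x :: 'k))\<^sup>2 \<le> (norm b)\<^sup>2 * (norm (F x))\<^sup>2"
      unfolding power_mult_distrib[symmetric] by (rule power_mono) simp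
    then show "ennreal ((norm (coordinate F b x :: 'k))\<^sup>2) \<le> ennreal ((norm b)\<^sup>2) * ennreal ((norm (F x))\<^sup>2)"
      by (simp add: ennreal_mult[symmetric] ennreal_leI)
  qed
  also have "\<dots> = ennreal ((norm b)\<^sup>2) * (\<integral>\<^sup>+x. ennreal ((norm (F x))\<^sup>2) \<partial>lebesgue)"
    by (rule nn_integral_cmult) measurable
  also have "\<dots> < \<infinity>" using assms by (simp add: L2_iff ennreal_mult_less_top)
  finally show ?thesis using m by (simp add: L2_iff)
qed

lemma L2_component:
  fixes F :: "real ^ 'n \<Rightarrow> 'k::{real_normed_field,euclidean_space} ^ 'd"
  assumes F: "F \<in> L2"
  shows "(\<lambda>y. F y $ c) \<in> L2"
proof -
  have [measurable]: "F \<in> borel_measurable lebesgue" using F L2_measurable by blast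
  have "(\<lambda>y. F y $ c) \<in> borel_measurable lebesgue"
    by (rule measurable_compose[OF _ borel_measurable_continuous_onI[OF continuous_on_component[OF continuous_on_id]]]) measurable
  moreover have "(\<integral>\<^sup>+x. ennreal ((norm (F x $ c))\<^sup>2) \<partial>lebesgue) \<le> (\<integral>\<^sup>+x. ennreal ((norm (F x))\<^sup>2) \<partial>lebesgue)"
    by (intro nn_integral_mono ennreal_leI power_mono Finite_Cartesian_Product.norm_nth_le) simp
  ultimately show ?thesis using F by (auto simp: L2_iff intro: le_less_trans)
qed

text \<open>
  All that the iteration has to know about the weights on one cube. The bases \<open>Bv\<close> and
  \<open>Bu\<close> may depend on the cube, \<open>\<alpha>\<close> and \<open>\<gamma>\<close>
  bound the averages of the coordinates of \<open>F\<close> and \<open>G\<close>, and \<open>k b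
  u\<close> bounds the pairing of scalar multiples of \<open>b\<close> with \<open>u\<close>. The
  products have a common bound \<open>h\<close>, and \<open>H\<close> is a function that is at least
  \<open>h\<close> on the cube.
\<close>

definition local_bases ::
  "nat \<Rightarrow> (real ^ 'n \<Rightarrow> 'k::{real_normed_field,euclidean_space} ^ 'd) \<Rightarrow> (real ^ 'n \<Rightarrow> 'k ^ 'd) \<Rightarrow> (real ^ 'n \<Rightarrow> real) \<Rightarrow>
    (real ^ 'n) set \<Rightarrow> bool" where
  "local_bases m F G H Q \<longleftrightarrow> (\<exists>Bv Bu \<alpha> \<gamma> k h.
     finite Bv \<and> finite Bu \<and> card Bv \<le> m \<and> card Bu \<le> m \<and>
     (\<forall>y. (\<Sum>b\<in>Bv. inner y b *\<^sub>R b) = y) \<and> (\<forall>y. (\<Sum>u\<in>Bu. inner y u *\<^sub>R u) = y) \<and>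
     (\<forall>b\<in>Bv. 0 \<le> \<alpha> b \<and> (\<integral>\<^sup>+x\<in>dilate Q. ennreal \<bar>inner (F x) b\<bar> \<partial>lebesgue) \<le> ennreal (\<alpha> b) * emeasure lebesgue (dilate Q)) \<and>
     (\<forall>u\<in>Bu. 0 \<le> \<gamma> u \<and> (\<integral>\<^sup>+x\<in>dilate Q. ennreal \<bar>inner (G x) u\<bar> \<partial>lebesgue) \<le> ennreal (\<gamma> u) * emeasure lebesgue (dilate Q)) \<and>
     (\<forall>b\<in>Bv. \<forall>u\<in>Bu. 0 \<le> k b u \<and> \<alpha> b * \<gamma> u * k b u \<le> h \<and> (\<forall>t. \<bar>inner (t *s b) u\<bar> \<le> norm t * k b u)) \<and>
     0 \<le> h \<and> (\<forall>x\<in>Q. h \<le> H x))"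

lemma pairing_le_sum:
  fixes t :: "'k::{real_normed_field,euclidean_space} ^ 'd \<Rightarrow> 'k" and y :: "'k ^ 'd"
  assumes ex: "(\<Sum>u\<in>Bu. inner y u *\<^sub>R u) = y"
    and t: "\<And>b. b \<in> Bv \<Longrightarrow> norm (t b) \<le> c b"
    and k: "\<And>b u s. b \<in> Bv \<Longrightarrow> u \<in> Bu \<Longrightarrow> \<bar>inner (s *s b) u\<bar> \<le> norm (s::'k) * k b u"
    and k0: "\<And>b u. b \<in> Bv \<Longrightarrow> u \<in> Bu \<Longrightarrow> 0 \<le> k b u"
  shows "\<bar>inner (\<Sum>b\<in>Bv. t b *s b) y\<bar> \<le> (\<Sum>b\<in>Bv. \<Sum>u\<in>Bu. c b * k b u * \<bar>inner y u\<bar>)"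
proof -
  have "inner (\<Sum>b\<in>Bv. t b *s b) y = (\<Sum>b\<in>Bv. inner (t b *s b) (\<Sum>u\<in>Bu. inner y u *\<^sub>R u))"
    by (simp add: ex inner_sum_left)
  also have "\<dots> = (\<Sum>b\<in>Bv. \<Sum>u\<in>Bu. inner y u * inner (t b *s b) u)"
    by (simp add: inner_sum_right)
  also have "\<bar>\<dots>\<bar> \<le> (\<Sum>b\<in>Bv. \<bar>\<Sum>u\<in>Bu. inner y u * inner (t b *s b) u\<bar>)" by (rule sum_abs)
  also have "\<dots> \<le> (\<Sum>b\<in>Bv. \<Sum>u\<in>Bu. \<bar>inner y u * inner (t b *s b) u\<bar>)" by (intro sum_mono sum_abs)
  also have "\<dots> \<le> (\<Sum>b\<in>Bv. \<Sum>u\<in>Bu. c b * k b u * \<bar>inner y u\<bar>)"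
  proof (intro sum_mono)
    fix b u assume bu: "b \<in> Bv" "u \<in> Bu"
    have "\<bar>inner (t b *s b) u\<bar> \<le> norm (t b) * k b u" by (rule k[OF bu])
    also have "\<dots> \<le> c b * k b u" by (rule mult_right_mono[OF t[OF bu(1)] k0[OF bu]])
    finally have "\<bar>inner (t b *s b) u\<bar> * \<bar>inner y u\<bar> \<le> c b * k b u * \<bar>inner y u\<bar>" by (rule mult_right_mono) simp
    then show "\<bar>inner y u * inner (t b *s b) u\<bar> \<le> c b * k b u * \<bar>inner y u\<bar>" by (simp add: abs_mult mult.commute)
  qed
  finally show ?thesis .
qed

context dini_cz
begin

text \<open>
  \<open>T\<close> commutes with a change of basis of the target, because it acts on components and
  is linear over the scalars.
\<close>

lemma componentwise_expand:
  fixes F :: "real ^ 'n \<Rightarrow> 'k ^ 'd"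
  assumes F: "F \<in> L2" and S: "S \<in> sets lebesgue" and fin: "finite Bv"
    and ex: "\<And>y. (\<Sum>b\<in>Bv. inner y b *\<^sub>R b) = y"
  shows "AE x in lebesgue. componentwise T (restrict_to S F) x = (\<Sum>b\<in>Bv. T (restrict_to S (coordinate F b)) x *s b)"
proof -
  have "AE x in lebesgue. \<forall>c\<in>UNIV. T (\<lambda>y. restrict_to S F y $ c) x = (\<Sum>b\<in>Bv. b $ c * T (restrict_to S (coordinate F b)) x)"
  proof (rule AE_finite_allI)
    fix c :: 'd
    have eq: "(\<lambda>y. restrict_to S F y $ c) = (\<lambda>y. \<Sum>b\<in>Bv. b $ c * restrict_to S (coordinate F b) y)"
    proof
      fix y
      have "F y $ c = (\<Sum>b\<in>Bv. inner (F y) b *\<^sub>R b) $ c" by (simp add: ex)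
      also have "\<dots> = (\<Sum>b\<in>Bv. b $ c * coordinate F b y)"
        by (simp add: coordinate_def scaleR_conv_of_real[where 'a = 'k] mult.commute)
      finally show "restrict_to S F y $ c = (\<Sum>b\<in>Bv. b $ c * restrict_to S (coordinate F b) y)"
        by (cases "y \<in> S") auto
    qed
    show "AE x in lebesgue. T (\<lambda>y. restrict_to S F y $ c) x = (\<Sum>b\<in>Bv. b $ c * T (restrict_to S (coordinate F b)) x)"
      unfolding eq using T_sum[OF fin, of "\<lambda>b. restrict_to S (coordinate F b)" "\<lambda>b. b $ c"]
      by (simp add: L2_restrict_to[OF S coordinate_L2[OF F]])
  qed simp
  then show ?thesis
    by eventually_elim (simp add: componentwise_def vec_eq_iff mult.commute)
qed

lemma componentwise_measurable:
  fixes F :: "real ^ 'n \<Rightarrow> 'k ^ 'd"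
  assumes F: "F \<in> L2"
  shows "componentwise T F \<in> borel_measurable lebesgue"
proof -
  have "(\<lambda>x. T (\<lambda>y. F y $ c) x) \<in> borel_measurable lebesgue" for c
    using T_L2[OF L2_component[OF F]] L2_measurable by blast
  then have "(\<lambda>x. \<Sum>c\<in>UNIV. axis c (T (\<lambda>y. F y $ c) x)) \<in> borel_measurable lebesgue"
  proof (intro borel_measurable_sum)
    fix c :: 'd
    assume *: "\<And>c. T (\<lambda>y. F y $ c) \<in> borel_measurable lebesgue"
    have "continuous_on UNIV (\<lambda>z::'k. axis c z :: 'k ^ 'd)"
      unfolding axis_def
    proof (rule continuous_on_vec_lambda)
      show "continuous_on UNIV (\<lambda>z::'k. if i = c then z else 0)" for i by (cases "i = c") auto
    qed
    then have "(\<lambda>z::'k. axis c z :: 'k ^ 'd) \<in> borel_measurable borel" by (rule borel_measurable_continuous_onI)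
    then show "(\<lambda>x. axis c (T (\<lambda>y. F y $ c) x)) \<in> borel_measurable lebesgue" by (rule measurable_compose[OF *])
  qed
  moreover have "componentwise T F = (\<lambda>x. \<Sum>c\<in>UNIV. axis c (T (\<lambda>y. F y $ c) x))"
    by (rule ext) (simp add: componentwise_def vec_eq_iff axis_def)
  ultimately show ?thesis by simp
qed

text \<open>the integrand of the bilinear form localised to \<open>Q\<close>\<close>

definition theta :: "(real ^ 'n \<Rightarrow> 'k ^ 'd) \<Rightarrow> (real ^ 'n \<Rightarrow> 'k ^ 'd) \<Rightarrow> (real ^ 'n) set \<Rightarrow> real ^ 'n \<Rightarrow> ennreal" where
  "theta F G Q x = ennreal \<bar>inner (componentwise T (restrict_to (dilate Q) F) x) (G x)\<bar>"

text \<open>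
  The number of pairs of basis vectors, the constant of the local domination and the ratio of the
  measures of a cube and its dilate; the factor 2 is the price of integrating over the half of the
  cube that lies off the stopping cubes.
\<close>

definition form_const :: "nat \<Rightarrow> real" where
  "form_const m = 2 * (real m * (real m * (local_const m * (4 * real CARD('n) + 1) ^ CARD('n))))"

lemma form_const_nonneg: "0 \<le> form_const m"
  using loc_consts(5)[of m] by (simp add: form_const_def)

lemma theta_measurable:
  fixes F G :: "real ^ 'n \<Rightarrow> 'k ^ 'd"
  assumes "F \<in> L2" "G \<in> L2" "Q \<in> cubes"
  shows "theta F G Q \<in> borel_measurable lebesgue"
proof -
  have [measurable]: "componentwise T (restrict_to (dilate Q) F) \<in> borel_measurable lebesgue"
    using assms by (intro componentwise_measurable L2_restrict_to cubes_sets dilate_in_cubes)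
  have [measurable]: "G \<in> borel_measurable lebesgue" using assms L2_measurable by blast
  show ?thesis unfolding theta_def[abs_def] by measurable
qed

text \<open>
  On \<open>Q\<close> off the stopping cubes, and on each stopping cube for the difference, the
  coordinates of the operator are bounded by constants. Pairing with \<open>G\<close> gives the
  majorant \<open>S\<close>, whose integral is a sum of products of averages, each at most
  \<open>h\<close>; the constant \<open>h\<close> is charged to the integral of \<open>H\<close>
  over the half of \<open>Q\<close> off the stopping cubes.
\<close>

lemma form_step:
  fixes F G :: "real ^ 'n \<Rightarrow> 'k ^ 'd"
  assumes F: "F \<in> L2" and G: "G \<in> L2" and Q: "Q \<in> cubes"
    and H: "H \<in> borel_measurable lebesgue" and lb: "local_bases m F G H Q"
  obtains P S where "P \<subseteq> dyadic_subcubes Q" "countable P" "disjoint_family_on (\<lambda>R. R) P"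
    "emeasure lebesgue (\<Union>P) \<le> ennreal (1 / 2) * emeasure lebesgue Q" "S \<in> borel_measurable lebesgue"
    "(\<integral>\<^sup>+x\<in>Q. S x \<partial>lebesgue) \<le> ennreal (form_const m) * (\<integral>\<^sup>+x\<in>Q - \<Union>P. ennreal (H x) \<partial>lebesgue)"
    "AE x in lebesgue. x \<in> Q - \<Union>P \<longrightarrow> theta F G Q x \<le> S x"
    "\<forall>R\<in>P. AE x in lebesgue. x \<in> R \<longrightarrow> theta F G Q x \<le> S x + theta F G R x"
proof -
  have dQs[measurable]: "dilate Q \<in> sets lebesgue" by (rule cubes_sets[OF dilate_in_cubes[OF Q]])
  have Gm[measurable]: "G \<in> borel_measurable lebesgue" using G L2_measurable by blast
  obtain Bv Bu \<alpha> \<gamma> k h where fin: "finite Bv" "finite Bu" "card Bv \<le> m" "card Bu \<le> m"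
    and exv: "\<forall>y. (\<Sum>b\<in>Bv. inner y b *\<^sub>R b) = y" and exu: "\<forall>y. (\<Sum>u\<in>Bu. inner y u *\<^sub>R u) = y"
    and \<alpha>: "\<forall>b\<in>Bv. 0 \<le> \<alpha> b \<and> (\<integral>\<^sup>+x\<in>dilate Q. ennreal \<bar>inner (F x) b\<bar> \<partial>lebesgue) \<le> ennreal (\<alpha> b) * emeasure lebesgue (dilate Q)"
    and \<gamma>: "\<forall>u\<in>Bu. 0 \<le> \<gamma> u \<and> (\<integral>\<^sup>+x\<in>dilate Q. ennreal \<bar>inner (G x) u\<bar> \<partial>lebesgue) \<le> ennreal (\<gamma> u) * emeasure lebesgue (dilate Q)"
    and k: "\<forall>b\<in>Bv. \<forall>u\<in>Bu. 0 \<le> k b u \<and> \<alpha> b * \<gamma> u * k b u \<le> h \<and> (\<forall>t. \<bar>inner (t *s b) u\<bar> \<le> norm t * k b u)"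
    and h: "0 \<le> h" "\<forall>x\<in>Q. h \<le> H x"
    using lb unfolding local_bases_def by (elim exE conjE) (rule that)
  define A where "A = local_const m"
  have A: "0 \<le> A" unfolding A_def by (rule loc_consts)
  obtain P where PD: "P \<subseteq> dyadic_subcubes Q" and Pc: "countable P" and Pd: "disjoint_family_on (\<lambda>R. R) P"
    and half: "emeasure lebesgue (\<Union>P) \<le> ennreal (1 / 2) * emeasure lebesgue Q"
    and out: "\<forall>b\<in>Bv. AE x in lebesgue. x \<in> Q - \<Union>P \<longrightarrow> norm (T (restrict_to (dilate Q) (coordinate F b)) x) \<le> local_const m * \<alpha> b"
    and ins: "\<forall>R\<in>P. \<forall>b\<in>Bv. AE x in lebesgue. x \<in> R \<longrightarrow>
       norm (T (restrict_to (dilate Q) (coordinate F b)) x - T (restrict_to (dilate R) (coordinate F b)) x) \<le> local_const m * \<alpha> b"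
  proof (rule local_domination[OF Q fin(1,3)])
    show "(coordinate F b :: real ^ 'n \<Rightarrow> 'k) \<in> L2" for b by (rule coordinate_L2[OF F])
    show "0 \<le> \<alpha> b" if "b \<in> Bv" for b using \<alpha> that by blast
    show "(\<integral>\<^sup>+x\<in>dilate Q. ennreal (norm (coordinate F b x :: 'k)) \<partial>lebesgue) \<le> ennreal (\<alpha> b) * emeasure lebesgue (dilate Q)"
      if "b \<in> Bv" for b using \<alpha> that by (simp add: coordinate_def)
  qed
  have Rcube: "R \<in> cubes" if "R \<in> P" for R using that PD dyadic_in_cubes[OF Q] by blast
  have Rs: "R \<in> sets lebesgue" if "R \<in> P" for R using Rcube[OF that] cubes_sets by blast
  have PUs: "\<Union>P \<in> sets lebesgue" using Pc Rs by (intro sets.countable_Union) auto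
  have PUQ: "\<Union>P \<subseteq> Q" using PD dyadic_subset[OF Q] by blast
  define s where "s x = (\<Sum>b\<in>Bv. \<Sum>u\<in>Bu. A * \<alpha> b * k b u * \<bar>inner (G x) u\<bar>)" for x
  have sm[measurable]: "s \<in> borel_measurable lebesgue" unfolding s_def[abs_def] by measurable
  have pair: "\<bar>inner (\<Sum>b\<in>Bv. t b *s b) (G x)\<bar> \<le> s x" if "\<forall>b\<in>Bv. norm (t b) \<le> A * \<alpha> b" for t x
    unfolding s_def using that exu k by (intro pairing_le_sum) auto
  have sQ: "(\<integral>\<^sup>+x\<in>Q. ennreal (s x) \<partial>lebesgue) \<le> ennreal (form_const m) * (\<integral>\<^sup>+x\<in>Q - \<Union>P. ennreal (H x) \<partial>lebesgue)"
  proof -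
    have c0: "0 \<le> A * \<alpha> b * k b u" if "b \<in> Bv" "u \<in> Bu" for b u using that A \<alpha> k by simp
    have "(\<integral>\<^sup>+x\<in>Q. ennreal (s x) \<partial>lebesgue) \<le> (\<integral>\<^sup>+x. (\<Sum>b\<in>Bv. \<Sum>u\<in>Bu. ennreal (A * \<alpha> b * k b u) * (ennreal \<bar>inner (G x) u\<bar> * indicator (dilate Q) x)) \<partial>lebesgue)"
    proof (rule nn_integral_mono)
      fix x
      have "ennreal (s x) = (\<Sum>b\<in>Bv. \<Sum>u\<in>Bu. ennreal (A * \<alpha> b * k b u) * ennreal \<bar>inner (G x) u\<bar>)"
      proof -
        have "(\<Sum>b\<in>Bv. \<Sum>u\<in>Bu. ennreal (A * \<alpha> b * k b u) * ennreal \<bar>inner (G x) u\<bar>)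
            = (\<Sum>b\<in>Bv. \<Sum>u\<in>Bu. ennreal (A * \<alpha> b * k b u * \<bar>inner (G x) u\<bar>))"
          by (intro sum.cong refl ennreal_mult[symmetric] c0 abs_ge_zero)
        also have "\<dots> = (\<Sum>b\<in>Bv. ennreal (\<Sum>u\<in>Bu. A * \<alpha> b * k b u * \<bar>inner (G x) u\<bar>))"
          by (intro sum.cong refl sum_ennreal mult_nonneg_nonneg[OF c0 abs_ge_zero])
        also have "\<dots> = ennreal (s x)" unfolding s_def
          by (intro sum_ennreal sum_nonneg mult_nonneg_nonneg[OF c0 abs_ge_zero])
        finally show ?thesis by (rule sym)
      qed
      then show "ennreal (s x) * indicator Q x \<le> (\<Sum>b\<in>Bv. \<Sum>u\<in>Bu. ennreal (A * \<alpha> b * k b u) * (ennreal \<bar>inner (G x) u\<bar> * indicator (dilate Q) x))"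
        using subset_dilate[OF Q] by (cases "x \<in> Q") auto
    qed
    also have "\<dots> = (\<Sum>b\<in>Bv. \<Sum>u\<in>Bu. \<integral>\<^sup>+x. ennreal (A * \<alpha> b * k b u) * (ennreal \<bar>inner (G x) u\<bar> * indicator (dilate Q) x) \<partial>lebesgue)"
      using dQs by (subst nn_integral_sum, measurable, intro sum.cong refl, subst nn_integral_sum, measurable)
    also have "\<dots> = (\<Sum>b\<in>Bv. \<Sum>u\<in>Bu. ennreal (A * \<alpha> b * k b u) * (\<integral>\<^sup>+x\<in>dilate Q. ennreal \<bar>inner (G x) u\<bar> \<partial>lebesgue))"
      using dQs by (intro sum.cong refl nn_integral_cmult) measurable
    also have "\<dots> \<le> (\<Sum>b\<in>Bv. \<Sum>u\<in>Bu. ennreal (A * h) * emeasure lebesgue (dilate Q))"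
    proof (intro sum_mono)
      fix b u assume bu: "b \<in> Bv" "u \<in> Bu"
      have "ennreal (A * \<alpha> b * k b u) * (\<integral>\<^sup>+x\<in>dilate Q. ennreal \<bar>inner (G x) u\<bar> \<partial>lebesgue)
          \<le> ennreal (A * \<alpha> b * k b u) * (ennreal (\<gamma> u) * emeasure lebesgue (dilate Q))"
        using \<gamma> bu by (intro mult_left_mono) auto
      also have "\<dots> = ennreal (A * \<alpha> b * k b u * \<gamma> u) * emeasure lebesgue (dilate Q)"
        using \<gamma> bu by (subst ennreal_mult[OF c0[OF bu]]) (auto simp: mult.assoc)
      also have "A * \<alpha> b * k b u * \<gamma> u = A * (\<alpha> b * \<gamma> u * k b u)" by (simp add: mult_ac)
      also have "ennreal (A * (\<alpha> b * \<gamma> u * k b u)) * emeasure lebesgue (dilate Q) \<le> ennreal (A * h) * emeasure lebesgue (dilate Q)"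
        using k bu A by (intro mult_right_mono ennreal_leI mult_left_mono) auto
      finally show "ennreal (A * \<alpha> b * k b u) * (\<integral>\<^sup>+x\<in>dilate Q. ennreal \<bar>inner (G x) u\<bar> \<partial>lebesgue) \<le> ennreal (A * h) * emeasure lebesgue (dilate Q)" .
    qed
    also have "\<dots> = ennreal (real (card Bv) * (real (card Bu) * (A * h))) * emeasure lebesgue (dilate Q)"
      using A h(1) by (simp add: ennreal_of_nat_eq_real_of_nat ennreal_mult mult.assoc)
    also have "\<dots> \<le> ennreal (real m * (real m * (A * h))) * emeasure lebesgue (dilate Q)"
      using fin A h(1) by (intro mult_right_mono ennreal_leI mult_mono) auto
    also have "\<dots> = ennreal (real m * (real m * (A * h)) * (4 * real CARD('n) + 1) ^ CARD('n)) * emeasure lebesgue Q"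
      unfolding emeasure_dilate[OF Q] using A h(1) by (simp add: ennreal_mult mult.assoc)
    also have "real m * (real m * (A * h)) * (4 * real CARD('n) + 1) ^ CARD('n) = form_const m * (h * (1 / 2))"
      by (simp add: form_const_def A_def)
    also have "ennreal (form_const m * (h * (1 / 2))) * emeasure lebesgue Q = ennreal (form_const m) * (ennreal h * (ennreal (1 / 2) * emeasure lebesgue Q))"
      using form_const_nonneg[of m] h(1) by (subst ennreal_mult, simp, simp, subst ennreal_mult) (auto simp: mult.assoc)
    also have "\<dots> \<le> ennreal (form_const m) * (\<integral>\<^sup>+x\<in>Q - \<Union>P. ennreal (H x) \<partial>lebesgue)"
    proof (rule mult_left_mono)
      have "ennreal (1 / 2) * emeasure lebesgue Q \<le> emeasure lebesgue (Q - \<Union>P)"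
      proof -
        obtain q where q: "0 < q" "emeasure lebesgue Q = ennreal q" using emeasure_cubes[OF Q] measure_cubes_pos[OF Q] by blast
        have "emeasure lebesgue Q \<le> emeasure lebesgue (Q - \<Union>P) + emeasure lebesgue (\<Union>P)"
          using PUQ emeasure_subadditive[of "Q - \<Union>P" lebesgue "\<Union>P"] cubes_sets[OF Q] PUs by (simp add: Un_absorb2)
        also have "\<dots> \<le> emeasure lebesgue (Q - \<Union>P) + ennreal (1 / 2 * q)"
        proof (rule add_left_mono)
          have "ennreal (1 / 2 * q) = ennreal (1 / 2) * ennreal q" using q by (intro ennreal_mult) auto
          then show "emeasure lebesgue (\<Union>P) \<le> ennreal (1 / 2 * q)" using half by (simp only: q(2))
        qed
        finally have le: "ennreal q \<le> emeasure lebesgue (Q - \<Union>P) + ennreal (1 / 2 * q)" unfolding q(2) .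
        show ?thesis
        proof (cases "emeasure lebesgue (Q - \<Union>P)")
          case (real r)
          have "ennreal q \<le> ennreal (r + 1 / 2 * q)" using le real q by (simp add: ennreal_plus)
          moreover have "0 \<le> r + 1 / 2 * q" using real q by simp
          ultimately have "q \<le> r + 1 / 2 * q" by (simp only: ennreal_le_iff)
          then have "ennreal (1 / 2 * q) \<le> ennreal r" by (intro ennreal_leI) simp
          moreover have "ennreal (1 / 2 * q) = ennreal (1 / 2) * ennreal q" using q by (intro ennreal_mult) auto
          ultimately show ?thesis unfolding real q(2) by simp
        qed simp
      qed
      then have "ennreal h * (ennreal (1 / 2) * emeasure lebesgue Q) \<le> ennreal h * emeasure lebesgue (Q - \<Union>P)" by (rule mult_left_mono) simp
      also have "\<dots> = (\<integral>\<^sup>+x\<in>Q - \<Union>P. ennreal h \<partial>lebesgue)"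
        by (rule nn_integral_cmult_indicator[symmetric, OF sets.Diff[OF cubes_sets[OF Q] PUs]])
      also have "\<dots> \<le> (\<integral>\<^sup>+x\<in>Q - \<Union>P. ennreal (H x) \<partial>lebesgue)"
        using h by (intro nn_integral_mono) (auto simp: indicator_def intro: ennreal_leI)
      finally show "ennreal h * (ennreal (1 / 2) * emeasure lebesgue Q) \<le> (\<integral>\<^sup>+x\<in>Q - \<Union>P. ennreal (H x) \<partial>lebesgue)" .
    qed simp
    finally show ?thesis .
  qed
  have expQ: "AE x in lebesgue. componentwise T (restrict_to (dilate R) F) x = (\<Sum>b\<in>Bv. T (restrict_to (dilate R) (coordinate F b)) x *s b)"
    if "R \<in> cubes" for R
    using componentwise_expand[OF F cubes_sets[OF dilate_in_cubes[OF that]] fin(1)] exv by blast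
  have 1: "AE x in lebesgue. x \<in> Q - \<Union>P \<longrightarrow> theta F G Q x \<le> ennreal (s x)"
  proof -
    have "AE x in lebesgue. \<forall>b\<in>Bv. x \<in> Q - \<Union>P \<longrightarrow> norm (T (restrict_to (dilate Q) (coordinate F b)) x) \<le> A * \<alpha> b"
      using out unfolding A_def by (intro AE_finite_allI fin(1)) blast
    then show ?thesis using expQ[OF Q]
    proof eventually_elim
      fix x assume n: "\<forall>b\<in>Bv. x \<in> Q - \<Union>P \<longrightarrow> norm (T (restrict_to (dilate Q) (coordinate F b)) x) \<le> A * \<alpha> b"
        and e: "componentwise T (restrict_to (dilate Q) F) x = (\<Sum>b\<in>Bv. T (restrict_to (dilate Q) (coordinate F b)) x *s b)"
      show "x \<in> Q - \<Union>P \<longrightarrow> theta F G Q x \<le> ennreal (s x)"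
        unfolding theta_def e using n by (auto intro!: ennreal_leI pair)
    qed
  qed
  have 2: "AE x in lebesgue. x \<in> R \<longrightarrow> theta F G Q x \<le> ennreal (s x) + theta F G R x" if R: "R \<in> P" for R
  proof -
    have "AE x in lebesgue. \<forall>b\<in>Bv. x \<in> R \<longrightarrow>
       norm (T (restrict_to (dilate Q) (coordinate F b)) x - T (restrict_to (dilate R) (coordinate F b)) x) \<le> A * \<alpha> b"
      using ins R unfolding A_def by (intro AE_finite_allI fin(1)) blast
    then show ?thesis using expQ[OF Q] expQ[OF Rcube[OF R]]
    proof eventually_elim
      fix x assume n: "\<forall>b\<in>Bv. x \<in> R \<longrightarrow>
          norm (T (restrict_to (dilate Q) (coordinate F b)) x - T (restrict_to (dilate R) (coordinate F b)) x) \<le> A * \<alpha> b"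
        and e: "componentwise T (restrict_to (dilate Q) F) x = (\<Sum>b\<in>Bv. T (restrict_to (dilate Q) (coordinate F b)) x *s b)"
        and e': "componentwise T (restrict_to (dilate R) F) x = (\<Sum>b\<in>Bv. T (restrict_to (dilate R) (coordinate F b)) x *s b)"
      show "x \<in> R \<longrightarrow> theta F G Q x \<le> ennreal (s x) + theta F G R x"
      proof
        assume x: "x \<in> R"
        let ?d = "\<Sum>b\<in>Bv. (T (restrict_to (dilate Q) (coordinate F b)) x - T (restrict_to (dilate R) (coordinate F b)) x) *s b"
        have "componentwise T (restrict_to (dilate Q) F) x = ?d + componentwise T (restrict_to (dilate R) F) x"
          unfolding e e' by (simp add: vector_sub_rdistrib sum_subtractf)
        then have "\<bar>inner (componentwise T (restrict_to (dilate Q) F) x) (G x)\<bar> \<le> \<bar>inner ?d (G x)\<bar> + \<bar>inner (componentwise T (restrict_to (dilate R) F) x) (G x)\<bar>"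
          by (simp add: inner_add_left)
        also have "\<bar>inner ?d (G x)\<bar> \<le> s x" by (rule pair) (use n x in auto)
        finally have "theta F G Q x \<le> ennreal (s x + \<bar>inner (componentwise T (restrict_to (dilate R) F) x) (G x)\<bar>)"
          unfolding theta_def by (simp add: ennreal_leI)
        also have "\<dots> = ennreal (s x) + theta F G R x" unfolding theta_def
        proof (rule ennreal_plus)
          show "0 \<le> s x" using order_trans[OF abs_ge_zero pair[of "\<lambda>_. 0" x]] A \<alpha> by simp
        qed simp
        finally show "theta F G Q x \<le> ennreal (s x) + theta F G R x" .
      qed
    qed
  qed
  show ?thesis
    by (rule that[OF PD Pc Pd half _ sQ 1]) (use 2 in auto)
qed

text \<open>
  The integrals of \<open>H\<close> that successive generations are charged to are over disjoint
  sets, so the constant does not grow with \<open>n\<close>.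
\<close>

lemma form_bound_off_small_set:
  fixes F G :: "real ^ 'n \<Rightarrow> 'k ^ 'd"
  assumes F: "F \<in> L2" and G: "G \<in> L2"
    and H: "H \<in> borel_measurable lebesgue" and lb: "\<And>Q. Q \<in> cubes \<Longrightarrow> local_bases m F G H Q"
  shows "Q \<in> cubes \<Longrightarrow> \<exists>Z\<in>sets lebesgue. Z \<subseteq> Q \<and> emeasure lebesgue Z \<le> ennreal (1 / 2 ^ n) * emeasure lebesgue Q \<and>
    (\<integral>\<^sup>+x\<in>Q - Z. theta F G Q x \<partial>lebesgue) \<le> ennreal (form_const m) * (\<integral>\<^sup>+x\<in>Q. ennreal (H x) \<partial>lebesgue)"
proof (induction n arbitrary: Q)
  case 0
  then show ?case by (intro bexI[of _ Q]) (auto simp: cubes_sets)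
next
  case (Suc n)
  note Q = Suc.prems
  obtain P S where PD: "P \<subseteq> dyadic_subcubes Q" and Pc: "countable P" and Pd: "disjoint_family_on (\<lambda>R. R) P"
    and half: "emeasure lebesgue (\<Union>P) \<le> ennreal (1 / 2) * emeasure lebesgue Q" and Sm[measurable]: "S \<in> borel_measurable lebesgue"
    and SQ: "(\<integral>\<^sup>+x\<in>Q. S x \<partial>lebesgue) \<le> ennreal (form_const m) * (\<integral>\<^sup>+x\<in>Q - \<Union>P. ennreal (H x) \<partial>lebesgue)"
    and out: "AE x in lebesgue. x \<in> Q - \<Union>P \<longrightarrow> theta F G Q x \<le> S x"
    and ins: "\<forall>R\<in>P. AE x in lebesgue. x \<in> R \<longrightarrow> theta F G Q x \<le> S x + theta F G R x"
    by (rule form_step[OF F G Q H lb[OF Q]])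
  have Rcube: "R \<in> cubes" if "R \<in> P" for R using that PD dyadic_in_cubes[OF Q] by blast
  have Rs: "R \<in> sets lebesgue" if "R \<in> P" for R using Rcube[OF that] cubes_sets by blast
  have PUs: "\<Union>P \<in> sets lebesgue" using Pc Rs by (intro sets.countable_Union) auto
  have PUQ: "\<Union>P \<subseteq> Q" using PD dyadic_subset[OF Q] by blast
  have Qs: "Q \<in> sets lebesgue" by (rule cubes_sets[OF Q])
  let ?C = "ennreal (form_const m)"
  have "\<forall>R\<in>P. \<exists>Z. Z \<in> sets lebesgue \<and> Z \<subseteq> R \<and> emeasure lebesgue Z \<le> ennreal (1 / 2 ^ n) * emeasure lebesgue R \<and>
    (\<integral>\<^sup>+x\<in>R - Z. theta F G R x \<partial>lebesgue) \<le> ?C * (\<integral>\<^sup>+x\<in>R. ennreal (H x) \<partial>lebesgue)"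
    using Suc.IH[OF Rcube] by blast
  then obtain Z where Z: "\<forall>R\<in>P. Z R \<in> sets lebesgue \<and> Z R \<subseteq> R \<and> emeasure lebesgue (Z R) \<le> ennreal (1 / 2 ^ n) * emeasure lebesgue R \<and>
    (\<integral>\<^sup>+x\<in>R - Z R. theta F G R x \<partial>lebesgue) \<le> ?C * (\<integral>\<^sup>+x\<in>R. ennreal (H x) \<partial>lebesgue)"
    by (rule bchoice[THEN exE])
  define Y where "Y = (\<Union>R\<in>P. Z R)"
  have Ys: "Y \<in> sets lebesgue" unfolding Y_def using Pc Z by (intro sets.countable_UN') auto
  have YP: "Y \<subseteq> \<Union>P" unfolding Y_def using Z by blast
  have sumR: "(\<integral>\<^sup>+R. emeasure lebesgue R \<partial>count_space P) = emeasure lebesgue (\<Union>P)"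
    using emeasure_UN_countable[of P "\<lambda>R. R" lebesgue] Pc Pd Rs by simp
  have Ym: "emeasure lebesgue Y \<le> ennreal (1 / 2 ^ Suc n) * emeasure lebesgue Q"
  proof -
    have "emeasure lebesgue Y \<le> (\<integral>\<^sup>+R. emeasure lebesgue (Z R) \<partial>count_space P)"
      unfolding Y_def using Pc Z by (intro emeasure_UN_le_count_space) auto
    also have "\<dots> \<le> (\<integral>\<^sup>+R. ennreal (1 / 2 ^ n) * emeasure lebesgue R \<partial>count_space P)"
      using Z by (intro nn_integral_mono) auto
    also have "\<dots> = ennreal (1 / 2 ^ n) * emeasure lebesgue (\<Union>P)" unfolding sumR[symmetric] by (rule nn_integral_cmult) simp
    also have "\<dots> \<le> ennreal (1 / 2 ^ n) * (ennreal (1 / 2) * emeasure lebesgue Q)" by (rule mult_left_mono[OF half]) simp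
    also have "\<dots> = ennreal (1 / 2 ^ Suc n) * emeasure lebesgue Q"
      unfolding mult.assoc[symmetric] by (subst ennreal_mult[symmetric]) (auto simp: mult.commute)
    finally show ?thesis .
  qed
  have thQ[measurable]: "theta F G Q \<in> borel_measurable lebesgue" by (rule theta_measurable[OF F G Q])
  have thR: "theta F G R \<in> borel_measurable lebesgue" if "R \<in> P" for R by (rule theta_measurable[OF F G Rcube[OF that]])
  have RZd: "disjoint_family_on (\<lambda>R. R - Z R) P"
    using Pd unfolding disjoint_family_on_def by blast
  have PZs: "(\<Union>R\<in>P. R - Z R) \<in> sets lebesgue" using Pc Rs Z by (intro sets.countable_UN' sets.Diff) auto
  have QY: "Q - Y \<subseteq> (Q - \<Union>P) \<union> (\<Union>R\<in>P. R - Z R)" unfolding Y_def by blast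
  have "(\<integral>\<^sup>+x\<in>Q - Y. theta F G Q x \<partial>lebesgue)
      \<le> (\<integral>\<^sup>+x. theta F G Q x * indicator (Q - \<Union>P) x + theta F G Q x * indicator (\<Union>R\<in>P. R - Z R) x \<partial>lebesgue)"
  proof (rule nn_integral_mono)
    fix x
    show "theta F G Q x * indicator (Q - Y) x \<le> theta F G Q x * indicator (Q - \<Union>P) x + theta F G Q x * indicator (\<Union>R\<in>P. R - Z R) x"
    proof (cases "x \<in> Q - Y")
      case True
      then have "x \<in> (Q - \<Union>P) \<union> (\<Union>R\<in>P. R - Z R)" using QY by blast
      then consider "x \<in> Q - \<Union>P" | "x \<in> (\<Union>R\<in>P. R - Z R)" by blast
      then show ?thesis by cases (simp_all only: indicator_simps mult_1_right True add_increasing add_increasing2 order_refl zero_le)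
    qed (simp only: indicator_simps mult_zero_right zero_le not_False_eq_True)
  qed
  also have "\<dots> = (\<integral>\<^sup>+x\<in>Q - \<Union>P. theta F G Q x \<partial>lebesgue) + (\<integral>\<^sup>+x\<in>(\<Union>R\<in>P. R - Z R). theta F G Q x \<partial>lebesgue)"
    by (intro nn_integral_add borel_measurable_times_ennreal borel_measurable_indicator thQ sets.Diff Qs PUs PZs)
  also have "(\<integral>\<^sup>+x\<in>(\<Union>R\<in>P. R - Z R). theta F G Q x \<partial>lebesgue) = (\<integral>\<^sup>+R. (\<integral>\<^sup>+x\<in>R - Z R. theta F G Q x \<partial>lebesgue) \<partial>count_space P)"
    by (rule set_nn_integral_UN_disjoint[OF Pc RZd _ thQ]) (use Rs Z in \<open>auto intro: sets.Diff\<close>)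
  also have "\<dots> \<le> (\<integral>\<^sup>+R. (\<integral>\<^sup>+x\<in>R. S x \<partial>lebesgue) + ?C * (\<integral>\<^sup>+x\<in>R. ennreal (H x) \<partial>lebesgue) \<partial>count_space P)"
  proof (rule nn_integral_mono)
    fix R assume "R \<in> space (count_space P)"
    then have R: "R \<in> P" by simp
    have RZ: "R - Z R \<in> sets lebesgue" using Rs[OF R] Z R by (intro sets.Diff) auto
    have "(\<integral>\<^sup>+x\<in>R - Z R. theta F G Q x \<partial>lebesgue) \<le> (\<integral>\<^sup>+x. S x * indicator R x + theta F G R x * indicator (R - Z R) x \<partial>lebesgue)"
    proof (rule nn_integral_mono_AE)
      show "AE x in lebesgue. theta F G Q x * indicator (R - Z R) x \<le> S x * indicator R x + theta F G R x * indicator (R - Z R) x"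
        using bspec[OF ins R] by eventually_elim (auto simp: indicator_def)
    qed
    also have "\<dots> = (\<integral>\<^sup>+x\<in>R. S x \<partial>lebesgue) + (\<integral>\<^sup>+x\<in>R - Z R. theta F G R x \<partial>lebesgue)"
      by (intro nn_integral_add borel_measurable_times_ennreal borel_measurable_indicator thR[OF R] Sm Rs[OF R] RZ)
    also have "\<dots> \<le> (\<integral>\<^sup>+x\<in>R. S x \<partial>lebesgue) + ?C * (\<integral>\<^sup>+x\<in>R. ennreal (H x) \<partial>lebesgue)"
      using Z R by (intro add_left_mono) auto
    finally show "(\<integral>\<^sup>+x\<in>R - Z R. theta F G Q x \<partial>lebesgue) \<le> (\<integral>\<^sup>+x\<in>R. S x \<partial>lebesgue) + ?C * (\<integral>\<^sup>+x\<in>R. ennreal (H x) \<partial>lebesgue)" .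
  qed
  also have "\<dots> = (\<integral>\<^sup>+R. (\<integral>\<^sup>+x\<in>R. S x \<partial>lebesgue) \<partial>count_space P) + ?C * (\<integral>\<^sup>+R. (\<integral>\<^sup>+x\<in>R. ennreal (H x) \<partial>lebesgue) \<partial>count_space P)"
    by (subst nn_integral_add, simp, simp, subst nn_integral_cmult) auto
  also have "(\<integral>\<^sup>+R. (\<integral>\<^sup>+x\<in>R. S x \<partial>lebesgue) \<partial>count_space P) = (\<integral>\<^sup>+x\<in>\<Union>P. S x \<partial>lebesgue)"
    using set_nn_integral_UN_disjoint[OF Pc Pd Rs Sm] by simp
  also have "(\<integral>\<^sup>+R. (\<integral>\<^sup>+x\<in>R. ennreal (H x) \<partial>lebesgue) \<partial>count_space P) = (\<integral>\<^sup>+x\<in>\<Union>P. ennreal (H x) \<partial>lebesgue)"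
    using set_nn_integral_UN_disjoint[OF Pc Pd Rs, of "\<lambda>x. ennreal (H x)"] H by simp
  also have "(\<integral>\<^sup>+x\<in>Q - \<Union>P. theta F G Q x \<partial>lebesgue) \<le> (\<integral>\<^sup>+x\<in>Q - \<Union>P. S x \<partial>lebesgue)"
  proof (rule nn_integral_mono_AE)
    show "AE x in lebesgue. theta F G Q x * indicator (Q - \<Union>P) x \<le> S x * indicator (Q - \<Union>P) x"
      using out
    proof eventually_elim
      fix x assume o: "x \<in> Q - \<Union>P \<longrightarrow> theta F G Q x \<le> S x"
      show "theta F G Q x * indicator (Q - \<Union>P) x \<le> S x * indicator (Q - \<Union>P) x"
      proof (cases "x \<in> Q - \<Union>P")
        case True
        then show ?thesis using o by (intro mult_right_mono) simp_all
      qed (simp only: indicator_simps mult_zero_right order_refl not_False_eq_True)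
    qed
  qed
  finally have "(\<integral>\<^sup>+x\<in>Q - Y. theta F G Q x \<partial>lebesgue)
      \<le> ((\<integral>\<^sup>+x\<in>Q - \<Union>P. S x \<partial>lebesgue) + (\<integral>\<^sup>+x\<in>\<Union>P. S x \<partial>lebesgue)) + ?C * (\<integral>\<^sup>+x\<in>\<Union>P. ennreal (H x) \<partial>lebesgue)"
    by (simp add: add_right_mono add.assoc)
  also have "(\<integral>\<^sup>+x\<in>Q - \<Union>P. S x \<partial>lebesgue) + (\<integral>\<^sup>+x\<in>\<Union>P. S x \<partial>lebesgue) = (\<integral>\<^sup>+x. S x * indicator (Q - \<Union>P) x + S x * indicator (\<Union>P) x \<partial>lebesgue)"
    by (intro nn_integral_add[symmetric] borel_measurable_times_ennreal borel_measurable_indicator Sm sets.Diff Qs PUs)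
  also have "\<dots> = (\<integral>\<^sup>+x\<in>Q. S x \<partial>lebesgue)"
    using PUQ by (intro nn_integral_cong) (auto simp: indicator_def)
  also have "(\<integral>\<^sup>+x\<in>Q. S x \<partial>lebesgue) + ?C * (\<integral>\<^sup>+x\<in>\<Union>P. ennreal (H x) \<partial>lebesgue)
      \<le> ?C * (\<integral>\<^sup>+x\<in>Q - \<Union>P. ennreal (H x) \<partial>lebesgue) + ?C * (\<integral>\<^sup>+x\<in>\<Union>P. ennreal (H x) \<partial>lebesgue)"
    by (intro add_right_mono SQ)
  also have "\<dots> = ?C * ((\<integral>\<^sup>+x\<in>Q - \<Union>P. ennreal (H x) \<partial>lebesgue) + (\<integral>\<^sup>+x\<in>\<Union>P. ennreal (H x) \<partial>lebesgue))"
    by (rule distrib_left[symmetric])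
  also have "(\<integral>\<^sup>+x\<in>Q - \<Union>P. ennreal (H x) \<partial>lebesgue) + (\<integral>\<^sup>+x\<in>\<Union>P. ennreal (H x) \<partial>lebesgue)
      = (\<integral>\<^sup>+x. ennreal (H x) * indicator (Q - \<Union>P) x + ennreal (H x) * indicator (\<Union>P) x \<partial>lebesgue)"
    by (intro nn_integral_add[symmetric] borel_measurable_times_ennreal borel_measurable_indicator sets.Diff Qs PUs
        measurable_compose[OF H measurable_ennreal])
  also have "(\<integral>\<^sup>+x. ennreal (H x) * indicator (Q - \<Union>P) x + ennreal (H x) * indicator (\<Union>P) x \<partial>lebesgue) = (\<integral>\<^sup>+x\<in>Q. ennreal (H x) \<partial>lebesgue)"
    using PUQ by (intro nn_integral_cong) (auto simp: indicator_def)
  finally show ?case using Ys Ym YP PUQ by blast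
qed

text \<open>
  Truncation of the integrand makes its integral over the remaining set of measure at most
  $2^{-n}|Q|$ negligible.
\<close>

theorem form_bound:
  fixes F G :: "real ^ 'n \<Rightarrow> 'k ^ 'd"
  assumes F: "F \<in> L2" and G: "G \<in> L2" and Q: "Q \<in> cubes"
    and H: "H \<in> borel_measurable lebesgue" and lb: "\<And>Q. Q \<in> cubes \<Longrightarrow> local_bases m F G H Q"
  shows "(\<integral>\<^sup>+x\<in>Q. theta F G Q x \<partial>lebesgue) \<le> ennreal (form_const m) * (\<integral>\<^sup>+x\<in>Q. ennreal (H x) \<partial>lebesgue)" (is "_ \<le> ?K")
proof -
  have thQ[measurable]: "theta F G Q \<in> borel_measurable lebesgue" by (rule theta_measurable[OF F G Q])
  have Qs[measurable]: "Q \<in> sets lebesgue" by (rule cubes_sets[OF Q])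
  obtain q where q: "0 < q" "emeasure lebesgue Q = ennreal q" using emeasure_cubes[OF Q] measure_cubes_pos[OF Q] by blast
  have trunc: "(\<integral>\<^sup>+x\<in>Q. min (theta F G Q x) (of_nat k) \<partial>lebesgue) \<le> ?K" for k :: nat
  proof (rule ennreal_le_epsilon)
    fix e :: real assume e: "0 < e"
    obtain n where n: "real k * q / e < 2 ^ n" using real_arch_pow[of 2] by auto
    obtain Z where Z: "Z \<in> sets lebesgue" "Z \<subseteq> Q" "emeasure lebesgue Z \<le> ennreal (1 / 2 ^ n) * emeasure lebesgue Q"
      "(\<integral>\<^sup>+x\<in>Q - Z. theta F G Q x \<partial>lebesgue) \<le> ?K"
      using form_bound_off_small_set[OF F G H lb Q, of n] by blast
    have "(\<integral>\<^sup>+x\<in>Q. min (theta F G Q x) (of_nat k) \<partial>lebesgue) \<le> (\<integral>\<^sup>+x. theta F G Q x * indicator (Q - Z) x + of_nat k * indicator Z x \<partial>lebesgue)"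
      by (intro nn_integral_mono) (auto simp: indicator_def)
    also have "\<dots> = (\<integral>\<^sup>+x\<in>Q - Z. theta F G Q x \<partial>lebesgue) + of_nat k * emeasure lebesgue Z"
      using Z(1) by (subst nn_integral_add) (auto simp: nn_integral_cmult_indicator)
    also have "\<dots> \<le> ?K + ennreal e"
    proof (rule add_mono[OF Z(4)])
      have "of_nat k * emeasure lebesgue Z \<le> ennreal (real k) * (ennreal (1 / 2 ^ n) * ennreal q)"
        using Z(3) unfolding q(2) by (simp add: mult_left_mono ennreal_of_nat_eq_real_of_nat)
      also have "\<dots> = ennreal (real k * q / 2 ^ n)" using q by (simp add: ennreal_mult[symmetric])
      also have "\<dots> \<le> ennreal e" using n e by (intro ennreal_leI) (simp add: field_simps)
      finally show "of_nat k * emeasure lebesgue Z \<le> ennreal e" .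
    qed
    finally show "(\<integral>\<^sup>+x\<in>Q. min (theta F G Q x) (of_nat k) \<partial>lebesgue) \<le> ?K + ennreal e" .
  qed
  have "(\<integral>\<^sup>+x\<in>Q. theta F G Q x \<partial>lebesgue) = (\<integral>\<^sup>+x. (SUP k. min (theta F G Q x) (of_nat k) * indicator Q x) \<partial>lebesgue)"
  proof (rule nn_integral_cong)
    fix x
    have lim: "theta F G Q x \<le> (SUP k. min (theta F G Q x) (of_nat k))"
    proof -
      obtain r where r: "theta F G Q x = ennreal r" "0 \<le> r" unfolding theta_def by auto
      obtain j :: nat where "r \<le> real j" using real_arch_simple by blast
      then have "theta F G Q x \<le> of_nat j" unfolding r by (simp add: ennreal_of_nat_eq_real_of_nat ennreal_leI)
      then have "theta F G Q x = min (theta F G Q x) (of_nat j)" by simp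
      also have "\<dots> \<le> (SUP k. min (theta F G Q x) (of_nat k))" by (rule SUP_upper) simp
      finally show ?thesis .
    qed
    show "theta F G Q x * indicator Q x = (SUP k. min (theta F G Q x) (of_nat k) * indicator Q x)"
      by (cases "x \<in> Q") (auto intro!: antisym lim SUP_least)
  qed
  also have "\<dots> = (SUP k. \<integral>\<^sup>+x\<in>Q. min (theta F G Q x) (of_nat k) \<partial>lebesgue)"
    by (rule nn_integral_monotone_convergence_SUP)
      (auto simp: incseq_def le_fun_def intro!: mult_right_mono min.mono)
  also have "\<dots> \<le> ?K" by (rule SUP_least) (rule trunc)
  finally show ?thesis .
qed

end


section \<open>Matrix weights\<close>

lemma cube_subset_compact:
  obtains S where "compact S" "cube (a :: real ^ 'n) l \<subseteq> S"
proof
  show "compact (cbox a (\<chi> i. a $ i + l))" by simp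
  show "cube a l \<subseteq> cbox a (\<chi> i. a $ i + l)" by (auto simp: cube_def mem_box_cart less_imp_le)
qed

lemma locally_integrable_on_cube:
  fixes f :: "real ^ 'n \<Rightarrow> 'b::{banach,second_countable_topology}"
  assumes f: "locally_integrable f" and Q: "Q \<in> cubes"
  shows "set_integrable lebesgue Q f"
proof -
  obtain a l where l: "0 < l" "Q = cube a l" using Q by (rule cubesE)
  obtain S where S: "compact S" "cube a l \<subseteq> S" by (rule cube_subset_compact)
  have "set_integrable lebesgue S f" using f S by (simp add: locally_integrable_def)
  then show ?thesis unfolding l by (rule set_integrable_subset[OF _ cube_lebesgue S(2)])
qed

lemma locally_integrable_measurable:
  fixes f :: "real ^ 'n \<Rightarrow> 'b::{banach,second_countable_topology}"
  assumes f: "locally_integrable f"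
  shows "f \<in> borel_measurable lebesgue"
proof (rule borel_measurable_LIMSEQ_metric)
  show "(\<lambda>x. indicator (cball 0 (real n)) x *\<^sub>R f x) \<in> borel_measurable lebesgue" for n
    using f unfolding locally_integrable_def set_integrable_def
    by (meson borel_measurable_integrable compact_cball)
  fix x :: "real ^ 'n"
  obtain N where N: "norm x \<le> real N" using real_arch_simple by blast
  have "\<forall>\<^sub>F n in sequentially. indicator (cball 0 (real n)) x *\<^sub>R f x = f x"
    unfolding eventually_sequentially using N by (intro exI[of _ N]) auto
  then show "(\<lambda>n. indicator (cball 0 (real n)) x *\<^sub>R f x) \<longlonglongrightarrow> f x" by (rule tendsto_eventually)
qed

lemma bounded_linear_form:
  fixes x y :: "'k::{real_normed_field,euclidean_space} ^ 'd"
  shows "bounded_linear (\<lambda>A :: 'k ^ 'd ^ 'd. inner (A *v x) y)"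
  by (rule bounded_linear_compose[OF bounded_linear_inner_left
        bounded_bilinear.bounded_linear_left[OF bounded_bilinear_matrix_vector]])

context
  fixes V :: "real ^ 'n \<Rightarrow> 'k::{real_normed_field,euclidean_space} ^ 'd ^ 'd"
  assumes V: "matrix_weight V"
begin

lemma matrix_weight_measurable: "V \<in> borel_measurable lebesgue"
  using V locally_integrable_measurable by (auto simp: matrix_weight_def)

lemma matrix_weight_psd: "psd (V x)"
  using V by (simp add: matrix_weight_def)

lemma form_set_integrable:
  assumes Q: "Q \<in> cubes"
  shows "set_integrable lebesgue Q (\<lambda>z. inner (V z *v x) y)"
proof -
  have "set_integrable lebesgue Q V" using V Q by (auto simp: matrix_weight_def intro: locally_integrable_on_cube)
  then have "integrable lebesgue (\<lambda>z. inner ((indicator Q z *\<^sub>R V z) *v x) y)"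
    unfolding set_integrable_def by (rule integrable_bounded_linear[OF bounded_linear_form])
  moreover have "inner ((indicator Q z *\<^sub>R V z) *v x) y = indicator Q z *\<^sub>R inner (V z *v x) y" for z
    using linear_scale[OF bounded_linear.linear[OF bounded_linear_form[of x y]], of "indicator Q z" "V z"] by simp
  ultimately show ?thesis unfolding set_integrable_def by simp
qed

lemma average_form:
  assumes Q: "Q \<in> cubes"
  shows "inner (average Q V *v x) y = average Q (\<lambda>z. inner (V z *v x) y)"
proof -
  let ?L = "\<lambda>A :: 'k ^ 'd ^ 'd. inner (A *v x) y"
  have lin: "linear ?L" using bounded_linear_form by (rule bounded_linear.linear)
  have "integrable lebesgue (\<lambda>z. indicator Q z *\<^sub>R V z)"
    using locally_integrable_on_cube[OF _ Q, of V] V by (auto simp: matrix_weight_def set_integrable_def)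
  then have "?L (LINT z|lebesgue. indicator Q z *\<^sub>R V z) = (LINT z|lebesgue. ?L (indicator Q z *\<^sub>R V z))"
    by (rule integral_bounded_linear[OF bounded_linear_form, symmetric])
  also have "\<dots> = (LINT z|lebesgue. indicator Q z *\<^sub>R ?L (V z))"
    using linear_scale[OF lin] by simp
  finally show ?thesis
    unfolding average_def set_lebesgue_integral_def using linear_scale[OF lin] by simp
qed

lemma averaged_weight_form: "averaged_weight (\<lambda>z. inner (V z *v x) x)"
  unfolding averaged_weight_def
proof (intro conjI ballI allI)
  show nn: "0 \<le> inner (V z *v x) x" for z using matrix_weight_psd[of z] unfolding psd_def by blast
  show "(\<lambda>z. inner (V z *v x) x) \<in> borel_measurable lebesgue"
    using matrix_weight_measurable
    by (rule measurable_compose[OF _ borel_measurable_continuous_onI[OF linear_continuous_on[OF bounded_linear_form]]])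
  fix Q :: "(real ^ 'n) set" assume Q: "Q \<in> cubes"
  have i: "integrable lebesgue (\<lambda>z. indicator Q z *\<^sub>R inner (V z *v x) x)"
    using form_set_integrable[OF Q] by (simp add: set_integrable_def)
  have I: "0 \<le> (LINT z|lebesgue. indicator Q z *\<^sub>R inner (V z *v x) x)"
    by (rule Bochner_Integration.integral_nonneg) (simp add: nn)
  then show "0 \<le> average Q (\<lambda>z. inner (V z *v x) x)"
    by (simp add: average_def set_lebesgue_integral_def)
  have "(\<integral>\<^sup>+z\<in>Q. ennreal (inner (V z *v x) x) \<partial>lebesgue) = (\<integral>\<^sup>+z. ennreal (indicator Q z *\<^sub>R inner (V z *v x) x) \<partial>lebesgue)"
    by (intro nn_integral_cong) (auto simp: indicator_def)
  also have "\<dots> = ennreal (LINT z|lebesgue. indicator Q z *\<^sub>R inner (V z *v x) x)"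
    by (rule nn_integral_eq_integral[OF i]) (simp add: nn)
  also have "\<dots> = ennreal (average Q (\<lambda>z. inner (V z *v x) x)) * emeasure lebesgue Q"
    using measure_cubes_pos[OF Q] I
    by (simp add: emeasure_cubes[OF Q] average_def set_lebesgue_integral_def ennreal_mult[symmetric])
  finally show "(\<integral>\<^sup>+z\<in>Q. ennreal (inner (V z *v x) x) \<partial>lebesgue) = ennreal (average Q (\<lambda>z. inner (V z *v x) x)) * emeasure lebesgue Q" .
qed

lemma psd_average:
  assumes Q: "Q \<in> cubes"
  shows "psd (average Q V)"
  unfolding psd_def
proof (intro conjI allI)
  fix x y
  have "inner (V z *v x) y = inner (V z *v y) x" for z
    using matrix_weight_psd[of z] by (simp add: psd_def inner_commute)
  then have "inner (average Q V *v x) y = inner (average Q V *v y) x" by (simp add: average_form[OF Q])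
  then show "inner (average Q V *v x) y = inner x (average Q V *v y)" by (simp add: inner_commute)
  show "0 \<le> inner (average Q V *v x) x"
    using averaged_weight_form[of x] Q by (simp add: average_form[OF Q] averaged_weight_def)
qed

lemma mult_sqrt_measurable:
  assumes "f \<in> borel_measurable lebesgue"
  shows "mult_sqrt V f \<in> borel_measurable lebesgue"
  unfolding mult_sqrt_def
  by (intro borel_measurable_matrix_vector borel_measurable_msqrt matrix_weight_measurable matrix_weight_psd assms)

lemma mult_sqrt_L2:
  assumes f: "f \<in> borel_measurable lebesgue" and b: "\<And>x. norm (f x) \<le> b" and Q: "Q \<in> cubes" and z: "\<And>x. x \<notin> Q \<Longrightarrow> f x = 0"
  shows "mult_sqrt V f \<in> L2"
proof -
  obtain c where c: "0 < c" "\<And>(A :: 'k ^ 'd ^ 'd) x. norm (A *v x) \<le> norm A * norm x * c"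
    using bounded_bilinear.pos_bounded[OF bounded_bilinear_matrix_vector] by blast
  have b0: "0 \<le> b" using order_trans[OF norm_ge_zero b] .
  have i: "integrable lebesgue (\<lambda>x. indicator Q x *\<^sub>R V x)"
    using locally_integrable_on_cube[OF _ Q, of V] V by (auto simp: matrix_weight_def set_integrable_def)
  have "ennreal ((norm (mult_sqrt V f x))\<^sup>2) \<le> ennreal (c * b\<^sup>2) * ennreal (norm (indicator Q x *\<^sub>R V x))" for x
  proof (cases "x \<in> Q")
    case True
    have "(norm (mult_sqrt V f x))\<^sup>2 = inner (V x *v f x) (f x)"
      by (simp add: mult_sqrt_def norm_msqrt_mult[OF matrix_weight_psd])
    also have "\<dots> \<le> norm (V x *v f x) * norm (f x)" by (rule norm_cauchy_schwarz)
    also have "\<dots> \<le> (norm (V x) * b * c) * b"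
      using c b[of x] b0 by (intro mult_mono order_trans[OF c(2)] mult_left_mono) auto
    also have "\<dots> = c * b\<^sup>2 * norm (V x)" by (simp add: power2_eq_square)
    finally show ?thesis using True c b0 by (simp add: ennreal_mult[symmetric] ennreal_leI)
  next
    case False
    then show ?thesis by (simp add: mult_sqrt_def z)
  qed
  then have "(\<integral>\<^sup>+x. ennreal ((norm (mult_sqrt V f x))\<^sup>2) \<partial>lebesgue) \<le> (\<integral>\<^sup>+x. ennreal (c * b\<^sup>2) * ennreal (norm (indicator Q x *\<^sub>R V x)) \<partial>lebesgue)"
    by (rule nn_integral_mono)
  also have "\<dots> = ennreal (c * b\<^sup>2) * (\<integral>\<^sup>+x. ennreal (norm (indicator Q x *\<^sub>R V x)) \<partial>lebesgue)"
    by (intro nn_integral_cmult measurable_compose[OF measurable_compose[OF borel_measurable_integrable[OF i] borel_measurable_norm] measurable_ennreal])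
  also have "\<dots> < \<infinity>" using i by (simp add: integrable_iff_bounded ennreal_mult_less_top)
  finally show ?thesis using mult_sqrt_measurable[OF f] by (simp add: L2_iff)
qed

end

lemma A_infinity_condition:
  fixes w :: "real ^ 'n \<Rightarrow> real"
  assumes w: "averaged_weight w" and C: "A_infinity w < ennreal C" and Q: "Q \<in> cubes"
  shows "(\<integral>\<^sup>+x. dyadic_sup (dyadic_subcubes Q) w x * indicator Q x \<partial>lebesgue) \<le> ennreal C * (\<integral>\<^sup>+x\<in>Q. ennreal (w x) \<partial>lebesgue)"
proof -
  let ?J = "\<integral>\<^sup>+x. dyadic_sup (dyadic_subcubes Q) w x * indicator Q x \<partial>lebesgue"
  obtain C' where C': "\<forall>Q\<in>cubes. (\<integral>\<^sup>+x\<in>Q. dyadic_maximal Q w x \<partial>lebesgue) / emeasure lebesgue Q \<le> C' * ennreal (average Q w)"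
    and less: "C' < ennreal C"
    using C unfolding A_infinity_def Inf_less_iff by blast
  obtain q where q: "0 < q" "emeasure lebesgue Q = ennreal q" using emeasure_cubes[OF Q] measure_cubes_pos[OF Q] by blast
  have "?J / ennreal q \<le> C' * ennreal (average Q w)"
  proof -
    have "dyadic_maximal Q w = dyadic_sup (dyadic_subcubes Q) w"
      by (rule ext) (rule dyadic_maximal_eq[OF Q w])
    then show ?thesis using bspec[OF C' Q] by (simp only: q(2))
  qed
  then have "?J / ennreal q * ennreal q \<le> C' * ennreal (average Q w) * ennreal q" by (rule mult_right_mono) simp
  moreover have "?J / ennreal q * ennreal q = ?J"
    using q by (simp add: ennreal_divide_times ennreal_divide_self)
  moreover have "ennreal (average Q w) * ennreal q = (\<integral>\<^sup>+x\<in>Q. ennreal (w x) \<partial>lebesgue)"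
    using w Q by (simp add: averaged_weight_def q(2))
  ultimately have "?J \<le> C' * (\<integral>\<^sup>+x\<in>Q. ennreal (w x) \<partial>lebesgue)" by (simp add: mult.assoc)
  also have "\<dots> \<le> ennreal C * (\<integral>\<^sup>+x\<in>Q. ennreal (w x) \<partial>lebesgue)" using less by (intro mult_right_mono) auto
  finally show ?thesis .
qed

text \<open>
  The average of \<open>w\<close> over \<open>Q\<close> is at most its dyadic maximal function, so a
  constant below 1 forces it to vanish.
\<close>

lemma A_infinity_less_one_null:
  fixes w :: "real ^ 'n \<Rightarrow> real"
  assumes w: "averaged_weight w" and C: "A_infinity w < 1" and Q: "Q \<in> cubes"
  shows "AE x in lebesgue. x \<in> Q \<longrightarrow> w x = 0"
proof -
  obtain c where c: "A_infinity w < ennreal c" "ennreal c < 1" "0 \<le> c"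
  proof -
    obtain d where d: "A_infinity w < d" "d < 1" using dense[OF C] by blast
    then obtain c where "d = ennreal c" "0 \<le> c" by (cases d) auto
    with d that show ?thesis by blast
  qed
  have c1: "c < 1" using c by (simp add: ennreal_less_one_iff)
  have wm: "w \<in> borel_measurable lebesgue" and w0: "\<And>x. 0 \<le> w x" using w by (auto simp: averaged_weight_def)
  obtain q where q: "0 < q" "emeasure lebesgue Q = ennreal q" using emeasure_cubes[OF Q] measure_cubes_pos[OF Q] by blast
  define a where "a = average Q w"
  have a: "0 \<le> a" "(\<integral>\<^sup>+x\<in>Q. ennreal (w x) \<partial>lebesgue) = ennreal (a * q)"
    using w Q q by (auto simp: averaged_weight_def a_def ennreal_mult)
  have "ennreal (a * q) = (\<integral>\<^sup>+x\<in>Q. ennreal a \<partial>lebesgue)"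
    using cubes_sets[OF Q] a q by (simp add: nn_integral_cmult_indicator ennreal_mult)
  also have "\<dots> \<le> (\<integral>\<^sup>+x. dyadic_sup (dyadic_subcubes Q) w x * indicator Q x \<partial>lebesgue)"
    using dyadic_sup_upper[OF self_in_dyadic[OF Q], of _ w]
    by (intro nn_integral_mono) (auto simp: indicator_def a_def)
  also have "\<dots> \<le> ennreal c * ennreal (a * q)" unfolding a(2)[symmetric] by (rule A_infinity_condition[OF w c(1) Q])
  also have "\<dots> = ennreal (c * (a * q))" using a q c by (simp add: ennreal_mult)
  finally have "a * q \<le> c * (a * q)" using a q c by (subst (asm) ennreal_le_iff) auto
  then have "(1 - c) * (a * q) \<le> 0" by (simp add: left_diff_distrib)
  then have "a * q \<le> 0" using c1 by (simp add: mult_le_0_iff)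
  then have "(\<integral>\<^sup>+x\<in>Q. ennreal (w x) \<partial>lebesgue) = 0" unfolding a(2) by (simp add: ennreal_neg)
  from set_nn_integral_zeroD[OF wm cubes_sets[OF Q] this] show ?thesis
    by eventually_elim (use w0 in \<open>auto intro: antisym\<close>)
qed

text \<open>
  The reverse Holder inequality requires a constant of at least 1, and the case of a smaller one is
  void: the diagonal entries of the weight vanish almost everywhere, and with them its square root.
\<close>

lemma degenerate_matrix_weight:
  fixes V :: "real ^ 'n \<Rightarrow> 'k::{real_normed_field,euclidean_space} ^ 'd ^ 'd"
  assumes V: "matrix_weight V" and A: "A_infinity_sc V < 1" and Q: "Q \<in> cubes"
  shows "AE x in lebesgue. x \<in> Q \<longrightarrow> (\<forall>y. msqrt (V x) *v y = 0)"
proof -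
  have "AE x in lebesgue. \<forall>j\<in>(UNIV :: 'd set). x \<in> Q \<longrightarrow> inner (V x *v axis j 1) (axis j 1) = 0"
  proof (rule AE_finite_allI)
    fix j :: 'd
    have "A_infinity (\<lambda>x. inner (V x *v axis j 1) (axis j 1)) \<le> A_infinity_sc V"
      unfolding A_infinity_sc_def by (rule SUP_upper) simp
    then show "AE x in lebesgue. x \<in> Q \<longrightarrow> inner (V x *v axis j 1) (axis j 1) = 0"
      using A by (intro A_infinity_less_one_null[OF averaged_weight_form[OF V] _ Q]) auto
  qed simp
  then show ?thesis
  proof eventually_elim
    fix x assume z: "\<forall>j\<in>UNIV. x \<in> Q \<longrightarrow> inner (V x *v axis j 1) (axis j 1) = 0"
    show "x \<in> Q \<longrightarrow> (\<forall>y. msqrt (V x) *v y = 0)"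
    proof (intro impI allI)
      fix y assume x: "x \<in> Q"
      have n: "msqrt (V x) *v axis j 1 = 0" for j
        using norm_msqrt_mult[OF matrix_weight_psd[OF V], of x "axis j 1"] z x by simp
      have "msqrt (V x) *v y = msqrt (V x) *v (\<Sum>j\<in>UNIV. y $ j *s axis j 1)" by (simp add: basis_expansion)
      also have "\<dots> = (\<Sum>j\<in>UNIV. msqrt (V x) *v (y $ j *s axis j 1))"
        by (simp add: linear_sum[OF matrix_vector_mul_linear])
      also have "\<dots> = 0" by (simp add: matrix_vector_scalar_mult_commute n)
      finally show "msqrt (V x) *v y = 0" .
    qed
  qed
qed

text \<open>the gain of \<open>reverse_Holder\<close>\<close>

definition eps_of :: "nat \<Rightarrow> real \<Rightarrow> real" where "eps_of n C = 1 / (2 * 2 ^ n * C)"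

text \<open>the exponent conjugate to \<open>2 * (1 + eps_of n C)\<close>\<close>

definition p_of :: "nat \<Rightarrow> real \<Rightarrow> real" where "p_of n C = 2 * (1 + eps_of n C) / (1 + 2 * eps_of n C)"

lemma eps_of_bounds:
  assumes "1 \<le> C" shows "0 < eps_of n C" "eps_of n C \<le> 1"
proof -
  have "(1 :: real) \<le> 2 ^ n" by (rule one_le_power) simp
  then have "(1 :: real) * 1 \<le> (2 * 2 ^ n) * C" using assms by (intro mult_mono) linarith+
  then show "0 < eps_of n C" "eps_of n C \<le> 1" using assms by (auto simp: eps_of_def divide_le_eq_1)
qed

text \<open>
  The coordinate of $V^{1/2} f$ along \<open>b\<close> is at most $|f| (Vb,b)^{1/2}$. Holder's
  inequality separates \<open>f\<close> from the weight $(Vb,b)$, and the reverse Holder inequality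
  returns the average of the weight. The exponent of \<open>f\<close> stays below 2 by an amount
  comparable to $1/C$.
\<close>

lemma coefficient_average:
  fixes V :: "real ^ 'n \<Rightarrow> 'k::{real_normed_field,euclidean_space} ^ 'd ^ 'd"
  assumes V: "matrix_weight V" and C: "1 \<le> C" and A: "A_infinity_sc V < ennreal C" and Q: "Q \<in> cubes"
    and f: "f \<in> borel_measurable lebesgue" and \<beta>: "0 \<le> \<beta>"
    and If: "(\<integral>\<^sup>+x\<in>Q. ennreal (norm (f x) powr p_of CARD('n) C) \<partial>lebesgue) \<le> ennreal (\<beta> powr p_of CARD('n) C) * emeasure lebesgue Q"
  shows "(\<integral>\<^sup>+x\<in>Q. ennreal \<bar>inner (mult_sqrt V f x) b\<bar> \<partial>lebesgue)
    \<le> ennreal (2 * sqrt (inner (average Q V *v b) b) * \<beta>) * emeasure lebesgue Q"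
proof -
  define w where "w x = inner (V x *v b) b" for x
  define e where "e = eps_of CARD('n) C"
  have e: "0 < e" unfolding e_def by (rule eps_of_bounds[OF C])
  have aw: "averaged_weight w" unfolding w_def[abs_def] by (rule averaged_weight_form[OF V])
  have wm: "w \<in> borel_measurable lebesgue" and w0: "\<And>x. 0 \<le> w x" and av0: "0 \<le> average Q w"
    using aw Q by (auto simp: averaged_weight_def)
  have Aw: "A_infinity w < ennreal C"
  proof (rule le_less_trans[OF _ A])
    show "A_infinity w \<le> A_infinity_sc V" unfolding A_infinity_sc_def w_def[abs_def] by (rule SUP_upper) simp
  qed
  have rh: "(\<integral>\<^sup>+x\<in>Q. ennreal (w x powr (1 + e)) \<partial>lebesgue) \<le> ennreal (4 * average Q w powr (1 + e)) * emeasure lebesgue Q"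
    unfolding e_def eps_of_def by (rule reverse_Holder[OF aw C A_infinity_condition[OF aw Aw] Q])
  let ?\<alpha> = "2 * sqrt (average Q w)"
  have "(\<integral>\<^sup>+x\<in>Q. ennreal \<bar>inner (mult_sqrt V f x) b\<bar> \<partial>lebesgue) \<le> (\<integral>\<^sup>+x\<in>Q. ennreal (sqrt (w x) * norm (f x)) \<partial>lebesgue)"
  proof (intro nn_integral_mono mult_right_mono ennreal_leI)
    fix x
    have "inner (mult_sqrt V f x) b = inner (f x) (msqrt (V x) *v b)"
      using psd_msqrt[OF matrix_weight_psd[OF V]] by (simp add: mult_sqrt_def psd_def)
    also have "\<bar>\<dots>\<bar> \<le> norm (f x) * norm (msqrt (V x) *v b)" by (rule Cauchy_Schwarz_ineq2)
    also have "norm (msqrt (V x) *v b) = sqrt (w x)"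
      using norm_msqrt_mult[OF matrix_weight_psd[OF V], of x b] by (simp add: w_def real_sqrt_unique)
    finally show "\<bar>inner (mult_sqrt V f x) b\<bar> \<le> sqrt (w x) * norm (f x)" by (simp add: mult.commute)
  qed simp
  also have "\<dots> \<le> ennreal (?\<alpha> * \<beta>) * emeasure lebesgue Q"
  proof (rule Holder_average[OF wm _ cubes_sets[OF Q] w0 norm_ge_zero e _ \<beta>])
    show "(\<lambda>x. norm (f x)) \<in> borel_measurable lebesgue" using f by measurable
    show "0 \<le> ?\<alpha>" using av0 by simp
    show "(\<integral>\<^sup>+x\<in>Q. ennreal (norm (f x) powr (2 * (1 + e) / (1 + 2 * e))) \<partial>lebesgue) \<le> ennreal (\<beta> powr (2 * (1 + e) / (1 + 2 * e))) * emeasure lebesgue Q"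
      using If unfolding p_of_def e_def .
    show "(\<integral>\<^sup>+x\<in>Q. ennreal (w x powr (1 + e)) \<partial>lebesgue) \<le> ennreal (?\<alpha> powr (2 * (1 + e))) * emeasure lebesgue Q"
    proof (rule order_trans[OF rh], intro mult_right_mono ennreal_leI)
      have "(2::real) powr 2 \<le> 2 powr (2 * (1 + e))" using e by (intro powr_mono) auto
      then have "4 * average Q w powr (1 + e) \<le> 2 powr (2 * (1 + e)) * average Q w powr (1 + e)"
        by (intro mult_right_mono) auto
      also have "\<dots> = ?\<alpha> powr (2 * (1 + e))"
        using av0 by (simp add: powr_mult powr_half_sqrt[symmetric] powr_powr add_divide_distrib)
      finally show "4 * average Q w powr (1 + e) \<le> ?\<alpha> powr (2 * (1 + e))" .
    qed simp
  qed
  finally show ?thesis unfolding average_form[OF V Q] w_def[abs_def] .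
qed

text \<open>
  The power mean itself is the witness, so that it is one number on the cube below the maximal
  function at every point.
\<close>

lemma average_power_mean:
  fixes f :: "real ^ 'n \<Rightarrow> 'b::euclidean_space"
  assumes f: "f \<in> borel_measurable lebesgue" and b: "\<And>x. norm (f x) \<le> b" and C: "1 \<le> C" and Q: "Q \<in> cubes"
  obtains \<beta> where "0 \<le> \<beta>"
    "(\<integral>\<^sup>+x\<in>dilate Q. ennreal (norm (f x) powr p_of CARD('n) C) \<partial>lebesgue) \<le> ennreal (\<beta> powr p_of CARD('n) C) * emeasure lebesgue (dilate Q)"
    "\<forall>x\<in>Q. \<beta> \<le> real CARD('n) ^ CARD('n) * hl_p (p_of CARD('n) C) (\<lambda>x. norm (f x)) x"
proof -
  let ?p = "p_of CARD('n) C"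
  note e = eps_of_bounds[OF C, of "CARD('n)"]
  have p: "1 < ?p" using e by (simp add: p_of_def field_simps)
  have dQ: "dilate Q \<in> cubes" by (rule dilate_in_cubes[OF Q])
  obtain q where q: "0 < q" "emeasure lebesgue (dilate Q) = ennreal q" using emeasure_cubes[OF dQ] measure_cubes_pos[OF dQ] by blast
  let ?I = "\<integral>\<^sup>+x\<in>dilate Q. ennreal (norm (f x) powr ?p) \<partial>lebesgue"
  have "?I \<le> (\<integral>\<^sup>+x\<in>dilate Q. ennreal (b powr ?p) \<partial>lebesgue)"
    using b p by (intro nn_integral_mono mult_right_mono ennreal_leI powr_mono2) auto
  also have "\<dots> = ennreal (b powr ?p) * ennreal q" using cubes_sets[OF dQ] q by (simp add: nn_integral_cmult_indicator)
  also have "\<dots> < \<infinity>" by (simp add: ennreal_mult_less_top)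
  finally obtain i where i: "?I = ennreal i" "0 \<le> i" by (cases ?I) auto
  define \<beta> where "\<beta> = (i / q) powr (1 / ?p)"
  have \<beta>p: "\<beta> powr ?p = i / q" using i q p by (simp add: \<beta>_def powr_powr)
  have I: "?I = ennreal (\<beta> powr ?p) * emeasure lebesgue (dilate Q)"
    unfolding \<beta>p i(1) q(2) using i(2) q(1) by (simp add: ennreal_mult[symmetric])
  show ?thesis
  proof (rule that[of \<beta>])
    show "0 \<le> \<beta>" by (simp add: \<beta>_def)
    show "?I \<le> ennreal (\<beta> powr ?p) * emeasure lebesgue (dilate Q)" using I by simp
    show "\<forall>x\<in>Q. \<beta> \<le> real CARD('n) ^ CARD('n) * hl_p ?p (\<lambda>x. norm (f x)) x"
    proof
      fix x assume x: "x \<in> Q"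
      let ?M = "real CARD('n) ^ CARD('n) * hl_p ?p (\<lambda>x. norm (f x)) x"
      have M0: "0 \<le> ?M" by (simp add: hl_p_nonneg)
      have "?I \<le> ennreal (?M powr ?p) * emeasure lebesgue (dilate Q)"
        unfolding p_of_def by (rule hl_p_average[OF _ norm_ge_zero b e Q x]) (use f in measurable)
      then have "ennreal (\<beta> powr ?p * q) \<le> ennreal (?M powr ?p * q)"
        unfolding I q(2) using q by (simp add: ennreal_mult)
      then have le: "\<beta> powr ?p \<le> ?M powr ?p" using q by simp
      have "(\<beta> powr ?p) powr (1 / ?p) \<le> (?M powr ?p) powr (1 / ?p)" by (rule powr_mono2[OF _ _ le]) (use p in auto)
      moreover have "(z powr ?p) powr (1 / ?p) = z" if "0 \<le> z" for z using p that by (simp add: powr_powr)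
      moreover have "0 \<le> \<beta>" by (simp add: \<beta>_def)
      ultimately show "\<beta> \<le> ?M" using M0 by metis
    qed
  qed
qed

text \<open>
  The eigenbases are those of the averages over the dilate. The averages of the coordinates contain
  the square roots of the eigenvalues, and the joint $\mathbf A_2$ condition cancels these against
  the pairing of the eigenvectors.
\<close>

lemma matrix_A2_local_bases:
  fixes V W :: "real ^ 'n \<Rightarrow> 'k::{real_normed_field,euclidean_space} ^ 'd ^ 'd"
  assumes V: "matrix_weight V" and W: "matrix_weight W"
    and CV: "1 \<le> CV" "A_infinity_sc V < ennreal CV" and CW: "1 \<le> CW" "A_infinity_sc W < ennreal CW"
    and A2: "\<And>Q. Q \<in> cubes \<Longrightarrow> mnorm (msqrt (average Q W) ** msqrt (average Q V)) \<le> K" and K: "0 \<le> K"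
    and f: "f \<in> borel_measurable lebesgue" "\<And>x. norm (f x) \<le> bf"
    and g: "g \<in> borel_measurable lebesgue" "\<And>x. norm (g x) \<le> bg"
    and Q: "Q \<in> cubes"
  shows "local_bases DIM('k ^ 'd) (mult_sqrt V f) (mult_sqrt W g)
    (\<lambda>x. 4 * K * ((real CARD('n) ^ CARD('n) * hl_p (p_of CARD('n) CV) (\<lambda>x. norm (f x)) x) *
       (real CARD('n) ^ CARD('n) * hl_p (p_of CARD('n) CW) (\<lambda>x. norm (g x)) x))) Q"
proof -
  have dQ: "dilate Q \<in> cubes" by (rule dilate_in_cubes[OF Q])
  let ?V = "average (dilate Q) V" and ?W = "average (dilate Q) W"
  obtain Bv lv where Bv: "eigenbasis (\<lambda>x. ?V *v x) Bv lv" and lv0: "\<And>b. 0 \<le> lv b"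
    and lv: "\<And>b. b \<in> Bv \<Longrightarrow> lv b = inner (?V *v b) b" and sv: "\<And>b. b \<in> Bv \<Longrightarrow> msqrt ?V *v b = sqrt (lv b) *\<^sub>R b"
    by (rule psd_eigenbasis[OF psd_average[OF V dQ]]) (rule that)
  obtain Bw lw where Bw: "eigenbasis (\<lambda>x. ?W *v x) Bw lw" and lw0: "\<And>b. 0 \<le> lw b"
    and lw: "\<And>b. b \<in> Bw \<Longrightarrow> lw b = inner (?W *v b) b" and sw: "\<And>b. b \<in> Bw \<Longrightarrow> msqrt ?W *v b = sqrt (lw b) *\<^sub>R b"
    by (rule psd_eigenbasis[OF psd_average[OF W dQ]]) (rule that)
  obtain \<beta>f where \<beta>f: "0 \<le> \<beta>f"
    "(\<integral>\<^sup>+x\<in>dilate Q. ennreal (norm (f x) powr p_of CARD('n) CV) \<partial>lebesgue) \<le> ennreal (\<beta>f powr p_of CARD('n) CV) * emeasure lebesgue (dilate Q)"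
    "\<forall>x\<in>Q. \<beta>f \<le> real CARD('n) ^ CARD('n) * hl_p (p_of CARD('n) CV) (\<lambda>x. norm (f x)) x"
    by (rule average_power_mean[OF f CV(1) Q])
  obtain \<beta>g where \<beta>g: "0 \<le> \<beta>g"
    "(\<integral>\<^sup>+x\<in>dilate Q. ennreal (norm (g x) powr p_of CARD('n) CW) \<partial>lebesgue) \<le> ennreal (\<beta>g powr p_of CARD('n) CW) * emeasure lebesgue (dilate Q)"
    "\<forall>x\<in>Q. \<beta>g \<le> real CARD('n) ^ CARD('n) * hl_p (p_of CARD('n) CW) (\<lambda>x. norm (g x)) x"
    by (rule average_power_mean[OF g CW(1) Q])
  \<comment> \<open>If one of the eigenvalues is zero, the corresponding average is zero and the
    trivial bound of the pairing does.\<close>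
  define k where "k b u = (if 0 < lv b \<and> 0 < lw u then K / (sqrt (lv b) * sqrt (lw u)) else 1)" for b u
  define \<alpha> where "\<alpha> b = 2 * sqrt (lv b) * \<beta>f" for b
  define \<gamma> where "\<gamma> u = 2 * sqrt (lw u) * \<beta>g" for u
  define h where "h = 4 * K * (\<beta>f * \<beta>g)"
  have P1: "finite Bv \<and> finite Bw \<and> card Bv \<le> DIM('k ^ 'd) \<and> card Bw \<le> DIM('k ^ 'd)"
    using Bv Bw by (simp add: eigenbasis_def)
  have P2: "\<forall>y. (\<Sum>b\<in>Bv. inner y b *\<^sub>R b) = y" "\<forall>y. (\<Sum>u\<in>Bw. inner y u *\<^sub>R u) = y"
    using eigenbasis_expand[OF Bv] eigenbasis_expand[OF Bw] by blast+
  have P3: "\<forall>b\<in>Bv. 0 \<le> \<alpha> b \<and> (\<integral>\<^sup>+x\<in>dilate Q. ennreal \<bar>inner (mult_sqrt V f x) b\<bar> \<partial>lebesgue) \<le> ennreal (\<alpha> b) * emeasure lebesgue (dilate Q)"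
  proof (intro ballI conjI)
    fix b assume b: "b \<in> Bv"
    show "0 \<le> \<alpha> b" using lv0 \<beta>f by (simp add: \<alpha>_def)
    show "(\<integral>\<^sup>+x\<in>dilate Q. ennreal \<bar>inner (mult_sqrt V f x) b\<bar> \<partial>lebesgue) \<le> ennreal (\<alpha> b) * emeasure lebesgue (dilate Q)"
      unfolding \<alpha>_def lv[OF b] by (rule coefficient_average[OF V CV dQ f(1) \<beta>f(1,2)])
  qed
  have P4: "\<forall>u\<in>Bw. 0 \<le> \<gamma> u \<and> (\<integral>\<^sup>+x\<in>dilate Q. ennreal \<bar>inner (mult_sqrt W g x) u\<bar> \<partial>lebesgue) \<le> ennreal (\<gamma> u) * emeasure lebesgue (dilate Q)"
  proof (intro ballI conjI)
    fix u assume u: "u \<in> Bw"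
    show "0 \<le> \<gamma> u" using lw0 \<beta>g by (simp add: \<gamma>_def)
    show "(\<integral>\<^sup>+x\<in>dilate Q. ennreal \<bar>inner (mult_sqrt W g x) u\<bar> \<partial>lebesgue) \<le> ennreal (\<gamma> u) * emeasure lebesgue (dilate Q)"
      unfolding \<gamma>_def lw[OF u] by (rule coefficient_average[OF W CW dQ g(1) \<beta>g(1,2)])
  qed
  have h0: "0 \<le> h" using K \<beta>f \<beta>g by (simp add: h_def)
  have P5: "\<forall>b\<in>Bv. \<forall>u\<in>Bw. 0 \<le> k b u \<and> \<alpha> b * \<gamma> u * k b u \<le> h \<and> (\<forall>t. \<bar>inner (t *s b) u\<bar> \<le> norm t * k b u)"
  proof (intro ballI)
    fix b u assume bu: "b \<in> Bv" "u \<in> Bw"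
    have nb: "norm b = 1" "norm u = 1" using Bv Bw bu by (auto simp: eigenbasis_def)
    show "0 \<le> k b u \<and> \<alpha> b * \<gamma> u * k b u \<le> h \<and> (\<forall>t. \<bar>inner (t *s b) u\<bar> \<le> norm t * k b u)"
    proof (cases "0 < lv b \<and> 0 < lw u")
      case True
      let ?s = "sqrt (lv b) * sqrt (lw u)"
      have s: "0 < ?s" using True by simp
      have kk: "k b u = K / ?s" using True by (simp add: k_def)
      have "\<bar>inner (t *s b) u\<bar> \<le> norm t * k b u" for t
      proof -
        have "\<bar>sqrt (lv b) * sqrt (lw u) * inner (t *s b) u\<bar> \<le> norm t * mnorm (msqrt ?W ** msqrt ?V)"
          by (rule eigenvector_pairing_le[OF psd_average[OF W dQ] sv[OF bu(1)] nb(1) sw[OF bu(2)] nb(2)])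
        also have "\<dots> \<le> norm t * K" by (rule mult_left_mono[OF A2[OF dQ]]) simp
        finally have "?s * \<bar>inner (t *s b) u\<bar> \<le> norm t * K" using lv0[of b] lw0[of u] by (simp add: abs_mult)
        then show ?thesis unfolding kk using s by (simp add: field_simps)
      qed
      moreover have "\<alpha> b * \<gamma> u * k b u = h" unfolding kk \<alpha>_def \<gamma>_def h_def using True by simp
      ultimately show ?thesis using K s kk by simp
    next
      case False
      then have z: "lv b = 0 \<or> lw u = 0" using lv0[of b] lw0[of u] by auto
      have kk: "k b u = 1" unfolding k_def using False by (rule if_not_P)
      have "\<bar>inner (t *s b) u\<bar> \<le> norm t * k b u" for t
        using Cauchy_Schwarz_ineq2[of "t *s b" u] nb by (simp add: kk norm_vector_scalar_mult)
      moreover have "\<alpha> b * \<gamma> u * k b u = 0" unfolding \<alpha>_def \<gamma>_def using z by auto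
      then have "\<alpha> b * \<gamma> u * k b u \<le> h" using h0 by linarith
      moreover have "0 \<le> k b u" using kk by simp
      ultimately show ?thesis by blast
    qed
  qed
  have P6: "\<forall>x\<in>Q. h \<le> 4 * K * ((real CARD('n) ^ CARD('n) * hl_p (p_of CARD('n) CV) (\<lambda>x. norm (f x)) x) *
       (real CARD('n) ^ CARD('n) * hl_p (p_of CARD('n) CW) (\<lambda>x. norm (g x)) x))"
    unfolding h_def using \<beta>f \<beta>g K by (intro ballI mult_left_mono mult_mono) (auto simp: hl_p_nonneg)
  show ?thesis unfolding local_bases_def
    by (rule exI[of _ Bv], rule exI[of _ Bw], rule exI[of _ \<alpha>], rule exI[of _ \<gamma>], rule exI[of _ k], rule exI[of _ h])
      (intro conjI P1[THEN conjunct1] P1[THEN conjunct2, THEN conjunct1] P1[THEN conjunct2, THEN conjunct2, THEN conjunct1]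
        P1[THEN conjunct2, THEN conjunct2, THEN conjunct2] P2 P3 P4 P5 h0 P6)
qed


section \<open>The two-weight bound\<close>

lemma square_le_imp_le_ennreal_sqrt:
  assumes "(x :: ennreal)\<^sup>2 \<le> ennreal k" "0 \<le> k"
  shows "x \<le> ennreal (sqrt k)"
proof (cases x)
  case (real r)
  then have "r\<^sup>2 \<le> k" using assms by (simp add: ennreal_power)
  then show ?thesis unfolding real by (intro ennreal_leI real_le_rsqrt)
next
  case top
  then show ?thesis using assms by (simp add: top_unique power2_eq_square ennreal_top_mult)
qed

lemma SUP_square_le:
  fixes F :: "'a \<Rightarrow> ennreal"
  assumes "\<And>f. f \<in> A \<Longrightarrow> (F f)\<^sup>2 \<le> ennreal k" "0 \<le> k"
  shows "(SUP f\<in>A. F f)\<^sup>2 \<le> ennreal k"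
proof -
  have "(SUP f\<in>A. F f) \<le> ennreal (sqrt k)"
    by (rule SUP_least) (rule square_le_imp_le_ennreal_sqrt[OF assms])
  then have "(SUP f\<in>A. F f)\<^sup>2 \<le> (ennreal (sqrt k))\<^sup>2"
    unfolding power2_eq_square by (intro mult_mono) auto
  also have "\<dots> = ennreal k" using assms(2) by (simp add: ennreal_power)
  finally show ?thesis .
qed

lemma bounded_subset_cube:
  fixes S :: "(real ^ 'n) set"
  assumes "bounded S"
  obtains Q where "Q \<in> cubes" "S \<subseteq> Q"
proof -
  obtain r where r: "0 < r" "\<forall>x\<in>S. norm x \<le> r" using assms bounded_pos by blast
  have "S \<subseteq> cube (\<chi> i. - (2 * r)) (4 * r)"
  proof
    fix x assume x: "x \<in> S"
    have "\<bar>x $ i\<bar> \<le> r" for i using component_le_norm_cart[of x i] r(2) x by (meson order_trans)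
    then have "- r \<le> x $ i \<and> x $ i \<le> r" for i by (simp add: abs_le_iff) (metis minus_le_iff)
    then show "x \<in> cube (\<chi> i. - (2 * r)) (4 * r)" using r(1) by (auto simp: mem_cube) (smt (verit))+
  qed
  moreover have "cube (\<chi> i. - (2 * r)) (4 * r) \<in> cubes" 
  proof -
    have "0 < 4 * r" using r(1) by linarith
    then show ?thesis unfolding cubes_def by blast
  qed
  ultimately show ?thesis using that by blast
qed

context dini_cz
begin

text \<open>
  The factors are the constant of \<open>form_bound\<close>, the loss in comparing cubes with balls
  together with the 4 of the two coefficient estimates, and the norm of the maximal functions
  without the $A_\infty$ constants.
\<close>

definition two_weight_const :: "nat \<Rightarrow> real" where
  "two_weight_const m = form_const m * (4 * (real CARD('n) ^ CARD('n) * real CARD('n) ^ CARD('n))) * (hl_const CARD('n) * (4 * 2 ^ CARD('n)))"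

lemma two_weight_const_nonneg: "0 \<le> two_weight_const m"
  using form_const_nonneg[of m] by (simp add: two_weight_const_def hl_const_def)

lemma two_weight_form_bound:
  fixes V W :: "real ^ 'n \<Rightarrow> 'k ^ 'd ^ 'd"
  assumes V: "matrix_weight V" and W: "matrix_weight W"
    and CV: "1 \<le> CV" "A_infinity_sc V < ennreal CV" and CW: "1 \<le> CW" "A_infinity_sc W < ennreal CW"
    and A2: "\<And>Q. Q \<in> cubes \<Longrightarrow> mnorm (msqrt (average Q W) ** msqrt (average Q V)) \<le> A" and A: "0 \<le> A"
    and f: "f \<in> borel_measurable lebesgue" "\<And>x. norm (f x) \<le> bf" "\<And>x. x \<notin> Q \<Longrightarrow> f x = 0"
    and g: "g \<in> borel_measurable lebesgue" "\<And>x. norm (g x) \<le> bg" "\<And>x. x \<notin> Q \<Longrightarrow> g x = 0"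
    and Q: "Q \<in> cubes"
    and If: "(\<integral>\<^sup>+x. ennreal ((norm (f x))\<^sup>2) \<partial>lebesgue) \<le> ennreal a" "0 \<le> a"
    and Ig: "(\<integral>\<^sup>+x. ennreal ((norm (g x))\<^sup>2) \<partial>lebesgue) \<le> ennreal b" "0 \<le> b"
  shows "(\<integral>\<^sup>+x. ennreal \<bar>inner (mult_sqrt W (componentwise T (mult_sqrt V f)) x) (g x)\<bar> \<partial>lebesgue)
    \<le> ennreal (two_weight_const DIM('k ^ 'd) * A * sqrt (CV * CW) * sqrt a * sqrt b)"
proof -
  let ?F = "mult_sqrt V f" and ?G = "mult_sqrt W g"
  let ?pV = "p_of CARD('n) CV" and ?pW = "p_of CARD('n) CW"
  let ?mf = "hl_p ?pV (\<lambda>x. norm (f x))" and ?mg = "hl_p ?pW (\<lambda>x. norm (g x))"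
  let ?N = "real CARD('n) ^ CARD('n)"
  let ?m = "DIM('k ^ 'd)"
  let ?k = "hl_const CARD('n)"
  define H where "H x = 4 * A * ((?N * ?mf x) * (?N * ?mg x))" for x
  have F: "?F \<in> L2" by (rule mult_sqrt_L2[OF V f(1,2) Q f(3)])
  have G: "?G \<in> L2" by (rule mult_sqrt_L2[OF W g(1,2) Q g(3)])
  have Hm: "H \<in> borel_measurable lebesgue" unfolding H_def[abs_def] by measurable
  have k0: "0 \<le> ?k" by (simp add: hl_const_def)
  have lb: "local_bases ?m ?F ?G H R" if "R \<in> cubes" for R
    unfolding H_def[abs_def] by (rule matrix_A2_local_bases[OF V W CV CW A2 A f(1,2) g(1,2) that])
  have restr: "restrict_to (dilate Q) ?F = ?F"
  proof
    fix x show "restrict_to (dilate Q) ?F x = ?F x"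
      using subset_dilate[OF Q] f(3)[of x] by (cases "x \<in> Q") (auto simp: mult_sqrt_def restrict_to_def)
  qed
  have "(\<integral>\<^sup>+x. ennreal \<bar>inner (mult_sqrt W (componentwise T ?F) x) (g x)\<bar> \<partial>lebesgue) = (\<integral>\<^sup>+x\<in>Q. theta ?F ?G Q x \<partial>lebesgue)"
  proof (rule nn_integral_cong)
    fix x
    have "inner (mult_sqrt W (componentwise T ?F) x) (g x) = inner (componentwise T ?F x) (?G x)"
      using psd_msqrt[OF matrix_weight_psd[OF W]] by (simp add: mult_sqrt_def psd_def)
    moreover have "x \<notin> Q \<Longrightarrow> ?G x = 0" using g(3) by (simp add: mult_sqrt_def)
    ultimately show "ennreal \<bar>inner (mult_sqrt W (componentwise T ?F) x) (g x)\<bar> = theta ?F ?G Q x * indicator Q x"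
      unfolding theta_def restr by (cases "x \<in> Q") auto
  qed
  also have "\<dots> \<le> ennreal (form_const ?m) * (\<integral>\<^sup>+x\<in>Q. ennreal (H x) \<partial>lebesgue)"
    by (rule form_bound[OF F G Q Hm lb])
  also have "\<dots> \<le> ennreal (form_const ?m) * (ennreal (4 * A * (?N * ?N)) * ennreal (sqrt (?k * (4 * 2 ^ CARD('n) * CV) * a) * sqrt (?k * (4 * 2 ^ CARD('n) * CW) * b)))"
  proof (rule mult_left_mono)
    have "(\<integral>\<^sup>+x\<in>Q. ennreal (H x) \<partial>lebesgue) \<le> (\<integral>\<^sup>+x. ennreal (4 * A * (?N * ?N)) * ennreal (?mf x * ?mg x) \<partial>lebesgue)"
    proof (rule nn_integral_mono)
      fix x
      have "H x = (4 * A * (?N * ?N)) * (?mf x * ?mg x)" by (simp add: H_def mult_ac)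
      then have "ennreal (H x) = ennreal (4 * A * (?N * ?N)) * ennreal (?mf x * ?mg x)"
        using A by (simp only: ennreal_mult mult_nonneg_nonneg hl_p_nonneg zero_le_numeral zero_le_power of_nat_0_le_iff)
      then show "ennreal (H x) * indicator Q x \<le> ennreal (4 * A * (?N * ?N)) * ennreal (?mf x * ?mg x)"
        by (cases "x \<in> Q") auto
    qed
    also have "\<dots> = ennreal (4 * A * (?N * ?N)) * (\<integral>\<^sup>+x. ennreal (?mf x * ?mg x) \<partial>lebesgue)"
      by (rule nn_integral_cmult) measurable
    also have "\<dots> \<le> ennreal (4 * A * (?N * ?N)) * ennreal (sqrt (?k * (4 * 2 ^ CARD('n) * CV) * a) * sqrt (?k * (4 * 2 ^ CARD('n) * CW) * b))"
    proof (intro mult_left_mono Cauchy_Schwarz_real_nn)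
      have bd: "(\<integral>\<^sup>+x. ennreal ((hl_p (p_of CARD('n) C) (\<lambda>x. norm (u x)) x)\<^sup>2) \<partial>lebesgue) \<le> ennreal (?k * (4 * 2 ^ CARD('n) * C) * c)"
        if C: "1 \<le> C" and u: "u \<in> borel_measurable lebesgue" "\<And>x. norm (u x) \<le> bu"
          and I: "(\<integral>\<^sup>+x. ennreal ((norm (u x))\<^sup>2) \<partial>lebesgue) \<le> ennreal c" "0 \<le> c" for C c bu and u :: "real ^ 'n \<Rightarrow> 'k ^ 'd"
      proof -
        have "(\<integral>\<^sup>+x. ennreal ((hl_p (p_of CARD('n) C) (\<lambda>x. norm (u x)) x)\<^sup>2) \<partial>lebesgue)
            \<le> ennreal (?k * (2 / eps_of CARD('n) C)) * (\<integral>\<^sup>+x. ennreal ((norm (u x))\<^sup>2) \<partial>lebesgue)"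
          unfolding p_of_def by (rule hl_p_L2[OF _ norm_ge_zero u(2) eps_of_bounds[OF C]]) (use u(1) in measurable)
        also have "\<dots> \<le> ennreal (?k * (2 / eps_of CARD('n) C)) * ennreal c" by (rule mult_left_mono[OF I(1)]) simp
        also have "\<dots> = ennreal (?k * (2 / eps_of CARD('n) C) * c)"
          using k0 I(2) eps_of_bounds[OF C, of "CARD('n)"] by (intro ennreal_mult[symmetric]) auto
        also have "2 / eps_of CARD('n) C = 4 * 2 ^ CARD('n) * C" by (simp add: eps_of_def)
        finally show ?thesis .
      qed
      show "(\<integral>\<^sup>+x. ennreal ((?mf x)\<^sup>2) \<partial>lebesgue) \<le> ennreal (?k * (4 * 2 ^ CARD('n) * CV) * a)"
        by (rule bd[OF CV(1) f(1,2) If])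
      show "(\<integral>\<^sup>+x. ennreal ((?mg x)\<^sup>2) \<partial>lebesgue) \<le> ennreal (?k * (4 * 2 ^ CARD('n) * CW) * b)"
        by (rule bd[OF CW(1) g(1,2) Ig])
    qed (use k0 CV(1) CW(1) If(2) Ig(2) in auto)
    finally show "(\<integral>\<^sup>+x\<in>Q. ennreal (H x) \<partial>lebesgue) \<le> ennreal (4 * A * (?N * ?N)) * ennreal (sqrt (?k * (4 * 2 ^ CARD('n) * CV) * a) * sqrt (?k * (4 * 2 ^ CARD('n) * CW) * b))" .
  qed simp
  also have "\<dots> = ennreal (form_const ?m * ((4 * A * (?N * ?N)) * (sqrt (?k * (4 * 2 ^ CARD('n) * CV) * a) * sqrt (?k * (4 * 2 ^ CARD('n) * CW) * b))))"
    using form_const_nonneg[of ?m] A k0 CV(1) CW(1) If(2) Ig(2) by (subst ennreal_mult[symmetric], simp, simp)+ simp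
  also have "sqrt (?k * (4 * 2 ^ CARD('n) * CV) * a) * sqrt (?k * (4 * 2 ^ CARD('n) * CW) * b)
      = (?k * (4 * 2 ^ CARD('n))) * (sqrt (CV * CW) * sqrt a * sqrt b)"
  proof -
    have "sqrt (?k * (4 * 2 ^ CARD('n) * CV) * a) * sqrt (?k * (4 * 2 ^ CARD('n) * CW) * b)
        = sqrt ((?k * (4 * 2 ^ CARD('n)))\<^sup>2 * (CV * CW * a * b))"
      by (simp only: real_sqrt_mult[symmetric]) (simp add: power2_eq_square mult_ac)
    also have "\<dots> = (?k * (4 * 2 ^ CARD('n))) * sqrt (CV * CW * a * b)"
      using k0 by (simp add: real_sqrt_mult)
    finally show ?thesis by (simp add: real_sqrt_mult)
  qed
  also have "form_const ?m * ((4 * A * (?N * ?N)) * ((?k * (4 * 2 ^ CARD('n))) * (sqrt (CV * CW) * sqrt a * sqrt b)))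
      = two_weight_const ?m * A * sqrt (CV * CW) * sqrt a * sqrt b"
    unfolding two_weight_const_def by (simp only: mult_ac)
  finally show ?thesis .
qed

text \<open>
  Duality: the form is tested with truncations of the image of \<open>f\<close> itself, for which it
  is the square of the norm; the truncations are bounded with bounded support, and monotone
  convergence removes them.
\<close>

lemma two_weight_norm_bound:
  fixes V W :: "real ^ 'n \<Rightarrow> 'k ^ 'd ^ 'd"
  assumes V: "matrix_weight V" and W: "matrix_weight W"
    and CV: "1 \<le> CV" "A_infinity_sc V < ennreal CV" and CW: "1 \<le> CW" "A_infinity_sc W < ennreal CW"
    and A2: "\<And>Q. Q \<in> cubes \<Longrightarrow> mnorm (msqrt (average Q W) ** msqrt (average Q V)) \<le> A" and A: "0 \<le> A"
    and f: "f \<in> borel_measurable lebesgue" "\<And>x. norm (f x) \<le> bf" "bounded {x. f x \<noteq> 0}"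
    and If: "(\<integral>\<^sup>+x. ennreal ((norm (f x))\<^sup>2) \<partial>lebesgue) \<le> 1"
  shows "(\<integral>\<^sup>+x. ennreal ((norm (mult_sqrt W (componentwise T (mult_sqrt V f)) x))\<^sup>2) \<partial>lebesgue)
    \<le> ennreal ((two_weight_const DIM('k ^ 'd) * A)\<^sup>2 * (CV * CW))"
proof -
  define h where "h = mult_sqrt W (componentwise T (mult_sqrt V f))"
  define c where "c = two_weight_const DIM('k ^ 'd) * A * sqrt (CV * CW)"
  have c0: "0 \<le> c" using two_weight_const_nonneg A CV(1) CW(1) by (simp add: c_def)
  have c2: "c\<^sup>2 = (two_weight_const DIM('k ^ 'd) * A)\<^sup>2 * (CV * CW)" using CV(1) CW(1) by (simp add: c_def power_mult_distrib)
  have f1: "(\<integral>\<^sup>+x. ennreal ((norm (f x))\<^sup>2) \<partial>lebesgue) \<le> ennreal 1" using If by simp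
  obtain Q0 where Q0: "Q0 \<in> cubes" "{x. f x \<noteq> 0} \<subseteq> Q0" using f(3) by (rule bounded_subset_cube)
  have FL2: "mult_sqrt V f \<in> L2" by (rule mult_sqrt_L2[OF V f(1,2) Q0(1)]) (use Q0(2) in auto)
  have hm[measurable]: "h \<in> borel_measurable lebesgue"
    unfolding h_def by (intro mult_sqrt_measurable[OF W] componentwise_measurable FL2)
  define X where "X n = {x. norm x \<le> real n \<and> norm (h x) \<le> real n}" for n
  have Xs[measurable]: "X n \<in> sets lebesgue" for n
  proof -
    have "X n = cball 0 (real n) \<inter> {x \<in> space lebesgue. norm (h x) \<le> real n}" by (auto simp: X_def)
    moreover have "{x \<in> space lebesgue. norm (h x) \<le> real n} \<in> sets lebesgue" by measurable
    ultimately show ?thesis by (simp add: sets.Int)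
  qed
  have step: "(\<integral>\<^sup>+x\<in>X n. ennreal ((norm (h x))\<^sup>2) \<partial>lebesgue) \<le> ennreal (c\<^sup>2)" for n
  proof -
    define g where "g = restrict_to (X n) h"
    have gm: "g \<in> borel_measurable lebesgue" unfolding g_def by (rule restrict_to_measurable[OF Xs hm])
    have gb: "norm (g x) \<le> real n" for x by (cases "x \<in> X n") (auto simp: g_def X_def)
    have "bounded ({x. f x \<noteq> 0} \<union> cball 0 (real n))" using f(3) by simp
    then obtain Q where Q: "Q \<in> cubes" "{x. f x \<noteq> 0} \<union> cball 0 (real n) \<subseteq> Q" by (rule bounded_subset_cube)
    have fz: "f x = 0" if "x \<notin> Q" for x using that Q(2) by blast
    have gz: "g x = 0" if "x \<notin> Q" for x
    proof -
      have "x \<notin> cball 0 (real n)" using that Q(2) by blast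
      then have "x \<notin> X n" by (simp add: X_def)
      then show ?thesis by (simp add: g_def)
    qed
    let ?I = "\<integral>\<^sup>+x. ennreal ((norm (g x))\<^sup>2) \<partial>lebesgue"
    have "?I \<le> (\<integral>\<^sup>+x\<in>Q. ennreal ((real n)\<^sup>2) \<partial>lebesgue)"
    proof (rule nn_integral_mono)
      fix x show "ennreal ((norm (g x))\<^sup>2) \<le> ennreal ((real n)\<^sup>2) * indicator Q x"
        using gb[of x] gz[of x] by (cases "x \<in> Q") (auto intro!: ennreal_leI power_mono)
    qed
    also have "\<dots> = ennreal ((real n)\<^sup>2) * ennreal (measure lebesgue Q)"
      using cubes_sets[OF Q(1)] by (simp add: nn_integral_cmult_indicator emeasure_cubes[OF Q(1)])
    also have "\<dots> < \<infinity>" by (simp add: ennreal_mult_less_top)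
    finally obtain y where y: "?I = ennreal y" "0 \<le> y" by (cases ?I) auto
    have "(\<integral>\<^sup>+x. ennreal \<bar>inner (mult_sqrt W (componentwise T (mult_sqrt V f)) x) (g x)\<bar> \<partial>lebesgue)
        \<le> ennreal (two_weight_const DIM('k ^ 'd) * A * sqrt (CV * CW) * sqrt 1 * sqrt y)"
      by (rule two_weight_form_bound[OF V W CV CW A2 A f(1,2) fz gm gb gz Q(1) f1 _ _ y(2)]) (simp_all add: y(1))
    moreover have "\<bar>inner (mult_sqrt W (componentwise T (mult_sqrt V f)) x) (g x)\<bar> = (norm (g x))\<^sup>2" for x
      unfolding h_def[symmetric] by (cases "x \<in> X n") (auto simp: g_def power2_norm_eq_inner)
    ultimately have "ennreal y \<le> ennreal (c * sqrt y)" by (simp add: y(1) c_def)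
    then have "sqrt y * sqrt y \<le> c * sqrt y" using y(2) c0 by simp
    then have "sqrt y \<le> c"
    proof (cases "y = 0")
      case False
      then have "0 < sqrt y" using y(2) by simp
      with \<open>sqrt y * sqrt y \<le> c * sqrt y\<close> show ?thesis by (rule mult_right_le_imp_le)
    qed (use c0 in simp)
    then have "(sqrt y)\<^sup>2 \<le> c\<^sup>2" using y(2) by (intro power_mono) auto
    then have "y \<le> c\<^sup>2" using y(2) by simp
    moreover have "?I = (\<integral>\<^sup>+x\<in>X n. ennreal ((norm (h x))\<^sup>2) \<partial>lebesgue)"
      by (intro nn_integral_cong) (auto simp: g_def restrict_to_def indicator_def)
    ultimately show ?thesis unfolding y(1)[symmetric] using y by (metis ennreal_leI)
  qed
  have "(\<integral>\<^sup>+x. ennreal ((norm (h x))\<^sup>2) \<partial>lebesgue) = (\<integral>\<^sup>+x. (SUP n. ennreal ((norm (h x))\<^sup>2) * indicator (X n) x) \<partial>lebesgue)"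
  proof (rule nn_integral_cong)
    fix x
    obtain j where "max (norm x) (norm (h x)) \<le> real j" using real_arch_simple by blast
    then have "x \<in> X j" by (simp add: X_def)
    then have "ennreal ((norm (h x))\<^sup>2) \<le> (SUP n. ennreal ((norm (h x))\<^sup>2) * indicator (X n) x)"
      by (intro SUP_upper2[of j]) auto
    moreover have "(SUP n. ennreal ((norm (h x))\<^sup>2) * indicator (X n) x) \<le> ennreal ((norm (h x))\<^sup>2)"
      by (rule SUP_least) (auto simp: indicator_def)
    ultimately show "ennreal ((norm (h x))\<^sup>2) = (SUP n. ennreal ((norm (h x))\<^sup>2) * indicator (X n) x)" by (rule antisym)
  qed
  also have "\<dots> = (SUP n. \<integral>\<^sup>+x\<in>X n. ennreal ((norm (h x))\<^sup>2) \<partial>lebesgue)"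
  proof (rule nn_integral_monotone_convergence_SUP)
    show "incseq (\<lambda>n x. ennreal ((norm (h x))\<^sup>2) * indicator (X n) x)"
    proof (rule incseq_SucI, rule le_funI)
      fix n x
      have "X n \<subseteq> X (Suc n)" by (auto simp: X_def)
      then show "ennreal ((norm (h x))\<^sup>2) * indicator (X n) x \<le> ennreal ((norm (h x))\<^sup>2) * indicator (X (Suc n)) x"
        by (auto simp: indicator_def)
    qed
  qed measurable
  also have "\<dots> \<le> ennreal (c\<^sup>2)" by (rule SUP_least) (rule step)
  finally show ?thesis unfolding h_def c2 .
qed

lemma componentwise_null:
  fixes F :: "real ^ 'n \<Rightarrow> 'k ^ 'd"
  assumes F: "F \<in> L2" and z: "AE x in lebesgue. F x = 0"
  shows "AE x in lebesgue. componentwise T F x = 0"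
proof -
  have "AE x in lebesgue. \<forall>c\<in>UNIV. T (\<lambda>y. F y $ c) x = 0"
  proof (rule AE_finite_allI)
    fix c :: 'd
    have "AE x in lebesgue. F x $ c = 0" using z by eventually_elim simp
    then show "AE x in lebesgue. T (\<lambda>y. F y $ c) x = 0" by (rule T_null[OF L2_component[OF F]])
  qed simp
  then show ?thesis by eventually_elim (simp add: componentwise_def vec_eq_iff)
qed

lemma degenerate_operator_null:
  fixes V W :: "real ^ 'n \<Rightarrow> 'k ^ 'd ^ 'd"
  assumes V: "matrix_weight V" and W: "matrix_weight W"
    and A: "A_infinity_sc V < 1 \<or> A_infinity_sc W < 1"
    and f: "f \<in> borel_measurable lebesgue" "\<And>x. norm (f x) \<le> bf" "bounded {x. f x \<noteq> 0}"
  shows "AE x in lebesgue. mult_sqrt W (componentwise T (mult_sqrt V f)) x = 0"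
  using A
proof
  assume A: "A_infinity_sc V < 1"
  obtain Q where Q: "Q \<in> cubes" "{x. f x \<noteq> 0} \<subseteq> Q" using f(3) by (rule bounded_subset_cube)
  have z: "f x = 0" if "x \<notin> Q" for x using that Q(2) by blast
  have "AE x in lebesgue. mult_sqrt V f x = 0"
    using degenerate_matrix_weight[OF V A Q(1)]
  proof eventually_elim
    fix x assume "x \<in> Q \<longrightarrow> (\<forall>y. msqrt (V x) *v y = 0)"
    then show "mult_sqrt V f x = 0" using z[of x] by (cases "x \<in> Q") (auto simp: mult_sqrt_def)
  qed
  moreover have "mult_sqrt V f \<in> L2" by (rule mult_sqrt_L2[OF V f(1,2) Q(1) z])
  ultimately have "AE x in lebesgue. componentwise T (mult_sqrt V f) x = 0" by (intro componentwise_null)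
  then show ?thesis by eventually_elim (simp add: mult_sqrt_def)
next
  assume A: "A_infinity_sc W < 1"
  have "AE x in lebesgue. norm x \<le> real n \<longrightarrow> (\<forall>y. msqrt (W x) *v y = 0)" for n
  proof -
    obtain Q :: "(real ^ 'n) set" where Q: "Q \<in> cubes" "cball 0 (real n) \<subseteq> Q" by (rule bounded_subset_cube[OF bounded_cball])
    show ?thesis using degenerate_matrix_weight[OF W A Q(1)] by eventually_elim (use Q(2) in auto)
  qed
  then have "AE x in lebesgue. \<forall>n. norm x \<le> real n \<longrightarrow> (\<forall>y. msqrt (W x) *v y = 0)"
    unfolding AE_all_countable by (rule allI)
  then show ?thesis
  proof eventually_elim
    fix x assume *: "\<forall>n. norm x \<le> real n \<longrightarrow> (\<forall>y. msqrt (W x) *v y = 0)"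
    obtain n where "norm x \<le> real n" using real_arch_simple by blast
    then have "\<forall>y. msqrt (W x) *v y = 0" using * by blast
    then show "mult_sqrt W (componentwise T (mult_sqrt V f)) x = 0" by (simp add: mult_sqrt_def)
  qed
qed

text \<open>
  The preceding estimates require a number strictly above the $A_\infty$ constant. Twice the
  constant serves when it is at least 1, and this gives the factor 4; otherwise the operator is
  zero.
\<close>

theorem two_weight_operator_norm_bound:
  fixes V W :: "real ^ 'n \<Rightarrow> 'k ^ 'd ^ 'd"
  assumes V: "matrix_weight V" and W: "matrix_weight W" and J: "joint_A2 V W < \<infinity>"
    and AV: "A_infinity_sc V < \<infinity>" and AW: "A_infinity_sc W < \<infinity>"
  shows "(L2_operator_norm (mult_sqrt W \<circ> componentwise T \<circ> mult_sqrt V))\<^sup>2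
    \<le> ennreal (4 * (two_weight_const DIM('k ^ 'd))\<^sup>2) * A_infinity_sc V * A_infinity_sc W * joint_A2 V W"
proof -
  obtain j where j: "joint_A2 V W = ennreal j" "0 \<le> j" using J by (cases "joint_A2 V W") auto
  obtain av where av: "A_infinity_sc V = ennreal av" "0 \<le> av" using AV by (cases "A_infinity_sc V") auto
  obtain aw where aw: "A_infinity_sc W = ennreal aw" "0 \<le> aw" using AW by (cases "A_infinity_sc W") auto
  let ?C = "two_weight_const DIM('k ^ 'd)"
  have rhs: "ennreal (4 * ?C\<^sup>2) * A_infinity_sc V * A_infinity_sc W * joint_A2 V W = ennreal (4 * ?C\<^sup>2 * av * aw * j)"
    unfolding j(1) av(1) aw(1) using j av aw by (simp add: ennreal_mult)
  have A2: "mnorm (msqrt (average Q W) ** msqrt (average Q V)) \<le> sqrt j" if Q: "Q \<in> cubes" for Q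
  proof -
    have "ennreal ((mnorm (msqrt (average Q W) ** msqrt (average Q V)))\<^sup>2) \<le> ennreal j"
      unfolding j(1)[symmetric] joint_A2_def by (rule SUP_upper[OF Q])
    then show ?thesis using j(2) by (intro real_le_rsqrt) simp
  qed
  have main: "(L2norm ((mult_sqrt W \<circ> componentwise T \<circ> mult_sqrt V) f))\<^sup>2 \<le> ennreal (4 * ?C\<^sup>2 * av * aw * j)"
    if fA: "f \<in> {f \<in> borel_measurable lebesgue. bounded (range f) \<and> compact (fsupp f) \<and> L2norm f \<le> 1}"
    for f :: "real ^ 'n \<Rightarrow> 'k ^ 'd"
  proof -
    have fm: "f \<in> borel_measurable lebesgue" using fA by simp
    obtain bf where bf: "\<And>x. norm (f x) \<le> bf" using fA by (auto simp: bounded_iff)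
    have fs: "bounded {x. f x \<noteq> 0}"
      using fA compact_imp_bounded[of "fsupp f"] bounded_subset closure_subset unfolding fsupp_def by blast
    have "(L2norm f)\<^sup>2 \<le> 1\<^sup>2" using fA unfolding power2_eq_square by (intro mult_mono) auto
    then have If: "(\<integral>\<^sup>+x. ennreal ((norm (f x))\<^sup>2) \<partial>lebesgue) \<le> 1" unfolding L2norm_square by simp
    show ?thesis
    proof (cases "av < 1 \<or> aw < 1")
      case True
      then have "A_infinity_sc V < 1 \<or> A_infinity_sc W < 1"
        using av aw by (auto simp: ennreal_less_one_iff)
      then have "AE x in lebesgue. mult_sqrt W (componentwise T (mult_sqrt V f)) x = 0"
        by (rule degenerate_operator_null[OF V W _ fm bf fs])
      then have "AE x in lebesgue. ennreal ((norm ((mult_sqrt W \<circ> componentwise T \<circ> mult_sqrt V) f x))\<^sup>2) = 0"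
        by eventually_elim simp
      then have "(\<integral>\<^sup>+x. ennreal ((norm ((mult_sqrt W \<circ> componentwise T \<circ> mult_sqrt V) f x))\<^sup>2) \<partial>lebesgue) = (\<integral>\<^sup>+x. 0 \<partial>(lebesgue :: (real ^ 'n) measure))"
        by (rule nn_integral_cong_AE)
      then show ?thesis unfolding L2norm_square by simp
    next
      case False
      have lt: "t < 2 * t" "1 \<le> 2 * t" if "1 \<le> t" for t :: real using that by auto
      have CV: "1 \<le> 2 * av" "A_infinity_sc V < ennreal (2 * av)" and CW: "1 \<le> 2 * aw" "A_infinity_sc W < ennreal (2 * aw)"
        using False by (auto simp: av(1) aw(1) intro!: ennreal_lessI)
      have "(\<integral>\<^sup>+x. ennreal ((norm (mult_sqrt W (componentwise T (mult_sqrt V f)) x))\<^sup>2) \<partial>lebesgue)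
          \<le> ennreal ((?C * sqrt j)\<^sup>2 * (2 * av * (2 * aw)))"
        using j(2) by (intro two_weight_norm_bound[OF V W CV CW A2 _ fm bf fs If]) auto
      also have "(?C * sqrt j)\<^sup>2 * (2 * av * (2 * aw)) = 4 * ?C\<^sup>2 * av * aw * j"
        using j(2) by (simp add: power_mult_distrib)
      finally show ?thesis unfolding L2norm_square by simp
    qed
  qed
  show ?thesis
    unfolding rhs L2_operator_norm_def
    by (rule SUP_square_le[OF main]) (use j av aw in auto)
qed

end

theorem theorem1p1:
  fixes T :: "(real ^ 'n \<Rightarrow> 'k::{real_normed_field,euclidean_space}) \<Rightarrow> real ^ 'n \<Rightarrow> 'k"
    and \<omega> :: "real \<Rightarrow> real"
  assumes "modulus_of_continuity \<omega>" and "dini \<omega>" and "CZ_operator \<omega> T"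
  shows "\<exists>C::real. 0 \<le> C \<and>
    (\<forall>V W :: real ^ 'n \<Rightarrow> 'k ^ 'd ^ 'd.
      matrix_weight V \<and> matrix_weight W \<and> joint_A2 V W < \<infinity> \<and>
      A_infinity_sc V < \<infinity> \<and> A_infinity_sc W < \<infinity> \<longrightarrow>
      (L2_operator_norm (mult_sqrt W \<circ> componentwise T \<circ> mult_sqrt V))\<^sup>2
        \<le> ennreal C * A_infinity_sc V * A_infinity_sc W * joint_A2 V W)"
proof -
  obtain K B CK where cz: "dini_cz T K \<omega> B CK" by (rule CZ_operator_dini_cz[OF assms])
  interpret dini_cz T K \<omega> B CK by (rule cz)
  show ?thesis
  proof (rule exI[of _ "4 * (two_weight_const DIM('k ^ 'd))\<^sup>2"], intro conjI allI impI)
    fix V W :: "real ^ 'n \<Rightarrow> 'k ^ 'd ^ 'd"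
    assume "matrix_weight V \<and> matrix_weight W \<and> joint_A2 V W < \<infinity> \<and> A_infinity_sc V < \<infinity> \<and> A_infinity_sc W < \<infinity>"
    then show "(L2_operator_norm (mult_sqrt W \<circ> componentwise T \<circ> mult_sqrt V))\<^sup>2
        \<le> ennreal (4 * (two_weight_const DIM('k ^ 'd))\<^sup>2) * A_infinity_sc V * A_infinity_sc W * joint_A2 V W"
      by (intro two_weight_operator_norm_bound) auto
  qed simp
qed

end
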